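(* Let $A$ be a commutative ring whose underlying abelian group is torsion-free and which is finitely generated as a commutative ring. Let $I$ be a maximal ideal of $A$, and suppose that $A$ is separated in the $I$-adic topology. Then the natural maps of graded Hopf algebroids \[ (L^A\otimes_{A} \hat{A}_I , L^AB \otimes_{A} \hat{A}_I ) \rightarrow ((L^A)^{\wedge}_I , (L^AB)^{\wedge}_I ) \rightarrow (L^{\hat{A}_I} , L^{\hat{A}_I}B ) \] are isomorphisms.
   Context: For a commutative ring $A$ and a commutative $A$-algebra $R$, a (one-dimensional) formal $A$-module over $R$ is a formal group law $F(X,Y)\in R[[X,Y]]$ together with a ring homomorphism $\rho: A\to \mathrm{End}(F)$ such that $\rho(a)(X)\equiv aX \bmod X^2$ for all $a\in A$; here $\mathrm{End}(F)\subseteq R[[X]]$ has addition $F(f(X),g(X))$ and multiplication given by composition. A strict isomorphism of formal $A$-modules is an isomorphism $f$ of formal group laws commuting with the $A$-actions with $f(X)\equiv X\bmod X^2$. The commutative $A$-algebras $L^A$ and $L^AB$ corepresent, on commutative $A$-algebras $R$, the set of formal $A$-modules over $R$ and the set of strict isomorphisms of formal $A$-modules over $R$, respectively; $(L^A,L^AB)$ is a Hopf algebroid corepresenting the groupoid of formal $A$-modules and strict isomorphisms. It is graded, concentrated in even nonnegative degrees: coefficients of total power $i$ in the universal power series $F(X,Y)$, $\rho(a)(X)$, $f(X)$ have degree $2(i-1)$. $\hat{A}_I$ is the $I$-adic completion of $A$; completions $(-)^{\wedge}_I$ of graded objects are $I$-adic completions in the graded sense (degree by degree). *)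

theory Defs
  imports "HOL-Algebra.Algebra" "HOL-Library.Poly_Mapping"
begin

section \<open>Rings given by generators and relations\<close>

text \<open>Integer polynomials in variables from a type of generators: finitely supported
  functions from monomials to the integers.\<close>

type_synonym 'g zpoly = "('g \<Rightarrow>\<^sub>0 nat) \<Rightarrow>\<^sub>0 int"

definition zpoly_ring :: "'g set \<Rightarrow> 'g zpoly ring" where
  "zpoly_ring S =
    \<lparr>carrier = {p. \<forall>m\<in>Poly_Mapping.keys p. Poly_Mapping.keys m \<subseteq> S},
     monoid.mult = (*), one = 1, ring.zero = 0, add = (+)\<rparr>"

definition zvar :: "'g \<Rightarrow> 'g zpoly" where
  "zvar g = Poly_Mapping.single (Poly_Mapping.single g 1) 1"

definition pres :: "'g set \<Rightarrow> 'g zpoly set \<Rightarrow> 'g zpoly set ring" where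
  "pres S E = zpoly_ring S Quot (Idl\<^bsub>zpoly_ring S\<^esub> E)"

definition pres_class :: "'g set \<Rightarrow> 'g zpoly set \<Rightarrow> 'g zpoly \<Rightarrow> 'g zpoly set" where
  "pres_class S E p = (Idl\<^bsub>zpoly_ring S\<^esub> E) +>\<^bsub>zpoly_ring S\<^esub> p"

definition zeval :: "('r, 'm) ring_scheme \<Rightarrow> ('g \<Rightarrow> 'r) \<Rightarrow> 'g zpoly \<Rightarrow> 'r" where
  "zeval R f p =
    (\<Oplus>\<^bsub>R\<^esub>m\<in>Poly_Mapping.keys p.
       add_pow R (Poly_Mapping.lookup p m)
         (\<Otimes>\<^bsub>R\<^esub>g\<in>Poly_Mapping.keys m. f g [^]\<^bsub>R\<^esub> Poly_Mapping.lookup m g))"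

text \<open>The homomorphism from a presented ring to \<open>R\<close> sending the class of each generator
  \<open>g\<close> to \<open>f g\<close>; meaningful when \<open>f\<close> satisfies the relations, so that \<open>zeval R f\<close> is constant
  on the coset \<open>C\<close>.\<close>

definition pres_map :: "('r, 'm) ring_scheme \<Rightarrow> ('g \<Rightarrow> 'r) \<Rightarrow> 'g zpoly set \<Rightarrow> 'r" where
  "pres_map R f C = (THE y. \<forall>p\<in>C. zeval R f p = y)"


section \<open>Graded rings and tensor products\<close>

text \<open>\<open>hpart R n\<close> is the homogeneous part of degree \<open>n\<close>.\<close>

record 'a graded_ring = "'a ring" +
  hpart :: "nat \<Rightarrow> 'a set"

definition with_grading :: "('a, 'm) ring_scheme \<Rightarrow> (nat \<Rightarrow> 'a set) \<Rightarrow> 'a graded_ring" where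
  "with_grading R d =
    \<lparr>carrier = carrier R, monoid.mult = monoid.mult R, one = one R, ring.zero = ring.zero R, add = add R, hpart = d\<rparr>"

definition degree_zero :: "('a, 'm) ring_scheme \<Rightarrow> 'a graded_ring" where
  "degree_zero R = with_grading R (\<lambda>n. if n = 0 then carrier R else {\<zero>\<^bsub>R\<^esub>})"

definition weighted_pres ::
    "'g set \<Rightarrow> 'g zpoly set \<Rightarrow> ('g \<Rightarrow> nat) \<Rightarrow> 'g zpoly set graded_ring" where
  "weighted_pres S E w = with_grading (pres S E)
    (\<lambda>n. {pres_class S E p | p. p \<in> carrier (zpoly_ring S) \<and>
           (\<forall>m\<in>Poly_Mapping.keys p.
              (\<Sum>g\<in>Poly_Mapping.keys m. Poly_Mapping.lookup m g * w g) = n)})"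

text \<open>The tensor product of commutative \<open>K\<close>-algebras \<open>B\<close>, \<open>C\<close> with structure maps
  \<open>f : K \<rightarrow> B\<close> and \<open>g : K \<rightarrow> C\<close>. The generator \<open>(b, c)\<close> is the elementary tensor; the relations
  are biadditivity, balancedness over \<open>K\<close>, and the rule for multiplying elementary tensors.\<close>

definition tensor_rels ::
    "('b, 'm) ring_scheme \<Rightarrow> ('c, 'n) ring_scheme \<Rightarrow> ('k, 'o) ring_scheme \<Rightarrow>
     ('k \<Rightarrow> 'b) \<Rightarrow> ('k \<Rightarrow> 'c) \<Rightarrow> ('b \<times> 'c) zpoly set" where
  "tensor_rels B C K f g =
    {zvar (b \<oplus>\<^bsub>B\<^esub> b', c) - (zvar (b, c) + zvar (b', c)) | b b' c.
       b \<in> carrier B \<and> b' \<in> carrier B \<and> c \<in> carrier C} \<union>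
    {zvar (b, c \<oplus>\<^bsub>C\<^esub> c') - (zvar (b, c) + zvar (b, c')) | b c c'.
       b \<in> carrier B \<and> c \<in> carrier C \<and> c' \<in> carrier C} \<union>
    {zvar (b \<otimes>\<^bsub>B\<^esub> f k, c) - zvar (b, g k \<otimes>\<^bsub>C\<^esub> c) | b c k.
       b \<in> carrier B \<and> c \<in> carrier C \<and> k \<in> carrier K} \<union>
    {zvar (b, c) * zvar (b', c') - zvar (b \<otimes>\<^bsub>B\<^esub> b', c \<otimes>\<^bsub>C\<^esub> c') | b b' c c'.
       b \<in> carrier B \<and> b' \<in> carrier B \<and> c \<in> carrier C \<and> c' \<in> carrier C} \<union>
    {zvar (\<one>\<^bsub>B\<^esub>, \<one>\<^bsub>C\<^esub>) - 1}"

definition tensor_elem ::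
    "('b, 'm) ring_scheme \<Rightarrow> ('c, 'n) ring_scheme \<Rightarrow> ('k, 'o) ring_scheme \<Rightarrow>
     ('k \<Rightarrow> 'b) \<Rightarrow> ('k \<Rightarrow> 'c) \<Rightarrow> 'b \<Rightarrow> 'c \<Rightarrow> ('b \<times> 'c) zpoly set" where
  "tensor_elem B C K f g b c =
    pres_class (carrier B \<times> carrier C) (tensor_rels B C K f g) (zvar (b, c))"

definition tensor ::
    "'b graded_ring \<Rightarrow> 'c graded_ring \<Rightarrow> ('k, 'o) ring_scheme \<Rightarrow>
     ('k \<Rightarrow> 'b) \<Rightarrow> ('k \<Rightarrow> 'c) \<Rightarrow> ('b \<times> 'c) zpoly set graded_ring" where
  "tensor B C K f g =
    (let T = pres (carrier B \<times> carrier C) (tensor_rels B C K f g) in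
     with_grading T
       (\<lambda>n. generate (add_monoid T)
          {tensor_elem B C K f g b c | b c i j. i + j = n \<and> b \<in> hpart B i \<and> c \<in> hpart C j}))"


section \<open>Adic completions\<close>

text \<open>The limit of the rings \<open>R / J k\<close> for a decreasing sequence of ideals: sequences of
  cosets such that the image of \<open>x (Suc k)\<close> in \<open>R / J k\<close> is \<open>x k\<close>.\<close>

definition adic_limit :: "('a, 'm) ring_scheme \<Rightarrow> (nat \<Rightarrow> 'a set) \<Rightarrow> (nat \<Rightarrow> 'a set) ring" where
  "adic_limit R J =
    \<lparr>carrier = {x. \<forall>k. x k \<in> carrier (R Quot J k) \<and> J k <+>\<^bsub>R\<^esub> x (Suc k) = x k},
     monoid.mult = (\<lambda>x y k. x k \<otimes>\<^bsub>R Quot J k\<^esub> y k),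
     one = (\<lambda>k. \<one>\<^bsub>R Quot J k\<^esub>),
     ring.zero = (\<lambda>k. \<zero>\<^bsub>R Quot J k\<^esub>),
     add = (\<lambda>x y k. x k \<oplus>\<^bsub>R Quot J k\<^esub> y k)\<rparr>"

definition to_limit :: "('a, 'm) ring_scheme \<Rightarrow> (nat \<Rightarrow> 'a set) \<Rightarrow> 'a \<Rightarrow> nat \<Rightarrow> 'a set" where
  "to_limit R J r = (\<lambda>k. J k +>\<^bsub>R\<^esub> r)"

text \<open>The map of limits induced by a homomorphism \<open>h\<close> into \<open>R'\<close> carrying the \<open>k\<close>-th ideal of the
  source filtration into \<open>J' k\<close>.\<close>

definition limit_map ::
    "('b, 'm) ring_scheme \<Rightarrow> (nat \<Rightarrow> 'b set) \<Rightarrow> ('a \<Rightarrow> 'b) \<Rightarrow> (nat \<Rightarrow> 'a set) \<Rightarrow> nat \<Rightarrow> 'b set" where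
  "limit_map R' J' h x = (\<lambda>k. J' k <+>\<^bsub>R'\<^esub> h ` x k)"

text \<open>Completion in the graded sense. For a filtration by homogeneous ideals, the degree \<open>n\<close> part
  below is the limit of \<open>R\<^sub>n / (R\<^sub>n \<inter> J k)\<close>, and the whole ring is the (internal) direct sum of
  these inside the ungraded limit.\<close>

definition limit_part :: "'a graded_ring \<Rightarrow> (nat \<Rightarrow> 'a set) \<Rightarrow> nat \<Rightarrow> (nat \<Rightarrow> 'a set) set" where
  "limit_part R J n = {x \<in> carrier (adic_limit R J). \<forall>k. \<exists>r\<in>hpart R n. x k = J k +>\<^bsub>R\<^esub> r}"

definition graded_limit :: "'a graded_ring \<Rightarrow> (nat \<Rightarrow> 'a set) \<Rightarrow> (nat \<Rightarrow> 'a set) graded_ring" where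
  "graded_limit R J = with_grading
    ((adic_limit R J)\<lparr>carrier :=
       {finsum (adic_limit R J) y {..N} | y N. \<forall>n. y n \<in> limit_part R J n}\<rparr>)
    (limit_part R J)"

definition graded_complete :: "'a graded_ring \<Rightarrow> (nat \<Rightarrow> 'a set) \<Rightarrow> bool" where
  "graded_complete R J \<longleftrightarrow>
    bij_betw (to_limit R J) (carrier R) (carrier (graded_limit R J))"

text \<open>For graded complete \<open>R'\<close>, the continuous extension to the graded completion of a
  homomorphism \<open>h\<close> into \<open>R'\<close>: the unique map whose composite with the isomorphism from \<open>R'\<close> to
  its completion is the completion of \<open>h\<close>.\<close>

definition extend_limit ::
    "'b graded_ring \<Rightarrow> (nat \<Rightarrow> 'b set) \<Rightarrow> ('a \<Rightarrow> 'b) \<Rightarrow> (nat \<Rightarrow> 'a set) \<Rightarrow> 'b" where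
  "extend_limit R' J' h x = inv_into (carrier R') (to_limit R' J') (limit_map R' J' h x)"

text \<open>Powers of ideals are taken in the library's monoid of ideals. \<open>adic A I R s\<close> is the \<open>I\<close>-adic
  filtration, by the ideals \<open>I^k R\<close>, of an \<open>A\<close>-algebra \<open>R\<close> with structure map \<open>s\<close>.\<close>

definition adic ::
    "('a, 'm) ring_scheme \<Rightarrow> 'a set \<Rightarrow> ('b, 'n) ring_scheme \<Rightarrow> ('a \<Rightarrow> 'b) \<Rightarrow> nat \<Rightarrow> 'b set" where
  "adic A I R s k = Idl\<^bsub>R\<^esub> (s ` (I [^]\<^bsub>ideals_set A\<^esub> k))"

definition completion :: "('a, 'm) ring_scheme \<Rightarrow> 'a set \<Rightarrow> (nat \<Rightarrow> 'a set) ring" where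
  "completion A I = adic_limit A (\<lambda>k. I [^]\<^bsub>ideals_set A\<^esub> k)"

definition to_completion :: "('a, 'm) ring_scheme \<Rightarrow> 'a set \<Rightarrow> 'a \<Rightarrow> nat \<Rightarrow> 'a set" where
  "to_completion A I = to_limit A (\<lambda>k. I [^]\<^bsub>ideals_set A\<^esub> k)"


section \<open>Formal power series over a ring\<close>

text \<open>Series in three variables \<open>X\<close>, \<open>Y\<close>, \<open>Z\<close>, as functions of the exponent triple; this is enough
  for all the identities below. Series \<open>f(X)\<close>, \<open>F(X,Y)\<close> into which one substitutes are given by
  their coefficients \<open>f i\<close>, \<open>F i j\<close>.\<close>

type_synonym 'r ps = "nat \<times> nat \<times> nat \<Rightarrow> 'r"

definition ps_zero :: "('r, 'm) ring_scheme \<Rightarrow> 'r ps" where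
  "ps_zero R = (\<lambda>_. \<zero>\<^bsub>R\<^esub>)"

definition ps_monom :: "('r, 'm) ring_scheme \<Rightarrow> nat \<times> nat \<times> nat \<Rightarrow> 'r ps" where
  "ps_monom R e = (\<lambda>d. if d = e then \<one>\<^bsub>R\<^esub> else \<zero>\<^bsub>R\<^esub>)"

abbreviation ps_X :: "('r, 'm) ring_scheme \<Rightarrow> 'r ps" where "ps_X R \<equiv> ps_monom R (1, 0, 0)"
abbreviation ps_Y :: "('r, 'm) ring_scheme \<Rightarrow> 'r ps" where "ps_Y R \<equiv> ps_monom R (0, 1, 0)"
abbreviation ps_Z :: "('r, 'm) ring_scheme \<Rightarrow> 'r ps" where "ps_Z R \<equiv> ps_monom R (0, 0, 1)"

definition ps_mult :: "('r, 'm) ring_scheme \<Rightarrow> 'r ps \<Rightarrow> 'r ps \<Rightarrow> 'r ps" where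
  "ps_mult R u v = (\<lambda>(a, b, c).
    \<Oplus>\<^bsub>R\<^esub>e\<in>{..a} \<times> {..b} \<times> {..c}.
      (case e of (i, j, k) \<Rightarrow> u (i, j, k) \<otimes>\<^bsub>R\<^esub> v (a - i, b - j, c - k)))"

primrec ps_pow :: "('r, 'm) ring_scheme \<Rightarrow> 'r ps \<Rightarrow> nat \<Rightarrow> 'r ps" where
  "ps_pow R u 0 = ps_monom R (0, 0, 0)"
| "ps_pow R u (Suc n) = ps_mult R (ps_pow R u n) u"

text \<open>Substitution \<open>f(u)\<close>, \<open>F(u,v)\<close> of series \<open>u\<close>, \<open>v\<close> with zero constant term. Then only the terms
  \<open>f i * u^i\<close> with \<open>i \<le> d\<close>, resp. \<open>F i j * u^i * v^j\<close> with \<open>i, j \<le> d\<close>, contribute to the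
  coefficients of total degree \<open>d\<close>, so the sums can be truncated.\<close>

definition ps_subst1 :: "('r, 'm) ring_scheme \<Rightarrow> (nat \<Rightarrow> 'r) \<Rightarrow> 'r ps \<Rightarrow> 'r ps" where
  "ps_subst1 R f u = (\<lambda>(a, b, c).
    \<Oplus>\<^bsub>R\<^esub>i\<in>{..a + b + c}. f i \<otimes>\<^bsub>R\<^esub> ps_pow R u i (a, b, c))"

definition ps_subst2 :: "('r, 'm) ring_scheme \<Rightarrow> (nat \<Rightarrow> nat \<Rightarrow> 'r) \<Rightarrow> 'r ps \<Rightarrow> 'r ps \<Rightarrow> 'r ps" where
  "ps_subst2 R F u v = (\<lambda>(a, b, c).
    \<Oplus>\<^bsub>R\<^esub>e\<in>{..a + b + c} \<times> {..a + b + c}.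
      (case e of (i, j) \<Rightarrow>
        F i j \<otimes>\<^bsub>R\<^esub> ps_mult R (ps_pow R u i) (ps_pow R v j) (a, b, c)))"

definition series_comp :: "('r, 'm) ring_scheme \<Rightarrow> (nat \<Rightarrow> 'r) \<Rightarrow> (nat \<Rightarrow> 'r) \<Rightarrow> nat \<Rightarrow> 'r" where
  "series_comp R g f i = ps_subst1 R g (ps_subst1 R f (ps_X R)) (i, 0, 0)"

definition series_inverse :: "('r, 'm) ring_scheme \<Rightarrow> (nat \<Rightarrow> 'r) \<Rightarrow> nat \<Rightarrow> 'r" where
  "series_inverse R f = (THE g. range g \<subseteq> carrier R \<and> g 0 = \<zero>\<^bsub>R\<^esub> \<and>
     ps_subst1 R g (ps_subst1 R f (ps_X R)) = ps_X R)"


section \<open>Formal modules\<close>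

text \<open>The defining identities are recorded as sets of pairs of elements of \<open>R\<close> required to be
  equal. The same sets define formal modules over a ring and, applied to indeterminate
  coefficients, the relations of the rings corepresenting them.\<close>

definition ps_eqs :: "'r ps \<Rightarrow> 'r ps \<Rightarrow> ('r \<times> 'r) set" where
  "ps_eqs u v = {(u d, v d) | d. True}"

definition algebra_eqs ::
    "('a, 'm) ring_scheme \<Rightarrow> ('r, 'n) ring_scheme \<Rightarrow> ('a \<Rightarrow> 'r) \<Rightarrow> ('r \<times> 'r) set" where
  "algebra_eqs A R \<eta> =
    {(\<eta> (a \<oplus>\<^bsub>A\<^esub> b), \<eta> a \<oplus>\<^bsub>R\<^esub> \<eta> b) | a b. a \<in> carrier A \<and> b \<in> carrier A} \<union>
    {(\<eta> (a \<otimes>\<^bsub>A\<^esub> b), \<eta> a \<otimes>\<^bsub>R\<^esub> \<eta> b) | a b. a \<in> carrier A \<and> b \<in> carrier A} \<union>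
    {(\<eta> \<one>\<^bsub>A\<^esub>, \<one>\<^bsub>R\<^esub>)}"

definition fgl_eqs :: "('r, 'n) ring_scheme \<Rightarrow> (nat \<Rightarrow> nat \<Rightarrow> 'r) \<Rightarrow> ('r \<times> 'r) set" where
  "fgl_eqs R F =
    ps_eqs (ps_subst2 R F (ps_X R) (ps_zero R)) (ps_X R) \<union>
    ps_eqs (ps_subst2 R F (ps_zero R) (ps_Y R)) (ps_Y R) \<union>
    ps_eqs (ps_subst2 R F (ps_X R) (ps_Y R)) (ps_subst2 R F (ps_Y R) (ps_X R)) \<union>
    ps_eqs (ps_subst2 R F (ps_subst2 R F (ps_X R) (ps_Y R)) (ps_Z R))
           (ps_subst2 R F (ps_X R) (ps_subst2 R F (ps_Y R) (ps_Z R)))"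

definition fgl_hom_eqs ::
    "('r, 'n) ring_scheme \<Rightarrow> (nat \<Rightarrow> nat \<Rightarrow> 'r) \<Rightarrow> (nat \<Rightarrow> nat \<Rightarrow> 'r) \<Rightarrow> (nat \<Rightarrow> 'r) \<Rightarrow> ('r \<times> 'r) set"
  where
  "fgl_hom_eqs R F G f =
    {(f 0, \<zero>\<^bsub>R\<^esub>)} \<union>
    ps_eqs (ps_subst1 R f (ps_subst2 R F (ps_X R) (ps_Y R)))
           (ps_subst2 R G (ps_subst1 R f (ps_X R)) (ps_subst1 R f (ps_Y R)))"

text \<open>\<open>R\<close> is an \<open>A\<close>-algebra via \<open>\<eta>\<close>, and \<open>\<rho> a\<close> is the coefficient sequence of the series \<open>\<rho>(a)\<close>.\<close>

definition formal_module_eqs ::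
    "('a, 'm) ring_scheme \<Rightarrow> ('r, 'n) ring_scheme \<Rightarrow>
     ('a \<Rightarrow> 'r) \<Rightarrow> (nat \<Rightarrow> nat \<Rightarrow> 'r) \<Rightarrow> ('a \<Rightarrow> nat \<Rightarrow> 'r) \<Rightarrow> ('r \<times> 'r) set" where
  "formal_module_eqs A R \<eta> F \<rho> =
    algebra_eqs A R \<eta> \<union> fgl_eqs R F \<union>
    (\<Union>a\<in>carrier A. fgl_hom_eqs R F F (\<rho> a)) \<union>
    (\<Union>a\<in>carrier A. \<Union>b\<in>carrier A.
       ps_eqs (ps_subst1 R (\<rho> (a \<oplus>\<^bsub>A\<^esub> b)) (ps_X R))
              (ps_subst2 R F (ps_subst1 R (\<rho> a) (ps_X R)) (ps_subst1 R (\<rho> b) (ps_X R))) \<union>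
       ps_eqs (ps_subst1 R (\<rho> (a \<otimes>\<^bsub>A\<^esub> b)) (ps_X R))
              (ps_subst1 R (\<rho> a) (ps_subst1 R (\<rho> b) (ps_X R)))) \<union>
    ps_eqs (ps_subst1 R (\<rho> \<one>\<^bsub>A\<^esub>) (ps_X R)) (ps_X R) \<union>
    {(\<rho> a 1, \<eta> a) | a. a \<in> carrier A}"

definition strict_iso_eqs ::
    "('a, 'm) ring_scheme \<Rightarrow> ('r, 'n) ring_scheme \<Rightarrow>
     (nat \<Rightarrow> nat \<Rightarrow> 'r) \<Rightarrow> ('a \<Rightarrow> nat \<Rightarrow> 'r) \<Rightarrow>
     (nat \<Rightarrow> nat \<Rightarrow> 'r) \<Rightarrow> ('a \<Rightarrow> nat \<Rightarrow> 'r) \<Rightarrow> (nat \<Rightarrow> 'r) \<Rightarrow> ('r \<times> 'r) set" where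
  "strict_iso_eqs A R F \<rho> G \<sigma> f =
    fgl_hom_eqs R F G f \<union> {(f 1, \<one>\<^bsub>R\<^esub>)} \<union>
    (\<Union>a\<in>carrier A.
       ps_eqs (ps_subst1 R f (ps_subst1 R (\<rho> a) (ps_X R)))
              (ps_subst1 R (\<sigma> a) (ps_subst1 R f (ps_X R))))"

text \<open>A family of elements indexed by the following generators packages the data of an
  \<open>A\<close>-algebra structure, a series \<open>F\<close> and series \<open>\<rho>(a)\<close>.\<close>

datatype 'a mod_gen = Scal 'a | FCoeff nat nat | Act 'a nat

datatype 'a iso_gen = Src "'a mod_gen" | Tgt "'a mod_gen" | IsoCoeff nat

definition module_eqs ::
    "('a, 'm) ring_scheme \<Rightarrow> ('r, 'n) ring_scheme \<Rightarrow> ('a mod_gen \<Rightarrow> 'r) \<Rightarrow> ('r \<times> 'r) set" where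
  "module_eqs A R d =
    formal_module_eqs A R (\<lambda>a. d (Scal a)) (\<lambda>i j. d (FCoeff i j)) (\<lambda>a i. d (Act a i))"

definition iso_eqs ::
    "('a, 'm) ring_scheme \<Rightarrow> ('r, 'n) ring_scheme \<Rightarrow> ('a iso_gen \<Rightarrow> 'r) \<Rightarrow> ('r \<times> 'r) set" where
  "iso_eqs A R d =
    module_eqs A R (\<lambda>g. d (Src g)) \<union> module_eqs A R (\<lambda>g. d (Tgt g)) \<union>
    {(d (Src (Scal a)), d (Tgt (Scal a))) | a. a \<in> carrier A} \<union>
    strict_iso_eqs A R (\<lambda>i j. d (Src (FCoeff i j))) (\<lambda>a i. d (Src (Act a i)))
      (\<lambda>i j. d (Tgt (FCoeff i j))) (\<lambda>a i. d (Tgt (Act a i))) (\<lambda>i. d (IsoCoeff i))"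

definition mod_gens :: "('a, 'm) ring_scheme \<Rightarrow> 'a mod_gen set" where
  "mod_gens A = {Scal a | a. a \<in> carrier A} \<union> {FCoeff i j | i j. True} \<union>
    {Act a i | a i. a \<in> carrier A}"

definition iso_gens :: "('a, 'm) ring_scheme \<Rightarrow> 'a iso_gen set" where
  "iso_gens A = Src ` mod_gens A \<union> Tgt ` mod_gens A \<union> range IsoCoeff"

text \<open>The formal \<open>A\<close>-modules, and the strict isomorphisms of formal \<open>A\<close>-modules, over \<open>R\<close>
  (the \<open>A\<close>-algebra structure of \<open>R\<close> being part of the data).\<close>

definition formal_module ::
    "('a, 'm) ring_scheme \<Rightarrow> ('r, 'n) ring_scheme \<Rightarrow> ('a mod_gen \<Rightarrow> 'r) \<Rightarrow> bool" where
  "formal_module A R d \<longleftrightarrow>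
    d ` mod_gens A \<subseteq> carrier R \<and> (\<forall>(x, y)\<in>module_eqs A R d. x = y)"

definition strict_iso ::
    "('a, 'm) ring_scheme \<Rightarrow> ('r, 'n) ring_scheme \<Rightarrow> ('a iso_gen \<Rightarrow> 'r) \<Rightarrow> bool" where
  "strict_iso A R d \<longleftrightarrow>
    d ` iso_gens A \<subseteq> carrier R \<and> (\<forall>(x, y)\<in>iso_eqs A R d. x = y)"


section \<open>The rings corepresenting formal modules and strict isomorphisms\<close>

text \<open>Coefficients of total power \<open>i\<close> have degree \<open>2(i - 1)\<close>. The truncated subtraction only
  affects constant terms, which are zero in the rings.\<close>

primrec mod_weight :: "'a mod_gen \<Rightarrow> nat" where
  "mod_weight (Scal a) = 0"
| "mod_weight (FCoeff i j) = 2 * (i + j - 1)"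
| "mod_weight (Act a i) = 2 * (i - 1)"

primrec iso_weight :: "'a iso_gen \<Rightarrow> nat" where
  "iso_weight (Src g) = mod_weight g"
| "iso_weight (Tgt g) = mod_weight g"
| "iso_weight (IsoCoeff i) = 2 * (i - 1)"

definition mod_rels :: "('a, 'm) ring_scheme \<Rightarrow> 'a mod_gen zpoly set" where
  "mod_rels A = {x - y | x y. (x, y) \<in> module_eqs A (zpoly_ring (mod_gens A)) zvar}"

definition iso_rels :: "('a, 'm) ring_scheme \<Rightarrow> 'a iso_gen zpoly set" where
  "iso_rels A = {x - y | x y. (x, y) \<in> iso_eqs A (zpoly_ring (iso_gens A)) zvar}"

definition L_ring :: "('a, 'm) ring_scheme \<Rightarrow> 'a mod_gen zpoly set graded_ring" where
  "L_ring A = weighted_pres (mod_gens A) (mod_rels A) mod_weight"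

definition LB_ring :: "('a, 'm) ring_scheme \<Rightarrow> 'a iso_gen zpoly set graded_ring" where
  "LB_ring A = weighted_pres (iso_gens A) (iso_rels A) iso_weight"

definition L_gen :: "('a, 'm) ring_scheme \<Rightarrow> 'a mod_gen \<Rightarrow> 'a mod_gen zpoly set" where
  "L_gen A g = pres_class (mod_gens A) (mod_rels A) (zvar g)"

definition LB_gen :: "('a, 'm) ring_scheme \<Rightarrow> 'a iso_gen \<Rightarrow> 'a iso_gen zpoly set" where
  "LB_gen A g = pres_class (iso_gens A) (iso_rels A) (zvar g)"

definition L_scal :: "('a, 'm) ring_scheme \<Rightarrow> 'a \<Rightarrow> 'a mod_gen zpoly set" where
  "L_scal A a = L_gen A (Scal a)"

definition LB_scal :: "('a, 'm) ring_scheme \<Rightarrow> 'a \<Rightarrow> 'a iso_gen zpoly set" where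
  "LB_scal A a = LB_gen A (Src (Scal a))"

text \<open>Functoriality in \<open>A\<close>: a homomorphism \<open>h : A \<rightarrow> B\<close> turns formal \<open>B\<close>-modules into formal
  \<open>A\<close>-modules by restriction, and so induces maps of corepresenting rings.\<close>

definition L_map ::
    "('b, 'm) ring_scheme \<Rightarrow> ('a \<Rightarrow> 'b) \<Rightarrow> 'a mod_gen zpoly set \<Rightarrow> 'b mod_gen zpoly set" where
  "L_map B h = pres_map (L_ring B) (\<lambda>g. L_gen B (map_mod_gen h g))"

definition LB_map ::
    "('b, 'm) ring_scheme \<Rightarrow> ('a \<Rightarrow> 'b) \<Rightarrow> 'a iso_gen zpoly set \<Rightarrow> 'b iso_gen zpoly set" where
  "LB_map B h = pres_map (LB_ring B) (\<lambda>g. LB_gen B (map_iso_gen h g))"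


section \<open>Graded Hopf algebroids\<close>

text \<open>The comultiplication takes values in the tensor product of two copies of \<open>mor_ring\<close> over
  \<open>obj_ring\<close>, which acts on the left factor through the right unit and on the right factor
  through the left unit.\<close>

record ('l, 'g) hopf_algebroid =
  obj_ring :: "'l graded_ring"
  mor_ring :: "'g graded_ring"
  lunit :: "'l \<Rightarrow> 'g"
  runit :: "'l \<Rightarrow> 'g"
  counit :: "'g \<Rightarrow> 'l"
  conjugation :: "'g \<Rightarrow> 'g"
  comult :: "'g \<Rightarrow> ('g \<times> 'g) zpoly set"

definition comp_ring :: "('l, 'g) hopf_algebroid \<Rightarrow> ('g \<times> 'g) zpoly set graded_ring" where
  "comp_ring H = tensor (mor_ring H) (mor_ring H) (obj_ring H) (runit H) (lunit H)"

definition comp_elem :: "('l, 'g) hopf_algebroid \<Rightarrow> 'g \<Rightarrow> 'g \<Rightarrow> ('g \<times> 'g) zpoly set" where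
  "comp_elem H = tensor_elem (mor_ring H) (mor_ring H) (obj_ring H) (runit H) (lunit H)"

text \<open>The homomorphism between these tensor products induced by \<open>f\<close> on both factors.\<close>

definition comp_map ::
    "('l, 'g) hopf_algebroid \<Rightarrow> ('h \<Rightarrow> 'g) \<Rightarrow> ('h \<times> 'h) zpoly set \<Rightarrow> ('g \<times> 'g) zpoly set" where
  "comp_map H f = pres_map (comp_ring H) (\<lambda>(x, y). comp_elem H (f x) (f y))"

definition graded_ring_hom :: "'a graded_ring \<Rightarrow> 'b graded_ring \<Rightarrow> ('a \<Rightarrow> 'b) set" where
  "graded_ring_hom R S = {f \<in> ring_hom R S. \<forall>n. f ` hpart R n \<subseteq> hpart S n}"

definition hopf_hom ::
    "('l, 'g) hopf_algebroid \<Rightarrow> ('k, 'h) hopf_algebroid \<Rightarrow> ('l \<Rightarrow> 'k) \<Rightarrow> ('g \<Rightarrow> 'h) \<Rightarrow> bool" where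
  "hopf_hom H H' f0 f1 \<longleftrightarrow>
    f0 \<in> graded_ring_hom (obj_ring H) (obj_ring H') \<and>
    f1 \<in> graded_ring_hom (mor_ring H) (mor_ring H') \<and>
    (\<forall>x\<in>carrier (obj_ring H). f1 (lunit H x) = lunit H' (f0 x)) \<and>
    (\<forall>x\<in>carrier (obj_ring H). f1 (runit H x) = runit H' (f0 x)) \<and>
    (\<forall>y\<in>carrier (mor_ring H). f0 (counit H y) = counit H' (f1 y)) \<and>
    (\<forall>y\<in>carrier (mor_ring H). f1 (conjugation H y) = conjugation H' (f1 y)) \<and>
    (\<forall>y\<in>carrier (mor_ring H). comp_map H' f1 (comult H y) = comult H' (f1 y))"

definition hopf_iso ::
    "('l, 'g) hopf_algebroid \<Rightarrow> ('k, 'h) hopf_algebroid \<Rightarrow> ('l \<Rightarrow> 'k) \<Rightarrow> ('g \<Rightarrow> 'h) \<Rightarrow> bool" where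
  "hopf_iso H H' f0 f1 \<longleftrightarrow> hopf_hom H H' f0 f1 \<and>
    bij_betw f0 (carrier (obj_ring H)) (carrier (obj_ring H')) \<and>
    bij_betw f1 (carrier (mor_ring H)) (carrier (mor_ring H')) \<and>
    (\<forall>n. bij_betw f0 (hpart (obj_ring H) n) (hpart (obj_ring H') n)) \<and>
    (\<forall>n. bij_betw f1 (hpart (mor_ring H) n) (hpart (mor_ring H') n))"


subsection \<open>The Hopf algebroid of formal modules and strict isomorphisms\<close>

text \<open>The structure maps corepresent, in this order: source, target, identity, inverse and
  composition. The left tensor factor is the first of two composable isomorphisms.\<close>

definition L_lunit :: "('a, 'm) ring_scheme \<Rightarrow> 'a mod_gen zpoly set \<Rightarrow> 'a iso_gen zpoly set" where
  "L_lunit A = pres_map (LB_ring A) (\<lambda>g. LB_gen A (Src g))"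

definition L_runit :: "('a, 'm) ring_scheme \<Rightarrow> 'a mod_gen zpoly set \<Rightarrow> 'a iso_gen zpoly set" where
  "L_runit A = pres_map (LB_ring A) (\<lambda>g. LB_gen A (Tgt g))"

definition L_counit :: "('a, 'm) ring_scheme \<Rightarrow> 'a iso_gen zpoly set \<Rightarrow> 'a mod_gen zpoly set" where
  "L_counit A = pres_map (L_ring A) (\<lambda>g. case g of
      Src h \<Rightarrow> L_gen A h
    | Tgt h \<Rightarrow> L_gen A h
    | IsoCoeff i \<Rightarrow> (if i = 1 then \<one>\<^bsub>L_ring A\<^esub> else \<zero>\<^bsub>L_ring A\<^esub>))"

definition L_conjugation ::
    "('a, 'm) ring_scheme \<Rightarrow> 'a iso_gen zpoly set \<Rightarrow> 'a iso_gen zpoly set" where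
  "L_conjugation A = pres_map (LB_ring A) (\<lambda>g. case g of
      Src h \<Rightarrow> LB_gen A (Tgt h)
    | Tgt h \<Rightarrow> LB_gen A (Src h)
    | IsoCoeff i \<Rightarrow> series_inverse (LB_ring A) (\<lambda>j. LB_gen A (IsoCoeff j)) i)"

definition L_comult ::
    "('a, 'm) ring_scheme \<Rightarrow> 'a iso_gen zpoly set \<Rightarrow>
     ('a iso_gen zpoly set \<times> 'a iso_gen zpoly set) zpoly set" where
  "L_comult A =
    (let T = tensor (LB_ring A) (LB_ring A) (L_ring A) (L_runit A) (L_lunit A);
         t = tensor_elem (LB_ring A) (LB_ring A) (L_ring A) (L_runit A) (L_lunit A);
         in1 = (\<lambda>g. t (LB_gen A g) \<one>\<^bsub>LB_ring A\<^esub>);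
         in2 = (\<lambda>g. t \<one>\<^bsub>LB_ring A\<^esub> (LB_gen A g))
     in pres_map T (\<lambda>g. case g of
          Src h \<Rightarrow> in1 (Src h)
        | Tgt h \<Rightarrow> in2 (Tgt h)
        | IsoCoeff i \<Rightarrow>
            series_comp T (\<lambda>j. in2 (IsoCoeff j)) (\<lambda>j. in1 (IsoCoeff j)) i))"

definition L_hopf ::
    "('a, 'm) ring_scheme \<Rightarrow> ('a mod_gen zpoly set, 'a iso_gen zpoly set) hopf_algebroid" where
  "L_hopf A =
    \<lparr>obj_ring = L_ring A, mor_ring = LB_ring A,
     lunit = L_lunit A, runit = L_runit A, counit = L_counit A,
     conjugation = L_conjugation A, comult = L_comult A\<rparr>"


subsection \<open>Base change and completion of Hopf algebroids\<close>

text \<open>\<open>H\<close> is a Hopf algebroid of \<open>A\<close>-algebras: \<open>s0\<close>, \<open>s1\<close> are the structure maps from \<open>A\<close> to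
  \<open>obj_ring H\<close> and \<open>mor_ring H\<close>. Its base change along \<open>\<phi> : A \<rightarrow> B\<close> has the structure maps of
  \<open>H\<close> tensored with the identity of \<open>B\<close>; for the comultiplication this uses the identification
  of \<open>(\<Gamma> \<otimes>\<^sub>L \<Gamma>) \<otimes>\<^sub>A B\<close> with the tensor square of \<open>\<Gamma> \<otimes>\<^sub>A B\<close> over \<open>L \<otimes>\<^sub>A B\<close>.\<close>

definition base_change ::
    "('a, 'm) ring_scheme \<Rightarrow> ('a \<Rightarrow> 'l) \<Rightarrow> ('a \<Rightarrow> 'g) \<Rightarrow> ('l, 'g) hopf_algebroid \<Rightarrow>
     ('b, 'n) ring_scheme \<Rightarrow> ('a \<Rightarrow> 'b) \<Rightarrow>
     (('l \<times> 'b) zpoly set, ('g \<times> 'b) zpoly set) hopf_algebroid" where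
  "base_change A s0 s1 H B \<phi> =
    (let L = tensor (obj_ring H) (degree_zero B) A s0 \<phi>;
         G = tensor (mor_ring H) (degree_zero B) A s1 \<phi>;
         e0 = tensor_elem (obj_ring H) (degree_zero B) A s0 \<phi>;
         e1 = tensor_elem (mor_ring H) (degree_zero B) A s1 \<phi>;
         l = pres_map G (\<lambda>(x, b). e1 (lunit H x) b);
         r = pres_map G (\<lambda>(x, b). e1 (runit H x) b);
         T = tensor G G L r l;
         t = tensor_elem G G L r l
     in \<lparr>obj_ring = L, mor_ring = G, lunit = l, runit = r,
         counit = pres_map L (\<lambda>(y, b). e0 (counit H y) b),
         conjugation = pres_map G (\<lambda>(y, b). e1 (conjugation H y) b),
         comult = pres_map T (\<lambda>(y, b).
           pres_map T (\<lambda>(u, v). t (e1 u \<one>\<^bsub>B\<^esub>) (e1 v \<one>\<^bsub>B\<^esub>)) (comult H y) \<otimes>\<^bsub>T\<^esub>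
           t (e1 \<one>\<^bsub>mor_ring H\<^esub> b) (e1 \<one>\<^bsub>mor_ring H\<^esub> \<one>\<^bsub>B\<^esub>))\<rparr>)"

text \<open>Graded \<open>I\<close>-adic completion. The comultiplication of the completion is the continuous extension
  of \<open>\<Gamma> \<rightarrow> \<Gamma> \<otimes>\<^sub>L \<Gamma> \<rightarrow> T\<close>, where \<open>T\<close> is the tensor square of the completion of \<open>\<Gamma>\<close> over that of \<open>L\<close>.
  It exists as soon as \<open>T\<close> is itself \<open>I\<close>-adically complete in each degree; this is
  \<open>hopf_completion_ok\<close>.\<close>

definition hopf_completion ::
    "('a, 'm) ring_scheme \<Rightarrow> 'a set \<Rightarrow> ('a \<Rightarrow> 'l) \<Rightarrow> ('a \<Rightarrow> 'g) \<Rightarrow> ('l, 'g) hopf_algebroid \<Rightarrow>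
     (nat \<Rightarrow> 'l set, nat \<Rightarrow> 'g set) hopf_algebroid" where
  "hopf_completion A I s0 s1 H =
    (let J0 = adic A I (obj_ring H) s0;
         J1 = adic A I (mor_ring H) s1;
         L = graded_limit (obj_ring H) J0;
         G = graded_limit (mor_ring H) J1;
         c1 = to_limit (mor_ring H) J1;
         l = limit_map (mor_ring H) J1 (lunit H);
         r = limit_map (mor_ring H) J1 (runit H);
         T = tensor G G L r l;
         t = tensor_elem G G L r l
     in \<lparr>obj_ring = L, mor_ring = G, lunit = l, runit = r,
         counit = limit_map (obj_ring H) J0 (counit H),
         conjugation = limit_map (mor_ring H) J1 (conjugation H),
         comult = extend_limit T (adic A I T (\<lambda>a. t (c1 (s1 a)) \<one>\<^bsub>G\<^esub>))
           (\<lambda>y. pres_map T (\<lambda>(u, v). t (c1 u) (c1 v)) (comult H y))\<rparr>)"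

definition hopf_completion_ok ::
    "('a, 'm) ring_scheme \<Rightarrow> 'a set \<Rightarrow> ('a \<Rightarrow> 'l) \<Rightarrow> ('a \<Rightarrow> 'g) \<Rightarrow> ('l, 'g) hopf_algebroid \<Rightarrow> bool" where
  "hopf_completion_ok A I s0 s1 H \<longleftrightarrow>
    (let K = hopf_completion A I s0 s1 H;
         c1 = to_limit (mor_ring H) (adic A I (mor_ring H) s1)
     in graded_complete (comp_ring K)
          (adic A I (comp_ring K) (\<lambda>a. comp_elem K (c1 (s1 a)) \<one>\<^bsub>mor_ring K\<^esub>)))"


section \<open>The natural maps\<close>

text \<open>For an \<open>A\<close>-algebra \<open>R\<close> with structure map \<open>s\<close>: the map from the base change of \<open>R\<close> to the
  completion of \<open>A\<close> into the graded completion of \<open>R\<close>, sending \<open>x \<otimes> b\<close> to \<open>b x\<close>.\<close>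

definition base_change_to_completion ::
    "('a, 'm) ring_scheme \<Rightarrow> 'a set \<Rightarrow> 'r graded_ring \<Rightarrow> ('a \<Rightarrow> 'r) \<Rightarrow>
     ('r \<times> (nat \<Rightarrow> 'a set)) zpoly set \<Rightarrow> nat \<Rightarrow> 'r set" where
  "base_change_to_completion A I R s =
    (let J = adic A I R s in
     pres_map (graded_limit R J)
       (\<lambda>(x, b). to_limit R J x \<otimes>\<^bsub>graded_limit R J\<^esub> limit_map R J s b))"

text \<open>The rings of the Hopf algebroid of the completion of \<open>A\<close>, with their \<open>I\<close>-adic filtrations. If
  they are complete in each degree, then the maps from the rings for \<open>A\<close> extend to the graded
  completions.\<close>

abbreviation L_completion_adic :: "('a, 'm) ring_scheme \<Rightarrow> 'a set \<Rightarrow>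
    nat \<Rightarrow> (nat \<Rightarrow> 'a set) mod_gen zpoly set set" where
  "L_completion_adic A I \<equiv> adic A I (L_ring (completion A I))
     (\<lambda>a. L_scal (completion A I) (to_completion A I a))"

abbreviation LB_completion_adic :: "('a, 'm) ring_scheme \<Rightarrow> 'a set \<Rightarrow>
    nat \<Rightarrow> (nat \<Rightarrow> 'a set) iso_gen zpoly set set" where
  "LB_completion_adic A I \<equiv> adic A I (LB_ring (completion A I))
     (\<lambda>a. LB_scal (completion A I) (to_completion A I a))"

definition L_completion_map ::
    "('a, 'm) ring_scheme \<Rightarrow> 'a set \<Rightarrow>
     (nat \<Rightarrow> 'a mod_gen zpoly set set) \<Rightarrow> (nat \<Rightarrow> 'a set) mod_gen zpoly set" where
  "L_completion_map A I = extend_limit (L_ring (completion A I)) (L_completion_adic A I)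
     (L_map (completion A I) (to_completion A I))"

definition LB_completion_map ::
    "('a, 'm) ring_scheme \<Rightarrow> 'a set \<Rightarrow>
     (nat \<Rightarrow> 'a iso_gen zpoly set set) \<Rightarrow> (nat \<Rightarrow> 'a set) iso_gen zpoly set" where
  "LB_completion_map A I = extend_limit (LB_ring (completion A I)) (LB_completion_adic A I)
     (LB_map (completion A I) (to_completion A I))"


section \<open>Corepresentability\<close>


lemma carrier_zpoly_ring:
  "p \<in> carrier (zpoly_ring S) \<longleftrightarrow> (\<forall>m\<in>Poly_Mapping.keys p. Poly_Mapping.keys m \<subseteq> S)"
  by (simp add: zpoly_ring_def)

lemma zpoly_ring_simps [simp]:
  "\<one>\<^bsub>zpoly_ring S\<^esub> = 1" "\<zero>\<^bsub>zpoly_ring S\<^esub> = 0"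
  "x \<otimes>\<^bsub>zpoly_ring S\<^esub> y = x * y" "x \<oplus>\<^bsub>zpoly_ring S\<^esub> y = x + y"
  by (simp_all add: zpoly_ring_def)

lemma zpoly_closed [simp, intro]:
  assumes "p \<in> carrier (zpoly_ring S)" "q \<in> carrier (zpoly_ring S)"
  shows "p + q \<in> carrier (zpoly_ring S)" "p * q \<in> carrier (zpoly_ring S)"
    "- p \<in> carrier (zpoly_ring S)"
  subgoal using assms keys_add[of p q] unfolding carrier_zpoly_ring by blast
  subgoal unfolding carrier_zpoly_ring
  proof
    fix m assume "m \<in> Poly_Mapping.keys (p * q)"
    with keys_mult[of p q] obtain a b where
      "m = a + b" "a \<in> Poly_Mapping.keys p" "b \<in> Poly_Mapping.keys q" by blast
    then show "Poly_Mapping.keys m \<subseteq> S"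
      using assms keys_add[of a b] unfolding carrier_zpoly_ring by blast
  qed
  subgoal using assms unfolding carrier_zpoly_ring by simp
  done

lemma zpoly_consts [simp, intro]: "0 \<in> carrier (zpoly_ring S)" "1 \<in> carrier (zpoly_ring S)"
  by (auto simp: carrier_zpoly_ring)

lemma zpoly_cring: "cring (zpoly_ring S)"
proof (rule cringI)
  show "abelian_group (zpoly_ring S)"
    by (rule abelian_groupI) (auto simp: algebra_simps intro: bexI[of _ "- x" for x])
  show "comm_monoid (zpoly_ring S)"
    by (rule comm_monoidI) (auto simp: algebra_simps)
qed (auto simp: algebra_simps)

lemma zpoly_a_inv [simp]: 
  assumes "p \<in> carrier (zpoly_ring S)" shows "\<ominus>\<^bsub>zpoly_ring S\<^esub> p = - p"
proof -
  interpret cring "zpoly_ring S" by (rule zpoly_cring)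
  show ?thesis by (rule minus_equality) (use assms in auto)
qed

lemma zpoly_a_minus: 
  assumes "p \<in> carrier (zpoly_ring S)" "q \<in> carrier (zpoly_ring S)"
  shows "p \<ominus>\<^bsub>zpoly_ring S\<^esub> q = p - q"
  using assms by (simp add: a_minus_def)

lemma zpoly_diff [simp, intro]:
  assumes "p \<in> carrier (zpoly_ring S)" "q \<in> carrier (zpoly_ring S)"
  shows "p - q \<in> carrier (zpoly_ring S)"
  using zpoly_closed(1)[OF assms(1) zpoly_closed(3)[OF assms(2,2)]] by simp

lemma zvar_closed [simp]: "zvar g \<in> carrier (zpoly_ring S) \<longleftrightarrow> g \<in> S"
  by (auto simp: carrier_zpoly_ring zvar_def)

lemma pm_sum_singles:
  "p = (\<Sum>m\<in>Poly_Mapping.keys p. Poly_Mapping.single m (Poly_Mapping.lookup p m))"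
  by (rule poly_mapping_eqI)
     (simp add: lookup_sum lookup_single when_def in_keys_iff)

lemma zpoly_induct [consumes 1, case_names zero one var add diff mult]:
  assumes p: "p \<in> carrier (zpoly_ring S)"
    and zero: "P 0" and one: "P 1" and var: "\<And>g. g \<in> S \<Longrightarrow> P (zvar g)"
    and add: "\<And>p q. \<lbrakk>p \<in> carrier (zpoly_ring S); q \<in> carrier (zpoly_ring S); P p; P q\<rbrakk> \<Longrightarrow> P (p + q)"
    and uminus: "\<And>p. \<lbrakk>p \<in> carrier (zpoly_ring S); P p\<rbrakk> \<Longrightarrow> P (- p)"
    and mult: "\<And>p q. \<lbrakk>p \<in> carrier (zpoly_ring S); q \<in> carrier (zpoly_ring S); P p; P q\<rbrakk> \<Longrightarrow> P (p * q)"
  shows "P p"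
proof -
  let ?C = "carrier (zpoly_ring S)"
  have mon: "Poly_Mapping.single m 1 \<in> ?C \<and> P (Poly_Mapping.single m 1)"
    if "Poly_Mapping.keys m \<subseteq> S" for m :: "'a \<Rightarrow>\<^sub>0 nat"
    using that
  proof (induction "\<Sum>g\<in>Poly_Mapping.keys m. Poly_Mapping.lookup m g" arbitrary: m rule: less_induct)
    case less
    show ?case
    proof (cases "m = 0")
      case True
      then show ?thesis using one by simp
    next
      case False
      then obtain g where g: "g \<in> Poly_Mapping.keys m" by fastforce
      define m' where "m' = m - Poly_Mapping.single g 1"
      have look: "Poly_Mapping.lookup m' h = (if h = g then Poly_Mapping.lookup m g - 1 else Poly_Mapping.lookup m h)" for h
        by (simp add: m'_def lookup_minus lookup_single when_def)
      have m: "m = m' + Poly_Mapping.single g 1"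
        by (rule poly_mapping_eqI) (use g in \<open>auto simp: lookup_add look lookup_single when_def in_keys_iff\<close>)
      have sub: "Poly_Mapping.keys m' \<subseteq> Poly_Mapping.keys m"
        by (auto simp: in_keys_iff look split: if_splits)
      have "(\<Sum>h\<in>Poly_Mapping.keys m'. Poly_Mapping.lookup m' h) \<le> (\<Sum>h\<in>Poly_Mapping.keys m. Poly_Mapping.lookup m' h)"
        by (rule sum_mono2) (use sub in auto)
      also have "\<dots> < (\<Sum>h\<in>Poly_Mapping.keys m. Poly_Mapping.lookup m h)"
        by (rule sum_strict_mono_ex1) (use g in \<open>auto simp: look in_keys_iff\<close>)
      finally have "Poly_Mapping.single m' 1 \<in> ?C \<and> P (Poly_Mapping.single m' 1)"
        using less sub by blast
      moreover have "Poly_Mapping.single m (1::int) = Poly_Mapping.single m' 1 * zvar g"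
        by (subst m) (simp add: zvar_def mult_single)
      moreover have "g \<in> S" using g less.prems by blast
      moreover have "Poly_Mapping.single m' 1 * zvar g \<in> ?C \<and> P (Poly_Mapping.single m' 1 * zvar g)"
        using calculation mult[of "Poly_Mapping.single m' 1" "zvar g"] var by simp
      ultimately show ?thesis by metis
    qed
  qed
  have cnat: "Poly_Mapping.single 0 (int n) \<in> ?C \<and> P (Poly_Mapping.single 0 (int n))" for n
  proof (induction n)
    case (Suc n)
    have "Poly_Mapping.single 0 (int (Suc n)) = Poly_Mapping.single 0 (int n) + (1 :: 'a zpoly)"
      by (metis add.commute of_nat_Suc single_add single_one)
    then show ?case using Suc add one by auto
  qed (use zero in auto)
  have cint: "Poly_Mapping.single 0 c \<in> ?C \<and> P (Poly_Mapping.single 0 c)" for c :: int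
  proof (cases "c \<ge> 0")
    case True then show ?thesis using cnat[of "nat c"] by simp
  next
    case False
    then have "Poly_Mapping.single 0 c = - (Poly_Mapping.single 0 (int (nat (- c))) :: 'a zpoly)"
      by (simp add: single_uminus)
    then show ?thesis using cnat[of "nat (- c)"] uminus by auto
  qed
  have trm: "Poly_Mapping.single m c \<in> ?C \<and> P (Poly_Mapping.single m c)"
    if "Poly_Mapping.keys m \<subseteq> S" for m c
  proof -
    have "Poly_Mapping.single m c = Poly_Mapping.single 0 c * Poly_Mapping.single m 1"
      by (simp add: mult_single)
    then show ?thesis
      using cint[of c] mon[OF that] mult[of "Poly_Mapping.single 0 c" "Poly_Mapping.single m 1"]
      by auto
  qed
  have "K \<subseteq> Poly_Mapping.keys p \<Longrightarrow>
     (\<Sum>m\<in>K. Poly_Mapping.single m (Poly_Mapping.lookup p m)) \<in> ?C \<and>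
     P (\<Sum>m\<in>K. Poly_Mapping.single m (Poly_Mapping.lookup p m))" if "finite K" for K
    using that
  proof (induction K)
    case (insert m K)
    then have "Poly_Mapping.keys m \<subseteq> S" using p by (auto simp: carrier_zpoly_ring)
    then show ?case using insert trm add by auto
  qed (use zero in auto)
  from this[of "Poly_Mapping.keys p"] show ?thesis using pm_sum_singles[of p] by auto
qed


context cring
begin

definition mon_eval :: "('g \<Rightarrow> 'a) \<Rightarrow> ('g \<Rightarrow>\<^sub>0 nat) \<Rightarrow> 'a" where
  "mon_eval f m = (\<Otimes>g\<in>Poly_Mapping.keys m. f g [^] Poly_Mapping.lookup m g)"

lemma mon_eval_closed: "f ` Poly_Mapping.keys m \<subseteq> carrier R \<Longrightarrow> mon_eval f m \<in> carrier R"
  unfolding mon_eval_def by (rule finprod_closed) auto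

lemma mon_eval_superset:
  assumes "finite K" "Poly_Mapping.keys m \<subseteq> K" "f ` K \<subseteq> carrier R"
  shows "mon_eval f m = (\<Otimes>g\<in>K. f g [^] Poly_Mapping.lookup m g)"
  unfolding mon_eval_def
  by (rule finprod_mono_neutral_cong_left) (use assms in \<open>auto simp: in_keys_iff\<close>)

lemma mon_eval_add:
  assumes "f ` Poly_Mapping.keys m \<subseteq> carrier R" "f ` Poly_Mapping.keys n \<subseteq> carrier R"
  shows "mon_eval f (m + n) = mon_eval f m \<otimes> mon_eval f n"
proof -
  let ?K = "Poly_Mapping.keys m \<union> Poly_Mapping.keys n"
  have K: "finite ?K" "f ` ?K \<subseteq> carrier R" using assms by auto
  have "mon_eval f (m + n) = (\<Otimes>g\<in>?K. f g [^] Poly_Mapping.lookup (m + n) g)"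
    by (rule mon_eval_superset) (use K keys_add[of m n] in auto)
  also have "\<dots> = (\<Otimes>g\<in>?K. f g [^] Poly_Mapping.lookup m g \<otimes> f g [^] Poly_Mapping.lookup n g)"
    by (rule finprod_cong') (use assms in \<open>auto simp: lookup_add nat_pow_mult image_subset_iff\<close>)
  also have "\<dots> = (\<Otimes>g\<in>?K. f g [^] Poly_Mapping.lookup m g) \<otimes> (\<Otimes>g\<in>?K. f g [^] Poly_Mapping.lookup n g)"
    by (rule finprod_multf) (use assms in auto)
  finally show ?thesis using K by (simp add: mon_eval_superset[symmetric])
qed

lemma zeval_superset:
  assumes "finite K" "Poly_Mapping.keys p \<subseteq> K" "\<And>m. m \<in> K \<Longrightarrow> f ` Poly_Mapping.keys m \<subseteq> carrier R"
  shows "zeval R f p = (\<Oplus>m\<in>K. add_pow R (Poly_Mapping.lookup p m) (mon_eval f m))"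
proof -
  have M: "mon_eval f m \<in> carrier R" if "m \<in> K" for m
    using mon_eval_closed assms(3)[OF that] by blast
  show ?thesis
    unfolding zeval_def mon_eval_def[symmetric]
    by (rule add.finprod_mono_neutral_cong_left)
       (use assms M in \<open>auto simp: in_keys_iff add_pow_int_ge\<close>)
qed

lemma zeval_keys:
  assumes "f ` S \<subseteq> carrier R" "p \<in> carrier (zpoly_ring S)" "m \<in> Poly_Mapping.keys p"
  shows "f ` Poly_Mapping.keys m \<subseteq> carrier R"
  using assms by (fastforce simp: carrier_zpoly_ring)

lemma zeval_closed:
  assumes "f ` S \<subseteq> carrier R" "p \<in> carrier (zpoly_ring S)"
  shows "zeval R f p \<in> carrier R"
proof -
  have M: "mon_eval f m \<in> carrier R" if "m \<in> Poly_Mapping.keys p" for m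
    using mon_eval_closed zeval_keys[OF assms that] by blast
  show ?thesis
    unfolding zeval_def mon_eval_def[symmetric] by (rule finsum_closed) (use M in auto)
qed

lemma zeval_add:
  assumes "f ` S \<subseteq> carrier R" "p \<in> carrier (zpoly_ring S)" "q \<in> carrier (zpoly_ring S)"
  shows "zeval R f (p + q) = zeval R f p \<oplus> zeval R f q"
proof -
  let ?K = "Poly_Mapping.keys p \<union> Poly_Mapping.keys q"
  have cl: "f ` Poly_Mapping.keys m \<subseteq> carrier R" if "m \<in> ?K" for m
    using that zeval_keys[OF assms(1,2)] zeval_keys[OF assms(1,3)] by blast
  have M: "mon_eval f m \<in> carrier R" if "m \<in> ?K" for m using mon_eval_closed[OF cl[OF that]] .
  have "zeval R f (p + q) = (\<Oplus>m\<in>?K. add_pow R (Poly_Mapping.lookup (p + q) m) (mon_eval f m))"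
    by (rule zeval_superset) (use cl keys_add[of p q] in auto)
  also have "\<dots> = (\<Oplus>m\<in>?K. add_pow R (Poly_Mapping.lookup p m) (mon_eval f m) \<oplus>
                       add_pow R (Poly_Mapping.lookup q m) (mon_eval f m))"
    by (rule finsum_cong') (use M in \<open>auto simp: lookup_add add.int_pow_mult add.int_pow_closed Pi_iff\<close>)
  also have "\<dots> = (\<Oplus>m\<in>?K. add_pow R (Poly_Mapping.lookup p m) (mon_eval f m)) \<oplus>
                  (\<Oplus>m\<in>?K. add_pow R (Poly_Mapping.lookup q m) (mon_eval f m))"
    by (rule finsum_addf) (use M in \<open>auto simp: Pi_iff add.int_pow_closed\<close>)
  also have "\<dots> = zeval R f p \<oplus> zeval R f q"
    using zeval_superset[of ?K p f] zeval_superset[of ?K q f] cl by simp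
  finally show ?thesis .
qed

lemma zeval_single:
  assumes "f ` Poly_Mapping.keys m \<subseteq> carrier R"
  shows "zeval R f (Poly_Mapping.single m c) = add_pow R c (mon_eval f m)"
  using zeval_superset[of "{m}" "Poly_Mapping.single m c" f] assms mon_eval_closed[OF assms]
  by (simp add: add.int_pow_closed)

lemma zeval_zero [simp]: "zeval R f 0 = \<zero>"
  by (simp add: zeval_def)

lemma zeval_one [simp]: "zeval R f 1 = \<one>"
  using zeval_single[of f 0 1] by (simp add: mon_eval_def)

lemma zeval_zvar: "f g \<in> carrier R \<Longrightarrow> zeval R f (zvar g) = f g"
  unfolding zvar_def by (subst zeval_single) (auto simp: mon_eval_def)

lemma zeval_mult:
  fixes f :: "'g \<Rightarrow> 'a"
  assumes f: "f ` S \<subseteq> carrier R" and p: "p \<in> carrier (zpoly_ring S)" and q: "q \<in> carrier (zpoly_ring S)"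
  shows "zeval R f (p * q) = zeval R f p \<otimes> zeval R f q"
proof -
  have sub: "f ` Poly_Mapping.keys m \<subseteq> carrier R" if "Poly_Mapping.keys m \<subseteq> S" for m :: "'g \<Rightarrow>\<^sub>0 nat"
    using that f by blast
  have sc: "Poly_Mapping.single m c \<in> carrier (zpoly_ring S)" 
    if "Poly_Mapping.keys m \<subseteq> S" for m c using that by (auto simp: carrier_zpoly_ring)
  have ss: "zeval R f (Poly_Mapping.single m c * Poly_Mapping.single n d) =
     zeval R f (Poly_Mapping.single m c) \<otimes> zeval R f (Poly_Mapping.single n d)"
    if "Poly_Mapping.keys m \<subseteq> S" "Poly_Mapping.keys n \<subseteq> S" for m n c d
  proof -
    have "f ` Poly_Mapping.keys (m + n) \<subseteq> carrier R"
      using sub[OF that(1)] sub[OF that(2)] keys_add[of m n] by blast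
    then show ?thesis
      using sub[OF that(1)] sub[OF that(2)] mon_eval_closed[of f m] mon_eval_closed[of f n]
      by (simp add: mult_single zeval_single mon_eval_add add_pow_ldistr_int add_pow_rdistr_int
          add.int_pow_pow add.int_pow_closed mult.commute)
  qed
  have dec: "P x" if x: "x \<in> carrier (zpoly_ring S)" and z: "P 0"
    and s: "\<And>m c. Poly_Mapping.keys m \<subseteq> S \<Longrightarrow> P (Poly_Mapping.single m c)"
    and a: "\<And>u v. \<lbrakk>u \<in> carrier (zpoly_ring S); v \<in> carrier (zpoly_ring S); P u; P v\<rbrakk> \<Longrightarrow> P (u + v)"
    for P and x :: "'g zpoly"
  proof -
    have "K \<subseteq> Poly_Mapping.keys x \<Longrightarrow>
     (\<Sum>m\<in>K. Poly_Mapping.single m (Poly_Mapping.lookup x m)) \<in> carrier (zpoly_ring S) \<and>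
     P (\<Sum>m\<in>K. Poly_Mapping.single m (Poly_Mapping.lookup x m))" if "finite K" for K
      using that
    proof (induction K)
      case (insert m K)
      then have "Poly_Mapping.keys m \<subseteq> S" using x by (auto simp: carrier_zpoly_ring)
      then show ?case using insert s sc a by auto
    qed (use z in auto)
    from this[of "Poly_Mapping.keys x"] show ?thesis using pm_sum_singles[of x] by auto
  qed
  note cl = zeval_closed[OF f]
  note ad = zeval_add[OF f]
  have one: "zeval R f (Poly_Mapping.single m c * q) = zeval R f (Poly_Mapping.single m c) \<otimes> zeval R f q"
    if m: "Poly_Mapping.keys m \<subseteq> S" for m c
    using q
  proof (rule dec)
    fix u v assume "u \<in> carrier (zpoly_ring S)" "v \<in> carrier (zpoly_ring S)" 
      "zeval R f (Poly_Mapping.single m c * u) = zeval R f (Poly_Mapping.single m c) \<otimes> zeval R f u"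
      "zeval R f (Poly_Mapping.single m c * v) = zeval R f (Poly_Mapping.single m c) \<otimes> zeval R f v"
    then show "zeval R f (Poly_Mapping.single m c * (u + v)) = zeval R f (Poly_Mapping.single m c) \<otimes> zeval R f (u + v)"
      using sc[OF m, of c] cl ad by (simp add: distrib_left r_distr)
  qed (use ss m cl sc in auto)
  show ?thesis
    using p
  proof (rule dec)
    fix u v assume "u \<in> carrier (zpoly_ring S)" "v \<in> carrier (zpoly_ring S)" 
      "zeval R f (u * q) = zeval R f u \<otimes> zeval R f q" "zeval R f (v * q) = zeval R f v \<otimes> zeval R f q"
    then show "zeval R f ((u + v) * q) = zeval R f (u + v) \<otimes> zeval R f q"
      using q cl ad by (simp add: distrib_right l_distr)
  qed (use one cl q in auto)
qed

lemma zeval_hom: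
  assumes "f ` S \<subseteq> carrier R" shows "zeval R f \<in> ring_hom (zpoly_ring S) R"
  by (rule ring_hom_memI) (auto simp: zeval_closed[OF assms] zeval_add[OF assms] zeval_mult[OF assms])

end

lemma zpoly_hom_eq_zeval:
  assumes R: "cring R" and f: "f ` S \<subseteq> carrier R" and h: "h \<in> ring_hom (zpoly_ring S) R"
    and hf: "\<And>g. g \<in> S \<Longrightarrow> h (zvar g) = f g" and p: "p \<in> carrier (zpoly_ring S)"
  shows "h p = zeval R f p"
proof -
  interpret R: cring R by fact
  interpret Z: cring "zpoly_ring S" by (rule zpoly_cring)
  interpret h: ring_hom_cring "zpoly_ring S" R h
    by (rule UnivPoly.ring_hom_cringI[OF zpoly_cring R h])
  interpret e: ring_hom_cring "zpoly_ring S" R "zeval R f"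
    by (rule UnivPoly.ring_hom_cringI[OF zpoly_cring R R.zeval_hom[OF f]])
  from p show ?thesis
  proof (induction p rule: zpoly_induct)
    case zero then show ?case using h.hom_zero by simp
  next
    case one then show ?case using h.hom_one by simp
  next
    case (var g) then show ?case using hf f R.zeval_zvar by (metis image_subset_iff)
  next
    case (add p q) then show ?case using h.hom_add[of p q] e.hom_add[of p q] by simp
  next
    case (diff p) then show ?case using h.hom_a_inv[of p] e.hom_a_inv[of p] by simp
  next
    case (mult p q) then show ?case using h.hom_mult[of p q] e.hom_mult[of p q] by simp
  qed
qed


locale presentation =
  fixes S :: "'g set" and E :: "'g zpoly set"
  assumes rels: "E \<subseteq> carrier (zpoly_ring S)"
begin

lemma ideal_rels: "ideal (Idl\<^bsub>zpoly_ring S\<^esub> E) (zpoly_ring S)"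
  using ring.genideal_ideal[OF cring.axioms(1)[OF zpoly_cring] rels] .

lemma pres_cring: "cring (pres S E)"
  unfolding pres_def by (rule ideal.quotient_is_cring[OF ideal_rels zpoly_cring])

lemma pres_class_hom: "pres_class S E \<in> ring_hom (zpoly_ring S) (pres S E)"
  using ideal.rcos_ring_hom[OF ideal_rels] unfolding pres_def pres_class_def[abs_def] .

lemma carrier_pres: "carrier (pres S E) = pres_class S E ` carrier (zpoly_ring S)"
  by (auto simp: pres_def pres_class_def FactRing_def A_RCOSETS_def' )

lemma pres_class_rel: 
  assumes "p \<in> carrier (zpoly_ring S)" "q \<in> carrier (zpoly_ring S)" "p - q \<in> E"
  shows "pres_class S E p = pres_class S E q"
proof -
  have "p - q \<in> Idl\<^bsub>zpoly_ring S\<^esub> E"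
    using ring.genideal_self[OF cring.axioms(1)[OF zpoly_cring] rels] assms by blast
  then show ?thesis
    using ring.quotient_eq_iff_same_a_r_cos[OF cring.axioms(1)[OF zpoly_cring] ideal_rels assms(1,2)]
      zpoly_a_minus[OF assms(1,2)] by (simp add: pres_class_def)
qed

lemma pres_class_member:
  assumes "p \<in> carrier (zpoly_ring S)"
  shows "p \<in> pres_class S E p" 
    and "q \<in> pres_class S E p \<Longrightarrow> q \<in> carrier (zpoly_ring S) \<and> q - p \<in> Idl\<^bsub>zpoly_ring S\<^esub> E"
proof -
  interpret ideal "Idl\<^bsub>zpoly_ring S\<^esub> E" "zpoly_ring S" by (rule ideal_rels)
  show "p \<in> pres_class S E p" using a_rcos_self[OF assms] by (simp add: pres_class_def)
  assume "q \<in> pres_class S E p"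
  then obtain i where "i \<in> Idl\<^bsub>zpoly_ring S\<^esub> E" "q = i + p"
    by (auto simp: pres_class_def a_r_coset_def')
  then show "q \<in> carrier (zpoly_ring S) \<and> q - p \<in> Idl\<^bsub>zpoly_ring S\<^esub> E"
    using Icarr assms by auto
qed

context
  fixes R :: "('r, 'm) ring_scheme" and f :: "'g \<Rightarrow> 'r"
  assumes R: "cring R" and f: "f ` S \<subseteq> carrier R" and f_rels: "\<And>e. e \<in> E \<Longrightarrow> zeval R f e = \<zero>\<^bsub>R\<^esub>"
begin

interpretation R: cring R by (rule R)
interpretation e: ring_hom_ring "zpoly_ring S" R "zeval R f"
  by (rule ring_hom_ringI2[OF cring.axioms(1)[OF zpoly_cring] R.ring_axioms R.zeval_hom[OF f]])

lemma zeval_Idl: 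
  assumes "i \<in> Idl\<^bsub>zpoly_ring S\<^esub> E" shows "zeval R f i = \<zero>\<^bsub>R\<^esub>"
proof -
  have "E \<subseteq> a_kernel (zpoly_ring S) R (zeval R f)"
    unfolding a_kernel_def' using rels f_rels by blast
  from ring.genideal_minimal[OF cring.axioms(1)[OF zpoly_cring] e.kernel_is_ideal this] assms
  have "i \<in> a_kernel (zpoly_ring S) R (zeval R f)" by (rule subsetD)
  then show ?thesis unfolding a_kernel_def' by simp
qed

lemma pres_map_class:
  assumes "p \<in> carrier (zpoly_ring S)"
  shows "pres_map R f (pres_class S E p) = zeval R f p"
  unfolding pres_map_def
proof (rule the_equality)
  show "\<forall>q\<in>pres_class S E p. zeval R f q = zeval R f p"
  proof
    fix q assume q: "q \<in> pres_class S E p"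
    note q' = pres_class_member(2)[OF assms q]
    have "zeval R f ((q - p) + p) = zeval R f p"
      using e.hom_add[of "q - p" p] q' assms zeval_Idl[of "q - p"] R.zeval_closed[OF f assms]
      by simp
    then show "zeval R f q = zeval R f p" by simp
  qed
qed (drule bspec, rule pres_class_member(1)[OF assms], simp)

lemma pres_map_hom: "pres_map R f \<in> ring_hom (pres S E) R"
proof -
  interpret c: ring_hom_ring "zpoly_ring S" "pres S E" "pres_class S E"
    by (rule ring_hom_ringI2[OF cring.axioms(1)[OF zpoly_cring] cring.axioms(1)[OF pres_cring] pres_class_hom])
  show ?thesis
  proof (rule ring_hom_memI)
    show "pres_map R f \<one>\<^bsub>pres S E\<^esub> = \<one>\<^bsub>R\<^esub>"
      using pres_map_class[of 1] c.hom_one by simp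
  next
    fix x y assume "x \<in> carrier (pres S E)" "y \<in> carrier (pres S E)"
    then obtain p q where pq: "p \<in> carrier (zpoly_ring S)" "q \<in> carrier (zpoly_ring S)"
      "x = pres_class S E p" "y = pres_class S E q" by (auto simp: carrier_pres)
    show "pres_map R f (x \<otimes>\<^bsub>pres S E\<^esub> y) = pres_map R f x \<otimes>\<^bsub>R\<^esub> pres_map R f y"
      using c.hom_mult[of p q] e.hom_mult[of p q] pq pres_map_class[of "p * q"] pres_map_class by simp
    show "pres_map R f (x \<oplus>\<^bsub>pres S E\<^esub> y) = pres_map R f x \<oplus>\<^bsub>R\<^esub> pres_map R f y"
      using c.hom_add[of p q] e.hom_add[of p q] pq pres_map_class[of "p + q"] pres_map_class by simp
  qed (auto simp: carrier_pres pres_map_class R.zeval_closed[OF f])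
qed

lemma pres_map_gen: "g \<in> S \<Longrightarrow> pres_map R f (pres_class S E (zvar g)) = f g"
  using pres_map_class[of "zvar g"] f by (auto simp: R.zeval_zvar image_subset_iff)

lemma pres_map_unique:
  assumes "h \<in> ring_hom (pres S E) R" "\<And>g. g \<in> S \<Longrightarrow> h (pres_class S E (zvar g)) = f g"
    and x: "x \<in> carrier (pres S E)"
  shows "h x = pres_map R f x"
proof -
  have "h \<circ> pres_class S E \<in> ring_hom (zpoly_ring S) R"
    using ring_hom_trans[OF pres_class_hom assms(1)] .
  moreover obtain p where "p \<in> carrier (zpoly_ring S)" "x = pres_class S E p"
    using x unfolding carrier_pres by blast
  ultimately show ?thesis
    using zpoly_hom_eq_zeval[OF R f, of "h \<circ> pres_class S E" p] assms(2) pres_map_class[of p]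
    by simp
qed

end

end


context cring
begin

lemma ps_monom_closed [simp]: "ps_monom R e d \<in> carrier R"
  by (simp add: ps_monom_def)

lemma ps_zero_closed [simp]: "ps_zero R d \<in> carrier R"
  by (simp add: ps_zero_def)

lemma ps_mult_closed:
  "\<lbrakk>\<And>d. u d \<in> carrier R; \<And>d. v d \<in> carrier R\<rbrakk> \<Longrightarrow> ps_mult R u v d \<in> carrier R"
  by (cases d) (auto simp: ps_mult_def intro!: finsum_closed)

lemma ps_pow_closed: "(\<And>d. u d \<in> carrier R) \<Longrightarrow> ps_pow R u n d \<in> carrier R"
  by (induction n arbitrary: d) (auto intro: ps_mult_closed)

lemma ps_subst1_closed:
  "\<lbrakk>\<And>i. f i \<in> carrier R; \<And>d. u d \<in> carrier R\<rbrakk> \<Longrightarrow> ps_subst1 R f u d \<in> carrier R"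
  by (cases d) (auto simp: ps_subst1_def intro!: finsum_closed ps_pow_closed)

lemma ps_subst2_closed:
  "\<lbrakk>\<And>i j. F i j \<in> carrier R; \<And>d. u d \<in> carrier R; \<And>d. v d \<in> carrier R\<rbrakk>
    \<Longrightarrow> ps_subst2 R F u v d \<in> carrier R"
  by (cases d) (auto simp: ps_subst2_def intro!: finsum_closed ps_mult_closed ps_pow_closed)

lemmas ps_closed = ps_mult_closed ps_pow_closed ps_subst1_closed ps_subst2_closed

end

context ring_hom_cring
begin

lemma hom_ps_monom: "(\<lambda>d. h (ps_monom R e d)) = ps_monom S e"
  by (auto simp: ps_monom_def)

lemma hom_ps_zero: "(\<lambda>d. h (ps_zero R d)) = ps_zero S"
  by (auto simp: ps_zero_def)

lemma hom_ps_mult: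
  assumes "\<And>d. u d \<in> carrier R" "\<And>d. v d \<in> carrier R"
  shows "(\<lambda>d. h (ps_mult R u v d)) = ps_mult S (\<lambda>d. h (u d)) (\<lambda>d. h (v d))"
proof
  fix d :: "nat \<times> nat \<times> nat"
  obtain a b c where d: "d = (a, b, c)" by (cases d)
  have "h (ps_mult R u v d) = (\<Oplus>\<^bsub>S\<^esub>e\<in>{..a} \<times> {..b} \<times> {..c}.
      h (case e of (i, j, k) \<Rightarrow> u (i, j, k) \<otimes> v (a - i, b - j, c - k)))"
    unfolding d ps_mult_def using assms by (auto simp: hom_finsum o_def Pi_iff)
  also have "\<dots> = ps_mult S (\<lambda>d. h (u d)) (\<lambda>d. h (v d)) d"
    unfolding d ps_mult_def prod.case
    by (rule S.finsum_cong') (use assms in \<open>auto simp: Pi_iff\<close>)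
  finally show "h (ps_mult R u v d) = \<dots>" .
qed

lemma hom_ps_pow:
  assumes "\<And>d. u d \<in> carrier R"
  shows "(\<lambda>d. h (ps_pow R u n d)) = ps_pow S (\<lambda>d. h (u d)) n"
  by (induction n) (simp_all add: hom_ps_monom hom_ps_mult R.ps_pow_closed assms)

lemma hom_ps_subst1:
  assumes "\<And>i. f i \<in> carrier R" "\<And>d. u d \<in> carrier R"
  shows "(\<lambda>d. h (ps_subst1 R f u d)) = ps_subst1 S (\<lambda>i. h (f i)) (\<lambda>d. h (u d))"
proof
  fix d :: "nat \<times> nat \<times> nat"
  obtain a b c where d: "d = (a, b, c)" by (cases d)
  note cl = R.ps_pow_closed[of u, OF assms(2)]
  have "h (ps_subst1 R f u d) = (\<Oplus>\<^bsub>S\<^esub>i\<in>{..a + b + c}. h (f i \<otimes> ps_pow R u i (a, b, c)))"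
    unfolding d ps_subst1_def using assms cl by (auto simp: hom_finsum o_def Pi_iff)
  also have "\<dots> = ps_subst1 S (\<lambda>i. h (f i)) (\<lambda>d. h (u d)) d"
    unfolding d ps_subst1_def prod.case hom_ps_pow[of u, OF assms(2), symmetric]
    by (rule S.finsum_cong') (use assms cl in \<open>auto simp: Pi_iff\<close>)
  finally show "h (ps_subst1 R f u d) = \<dots>" .
qed

lemma hom_ps_subst2:
  assumes "\<And>i j. F i j \<in> carrier R" "\<And>d. u d \<in> carrier R" "\<And>d. v d \<in> carrier R"
  shows "(\<lambda>d. h (ps_subst2 R F u v d)) =
    ps_subst2 S (\<lambda>i j. h (F i j)) (\<lambda>d. h (u d)) (\<lambda>d. h (v d))"
proof
  fix d :: "nat \<times> nat \<times> nat"
  obtain a b c where d: "d = (a, b, c)" by (cases d)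
  note clu = R.ps_pow_closed[of u, OF assms(2)] and clv = R.ps_pow_closed[of v, OF assms(3)]
  note cl = R.ps_mult_closed[of "ps_pow R u i" "ps_pow R v j" for i j, OF clu clv]
  have "h (ps_subst2 R F u v d) = (\<Oplus>\<^bsub>S\<^esub>e\<in>{..a + b + c} \<times> {..a + b + c}.
      h (case e of (i, j) \<Rightarrow> F i j \<otimes> ps_mult R (ps_pow R u i) (ps_pow R v j) (a, b, c)))"
    unfolding d ps_subst2_def using assms cl by (auto simp: hom_finsum o_def Pi_iff)
  also have "\<dots> = ps_subst2 S (\<lambda>i j. h (F i j)) (\<lambda>d. h (u d)) (\<lambda>d. h (v d)) d"
    unfolding d ps_subst2_def prod.case
      hom_ps_pow[of u, OF assms(2), symmetric] hom_ps_pow[of v, OF assms(3), symmetric]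
      hom_ps_mult[of "ps_pow R u i" "ps_pow R v j" for i j, OF clu clv, symmetric]
    by (rule S.finsum_cong') (use assms cl in \<open>auto simp: Pi_iff\<close>)
  finally show "h (ps_subst2 R F u v d) = \<dots>" .
qed

lemmas hom_ps = hom_ps_monom hom_ps_zero hom_ps_subst1 hom_ps_subst2

lemma image_ps_eqs:
  "map_prod h h ` ps_eqs u v = ps_eqs (\<lambda>d. h (u d)) (\<lambda>d. h (v d))"
  by (auto simp: ps_eqs_def)

lemma image_fgl_hom_eqs:
  assumes "\<And>i j. F i j \<in> carrier R" "\<And>i j. G i j \<in> carrier R" "\<And>i. f i \<in> carrier R"
  shows "map_prod h h ` fgl_hom_eqs R F G f =
    fgl_hom_eqs S (\<lambda>i j. h (F i j)) (\<lambda>i j. h (G i j)) (\<lambda>i. h (f i))"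
  using assms by (simp add: fgl_hom_eqs_def image_Un image_ps_eqs hom_ps R.ps_closed)

lemma image_fgl_eqs:
  assumes "\<And>i j. F i j \<in> carrier R"
  shows "map_prod h h ` fgl_eqs R F = fgl_eqs S (\<lambda>i j. h (F i j))"
  using assms by (simp add: fgl_eqs_def image_Un image_ps_eqs hom_ps R.ps_closed)

lemma image_algebra_eqs:
  assumes "cring A" "\<And>a. a \<in> carrier A \<Longrightarrow> \<eta> a \<in> carrier R"
  shows "map_prod h h ` algebra_eqs A R \<eta> = algebra_eqs A S (\<lambda>a. h (\<eta> a))"
proof -
  interpret A: cring A by fact
  have 1: "map_prod h h ` {(\<eta> (a \<oplus>\<^bsub>A\<^esub> b), \<eta> a \<oplus> \<eta> b) | a b. a \<in> carrier A \<and> b \<in> carrier A} =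
    {(h (\<eta> (a \<oplus>\<^bsub>A\<^esub> b)), h (\<eta> a) \<oplus>\<^bsub>S\<^esub> h (\<eta> b)) | a b. a \<in> carrier A \<and> b \<in> carrier A}"
    by (force simp: assms image_iff)
  have 2: "map_prod h h ` {(\<eta> (a \<otimes>\<^bsub>A\<^esub> b), \<eta> a \<otimes> \<eta> b) | a b. a \<in> carrier A \<and> b \<in> carrier A} =
    {(h (\<eta> (a \<otimes>\<^bsub>A\<^esub> b)), h (\<eta> a) \<otimes>\<^bsub>S\<^esub> h (\<eta> b)) | a b. a \<in> carrier A \<and> b \<in> carrier A}"
    by (force simp: assms image_iff)
  show ?thesis by (simp add: algebra_eqs_def image_Un 1 2)
qed

lemma image_module_eqs:
  assumes A: "cring A" and d: "d ` mod_gens A \<subseteq> carrier R"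
  shows "map_prod h h ` module_eqs A R d = module_eqs A S (\<lambda>g. h (d g))"
proof -
  interpret A: cring A by fact
  have d': "\<And>a. a \<in> carrier A \<Longrightarrow> d (Scal a) \<in> carrier R" "\<And>i j. d (FCoeff i j) \<in> carrier R"
    "\<And>a i. a \<in> carrier A \<Longrightarrow> d (Act a i) \<in> carrier R"
    using d by (auto simp: mod_gens_def)
  have 1: "map_prod h h ` {(d (Act a 1), d (Scal a)) | a. a \<in> carrier A} =
    {(h (d (Act a 1)), h (d (Scal a))) | a. a \<in> carrier A}"
    by (force simp: image_iff)
  show ?thesis
    unfolding module_eqs_def formal_module_eqs_def image_Un image_UN 1
    by (intro arg_cong2[where f = "(\<union>)"] SUP_cong refl image_algebra_eqs A image_fgl_eqs
        image_fgl_hom_eqs d') (auto simp: image_ps_eqs hom_ps R.ps_closed d')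
qed

lemma image_iso_eqs:
  assumes A: "cring A" and d: "d ` iso_gens A \<subseteq> carrier R"
  shows "map_prod h h ` iso_eqs A R d = iso_eqs A S (\<lambda>g. h (d g))"
proof -
  interpret A: cring A by fact
  have dm: "(\<lambda>g. d (Src g)) ` mod_gens A \<subseteq> carrier R" "(\<lambda>g. d (Tgt g)) ` mod_gens A \<subseteq> carrier R"
    "\<And>i. d (IsoCoeff i) \<in> carrier R"
    using d by (auto simp: iso_gens_def)
  then have d': "\<And>i j. d (Src (FCoeff i j)) \<in> carrier R" "\<And>a i. a \<in> carrier A \<Longrightarrow> d (Src (Act a i)) \<in> carrier R"
    "\<And>i j. d (Tgt (FCoeff i j)) \<in> carrier R" "\<And>a i. a \<in> carrier A \<Longrightarrow> d (Tgt (Act a i)) \<in> carrier R"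
    by (auto simp: mod_gens_def)
  have 1: "map_prod h h ` {(d (Src (Scal a)), d (Tgt (Scal a))) | a. a \<in> carrier A} =
    {(h (d (Src (Scal a))), h (d (Tgt (Scal a)))) | a. a \<in> carrier A}"
    by (force simp: image_iff)
  show ?thesis
    unfolding iso_eqs_def strict_iso_eqs_def image_Un image_UN 1
    by (intro arg_cong2[where f = "(\<union>)"] SUP_cong refl image_module_eqs A
        image_fgl_hom_eqs dm d') (auto simp: image_ps_eqs hom_ps R.ps_closed d' dm)
qed

end

context cring
begin

lemma ps_eqs_closed:
  "\<lbrakk>\<And>d. u d \<in> carrier R; \<And>d. v d \<in> carrier R\<rbrakk> \<Longrightarrow> ps_eqs u v \<subseteq> carrier R \<times> carrier R"
  by (auto simp: ps_eqs_def)

lemma module_eqs_closed: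
  assumes A: "cring A" and d: "d ` mod_gens A \<subseteq> carrier R"
  shows "module_eqs A R d \<subseteq> carrier R \<times> carrier R"
proof -
  interpret A: cring A by fact
  have d': "\<And>a. a \<in> carrier A \<Longrightarrow> d (Scal a) \<in> carrier R" "\<And>i j. d (FCoeff i j) \<in> carrier R"
    "\<And>a i. a \<in> carrier A \<Longrightarrow> d (Act a i) \<in> carrier R"
    using d by (auto simp: mod_gens_def)
  show ?thesis
    unfolding module_eqs_def formal_module_eqs_def fgl_eqs_def fgl_hom_eqs_def
    by (intro Un_least UN_least ps_eqs_closed) (auto simp: algebra_eqs_def d' ps_closed)
qed

lemma iso_eqs_closed:
  assumes A: "cring A" and d: "d ` iso_gens A \<subseteq> carrier R"
  shows "iso_eqs A R d \<subseteq> carrier R \<times> carrier R"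
proof -
  interpret A: cring A by fact
  have dm: "(\<lambda>g. d (Src g)) ` mod_gens A \<subseteq> carrier R" "(\<lambda>g. d (Tgt g)) ` mod_gens A \<subseteq> carrier R"
    "\<And>i. d (IsoCoeff i) \<in> carrier R"
    using d by (auto simp: iso_gens_def)
  then have d': "\<And>i j. d (Src (FCoeff i j)) \<in> carrier R" "\<And>a i. a \<in> carrier A \<Longrightarrow> d (Src (Act a i)) \<in> carrier R"
    "\<And>i j. d (Tgt (FCoeff i j)) \<in> carrier R" "\<And>a i. a \<in> carrier A \<Longrightarrow> d (Tgt (Act a i)) \<in> carrier R"
    "\<And>a. a \<in> carrier A \<Longrightarrow> d (Src (Scal a)) \<in> carrier R" "\<And>a. a \<in> carrier A \<Longrightarrow> d (Tgt (Scal a)) \<in> carrier R"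
    by (auto simp: mod_gens_def)
  show ?thesis
    unfolding iso_eqs_def strict_iso_eqs_def fgl_hom_eqs_def
    by (intro Un_least UN_least ps_eqs_closed module_eqs_closed A dm) (auto simp: d' dm ps_closed)
qed

end

text \<open>For every commutative ring \<open>R\<close>, homomorphisms from \<open>L_ring A\<close>,
  resp. \<open>LB_ring A\<close>, to \<open>R\<close> correspond to formal \<open>A\<close>-modules, resp. strict isomorphisms of
  formal \<open>A\<close>-modules, over \<open>R\<close>, by taking the images of the universal coefficients.\<close>

lemma module_eqs_cong:
  assumes A: "cring A" and eq: "\<And>g. g \<in> mod_gens A \<Longrightarrow> d g = d' g"
  shows "module_eqs A R d = module_eqs A R d'"
proof -
  interpret A: cring A by fact
  have F: "(\<lambda>i j. d (FCoeff i j)) = (\<lambda>i j. d' (FCoeff i j))"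
    by (intro ext eq) (simp add: mod_gens_def)
  have act: "(\<lambda>i. d (Act a i)) = (\<lambda>i. d' (Act a i))" "d (Act a i) = d' (Act a i)"
    "d (Scal a) = d' (Scal a)" if "a \<in> carrier A" for a i
    using that by (auto simp: mod_gens_def intro!: ext eq)
  have alg: "algebra_eqs A R (\<lambda>a. d (Scal a)) = algebra_eqs A R (\<lambda>a. d' (Scal a))"
    unfolding algebra_eqs_def
    by (intro arg_cong2[where f = "(\<union>)"] Collect_cong ex_cong1) (auto simp: act)
  show ?thesis
    unfolding module_eqs_def formal_module_eqs_def F alg
    by (intro arg_cong2[where f = "(\<union>)"] SUP_cong refl Collect_cong ex_cong1) (auto simp: act)
qed

lemma iso_eqs_cong:
  assumes A: "cring A" and eq: "\<And>g. g \<in> iso_gens A \<Longrightarrow> d g = d' g"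
  shows "iso_eqs A R d = iso_eqs A R d'"
proof -
  interpret A: cring A by fact
  have F: "(\<lambda>i j. d (Src (FCoeff i j))) = (\<lambda>i j. d' (Src (FCoeff i j)))"
      "(\<lambda>i j. d (Tgt (FCoeff i j))) = (\<lambda>i j. d' (Tgt (FCoeff i j)))"
      "(\<lambda>i. d (IsoCoeff i)) = (\<lambda>i. d' (IsoCoeff i))"
    by (intro ext eq; simp add: mod_gens_def iso_gens_def)+
  have I: "d (IsoCoeff i) = d' (IsoCoeff i)" for i using F(3) by metis
  have act: "(\<lambda>i. d (Src (Act a i))) = (\<lambda>i. d' (Src (Act a i)))"
    "(\<lambda>i. d (Tgt (Act a i))) = (\<lambda>i. d' (Tgt (Act a i)))"
    "d (Src (Scal a)) = d' (Src (Scal a))" "d (Tgt (Scal a)) = d' (Tgt (Scal a))" if "a \<in> carrier A" for a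
    using that by (auto simp: mod_gens_def iso_gens_def intro!: ext eq)
  have m: "module_eqs A R (\<lambda>g. d (Src g)) = module_eqs A R (\<lambda>g. d' (Src g))"
    "module_eqs A R (\<lambda>g. d (Tgt g)) = module_eqs A R (\<lambda>g. d' (Tgt g))"
    by (intro module_eqs_cong A eq; simp add: iso_gens_def)+
  show ?thesis
    unfolding iso_eqs_def strict_iso_eqs_def F m I
    by (intro arg_cong2[where f = "(\<union>)"] SUP_cong refl Collect_cong ex_cong1) (auto simp: act)
qed

lemma ring_hom_with_grading: "ring_hom (with_grading Q d) R = ring_hom Q R"
  by (simp add: ring_hom_def with_grading_def)

lemma presentation_corepresents:
  assumes R: "cring R"
    and E_eq: "E = {x - y | x y. (x, y) \<in> eqs (zpoly_ring S) zvar}"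
    and closed: "eqs (zpoly_ring S) zvar \<subseteq> carrier (zpoly_ring S) \<times> carrier (zpoly_ring S)"
    and natural: "\<And>h d. \<lbrakk>h \<in> ring_hom (zpoly_ring S) R\<rbrakk> \<Longrightarrow>
      map_prod h h ` eqs (zpoly_ring S) zvar = eqsR (\<lambda>g. h (zvar g))"
    and restr: "\<And>d d'. (\<And>g. g \<in> S \<Longrightarrow> d g = d' g) \<Longrightarrow> eqsR d = eqsR d'"
  shows "h \<in> ring_hom (pres S E) R \<Longrightarrow>
      (\<lambda>g. h (pres_class S E (zvar g))) ` S \<subseteq> carrier R \<and>
      (\<forall>(x, y)\<in>eqsR (\<lambda>g. h (pres_class S E (zvar g))). x = y)"
    and "\<lbrakk>d ` S \<subseteq> carrier R; \<forall>(x, y)\<in>eqsR d. x = y\<rbrakk> \<Longrightarrow>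
      \<exists>!h. h \<in> ring_hom (pres S E) R \<inter> extensional (carrier (pres S E)) \<and>
        (\<forall>g\<in>S. h (pres_class S E (zvar g)) = d g)"
proof -
  have EC: "E \<subseteq> carrier (zpoly_ring S)" using closed by (auto simp: E_eq)
  interpret presentation S E by unfold_locales (rule EC)
  interpret R: cring R by fact
  {
    assume h: "h \<in> ring_hom (pres S E) R"
    have hc: "h \<circ> pres_class S E \<in> ring_hom (zpoly_ring S) R"
      using ring_hom_trans[OF pres_class_hom h] .
    have "(\<lambda>g. h (pres_class S E (zvar g))) ` S \<subseteq> carrier R"
      using ring_hom_closed[OF hc] by auto
    moreover have "x = y" if "(x, y) \<in> eqsR (\<lambda>g. h (pres_class S E (zvar g)))" for x y
    proof -
      from that obtain p q where pq: "(p, q) \<in> eqs (zpoly_ring S) zvar"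
        "x = h (pres_class S E p)" "y = h (pres_class S E q)"
        using natural[OF hc, symmetric] by fastforce
      then have "pres_class S E p = pres_class S E q"
        using closed by (intro pres_class_rel) (auto simp: E_eq)
      then show ?thesis using pq by simp
    qed
    ultimately show "(\<lambda>g. h (pres_class S E (zvar g))) ` S \<subseteq> carrier R \<and>
      (\<forall>(x, y)\<in>eqsR (\<lambda>g. h (pres_class S E (zvar g))). x = y)" by blast
  }
  assume d: "d ` S \<subseteq> carrier R" and eq: "\<forall>(x, y)\<in>eqsR d. x = y"
  let ?e = "zeval R d"
  interpret e: ring_hom_cring "zpoly_ring S" R ?e
    by (rule UnivPoly.ring_hom_cringI[OF zpoly_cring R R.zeval_hom[OF d]])
  have img: "map_prod ?e ?e ` eqs (zpoly_ring S) zvar = eqsR d"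
    unfolding natural[OF R.zeval_hom[OF d]]
    by (rule restr, rule R.zeval_zvar) (use d in blast)
  have van: "?e r = \<zero>\<^bsub>R\<^esub>" if r: "r \<in> E" for r
  proof -
    from r obtain x y where xy: "(x, y) \<in> eqs (zpoly_ring S) zvar" "r = x - y"
      by (auto simp: E_eq)
    have "(?e x, ?e y) \<in> eqsR d" unfolding img[symmetric] using xy(1) by force
    from bspec[OF eq this] have same: "?e x = ?e y" by simp
    have c: "x \<in> carrier (zpoly_ring S)" "y \<in> carrier (zpoly_ring S)" using subsetD[OF closed xy(1)] by simp_all
    have "?e (x - y) \<oplus>\<^bsub>R\<^esub> ?e y = ?e x"
      using R.zeval_add[OF d zpoly_diff[OF c] c(2)] by simp
    then have "?e y \<oplus>\<^bsub>R\<^esub> ?e (x - y) = ?e y"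
      using same R.a_comm[OF R.zeval_closed[OF d c(2)] R.zeval_closed[OF d zpoly_diff[OF c]]] by simp
    then show ?thesis
      unfolding xy(2)
      using R.add.l_cancel_one[OF R.zeval_closed[OF d c(2)] R.zeval_closed[OF d zpoly_diff[OF c]]] by simp
  qed
  note map_hom = pres_map_hom[OF R d van] and map_gen = pres_map_gen[OF R d van]
    and map_unique = pres_map_unique[OF R d van]
  let ?h = "restrict (pres_map R d) (carrier (pres S E))"
  interpret P: cring "pres S E" by (rule pres_cring)
  have gen: "pres_class S E (zvar g) \<in> carrier (pres S E)" if "g \<in> S" for g
    using that by (auto simp: carrier_pres)
  show "\<exists>!h. h \<in> ring_hom (pres S E) R \<inter> extensional (carrier (pres S E)) \<and>
        (\<forall>g\<in>S. h (pres_class S E (zvar g)) = d g)"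
  proof (rule ex1I[of _ ?h])
    have "?h \<in> ring_hom (pres S E) R"
      using map_hom P.m_closed P.a_closed P.one_closed
      unfolding ring_hom_def by (simp add: Pi_iff)
    then show "?h \<in> ring_hom (pres S E) R \<inter> extensional (carrier (pres S E)) \<and>
        (\<forall>g\<in>S. ?h (pres_class S E (zvar g)) = d g)"
      using gen map_gen by simp
  next
    fix k assume k: "k \<in> ring_hom (pres S E) R \<inter> extensional (carrier (pres S E)) \<and>
        (\<forall>g\<in>S. k (pres_class S E (zvar g)) = d g)"
    show "k = ?h"
    proof (rule extensionalityI)
      show "k \<in> extensional (carrier (pres S E))" using k by blast
      show "?h \<in> extensional (carrier (pres S E))" by simp
      fix x assume x: "x \<in> carrier (pres S E)"
      have "k x = pres_map R d x" by (rule map_unique) (use k x in blast)+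
      then show "k x = ?h x" using x by simp
    qed
  qed
qed

theorem L_ring_corepresents:
  assumes A: "cring A" and R: "cring R"
  shows "h \<in> ring_hom (L_ring A) R \<Longrightarrow> formal_module A R (\<lambda>g. h (L_gen A g))"
    and "formal_module A R d \<Longrightarrow>
      \<exists>!h. h \<in> ring_hom (L_ring A) R \<inter> extensional (carrier (L_ring A)) \<and>
        (\<forall>g\<in>mod_gens A. h (L_gen A g) = d g)"
proof -
  interpret A: cring A by fact
  interpret Z: cring "zpoly_ring (mod_gens A)" by (rule zpoly_cring)
  have z: "zvar ` mod_gens A \<subseteq> carrier (zpoly_ring (mod_gens A))" by auto
  have nat: "map_prod h h ` module_eqs A (zpoly_ring (mod_gens A)) zvar =
      module_eqs A R (\<lambda>g. h (zvar g))" if "h \<in> ring_hom (zpoly_ring (mod_gens A)) R" for h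
    by (rule ring_hom_cring.image_module_eqs[OF UnivPoly.ring_hom_cringI[OF zpoly_cring R that] A z])
  have restr: "module_eqs A R d = module_eqs A R d'" if "\<And>g. g \<in> mod_gens A \<Longrightarrow> d g = d' g" for d d'
    using module_eqs_cong[OF A] that .
  note c = presentation_corepresents[where eqs = "module_eqs A" and eqsR = "module_eqs A R",
      OF R mod_rels_def Z.module_eqs_closed[OF A z] nat restr]
  have L: "ring_hom (L_ring A) R = ring_hom (pres (mod_gens A) (mod_rels A)) R"
    "carrier (L_ring A) = carrier (pres (mod_gens A) (mod_rels A))"
    by (simp_all add: L_ring_def weighted_pres_def ring_hom_with_grading)
       (simp add: with_grading_def)
  show "h \<in> ring_hom (L_ring A) R \<Longrightarrow> formal_module A R (\<lambda>g. h (L_gen A g))"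
    using c(1) by (simp add: L formal_module_def L_gen_def)
  show "formal_module A R d \<Longrightarrow>
      \<exists>!h. h \<in> ring_hom (L_ring A) R \<inter> extensional (carrier (L_ring A)) \<and>
        (\<forall>g\<in>mod_gens A. h (L_gen A g) = d g)"
    using c(2)[of d] by (simp add: L formal_module_def L_gen_def)
qed

theorem LB_ring_corepresents:
  assumes A: "cring A" and R: "cring R"
  shows "h \<in> ring_hom (LB_ring A) R \<Longrightarrow> strict_iso A R (\<lambda>g. h (LB_gen A g))"
    and "strict_iso A R d \<Longrightarrow>
      \<exists>!h. h \<in> ring_hom (LB_ring A) R \<inter> extensional (carrier (LB_ring A)) \<and>
        (\<forall>g\<in>iso_gens A. h (LB_gen A g) = d g)"
proof -
  interpret A: cring A by fact
  interpret Z: cring "zpoly_ring (iso_gens A)" by (rule zpoly_cring)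
  have z: "zvar ` iso_gens A \<subseteq> carrier (zpoly_ring (iso_gens A))" by auto
  have nat: "map_prod h h ` iso_eqs A (zpoly_ring (iso_gens A)) zvar =
      iso_eqs A R (\<lambda>g. h (zvar g))" if "h \<in> ring_hom (zpoly_ring (iso_gens A)) R" for h
    by (rule ring_hom_cring.image_iso_eqs[OF UnivPoly.ring_hom_cringI[OF zpoly_cring R that] A z])
  have restr: "iso_eqs A R d = iso_eqs A R d'" if "\<And>g. g \<in> iso_gens A \<Longrightarrow> d g = d' g" for d d'
    using iso_eqs_cong[OF A] that .
  note c = presentation_corepresents[where eqs = "iso_eqs A" and eqsR = "iso_eqs A R",
      OF R iso_rels_def Z.iso_eqs_closed[OF A z] nat restr]
  have L: "ring_hom (LB_ring A) R = ring_hom (pres (iso_gens A) (iso_rels A)) R"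
    "carrier (LB_ring A) = carrier (pres (iso_gens A) (iso_rels A))"
    by (simp_all add: LB_ring_def weighted_pres_def ring_hom_with_grading)
       (simp add: with_grading_def)
  show "h \<in> ring_hom (LB_ring A) R \<Longrightarrow> strict_iso A R (\<lambda>g. h (LB_gen A g))"
    using c(1) by (simp add: L strict_iso_def LB_gen_def)
  show "strict_iso A R d \<Longrightarrow>
      \<exists>!h. h \<in> ring_hom (LB_ring A) R \<inter> extensional (carrier (LB_ring A)) \<and>
        (\<forall>g\<in>iso_gens A. h (LB_gen A g) = d g)"
    using c(2)[of d] by (simp add: L strict_iso_def LB_gen_def)
qed

end

theory Submission
  imports Defs "HOL-Library.Product_Plus" "HOL-Computational_Algebra.Formal_Power_Series"
begin

text \<open>By Hilbert's basis theorem \<open>A\<close> is Noetherian, and the rings of formal modules and of strict isomorphisms are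
finitely generated over \<open>A\<close> in each degree; by Artin--Rees, base change to the completion is then the graded
completion. A formal \<open>A\<close>-module over a complete ring extends to the completion of \<open>A\<close>, since in each
degree the elements of a high power of \<open>I\<close> act trivially modulo \<open>I^k\<close>. The extension is unique:
comparing coefficients of degree \<open>i\<close> gives \<open>c (x * y) = x * c y + y^i * c x\<close> modulo lower ones, and
\<open>1 - x^(i-1)\<close> is invertible for \<open>x\<close> in the completed ideal.\<close>

text \<open>All comparisons rest on one criterion, the locale \<open>adic_span\<close>: let
  \<open>R\<close> be finitely generated over \<open>A\<close> in each degree, and let a graded ring
  \<open>C\<close> be spanned in each degree by products of images of \<open>R\<close> and of the
  completion of \<open>A\<close>. Then a compatible map from \<open>C\<close> to the graded
  completion of \<open>R\<close> is bijective, and \<open>C\<close> is itself complete. The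
  criterion is applied to the base changes, to the two rings over the completion, and to the tensor
  square of the completed ring of isomorphisms; the last case gives the continuous comultiplication.
  Two obstacles shape the rest. A ring given by generators and relations is the sum of its
  homogeneous parts, but directness of the sum needs an argument: sending \<open>x\<close> of degree
  \<open>n\<close> to \<open>x t^n\<close> is a homomorphism to polynomials in \<open>t\<close>,
  because the defining equations are homogeneous. And for the rings over the completion the spanning
  condition is not formal: the completion is in general not a finitely generated ring, so the
  coefficients of its action have to be traced back to those of \<open>A\<close>. Spanning is
  exactly what the uniqueness of the extended action provides.\<close>

abbreviation (input) add_in ("(_ +[_]/ _)" [65, 0, 66] 65) where "x +[R] y == x \<oplus>\<^bsub>R\<^esub> y"
abbreviation (input) diff_in ("(_ -[_]/ _)" [65, 0, 66] 65) where "x -[R] y == x \<ominus>\<^bsub>R\<^esub> y"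
abbreviation (input) neg_in ("-[_] _" [0, 81] 80) where "-[R] x == \<ominus>\<^bsub>R\<^esub> x"
abbreviation (input) mult_in ("(_ *[_]/ _)" [70, 0, 71] 70) where "x *[R] y == x \<otimes>\<^bsub>R\<^esub> y"
abbreviation (input) zero_in ("0[_]") where "0[R] == \<zero>\<^bsub>R\<^esub>"
abbreviation (input) one_in ("1[_]") where "1[R] == \<one>\<^bsub>R\<^esub>"
abbreviation (input) "lookup == Poly_Mapping.lookup"
abbreviation (input) "single == Poly_Mapping.single"
abbreviation (input) "upm R == up_ring.monom (UP R)"
abbreviation (input) "upc R == up_ring.coeff (UP R)"
abbreviation (input) "ipow A I k == I [^]\<^bsub>ideals_set A\<^esub> (k::nat)"
lemmas rh_cringI = UnivPoly.ring_hom_cringI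
abbreviation (input) "sub1 == ps_subst1"
abbreviation (input) "sub2 == ps_subst2"
abbreviation (input) "car == carrier"
lemmas rh_cl = ring_hom_closed
abbreviation (input) "bc_to_compl == base_change_to_completion"
abbreviation (input) "hcomult == hopf_algebroid.comult"
abbreviation (input) "lpart == limit_part"
abbreviation (input) "lmap == limit_map"
abbreviation (input) "pcls == pres_class"
abbreviation (input) "zpolys == zpoly_ring"
abbreviation (input) "deg0 == degree_zero"

section \<open>Hilbert's basis theorem\<close>

text \<open>Linear combinations are built one summand at a time, so the closure properties below are
  inductions without indexed sums. For \<open>W\<close> inside a subring \<open>B\<close> this is
  the ideal of \<open>B\<close> generated by \<open>W\<close>.\<close>

inductive_set lcomb :: "'r::comm_ring_1 set => 'r set => 'r set" for B W where
 zero: "0 : lcomb B W"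
| add: "[|x : lcomb B W; b : B; w : W|] ==> x + b * w : lcomb B W"

text \<open>Subrings are sets within one ring type, so that the chain obtained by adjoining
  variables one by one stays inside \<open>'g zpoly\<close>.\<close>

definition subrng :: "'r::comm_ring_1 set => bool" where
 "subrng B \<longleftrightarrow> 0 : B & 1 : B & (ALL x:B. - x : B & (ALL y:B. x + y : B & x * y : B))"

text \<open>Formulated for arbitrary subsets, with the finitely many generators taken from
  \<open>W\<close> itself. This later yields finitely many homogeneous generators of a set of
  homogeneous syzygies.\<close>

definition noeth :: "'r::comm_ring_1 set => bool" where
 "noeth B \<longleftrightarrow> (\<forall>W\<subseteq>B. \<exists>F\<subseteq>W. finite F & W \<subseteq> lcomb B F)"

lemma subrngD:
 assumes "subrng B"
 shows "0 : B" "1 : B" "x : B ==> - x : B" "[|x : B; y : B|] ==> x + y : B"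
  "[|x : B; y : B|] ==> x * y : B" "[|x : B; y : B|] ==> x - y : B" "x : B ==> x ^ n : B"
proof -
 show "[|x : B; y : B|] ==> x - y : B"
  using assms unfolding subrng_def by(metis diff_conv_add_uminus)
 show "x : B ==> x ^ n : B"
  by(induction n) (use assms in "auto simp: subrng_def")
qed (use assms in "auto simp: subrng_def")

lemma lcomb_plus:
 assumes "x : lcomb B W" "y : lcomb B W" shows "x + y : lcomb B W"
 using assms(2)
 by(induction rule: lcomb.induct) (use assms(1) in "auto simp: add.assoc[symmetric] intro: lcomb.add")

lemma lcomb_mult:
 assumes "subrng B" "x : lcomb B W" "b : B" shows "b * x : lcomb B W"
 using assms(2)
proof (induction rule: lcomb.induct)
 case (add x c w)
 have "b * (x + c * w) = b * x + (b * c) * w" by(simp add: algebra_simps)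
 thus ?case using add lcomb.add[of "b * x" B W "b * c" w] subrngD(5)[OF assms(1) assms(3)] by simp
qed (auto intro: lcomb.zero)

lemma lcomb_base: "[|subrng B; w : W|] ==> w : lcomb B W"
 using lcomb.add[OF lcomb.zero, of 1 B w W] by(simp add: subrngD)

lemma lcomb_diff: "[|subrng B; x : lcomb B W; y : lcomb B W|] ==> x - y : lcomb B W"
 using lcomb_plus[of x B W "- 1 * y"] lcomb_mult[of B y W "- 1"] subrngD(2,3)[of B] by simp

lemma lcomb_trans:
 assumes "subrng B" "x : lcomb B W" "W \<subseteq> lcomb B V" shows "x : lcomb B V"
 using assms(2)
proof (induction rule: lcomb.induct)
 case (add x b w)
 thus ?case using lcomb_plus[of x B V "b * w"] lcomb_mult[OF assms(1), of w V b] assms(3) by blast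
qed (auto intro: lcomb.zero)

lemma lcomb_subset: "[|subrng B; W \<subseteq> B|] ==> lcomb B W \<subseteq> B"
proof
 fix x assume B: "subrng B" "W \<subseteq> B" and "x : lcomb B W"
 from this(3) show "x : B" by(induction rule: lcomb.induct) (use B in "auto simp: subrngD subset_iff")
qed

lemma lcomb_mono: "W \<subseteq> V ==> lcomb B W \<subseteq> lcomb B V"
proof
 fix x assume W: "W \<subseteq> V" and "x : lcomb B W"
 from this(2) show "x : lcomb B V" by(induction rule: lcomb.induct) (use W in "auto intro: lcomb.intros")
qed

lemma lcomb_finite:
 assumes "x : lcomb B W" obtains F where "finite F" "F \<subseteq> W" "x : lcomb B F"
proof -
 have "EX F. finite F & F \<subseteq> W & x : lcomb B F" using assms
 proof (induction rule: lcomb.induct)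
  case zero thus ?case by(auto intro: lcomb.zero)
 next
  case (add x b w)
  then obtain F where F: "finite F" "F \<subseteq> W" "x : lcomb B F" by blast
  have "x : lcomb B (insert w F)" using F(3) lcomb_mono[of F "insert w F" B] by blast
  hence "x + b * w : lcomb B (insert w F)" using add by(intro lcomb.add) auto
  thus ?case using F add by(intro exI[of _ "insert w F"]) auto
 qed
 thus ?thesis using that by blast
qed

lemma lcomb_finite_set:
 assumes "finite V" "V \<subseteq> lcomb B W" obtains F where "finite F" "F \<subseteq> W" "V \<subseteq> lcomb B F"
proof -
 have "EX F. finite F & F \<subseteq> W & V \<subseteq> lcomb B F" using assms
 proof (induction V)
  case (insert x V)
  then obtain F G where "finite F" "F \<subseteq> W" "V \<subseteq> lcomb B F" "finite G" "G \<subseteq> W" "x : lcomb B G"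
   using lcomb_finite[of x B W] by(metis insert_subset)
  thus ?case using lcomb_mono[of F "F \<union> G" B] lcomb_mono[of G "F \<union> G" B]
   by(intro exI[of _ "F \<union> G"]) auto
 qed auto
 thus ?thesis using that by blast
qed

lemma lcomb_sum:
 assumes "finite F" "subrng B" "x : lcomb B F"
 obtains c where "!!f. c f : B" "x = (\<Sum>f\<in>F. c f * f)"
proof -
 have "EX c. (ALL f. c f : B) & x = (\<Sum>f\<in>F. c f * f)" using assms(3)
 proof (induction rule: lcomb.induct)
  case zero show ?case using subrngD(1)[OF assms(2)] by(intro exI[of _ "%_. 0"]) auto
 next
  case (add x b w)
  then obtain c where c: "ALL f. c f : B" "x = (\<Sum>f\<in>F. c f * f)" by blast
  have "(\<Sum>f\<in>F. (c(w := c w + b)) f * f) = (\<Sum>f\<in>F. c f * f + (if f = w then b * f else 0))"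
   by(rule sum.cong) (auto simp: algebra_simps)
  also have "... = x + b * w" using assms(1) add by(simp add: sum.distrib c)
  finally show ?case using c add subrngD(4)[OF assms(2)] by(intro exI[of _ "c(w := c w + b)"]) auto
 qed
 thus ?thesis using that by blast
qed

text \<open>Ideals suffice: the ideal spanned by \<open>W\<close> has a finite generating set, and
  each of its members uses only finitely many elements of \<open>W\<close>.\<close>

lemma noethI:
 assumes B: "subrng B" and fg: "!!J. [|J \<subseteq> B; J = lcomb B J|] ==> EX G. finite G & G \<subseteq> J & J \<subseteq> lcomb B G"
 shows "noeth B"
 unfolding noeth_def
proof (intro allI impI)
 fix W assume W: "W \<subseteq> B"
 let ?J = "lcomb B W"
 have "?J = lcomb B ?J"
  using lcomb_trans[OF B _ order_refl] lcomb_base[OF B] by(intro equalityI subsetI)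
 from fg[OF lcomb_subset[OF B W] this]
 obtain G where G: "finite G" "G \<subseteq> ?J" "?J \<subseteq> lcomb B G" by auto
 obtain F where F: "finite F" "F \<subseteq> W" "G \<subseteq> lcomb B F" using lcomb_finite_set[OF G(1,2)] .
 have "W \<subseteq> lcomb B F" using lcomb_base[OF B] G(3) lcomb_trans[OF B _ F(3)] by blast
 thus "\<exists>F\<subseteq>W. finite F & W \<subseteq> lcomb B F" using F by blast
qed

lemma subrng_of_int: "subrng (range of_int)"
 unfolding subrng_def by(auto intro: range_eqI[of _ _ 0] range_eqI[of _ _ 1] simp flip: of_int_minus of_int_add of_int_mult)

text \<open>The ring may have positive characteristic, so \<open>J\<close> is studied through the
  positive integers whose image lies in it. The least one generates \<open>J\<close> by division
  with remainder; if there is none, \<open>J\<close> is zero.\<close>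

lemma noeth_of_int: "noeth (range of_int :: 'r::comm_ring_1 set)"
proof (rule noethI[OF subrng_of_int])
 fix J :: "'r set" assume J: "J \<subseteq> range of_int" "J = lcomb (range of_int) J"
 have cl: "x - y : J" "of_int k * x : J" if "x : J" "y : J" for x y k
  using that J(2) lcomb_diff[OF subrng_of_int, of x J y] lcomb_mult[OF subrng_of_int, of x J "of_int k"] by auto
 show "EX G. finite G & G \<subseteq> J & J \<subseteq> lcomb (range of_int) G"
 proof (cases "EX n. n > 0 & of_int (int n) : J")
  case True
  define g where "g = (LEAST n. n > 0 & of_int (int n) : J)"
  have g: "g > 0" "of_int (int g) : J" using LeastI_ex[OF True] by(auto simp: g_def)
  have least: "n >= g" if "n > 0" "of_int (int n) : J" for n
   unfolding g_def by(rule Least_le) (use that in simp)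
  have "x : lcomb (range of_int) {of_int (int g)}" if "x : J" for x
  proof -
   obtain k where k: "x = of_int k" using subsetD[OF J(1) `x : J`] by auto
   have "of_int k - of_int (k div int g) * of_int (int g) : J" using cl that g k by blast
   hence "of_int (k mod int g) : J" by(simp add: minus_div_mult_eq_mod[symmetric])
   hence "k mod int g = 0"
    using least[of "nat (k mod int g)"] g
    by(smt (verit) pos_mod_bound pos_mod_sign int_nat_eq of_nat_0_less_iff of_nat_le_iff zero_less_nat_eq)
   hence "x = 0 + of_int (k div int g) * of_int (int g)"
    unfolding k by(metis add_0 dvd_eq_mod_eq_0 dvd_div_mult_self of_int_mult)
   thus ?thesis using lcomb.add[OF lcomb.zero] by(metis insertI1 range_eqI)
  qed
  thus ?thesis using g by(intro exI[of _ "{of_int (int g)}"]) auto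
 next
  case False
  have "x : lcomb (range of_int) {}" if "x : J" for x
  proof -
   obtain k where k: "x = of_int k" using subsetD[OF J(1) `x : J`] by auto
   have "of_int (- k) : J" using cl(2)[OF that that, of "-1"] k by simp
   hence "k = 0"
    using False that unfolding k
    by(metis k linorder_neqE_linordered_idom neg_0_less_iff_less of_nat_0_less_iff zero_less_imp_eq_int)
   thus ?thesis using k lcomb.zero by simp
  qed
  thus ?thesis by(intro exI[of _ "{}"]) auto
 qed
qed

text \<open>Values at \<open>x\<close> of polynomials of degree below \<open>n\<close>. Since
  \<open>x\<close> need not be transcendental, a leading coefficient belongs to an expression and
  not to an element.\<close>

primrec polys :: "'r::comm_ring_1 set => 'r => nat => 'r set" where
 "polys B x 0 = {0}"
| "polys B x (Suc n) = {b * x ^ n + p | b p. b : B & p : polys B x n}"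

context
 fixes B :: "'r::comm_ring_1 set" and x :: 'r
 assumes B: "subrng B"
begin

lemma polys_SucI: "[|b : B; p : polys B x n; q = b * x ^ n + p|] ==> q : polys B x (Suc n)"
 by auto

lemma polys_SucE:
 assumes "q : polys B x (Suc n)"
 obtains b p where "b : B" "p : polys B x n" "q = b * x ^ n + p"
 using assms by auto

lemma polys_Suc: "polys B x n \<subseteq> polys B x (Suc n)"
 using polys_SucI[OF subrngD(1)[OF B]] by force

lemma polys_mono: "m <= n ==> polys B x m \<subseteq> polys B x n"
 using lift_Suc_mono_le[of "polys B x" m n] polys_Suc by blast

lemma polys_add: "[|p : polys B x n; q : polys B x n|] ==> p + q : polys B x n"
proof (induction n arbitrary: p q)
 case (Suc n)
 then obtain b p' c q' where *: "b : B" "p' : polys B x n" "p = b * x ^ n + p'"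
  "c : B" "q' : polys B x n" "q = c * x ^ n + q'" by(elim polys_SucE)
 show ?case
  by(rule polys_SucI[of "b + c" "p' + q'"]) (use * Suc.IH subrngD(4)[OF B] in "auto simp: algebra_simps")
qed auto

lemma polys_scale: "[|p : polys B x n; b : B|] ==> b * x ^ k * p : polys B x (k + n)"
proof (induction n arbitrary: p)
 case 0 thus ?case using polys_mono[of 0 k] by auto
next
 case (Suc n)
 then obtain c p' where c: "c : B" "p' : polys B x n" "p = c * x ^ n + p'" by(elim polys_SucE)
 have "b * x ^ k * p : polys B x (Suc (k + n))"
  by(rule polys_SucI[of "b * c" "b * x ^ k * p'"])
   (use Suc.prems(2) Suc.IH[OF c(2) Suc.prems(2)] c(1) subrngD(5)[OF B] in "simp_all add: c(3) algebra_simps power_add")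
 thus ?case by simp
qed

lemma polys_scale1: "[|p : polys B x n; b : B|] ==> b * p : polys B x n"
 using polys_scale[of p n b 0] by simp

lemma polys_mult: "[|p : polys B x m; q : polys B x n|] ==> p * q : polys B x (m + n)"
proof (induction m arbitrary: p)
 case 0 thus ?case using polys_mono[of 0 n] by auto
next
 case (Suc m)
 then obtain c p' where c: "c : B" "p' : polys B x m" "p = c * x ^ m + p'" by(elim polys_SucE)
 have "p * q = c * x ^ m * q + p' * q" by(simp add: c algebra_simps)
 moreover have "c * x ^ m * q : polys B x (Suc m + n)"
  using polys_scale[OF Suc.prems(2) c(1), of m] polys_Suc[of "m + n"]
  by(simp del: polys.simps add: subset_iff)
 moreover have "p' * q : polys B x (Suc m + n)"
  using Suc.IH[OF c(2) Suc.prems(2)] polys_Suc[of "m + n"] by(simp del: polys.simps add: subset_iff)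
 ultimately show ?case using polys_add by metis
qed

lemma polys_incl: "b : B ==> b : polys B x 1" by simp

lemma polys_var: "x : polys B x 2"
 using subrngD(1,2)[OF B] by(force simp: numeral_2_eq_2)

lemma subrng_polys: "subrng (\<Union>n. polys B x n)" (is "subrng ?C")
 unfolding subrng_def
proof (intro conjI ballI)
 show "0 : ?C" by(rule UN_I[of 0]) auto
 show "1 : ?C" by(rule UN_I[of 1]) (use subrngD(2)[OF B] in auto)
 fix p assume "p : ?C"
 then obtain m where p: "p : polys B x m" by blast
 hence "- p : polys B x m" using polys_scale1[OF p, of "- 1"] subrngD(2,3)[OF B] by simp
 thus "- p : ?C" by blast
 fix q assume "q : ?C"
 then obtain n where q: "q : polys B x n" by blast
 have "p + q : polys B x (max m n)"
  using polys_add[of p "max m n" q] p q polys_mono[of m "max m n"] polys_mono[of n "max m n"] by auto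
 thus "p + q : ?C" by blast
 show "p * q : ?C" using polys_mult[OF p q] by blast
qed

text \<open>Hilbert's argument with leading coefficients: subtracting a combination of finitely many
  chosen elements of \<open>J\<close> lowers the degree of any expression for an element of
  \<open>J\<close>.\<close>

theorem hilbert_basis:
 assumes noeth: "noeth B" shows "noeth (\<Union>n. polys B x n)"
proof (rule noethI[OF subrng_polys])
 let ?C = "\<Union>n. polys B x n"
 note C = subrng_polys
 have BC: "b : B ==> b : ?C" for b using polys_incl by blast
 have xC: "x : ?C" using polys_var by blast
 fix J assume J: "J \<subseteq> ?C" "J = lcomb ?C J"
 have Jm: "c * p : J" if "p : J" "c : ?C" for p c
  using lcomb_mult[OF C, of p J c] J(2) that by auto
 have Ja: "p + q : J" "p - q : J" if "p : J" "q : J" for p q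
  using lcomb_plus[of p ?C J q] lcomb_diff[OF C, of p J q] J(2) that by auto
 define lead where "lead n = {b : B. EX p:polys B x n. b * x ^ n + p : J}" for n
 have leadB: "lead n \<subseteq> B" for n by(auto simp: lead_def)
 have lead_mono: "lead m \<subseteq> lead n" if "m <= n" for m n
 proof (rule lift_Suc_mono_le[OF _ that], rule subsetI)
  fix n b assume "b : lead n"
  then obtain p where p: "b : B" "p : polys B x n" "b * x ^ n + p : J" by(auto simp: lead_def)
  have "x * p : polys B x (Suc n)" using polys_scale[OF p(2) subrngD(2)[OF B], of 1] by simp
  moreover have "b * x ^ Suc n + x * p : J" using Jm[OF p(3) xC] by(simp add: algebra_simps)
  ultimately show "b : lead (Suc n)" using p by(auto simp: lead_def)
 qed
 have "ALL n. EX F. F \<subseteq> lead n & finite F & lead n \<subseteq> lcomb B F" using noeth leadB unfolding noeth_def by meson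
 then obtain F where F: "!!n. F n \<subseteq> lead n" "!!n. finite (F n)" "!!n. lead n \<subseteq> lcomb B (F n)" by metis
 \<comment> \<open>The sets \<open>lead n\<close> increase, so finitely many generators of their
   union lie in a single \<open>lead N\<close>; from degree \<open>N\<close> on they account for all
   leading coefficients.\<close>
 have "(\<Union>n. lead n) \<subseteq> B" using leadB by blast
 then obtain F' where F': "F' \<subseteq> (\<Union>n. lead n)" "finite F'" "(\<Union>n. lead n) \<subseteq> lcomb B F'"
  using noeth unfolding noeth_def by meson
 have "EX N. F' \<subseteq> lead N" using F'(2,1)
 proof (induction F')
  case (insert f F')
  then obtain N M where "F' \<subseteq> lead N" "f : lead M" by auto
  thus ?case using lead_mono[of N "max N M"] lead_mono[of M "max N M"]
   by(intro exI[of _ "max N M"]) auto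
 qed auto
 then obtain N where N: "F' \<subseteq> lead N" by blast
 have "ALL n. ALL b:lead n. EX p. p : polys B x n & b * x ^ n + p : J" by(auto simp: lead_def)
 then obtain r where r: "!!n b. b : lead n ==> r n b : polys B x n"
  "!!n b. b : lead n ==> b * x ^ n + r n b : J" by metis
 define g where "g n b = b * x ^ n + r n b" for n b
 \<comment> \<open>Lifts of generators of \<open>lead n\<close> for each \<open>n < N\<close>,
   together with lifts to degree \<open>N\<close> of the generators \<open>F'\<close> of the
   union.\<close>
 define G where "G = (\<Union>n<N. g n ` F n) \<union> g N ` F'"
 have GJ: "G \<subseteq> J" using r(2) F(1) N by(auto simp: G_def g_def subset_iff)
 have GC: "lcomb ?C G \<subseteq> J" using lcomb_mono[OF GJ] J(2) by blast
 \<comment> \<open>A lift in degree \<open>m = min n N\<close> is moved up to degree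
   \<open>n\<close> by the factor \<open>x ^ (n - m)\<close>.\<close>
 have approx: "EX q:lcomb ?C G. EX p:polys B x n. q = b * x ^ n + p" if "b : lead n" for n b
 proof -
  define F'' m where "F'' = (if n < N then F n else F')" and "m = min n N"
  have b: "b : lcomb B F''"
   unfolding F''_def using that subsetD[OF F(3)[of n]] subsetD[OF F'(3) UN_I[OF UNIV_I]] by simp
  have Fm: "g m f : G" "f : lead m" if "f : F''" for f
   using that F(1) N by(auto simp: F''_def m_def G_def split: if_splits)
  show ?thesis using b
  proof (induction rule: lcomb.induct)
   case zero
   thus ?case using lcomb.zero polys_mono[of 0 n] by(intro bexI[of _ 0]) auto
  next
   case (add b c f)
   then obtain q p where q: "q : lcomb ?C G" "p : polys B x n" "q = b * x ^ n + p" by blast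
   let ?q = "c * x ^ (n - m) * g m f"
   have "c * x ^ (n - m) : ?C" using subrngD(5)[OF C BC[OF add(2)] subrngD(7)[OF C xC]] .
   hence "q + ?q : lcomb ?C G" using lcomb.add[OF q(1)] Fm(1)[OF add(3)] by blast
   moreover have "c * x ^ (n - m) * r m f : polys B x n"
    using polys_scale[OF r(1)[OF Fm(2)[OF add(3)]] add(2), of "n - m"] by(simp add: m_def)
   moreover have "q + ?q = (b + c * f) * x ^ n + (p + c * x ^ (n - m) * r m f)"
   proof -
    have "x ^ n = x ^ (n - m) * x ^ m" by(simp add: m_def flip: power_add)
    thus ?thesis by(simp add: q(3) g_def algebra_simps)
   qed
   ultimately show ?case using polys_add[OF q(2)] by blast
  qed
 qed
 have main: "p : lcomb ?C G" if "p : J" "p : polys B x n" for p n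
  using that
 proof (induction n arbitrary: p)
  case 0 thus ?case by(auto intro: lcomb.zero)
 next
  case (Suc n)
  then obtain b p' where p': "b : B" "p' : polys B x n" "p = b * x ^ n + p'" by auto
  hence "b : lead n" using Suc.prems by(auto simp: lead_def)
  then obtain q p'' where q: "q : lcomb ?C G" "p'' : polys B x n" "q = b * x ^ n + p''" using approx by blast
  have "- 1 * p'' : polys B x n" using polys_scale1[OF q(2), of "- 1"] subrngD(2,3)[OF B] by simp
  from polys_add[OF p'(2) this] have "p - q : polys B x n" by(simp add: p' q)
  hence "p - q : lcomb ?C G" using Suc.IH Ja(2) Suc.prems(1) q(1) GC by blast
  thus ?case using lcomb_plus[OF q(1)] by force
 qed
 have "finite G" using F(2) F'(2) by(auto simp: G_def)
 moreover have "J \<subseteq> lcomb ?C G" using main J(1) by blast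
 ultimately show "EX G. finite G & G \<subseteq> J & J \<subseteq> lcomb ?C G" using GJ by blast
qed

end

lemma subrng_zpoly: "subrng (car (zpolys S))"
 unfolding subrng_def by auto

text \<open>Adjoining the variable \<open>g\<close> to the polynomials over \<open>S\<close> gives
  those over \<open>insert g S\<close>; the induction starts from the image of the integers.\<close>

theorem noeth_zpoly: "finite S ==> noeth (car (zpolys S))"
proof (induction S rule: finite_induct)
 case empty
 have "car (zpolys {}) = (range of_int :: 'a zpoly set)"
 proof (intro equalityI subsetI)
  fix p :: "'a zpoly" assume "p : car (zpolys {})"
  thus "p : range of_int"
   by(induction p rule: zpoly_induct) (use subrng_of_int in "auto simp: subrng_def")
 next
  fix p :: "'a zpoly" assume "p : range of_int"
  then obtain k where "p = of_int k" by blast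
  moreover have "of_int k : car (zpolys {})" for k
   by(rule int_induct[of _ 0]) (auto simp: algebra_simps)
  ultimately show "p : car (zpolys {})" by simp
 qed
 thus ?case using noeth_of_int by metis
next
 case (insert g S)
 note B = subrng_zpoly[of S]
 have "car (zpolys (insert g S)) = (\<Union>n. polys (car (zpolys S)) (zvar g) n)"
 proof (intro equalityI subsetI)
  fix p assume "p : car (zpolys (insert g S))"
  thus "p : (\<Union>n. polys (car (zpolys S)) (zvar g) n)"
  proof (induction p rule: zpoly_induct)
   case (var h)
   thus ?case using polys_incl[OF B, of "zvar h" "zvar g"] polys_var[OF B, of "zvar g"]
    by(cases "h : S") (auto simp del: polys.simps simp: One_nat_def)
  qed (use subrng_polys[OF B, of "zvar g"] in "auto simp: subrng_def simp del: polys.simps")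
 next
  fix p assume "p : (\<Union>n. polys (car (zpolys S)) (zvar g) n)"
  then obtain n where "p : polys (car (zpolys S)) (zvar g) n" by blast
  moreover have "car (zpolys S) <= car (zpolys (insert g S))"
   unfolding subset_iff carrier_zpoly_ring by blast
  ultimately show "p : car (zpolys (insert g S))"
  proof (induction n arbitrary: p)
   case (Suc n)
   have "zvar g ^ n : car (zpolys (insert g S))" by(rule subrngD(7)[OF subrng_zpoly]) simp
   thus ?case using Suc by auto
  qed auto
 qed
 thus ?case using hilbert_basis[OF B insert.IH, of "zvar g"] by simp
qed

section \<open>Additive spans and multiplicative families of subgroups\<close>

abbreviation aspan :: "('a, 'm) ring_scheme => 'a set => 'a set" where
 "aspan R V == generate (add_monoid R) V"

lemma genideal_pow_abbrev: "ipow A I (Suc k) = (ipow A I k) \<cdot>\<^bsub>A\<^esub> I"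
 by(simp add: nat_pow_def ideals_set_def)

context ring
begin

lemma aspan_closed: "[|x : aspan R V; V <= car R|] ==> x : car R"
 using add.generate_in_carrier[of V x] by simp

lemma aspan_subgroup: "V <= car R ==> additive_subgroup (aspan R V) R"
 by(rule additive_subgroupI) (rule add.generate_is_subgroup, simp)

lemma aspan_incl: "x : V ==> x : aspan R V"
 by(rule generate.incl)

lemma aspan_add: "[|x : aspan R V; y : aspan R V|] ==> x \<oplus> y : aspan R V"
 using generate.eng[of x "add_monoid R" V y] by simp

lemma aspan_zero: "\<zero> : aspan R V"
 using generate.one[of "add_monoid R" V] by simp

lemma aspan_induct [consumes 2, case_names zero incl neg add]:
 assumes x: "x : aspan R V" and V: "V <= car R"
  and P: "P \<zero>" "!!x. x : V ==> P x" "!!x. [|x : car R; x : aspan R V; P x|] ==> P (\<ominus> x)"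
   "!!x y. [|x : car R; y : car R; x : aspan R V; y : aspan R V; P x; P y|] ==> P (x \<oplus> y)"
 shows "P x"
 using x
proof (induction rule: generate.induct)
 case one thus ?case using P(1) by simp
next
 case (incl h) thus ?case using P(2) by simp
next
 case (inv h)
 hence "P (\<ominus> h)" using P(2,3) V aspan_incl by blast
 thus ?case by(simp add: a_inv_def)
next
 case (eng h1 h2)
 thus ?case using P(4) aspan_closed[OF _ V] by simp
qed

lemma aspan_min:
 assumes "additive_subgroup H R" "V \<subseteq> H" shows "aspan R V \<subseteq> H"
proof -
 interpret additive_subgroup H R by fact
 have "V <= car R" using assms(2) a_subset by blast
 thus ?thesis using add.generate_subgroup_incl[OF assms(2)] a_subgroup by blast
qed

lemma aspan_mult:
 assumes "x : aspan R V" "y : aspan R W" "V <= car R" "W <= car R"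
  and H: "additive_subgroup H R" and VW: "!!v w. [|v : V; w : W|] ==> v \<otimes> w : H"
 shows "x \<otimes> y : H"
proof -
 interpret H: additive_subgroup H R by fact
 have y: "y : car R" using assms aspan_closed by blast
 have vy: "v \<otimes> y : H" if v: "v : V" for v
 proof -
  have vc: "v : car R" using v assms(3) by blast
  show ?thesis using assms(2,4)
  proof (induction y rule: aspan_induct)
   case (neg y) thus ?case using r_minus[OF vc, of y] H.a_inv_closed by simp
  qed (use v vc VW in "auto simp: r_distr H.zero_closed H.a_closed")
 qed
 show ?thesis
  using assms(1,3)
 proof (induction x rule: aspan_induct)
  case (neg x) thus ?case using l_minus[of x y] y H.a_inv_closed by simp
 qed (use y vy in "auto simp: l_distr H.zero_closed H.a_closed")
qed

lemma Idl_finite_rep: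
 assumes "finite F" "F <= car R" "x : Idl F" and comm: "cring R"
 obtains c where "c : F \<rightarrow> car R" "x = (\<Oplus>f\<in>F. c f \<otimes> f)"
proof -
 interpret cring R by fact
 let ?S = "{x. EX c:F \<rightarrow> car R. x = (\<Oplus>f\<in>F. c f \<otimes> f)}"
 have Fc: "f : F ==> f : car R" for f using assms(2) by blast
 have cl: "(\<Oplus>f\<in>F. c f \<otimes> f) : car R" if "c : F \<rightarrow> car R" for c
  using that Fc by(auto intro!: finsum_closed)
 have scale: "a \<otimes> (\<Oplus>f\<in>F. c f \<otimes> f) = (\<Oplus>f\<in>F. (a \<otimes> c f) \<otimes> f)" if "c : F \<rightarrow> car R" "a : car R" for c a
  using that Fc by(subst finsum_rdistr[OF assms(1)]) (auto intro!: finsum_cong' simp: m_assoc Pi_iff)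
 have "ideal ?S R"
 proof (rule idealI)
  show "subgroup ?S (add_monoid R)"
  proof (rule add.subgroupI)
   show "?S <= car R" using cl by blast
   have "\<zero> = (\<Oplus>f\<in>F. \<zero> \<otimes> f)" using Fc by(simp add: add.finprod_one_eqI)
   thus "?S ~= {}" by(auto intro!: exI[of _ \<zero>] bexI[of _ "%_. \<zero>"])
   fix a assume "a : ?S"
   then obtain c where c: "c : F \<rightarrow> car R" "a = (\<Oplus>f\<in>F. c f \<otimes> f)" by blast
   have "\<ominus> a = (\<ominus> \<one>) \<otimes> a" using cl[OF c(1)] c(2) l_minus[of \<one> a] by simp
   hence "\<ominus> a = (\<Oplus>f\<in>F. (\<ominus> \<one> \<otimes> c f) \<otimes> f)" using scale[OF c(1), of "\<ominus> \<one>"] c(2) by simp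
   moreover have "(%f. \<ominus> \<one> \<otimes> c f) : F \<rightarrow> car R" using c(1) by auto
   ultimately show "\<ominus> a : ?S" by(intro CollectI bexI)
   fix b assume "b : ?S"
   then obtain d where d: "d : F \<rightarrow> car R" "b = (\<Oplus>f\<in>F. d f \<otimes> f)" by blast
   have "a \<oplus> b = (\<Oplus>f\<in>F. (c f \<oplus> d f) \<otimes> f)"
   proof -
    have "(\<Oplus>f\<in>F. (c f \<oplus> d f) \<otimes> f) = (\<Oplus>f\<in>F. c f \<otimes> f \<oplus> d f \<otimes> f)"
     by(rule finsum_cong') (use c(1) d(1) Fc in "auto simp: l_distr Pi_iff")
    thus ?thesis using c d Fc by(simp add: Pi_iff)
   qed
   moreover have "(%f. c f \<oplus> d f) : F \<rightarrow> car R" using c(1) d(1) by auto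
   ultimately show "a \<oplus> b : ?S" by auto
  qed
  fix a r assume "a : ?S" and r: "r : car R"
  then obtain c where c: "c : F \<rightarrow> car R" "a = (\<Oplus>f\<in>F. c f \<otimes> f)" by blast
  have "r \<otimes> a : ?S" using scale[OF c(1) r] c r by(auto intro!: bexI[of _ "%f. r \<otimes> c f"])
  thus "r \<otimes> a : ?S" "a \<otimes> r : ?S" using m_comm[of a r] cl[OF c(1)] c(2) r by auto
 qed (rule ring_axioms)
 moreover have "F \<subseteq> ?S"
 proof
  fix g assume g: "g : F"
  let ?c = "%f. if f = g then \<one> else \<zero>"
  have "(\<Oplus>f\<in>F. ?c f \<otimes> f) = (\<Oplus>f\<in>F. if g = f then f else \<zero>)"
   using Fc by(intro finsum_cong') auto
  also have "... = g" using finsum_singleton[OF g assms(1), of "%f. f"] Fc by auto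
  finally have "g = (\<Oplus>f\<in>F. ?c f \<otimes> f)" ..
  moreover have "?c : F \<rightarrow> car R" by auto
  ultimately show "g : ?S" by(intro CollectI bexI)
 qed
 ultimately have "x : ?S" using genideal_minimal assms(3) by blast
 thus ?thesis using that by blast
qed

text \<open>The ideal generated by \<open>V\<close> is the additive span of the products
  \<open>v \<otimes> r\<close>, so a property need only be checked on these and on sums.\<close>

lemma Idl_induct [consumes 3, case_names zero smult add]:
 assumes x: "x : Idl V" and V: "V <= car R" and comm: "cring R"
  and P: "P \<zero>" "!!v r. [|v : V; r : car R|] ==> P (v \<otimes> r)"
   "!!x y. [|x : Idl V; y : Idl V; P x; P y|] ==> P (x \<oplus> y)"
 shows "P x"
proof -
 interpret cring R by fact
 define G where "G = {v \<otimes> r | v r. v : V & r : car R}"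
 have GE: "EX v:V. EX r:car R. x = v \<otimes> r" if "x : G" for x using that by(auto simp: G_def)
 have GI: "v \<otimes> r : G" if "v : V" "r : car R" for v r using that by(auto simp: G_def)
 have Vc: "v : car R" if "v : V" for v using that V by blast
 have GR: "G <= car R" using GE Vc by fastforce
 interpret S: additive_subgroup "aspan R G" R by(rule aspan_subgroup[OF GR])
 have mr: "x \<otimes> r : aspan R G" if x: "x : aspan R G" and r: "r : car R" for x r
 proof (rule aspan_mult[OF x _ GR _ S.additive_subgroup_axioms])
  show "r : aspan R {r}" by(rule aspan_incl) simp
  show "{r} <= car R" using r by simp
  fix v w assume "v : G" and w: "w : {r}"
  then obtain u s where u: "u : V" "s : car R" "v = u \<otimes> s" using GE by blast
  hence "v \<otimes> w = u \<otimes> (s \<otimes> r)" using w Vc r by(simp add: m_assoc)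
  thus "v \<otimes> w : aspan R G" using aspan_incl[OF GI[OF u(1) m_closed[OF u(2) r]]] by simp
 qed
 have "ideal (aspan R G) R"
 proof (rule idealI)
  show "subgroup (aspan R G) (add_monoid R)" by(rule S.a_subgroup)
  fix a r assume a: "a : aspan R G" "r : car R"
  show "a \<otimes> r : aspan R G" by(rule mr[OF a])
  thus "r \<otimes> a : aspan R G" using m_comm[OF aspan_closed[OF a(1) GR] a(2)] by simp
 qed (rule ring_axioms)
 moreover have "V \<subseteq> aspan R G"
 proof
  fix v assume "v : V"
  thus "v : aspan R G" using aspan_incl[OF GI[OF _ one_closed]] Vc by fastforce
 qed
 ultimately have xG: "x : aspan R G" using genideal_minimal x by blast
 note I = genideal_ideal[OF V]
 have "v \<otimes> r : Idl V" if "v : V" "r : car R" for v r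
  using ideal.I_r_closed[OF I subsetD[OF genideal_self[OF V] that(1)] that(2)] .
 hence "G \<subseteq> Idl V" using GE by fastforce
 hence sub: "aspan R G \<subseteq> Idl V" using aspan_min[OF ideal.axioms(1)[OF I]] by blast
 \<comment> \<open>Additive spans are closed under negation, for which \<open>P\<close> has no case.
   Carrying \<open>\<ominus> x\<close> along works because the negative of a product is again one,
   with \<open>r\<close> negated.\<close>
 have "P x & P (\<ominus> x)"
  using xG GR
 proof (induction x rule: aspan_induct)
  case (incl x)
  then obtain v r where v: "v : V" "r : car R" "x = v \<otimes> r" using GE by blast
  hence "\<ominus> x = v \<otimes> (\<ominus> r)" using Vc r_minus[of v r] by auto
  thus ?case using v P(2)[of v r] P(2)[of v "\<ominus> r"] by simp
 next
  case (add x y)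
  have "x : Idl V" "y : Idl V" "\<ominus> x : Idl V" "\<ominus> y : Idl V"
   using add sub additive_subgroup.a_inv_closed[OF ideal.axioms(1)[OF I]] by auto
  thus ?case using add P(3) minus_add[of x y] by simp
 qed (use P(1) in auto)
 thus ?thesis by blast
qed

end

definition mwt :: "('g \<Rightarrow> nat) \<Rightarrow> ('g \<Rightarrow>\<^sub>0 nat) \<Rightarrow> nat" where
 "mwt w m = (\<Sum>g\<in>Poly_Mapping.keys m. lookup m g * w g)"

lemma mwt_superset:
 "[|finite K; Poly_Mapping.keys m \<subseteq> K|] ==> mwt w m = (\<Sum>g\<in>K. lookup m g * w g)"
 unfolding mwt_def by(rule sum.mono_neutral_left) (auto simp: in_keys_iff)

lemma mwt_add: "mwt w (m + n) = mwt w m + mwt w n"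
proof -
 let ?K = "Poly_Mapping.keys m \<union> Poly_Mapping.keys n"
 have "mwt w (m + n) = (\<Sum>g\<in>?K. lookup (m + n) g * w g)"
  by(rule mwt_superset) (use keys_add[of m n] in auto)
 thus ?thesis
  using mwt_superset[of ?K m w] mwt_superset[of ?K n w] by(simp add: lookup_add algebra_simps sum.distrib)
qed

lemma mwt_single: "mwt w (single g k) = k * w g"
 by(cases "k = 0") (simp_all add: mwt_def)

lemma mwt_zero [simp]: "mwt w 0 = 0"
 by(simp add: mwt_def)

text \<open>The multiplication rule of a grading, but neither directness nor exhaustion. Gradings,
  the powers of an ideal, and a subring as a constant family are all instances, so each closure
  lemma about series serves all of them.\<close>

locale gfam = cring R for R (structure) + fixes H :: "nat => 'a set"
 assumes H_sub: "additive_subgroup (H n) R" and H_one: "\<one> : H 0"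
  and H_mult: "[|x : H m; y : H n|] ==> x \<otimes> y : H (m + n)"
begin

lemma H_carr: "x : H n ==> x : car R"
 using additive_subgroup.a_Hcarr[OF H_sub] .

lemma H_zero: "\<zero> : H n"
 using additive_subgroup.zero_closed[OF H_sub] .

lemma H_add: "[|x : H n; y : H n|] ==> x \<oplus> y : H n"
 using additive_subgroup.a_closed[OF H_sub] .

lemma H_neg: "x : H n ==> \<ominus> x : H n"
 using additive_subgroup.a_inv_closed[OF H_sub] .

lemma H_diff: "[|x : H n; y : H n|] ==> x \<ominus> y : H n"
 by(simp add: a_minus_def H_add H_neg)

lemma H_finsum: "(!!i. i : A ==> f i : H n) ==> finsum R f A : H n"
proof (induction A rule: infinite_finite_induct)
 case (insert x F)
 thus ?case by(subst finsum_insert) (auto intro: H_carr H_add)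
qed (auto simp: finsum_infinite H_zero)

lemma H_int_pow: "x : H n ==> add_pow R (c :: int) x : H n"
proof -
 assume x: "x : H n"
 have "add_pow R (k :: nat) x : H n" for k
  by(induction k) (use x in "auto simp: H_zero H_add")
 thus ?thesis
  unfolding add_pow_def int_pow_def2 a_inv_def[symmetric] using H_neg by(simp del: pow_nat)
qed

lemma H_pow: "x : H n ==> x [^] (k :: nat) : H (k * n)"
proof (induction k)
 case (Suc k)
 thus ?case using H_mult[of "x [^] k" "k * n" x n] by(simp add: add.commute)
qed (simp add: H_one)

lemma H_finprod:
 assumes "finite K" "!!g. g : K ==> f g : H (w g)"
 shows "finprod R f K : H (sum w K)"
 using assms
proof (induction K)
 case (insert x F)
 thus ?case by(subst finprod_insert) (auto intro: H_carr H_mult)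
qed (simp add: H_one)

lemma zeval_H:
 assumes p: "!!m. m : Poly_Mapping.keys p ==> mwt w m = n"
  and f: "!!m g. [|m : Poly_Mapping.keys p; g : Poly_Mapping.keys m|] ==> f g : H (w g)"
 shows "zeval R f p : H n"
 unfolding zeval_def
proof (rule H_finsum, rule H_int_pow)
 fix m assume m: "m : Poly_Mapping.keys p"
 have "(\<Otimes>g\<in>Poly_Mapping.keys m. f g [^] lookup m g) : H (mwt w m)"
  unfolding mwt_def by(rule H_finprod) (auto intro: H_pow f[OF m])
 thus "(\<Otimes>g\<in>Poly_Mapping.keys m. f g [^] lookup m g) : H n" using p[OF m] by simp
qed

end

section \<open>Powers of ideals and the Artin--Rees lemma\<close>

lemma (in cring) ideals_pow:
 assumes "ideal I R"
 shows "ideal (I [^]\<^bsub>ideals_set R\<^esub> (k::nat)) R"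
  and "I [^]\<^bsub>ideals_set R\<^esub> (0::nat) = car R"
  and "(I [^]\<^bsub>ideals_set R\<^esub> j) \<cdot> (I [^]\<^bsub>ideals_set R\<^esub> k) = I [^]\<^bsub>ideals_set R\<^esub> (j + k :: nat)"
  and "I [^]\<^bsub>ideals_set R\<^esub> (1::nat) = I"
proof -
 interpret M: comm_monoid "ideals_set R" by(rule ideals_set_is_comm_monoid)
 have I: "I : car (ideals_set R)" using assms by(simp add: ideals_set_def)
 show "ideal (I [^]\<^bsub>ideals_set R\<^esub> k) R" using M.nat_pow_closed[OF I] by(simp add: ideals_set_def)
 show "I [^]\<^bsub>ideals_set R\<^esub> (0::nat) = car R" by(simp add: ideals_set_def)
 show "(I [^]\<^bsub>ideals_set R\<^esub> j) \<cdot> (I [^]\<^bsub>ideals_set R\<^esub> k) = I [^]\<^bsub>ideals_set R\<^esub> (j + k)"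
  using M.nat_pow_mult[OF I, of j k] by(simp add: ideals_set_def)
 show "I [^]\<^bsub>ideals_set R\<^esub> (1::nat) = I" using M.nat_pow_eone[OF I] by simp
qed

lemma (in cring) gfam_ideal_pow:
 assumes "ideal I R" shows "gfam R (%k. I [^]\<^bsub>ideals_set R\<^esub> k)"
proof (intro gfam.intro gfam_axioms.intro cring_axioms)
 show "additive_subgroup (I [^]\<^bsub>ideals_set R\<^esub> n) R" for n :: nat
  using ideals_pow(1)[OF assms] by(rule ideal.axioms(1))
 show "\<one> : I [^]\<^bsub>ideals_set R\<^esub> (0::nat)" using ideals_pow(2)[OF assms] by simp
 show "x \<otimes> y : I [^]\<^bsub>ideals_set R\<^esub> (m + n)"
  if "x : I [^]\<^bsub>ideals_set R\<^esub> m" "y : I [^]\<^bsub>ideals_set R\<^esub> n" for x y and m n :: nat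
  using ideal_prod.prod[OF that, of R] ideals_pow(3)[OF assms, of m n] by simp
qed

lemma (in cring) ideal_pow_mono:
 fixes j k :: nat
 assumes "ideal I R" "j <= k" shows "I [^]\<^bsub>ideals_set R\<^esub> k \<subseteq> I [^]\<^bsub>ideals_set R\<^esub> j"
 using ideal_prod_inter[OF ideals_pow(1,1)[OF assms(1)], of j "k - j"] ideals_pow(3)[OF assms(1), of j "k - j"] assms(2)
 by simp

lemma (in cring) zeval_surj:
 assumes S: "S <= car R" "generate_ring R S = car R" "f ` G <= car R" "S \<subseteq> f ` G"
  and a: "a : car R"
 shows "EX p:car (zpolys G). zeval R f p = a"
 using a unfolding S(2)[symmetric]
proof (induction rule: generate_ring.induct)
 case one thus ?case by(intro bexI[of _ 1]) auto
next
 case (incl h)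
 then obtain g where "g : G" "f g = h" using S(4) by auto
 thus ?case using S(3) by(intro bexI[of _ "zvar g"]) (auto simp: zeval_zvar)
next
 case (a_inv h)
 then obtain p where p: "p : car (zpolys G)" "zeval R f p = h" by blast
 interpret e: ring_hom_cring "zpolys G" R "zeval R f"
  by(rule rh_cringI[OF zpoly_cring cring_axioms zeval_hom[OF S(3)]])
 show ?case using e.hom_a_inv[OF p(1)] p by(intro bexI[of _ "- p"]) auto
next
 case (eng_add h1 h2)
 then obtain p q where "p : car (zpolys G)" "zeval R f p = h1" "q : car (zpolys G)" "zeval R f q = h2" by blast
 thus ?case using zeval_add[OF S(3)] by(intro bexI[of _ "p + q"]) auto
next
 case (eng_mult h1 h2)
 then obtain p q where "p : car (zpolys G)" "zeval R f p = h1" "q : car (zpolys G)" "zeval R f q = h2" by blast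
 thus ?case using zeval_mult[OF S(3)] by(intro bexI[of _ "p * q"]) auto
qed

lemma (in cring) zeval_sum:
 assumes "f ` G <= car R" "!!i. i : K ==> p i : car (zpolys G)"
 shows "zeval R f (sum p K) = (\<Oplus>i\<in>K. zeval R f (p i))" "sum p K : car (zpolys G)"
proof -
 have "zeval R f (sum p K) = (\<Oplus>i\<in>K. zeval R f (p i)) & sum p K : car (zpolys G)"
  using assms(2)
 proof (induction K rule: infinite_finite_induct)
  case (insert x F)
  thus ?case using zeval_closed[OF assms(1)]
   by(auto simp: zeval_add[OF assms(1)] Pi_iff)
 qed (auto simp: finsum_infinite)
 thus "zeval R f (sum p K) = (\<Oplus>i\<in>K. zeval R f (p i))" "sum p K : car (zpolys G)" by auto
qed

text \<open>\<open>R\<close> is a quotient of the integer polynomials in variables from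
  \<open>S\<close>, each variable being evaluated at itself. The preimage of an ideal
  \<open>K\<close> is spanned by finitely many of its members, and their values generate
  \<open>K\<close>.\<close>

lemma (in cring) fin_gen_noetherian:
 assumes S: "finite S" "S <= car R" "generate_ring R S = car R"
 shows "noetherian_ring R"
proof (rule noetherian_ringI)
 fix K assume K: "ideal K R"
 interpret K: ideal K R by fact
 have id: "(%x. x) ` S <= car R" using S by auto
 let ?e = "zeval R (%x. x)" and ?C = "car (zpolys S)"
 let ?W = "{p : ?C. ?e p : K}"
 have "?W \<subseteq> ?C" by blast
 then obtain F where F: "F \<subseteq> ?W" "finite F" "?W \<subseteq> lcomb ?C F"
  using noeth_zpoly[OF S(1)] unfolding noeth_def by meson
 have FK: "?e ` F \<subseteq> K" and FR: "?e ` F <= car R" using F(1) K.Icarr by auto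
 interpret I: ideal "Idl (?e ` F)" R by(rule genideal_ideal[OF FR])
 have "K \<subseteq> Idl (?e ` F)"
 proof
  fix a assume a: "a : K"
  then obtain p where p: "p : ?C" "?e p = a" using zeval_surj[OF S(2,3) id _ K.Icarr[OF a]] by auto
  hence "p : lcomb ?C F" using F(3) a by blast
  hence "p : ?C & ?e p : Idl (?e ` F)"
  proof (induction rule: lcomb.induct)
   case (add x b w)
   hence "w : ?C" "?e w : Idl (?e ` F)" using F(1) genideal_self[OF FR] by auto
   thus ?case using add zeval_closed[OF id]
    by(auto simp: zeval_add[OF id] zeval_mult[OF id] intro!: I.a_closed I.I_l_closed)
  qed (auto simp: I.zero_closed)
  thus "a : Idl (?e ` F)" using p by simp
 qed
 hence "K = Idl (?e ` F)" using Idl_subset_ideal[OF K] genideal_minimal[OF K FK] by blast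
 thus "\<exists>A\<subseteq>car R. finite A & K = Idl A" using FR F(2) by blast
qed

text \<open>The component of weight \<open>v\<close>, for weights in an arbitrary type; pairs of
  degrees are used below.\<close>

definition zpart :: "(('g \<Rightarrow>\<^sub>0 nat) \<Rightarrow> 'w) \<Rightarrow> 'w \<Rightarrow> 'g zpoly \<Rightarrow> 'g zpoly" where
 "zpart wt v p = (\<Sum>m | m \<in> Poly_Mapping.keys p \<and> wt m = v. single m (lookup p m))"

lemma lookup_zpart: "lookup (zpart wt v p) m = (if wt m = v then lookup p m else 0)"
 by(auto simp: zpart_def lookup_sum lookup_single when_def in_keys_iff)

lemma zpart_keys: "m : Poly_Mapping.keys (zpart wt v p) \<longleftrightarrow> m : Poly_Mapping.keys p & wt m = v"
 by(simp add: in_keys_iff lookup_zpart)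

lemma zpart_add: "zpart wt v (p + q) = zpart wt v p + zpart wt v q"
 by(rule poly_mapping_eqI) (simp add: lookup_zpart lookup_add)

lemma zpart_zero [simp]: "zpart wt v 0 = 0"
 by(rule poly_mapping_eqI) (simp add: lookup_zpart)

lemma zpart_sum: "zpart wt v (sum p K) = (\<Sum>i\<in>K. zpart wt v (p i))"
 by(induction K rule: infinite_finite_induct) (auto simp: zpart_add)

lemma zpart_single: "zpart wt v (single m c) = (if wt m = v then single m c else 0)"
 by(rule poly_mapping_eqI) (auto simp: lookup_zpart lookup_single when_def)

lemma zpart_id: "(!!m. m : Poly_Mapping.keys p ==> wt m = v) ==> zpart wt v p = p"
 by(rule poly_mapping_eqI) (auto simp: lookup_zpart in_keys_iff)

lemma zpart_carrier: "p : car (zpolys S) ==> zpart wt v p : car (zpolys S)"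
 unfolding carrier_zpoly_ring by(simp add: zpart_keys)

lemma zpoly_mult_sum:
 "p * q = (\<Sum>m\<in>Poly_Mapping.keys p. \<Sum>n\<in>Poly_Mapping.keys q.
  single (m + n) (lookup p m * lookup q n))" for p q :: "'g zpoly"
 by(subst (1 2) pm_sum_singles) (simp add: sum_product mult_single)

text \<open>For homogeneous \<open>q\<close>, the components of a product come from components of
  \<open>p\<close>. Weights cannot be subtracted in pairs of natural numbers, hence the separate
  case of a weight that is not of the form \<open>v + u\<close>.\<close>

lemma zpart_mult:
 assumes wt: "!!m n. wt (m + n) = wt m + (wt n :: 'w::cancel_comm_monoid_add)"
  and q: "!!m. m : Poly_Mapping.keys q ==> wt m = u"
 shows "zpart wt (v + u) (p * q) = zpart wt v p * q"
  and "(!!v. v + u ~= t) ==> zpart wt t (p * q) = 0"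
proof -
 have "zpart wt t (p * q) = (\<Sum>m\<in>Poly_Mapping.keys p. \<Sum>n\<in>Poly_Mapping.keys q. if wt m + u = t then
  single (m + n) (lookup p m * lookup q n) else 0)" for t
  by(subst zpoly_mult_sum) (auto simp: zpart_sum zpart_single wt q intro!: sum.cong)
 note * = this
 show "(!!v. v + u ~= t) ==> zpart wt t (p * q) = 0" by(simp add: *)
 have "zpart wt v p * q = (\<Sum>m | m \<in> Poly_Mapping.keys p & wt m = v. \<Sum>n\<in>Poly_Mapping.keys q.
  single (m + n) (lookup p m * lookup q n))"
  by(subst zpoly_mult_sum) (auto simp: lookup_zpart zpart_keys Collect_conj_eq intro!: sum.cong)
 also have "... = zpart wt (v + u) (p * q)"
  unfolding * by(rule sum.mono_neutral_cong_left) auto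
 finally show "zpart wt (v + u) (p * q) = zpart wt v p * q" ..
qed

text \<open>Elements \<open>\<Sum> b e * e\<close> of a module are evaluations of polynomials that are linear in variables
 \<open>Inr (Inr e)\<close> and whose coefficients are polynomials in the ring generators \<open>Inl s\<close>, homogeneous in
 variables \<open>Inr (Inl x)\<close> evaluated at generators \<open>x\<close> of the ideal; so the basis theorem for this
 polynomial ring bounds the degrees of generating syzygies.\<close>

lemma artin_rees:
 fixes A :: "('a, 'm) ring_scheme" and R :: "('r, 'n) ring_scheme"
 assumes A: "cring A" and fg: "EX S. finite S & S <= car A & generate_ring A S = car A"
  and I: "ideal I A" and R: "cring R" and s: "s : ring_hom A R"
  and E: "finite E" "E <= car R"
 obtains F :: "('a + 'a + 'r) zpoly set" and n :: "('a + 'a + 'r) zpoly => 'r => 'a" and c :: nat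
 where "finite F" "!!f e. [|f : F; e : E|] ==> n f e : car A"
  "!!f. f : F ==> (\<Oplus>\<^bsub>R\<^esub>e\<in>E. s (n f e) *[R] e) = 0[R]"
  "!!k b. [|b : E \<rightarrow> ipow A I (k::nat); (\<Oplus>\<^bsub>R\<^esub>e\<in>E. s (b e) *[R] e) = 0[R]|] ==>
   EX q. q : F \<rightarrow> ipow A I (k - c) & (ALL e:E. b e = (\<Oplus>\<^bsub>A\<^esub>f\<in>F. q f *[A] n f e))"
proof -
 interpret A: cring A by fact
 interpret R: cring R by fact
 interpret s: ring_hom_cring A R s by(rule rh_cringI[OF A R s])
 interpret P: gfam A "%k. ipow A I k" by(rule A.gfam_ideal_pow[OF I])
 obtain S where S: "finite S" "S <= car A" "generate_ring A S = car A" using fg by blast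
 interpret N: noetherian_ring A by(rule A.fin_gen_noetherian[OF S])
 obtain T where T: "T <= car A" "finite T" "I = Idl\<^bsub>A\<^esub> T" using N.finetely_gen[OF I] by auto
 have TI: "T \<subseteq> I" using A.genideal_self[OF T(1)] T(3) by simp
 define G0 :: "('a + 'a + 'r) set" where "G0 = Inl ` S \<union> Inr ` Inl ` T"
 define G where "G = G0 \<union> Inr ` Inr ` E"
 have finG: "finite G" using S(1) T(2) E(1) by(simp add: G_def G0_def)
 \<comment> \<open>\<open>wT\<close> is the degree in the generators of \<open>I\<close>, as in the
   Rees algebra; \<open>wY\<close> is the degree in the module variables and singles out the linear
   forms.\<close>
 define wT :: "'a + 'a + 'r => nat" where "wT = case_sum (%_. 0) (case_sum (%_. 1) (%_. 0))"
 define wY :: "'a + 'a + 'r => nat" where "wY = case_sum (%_. 0) (case_sum (%_. 0) (%_. 1))"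
 define wt where "wt m = (mwt wT m, mwt wY m)" for m
 have wt_add: "wt (m + n) = wt m + wt n" for m n by(simp add: wt_def mwt_add)
 let ?D = "car (zpolys G0)" and ?C = "car (zpolys G)"
 have C0C: "p : ?D ==> p : ?C" for p by(auto simp: carrier_zpoly_ring G_def)
 define hm where "hm k p \<longleftrightarrow> (ALL m:Poly_Mapping.keys p. mwt wT m = k)" for k and p :: "('a + 'a + 'r) zpoly"
 \<comment> \<open>\<open>ev0\<close> evaluates coefficients in \<open>A\<close>;
   \<open>ev1 e\<close> also sets the module variables to a unit vector and so reads off the
   coefficient of \<open>e\<close>; \<open>evR\<close> sends each module variable to the generator
   it stands for.\<close>
 define ev0 :: "'a + 'a + 'r => 'a" where "ev0 = case_sum id (case_sum id (%_. 0[A]))"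
 define ev1 where "ev1 e = case_sum id (case_sum id (%e'. if e' = e then 1[A] else 0[A]))" for e :: 'r
 define evR where "evR = case_sum s (case_sum s (%e. e))"
 have ev0: "ev0 ` G0 <= car A" using S T by(auto simp: G0_def ev0_def)
 have ev1: "ev1 e ` G <= car A" for e using S T by(auto simp: G_def G0_def ev1_def)
 have evR: "evR ` G <= car R" using S T E by(auto simp: G_def G0_def evR_def)
 have ev0G: "ev0 ` G <= car A" using ev0 by(auto simp: G_def ev0_def)
 have C0_cases: "EX m:Poly_Mapping.keys p. mwt wY m ~= 0" if "p : ?C" "p ~: ?D" for p
 proof -
  obtain m g where mg: "m : Poly_Mapping.keys p" "g : Poly_Mapping.keys m" "g ~: G0"
   using `p ~: ?D` unfolding carrier_zpoly_ring by blast
  hence "g : G" using `p : ?C` unfolding carrier_zpoly_ring by blast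
  hence "wY g = 1" using mg by(auto simp: G_def wY_def)
  hence "lookup m g * wY g ~= 0" using mg(2) by(simp add: in_keys_iff)
  hence "mwt wY m ~= 0" using mg(2) by(auto simp: mwt_def)
  thus ?thesis using mg(1) by blast
 qed
 have wY0: "mwt wY m = 0" if "Poly_Mapping.keys m \<subseteq> G0" for m
  unfolding mwt_def by(rule sum.neutral) (use that in "auto simp: G0_def wY_def")
 have ev_eq: "zeval A (ev1 e) p = zeval A ev0 p" "zeval R evR p = s (zeval A ev0 p)" if p: "p : ?D" for p e
 proof -
  have g: "ev1 e g = ev0 g" "evR g = s (ev0 g)" if "g : G0" for g
   using that by(auto simp: G0_def ev1_def ev0_def evR_def)
  have h0: "zeval A ev0 : ring_hom (zpolys G0) A" by(rule A.zeval_hom[OF ev0])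
  have i1: "ev1 e ` G0 <= car A" and i2: "evR ` G0 <= car R" using ev1 evR by(auto simp: G_def)
  show "zeval A (ev1 e) p = zeval A ev0 p"
   by(rule zpoly_hom_eq_zeval[OF A i1 h0 _ p, symmetric]) (use ev0 in "auto simp: g A.zeval_zvar")
  have h1: "s \<circ> zeval A ev0 : ring_hom (zpolys G0) R" by(rule ring_hom_trans[OF h0 s])
  show "zeval R evR p = s (zeval A ev0 p)"
   using zpoly_hom_eq_zeval[OF R i2 h1 _ p] ev0 g(2) by(simp add: A.zeval_zvar image_subset_iff)
 qed
 have hm_I: "zeval A ev0 p : ipow A I k" if "p : ?D" "hm k p" for p k
 proof (rule P.zeval_H[where w = wT])
  fix m assume m: "m : Poly_Mapping.keys p"
  show "mwt wT m = k" using that(2) m by(simp add: hm_def)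
  fix g assume "g : Poly_Mapping.keys m"
  hence "g : G0" using m that(1) by(auto simp: carrier_zpoly_ring)
  moreover have "ipow A I (1::nat) = I" "ipow A I (0::nat) = car A"
   using A.ideals_pow[OF I] by auto
  ultimately show "ev0 g : ipow A I (wT g)" using S T TI by(auto simp: G0_def ev0_def wT_def)
 qed
 have hm_add: "hm k (p + q)" "hm k (- p)" if "hm k p" "hm k q" for k p q
  using that keys_add[of p q] by(auto simp: hm_def)
 have hm_mult: "hm (j + k) (p * q)" if "hm j p" "hm k q" for j k p q
  using that keys_mult[of p q] by(fastforce simp: hm_def mwt_add)
 have hm_zero: "hm k 0" for k by(simp add: hm_def)
 have hm_var: "hm (wT g) (zvar g)" for g by(simp add: hm_def zvar_def mwt_single)
 have SG: "S \<subseteq> ev0 ` Inl ` S" by(force simp: ev0_def)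
 have surj0: "EX p:?D. hm 0 p & zeval A ev0 p = a" if "a : car A" for a
 proof -
  have "ev0 ` (Inl ` S) <= car A" using ev0 by(auto simp: G0_def)
  from A.zeval_surj[OF S(2,3) this SG that] obtain p where
   p: "p : car (zpolys (Inl ` S))" "zeval A ev0 p = a" by blast
  have keys: "EX x:S. g = Inl x" if "m : Poly_Mapping.keys p" "g : Poly_Mapping.keys m" for m g
   using p(1) that unfolding carrier_zpoly_ring by blast
  have "p : ?D" unfolding carrier_zpoly_ring G0_def using keys by blast
  moreover have "wT g = 0" if "m : Poly_Mapping.keys p" "g : Poly_Mapping.keys m" for m g
   using keys[OF that] by(auto simp: wT_def)
  hence "hm 0 p" unfolding hm_def mwt_def by simp
  ultimately have "p : ?D & hm 0 p" by blast
  thus ?thesis using p(2) by blast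
 qed
 have surj: "EX p:?D. hm k p & zeval A ev0 p = a" if "a : ipow A I k" for a and k :: nat
  using that
 proof (induction k arbitrary: a)
  case 0 thus ?case using surj0 A.ideals_pow(2)[OF I] by simp
 next
  case (Suc k)
  from Suc.prems have "a : (ipow A I k) \<cdot>\<^bsub>A\<^esub> I" by(simp only: genideal_pow_abbrev)
  thus ?case
  proof (induction rule: ideal_prod.induct)
   case (prod i j)
   obtain p where p: "p : ?D" "hm k p" "zeval A ev0 p = i" using Suc.IH[OF prod(1)] by blast
   have i: "i : car A" using prod(1) P.H_carr by blast
   have "j : Idl\<^bsub>A\<^esub> T" using prod(2) T(3) by simp
   from this T(1) A have "EX q:?D. hm 1 q & zeval A ev0 q = j"
   proof (induction j rule: A.Idl_induct)
    case zero thus ?case using hm_zero by(intro bexI[of _ 0]) auto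
   next
    case (smult x r)
    obtain q where q: "q : ?D" "hm 0 q" "zeval A ev0 q = r" using surj0[OF smult(2)] by blast
    have v: "zvar (Inr (Inl x)) : ?D" "zeval A ev0 (zvar (Inr (Inl x))) = x" "hm 1 (zvar (Inr (Inl x)))"
     using smult(1) T(1) hm_var[of "Inr (Inl x)"] by(auto simp: G0_def A.zeval_zvar ev0_def wT_def)
    show ?case using v q hm_mult[OF v(3) q(2)] A.zeval_mult[OF ev0 v(1) q(1)]
     by(intro bexI[of _ "zvar (Inr (Inl x)) * q"]) auto
   next
    case (add x y)
    then obtain p q where "p : ?D" "hm 1 p" "zeval A ev0 p = x" "q : ?D" "hm 1 q" "zeval A ev0 q = y" by blast
    thus ?case using hm_add(1) A.zeval_add[OF ev0] by(intro bexI[of _ "p + q"]) auto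
   qed
   then obtain q where q: "q : ?D" "hm 1 q" "zeval A ev0 q = j" by blast
   show ?case using p q hm_mult[OF p(2) q(2)] A.zeval_mult[OF ev0 p(1) q(1)]
    by(intro bexI[of _ "p * q"]) auto
  next
   case (sum x y)
   then obtain p q where "p : ?D" "hm (Suc k) p" "zeval A ev0 p = x" "q : ?D" "hm (Suc k) q" "zeval A ev0 q = y" by blast
   thus ?case using hm_add(1) A.zeval_add[OF ev0] by(intro bexI[of _ "p + q"]) auto
  qed
 qed
 define Y :: "'r => ('a + 'a + 'r) zpoly" where "Y e = zvar (Inr (Inr e))" for e
 define L where "L B = (\<Sum>e\<in>E. B e * Y e)" for B
 have Y: "Y e : ?C" if "e : E" for e using that by(simp add: Y_def G_def)
 have LC: "L B : ?C" if "B : E \<rightarrow> ?D" for B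
  unfolding L_def by(rule A.zeval_sum(2)[OF ev0G]) (use that Y C0C in auto)
 have L1: "zeval A (ev1 e) (L B) = zeval A ev0 (B e)" if B: "B : E \<rightarrow> ?D" and e: "e : E" for B e
 proof -
  have "zeval A (ev1 e) (L B) = (\<Oplus>\<^bsub>A\<^esub>e'\<in>E. zeval A (ev1 e) (B e' * Y e'))"
   unfolding L_def by(rule A.zeval_sum(1)[OF ev1]) (use B Y C0C in auto)
  also have "... = (\<Oplus>\<^bsub>A\<^esub>e'\<in>E. if e = e' then zeval A ev0 (B e') else 0[A])"
  proof (rule A.finsum_cong'[OF refl])
   show "(%e'. if e = e' then zeval A ev0 (B e') else 0[A]) : E \<rightarrow> car A"
    using A.zeval_closed[OF ev0 funcset_mem[OF B]] by auto
   fix e' assume e': "e' : E"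
   hence "zeval A (ev1 e) (Y e') = (if e = e' then 1[A] else 0[A])"
    unfolding Y_def by(subst A.zeval_zvar) (auto simp: ev1_def)
   thus "zeval A (ev1 e) (B e' * Y e') = (if e = e' then zeval A ev0 (B e') else 0[A])"
    using A.zeval_mult[OF ev1 C0C Y, of "B e'" e' e] B e' ev_eq(1)[of "B e'" e] A.zeval_closed[OF ev0, of "B e'"]
    by(auto simp: Pi_iff)
  qed
  also have "... = zeval A ev0 (B e)"
   by(rule A.finsum_singleton[OF e E(1)]) (rule funcsetI, rule A.zeval_closed[OF ev0], rule funcset_mem[OF B])
  finally show ?thesis .
 qed
 have LR: "zeval R evR (L B) = (\<Oplus>\<^bsub>R\<^esub>e\<in>E. s (zeval A ev0 (B e)) *[R] e)" if B: "B : E \<rightarrow> ?D" for B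
 proof -
  have "zeval R evR (L B) = (\<Oplus>\<^bsub>R\<^esub>e\<in>E. zeval R evR (B e * Y e))"
   unfolding L_def by(rule R.zeval_sum(1)[OF evR]) (use B Y C0C in auto)
  also have "... = (\<Oplus>\<^bsub>R\<^esub>e\<in>E. s (zeval A ev0 (B e)) *[R] e)"
  proof (rule R.finsum_cong'[OF refl])
   show "(%e. s (zeval A ev0 (B e)) *[R] e) : E \<rightarrow> car R"
    using B A.zeval_closed[OF ev0] E by(auto simp: Pi_iff subset_iff)
   fix e assume e: "e : E"
   hence "zeval R evR (Y e) = e"
    unfolding Y_def using E by(subst R.zeval_zvar) (auto simp: evR_def)
   thus "zeval R evR (B e * Y e) = s (zeval A ev0 (B e)) *[R] e"
    using R.zeval_mult[OF evR C0C Y[OF e], of "B e"] B e ev_eq(2)[of "B e"] by(auto simp: Pi_iff)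
  qed
  finally show ?thesis .
 qed
 have Lwt: "wt m = (k, 1)" if B: "B : E \<rightarrow> ?D" "!!e. e : E ==> hm k (B e)" and m: "m : Poly_Mapping.keys (L B)" for B k m
 proof -
  obtain e where e: "e : E" "m : Poly_Mapping.keys (B e * Y e)"
   using m keys_sum[of "%e. B e * Y e" E] by(auto simp: L_def)
  then obtain u v where uv: "m = u + v" "u : Poly_Mapping.keys (B e)" "v : Poly_Mapping.keys (Y e)"
   using keys_mult[of "B e" "Y e"] by blast
  have "v = single (Inr (Inr e)) 1" using uv(3) by(simp add: Y_def zvar_def)
  moreover have "mwt wT u = k" using B(2)[OF e(1)] uv(2) by(simp add: hm_def)
  moreover have "mwt wY u = 0" using B(1) e(1) uv(2) by(intro wY0) (auto simp: carrier_zpoly_ring Pi_iff)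
  ultimately show ?thesis by(simp add: uv(1) wt_def mwt_add mwt_single wT_def wY_def)
 qed
 \<comment> \<open>Linear forms with homogeneous coefficients, of every degree \<open>k\<close>,
   that evaluate to zero in \<open>R\<close>. This is a set and not an ideal, so that its finitely
   many generators are homogeneous as well.\<close>
 define W where "W = {L B | B k. B : E \<rightarrow> ?D & (ALL e:E. hm k (B e)) & zeval R evR (L B) = 0[R]}"
 have "W \<subseteq> ?C" using LC by(auto simp: W_def)
 then obtain F where F: "F \<subseteq> W" "finite F" "W \<subseteq> lcomb ?C F"
  using noeth_zpoly[OF finG] unfolding noeth_def by meson
 define n where "n f e = zeval A (ev1 e) f" for f e
 have "ALL f:F. EX k. ALL m:Poly_Mapping.keys f. wt m = (k, 1)" using F(1) Lwt unfolding W_def by blast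
 then obtain d where d: "!!f m. [|f : F; m : Poly_Mapping.keys f|] ==> wt m = (d f, 1)" by metis
 \<comment> \<open>The Artin-Rees constant is the largest ideal degree among the generating
   syzygies; \<open>0\<close> is inserted so that the maximum exists for empty
   \<open>F\<close>.\<close>
 define c where "c = Max (insert 0 (d ` F))"
 have dc: "d f <= c" if "f : F" for f unfolding c_def by(rule Max_ge) (use that F(2) in auto)
 have FC: "f : ?C" if "f : F" for f using that F(1) `W \<subseteq> ?C` by blast
 show ?thesis
 proof (rule that[OF F(2), of n c])
  show "n f e : car A" if "f : F" for f e
   unfolding n_def by(rule A.zeval_closed[OF ev1 FC[OF that]])
 next
  fix f assume "f : F"
  then obtain B where B: "f = L B" "B : E \<rightarrow> ?D" "zeval R evR (L B) = 0[R]" using F(1) unfolding W_def by blast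
  have "(\<Oplus>\<^bsub>R\<^esub>e\<in>E. s (n f e) *[R] e) = (\<Oplus>\<^bsub>R\<^esub>e\<in>E. s (zeval A ev0 (B e)) *[R] e)"
   by(rule R.finsum_cong'[OF refl])
    (use B(2) A.zeval_closed[OF ev0] E in "auto simp: n_def B(1) L1 Pi_iff subset_iff")
  thus "(\<Oplus>\<^bsub>R\<^esub>e\<in>E. s (n f e) *[R] e) = 0[R]" using LR[OF B(2)] B(3) by simp
 next
  fix k :: nat and b assume b: "b : E \<rightarrow> ipow A I k" and zero: "(\<Oplus>\<^bsub>R\<^esub>e\<in>E. s (b e) *[R] e) = 0[R]"
  have "ALL e:E. EX p. p : ?D & hm k p & zeval A ev0 p = b e" using surj b by blast
  then obtain B where B: "!!e. e : E ==> B e : ?D" "!!e. e : E ==> hm k (B e)"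
   "!!e. e : E ==> zeval A ev0 (B e) = b e" by metis
  have BE: "B : E \<rightarrow> ?D" using B(1) by blast
  have "(\<Oplus>\<^bsub>R\<^esub>e\<in>E. s (zeval A ev0 (B e)) *[R] e) = (\<Oplus>\<^bsub>R\<^esub>e\<in>E. s (b e) *[R] e)"
   by(rule R.finsum_cong'[OF refl]) (use b P.H_carr E B(3) in "auto simp: Pi_iff subset_iff")
  hence "L B : W" unfolding W_def using BE B(2) LR[OF BE] zero by auto
  hence "L B : lcomb ?C F" using F(3) by blast
  then obtain Q where Q: "!!f. Q f : ?C" "L B = (\<Sum>f\<in>F. Q f * f)"
   by(rule lcomb_sum[OF F(2) subrng_zpoly]) (rule that)
  \<comment> \<open>Only the component of bidegree \<open>(k - d f, 0)\<close> of the coefficient of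
    \<open>f\<close> contributes to a form of bidegree \<open>(k, 1)\<close>. If
    \<open>d f > k\<close> nothing contributes, and the truncated difference must not be
    used.\<close>
  define Q' where "Q' f = (if d f <= k then zpart wt (k - d f, 0) (Q f) else 0)" for f
  have "L B = zpart wt (k, 1) (L B)" by(rule zpart_id[symmetric]) (rule Lwt[OF BE B(2)])
  also have "... = (\<Sum>f\<in>F. zpart wt (k, 1) (Q f * f))" unfolding Q(2) by(rule zpart_sum)
  also have "... = (\<Sum>f\<in>F. Q' f * f)"
  proof (rule sum.cong[OF refl])
   fix f assume f: "f : F"
   show "zpart wt (k, 1) (Q f * f) = Q' f * f"
   proof (cases "d f <= k")
    case True
    hence "(k, 1) = (k - d f, 0) + (d f, 1 :: nat)" by simp
    thus ?thesis using zpart_mult(1)[OF wt_add d[OF f], of f "(k - d f, 0)" "Q f"] True by(simp add: Q'_def)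
   next
    case False
    hence "v + (d f, 1) ~= (k, 1)" for v :: "nat \<times> nat" by(cases v) auto
    from zpart_mult(2)[OF wt_add d[OF f] this] show ?thesis using False by(simp add: Q'_def)
   qed
  qed
  finally have LB: "L B = (\<Sum>f\<in>F. Q' f * f)" .
  \<comment> \<open>Degree zero in the module variables means that none of them occurs, so these
    coefficients can be evaluated in \<open>A\<close>.\<close>
  have Q'C: "Q' f : ?D" for f
  proof (rule ccontr)
   assume n: "Q' f ~: ?D"
   have "Q' f : ?C" using Q(1) by(auto simp: Q'_def zpart_carrier)
   from C0_cases[OF this n] show False by(auto simp: Q'_def zpart_keys wt_def split: if_splits)
  qed
  have Q'hm: "hm (k - d f) (Q' f)" for f by(auto simp: hm_def Q'_def zpart_keys wt_def)
  define q where "q f = zeval A ev0 (Q' f)" for f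
  have q: "q f : ipow A I (k - c)" if "f : F" for f
   using hm_I[OF Q'C Q'hm, of f] subsetD[OF A.ideal_pow_mono[OF I diff_le_mono2[OF dc[OF that]]]] by(simp add: q_def)
  moreover have "b e = (\<Oplus>\<^bsub>A\<^esub>f\<in>F. q f *[A] n f e)" if e: "e : E" for e
  proof -
   have "b e = zeval A (ev1 e) (\<Sum>f\<in>F. Q' f * f)" using L1[OF BE e] B(3)[OF e] LB by simp
   also have "... = (\<Oplus>\<^bsub>A\<^esub>f\<in>F. zeval A (ev1 e) (Q' f * f))"
    by(rule A.zeval_sum(1)[OF ev1]) (use Q'C C0C FC in auto)
   also have "... = (\<Oplus>\<^bsub>A\<^esub>f\<in>F. q f *[A] n f e)"
   proof (rule A.finsum_cong'[OF refl])
    show "(%f. q f *[A] n f e) : F \<rightarrow> car A"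
     using A.zeval_closed[OF ev0 Q'C] A.zeval_closed[OF ev1 FC] by(auto simp: q_def n_def)
    fix f assume f: "f : F"
    show "zeval A (ev1 e) (Q' f * f) = q f *[A] n f e"
     using A.zeval_mult[OF ev1 C0C[OF Q'C] FC[OF f]] ev_eq(1)[OF Q'C] by(simp add: q_def n_def)
   qed
   finally show ?thesis .
  qed
  ultimately show "EX q. q : F \<rightarrow> ipow A I (k - c) & (ALL e:E. b e = (\<Oplus>\<^bsub>A\<^esub>f\<in>F. q f *[A] n f e))"
   by(intro exI[of _ q]) auto
 qed
qed

section \<open>Associativity of substitution of power series\<close>

text \<open>Over the type class ring of integer polynomials, series in three variables are iterated
 univariate ones. The identities proved there are carried to arbitrary rings by evaluating
 generic coefficients.\<close>

abbreviation zring :: "'g zpoly ring" where "zring == zpolys UNIV"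

lemma carrier_zring [simp]: "car zring = UNIV"
 by(auto simp: carrier_zpoly_ring)

lemma finsum_zring: "finsum zring f K = sum f K"
proof -
 interpret cring zring by(rule zpoly_cring)
 show ?thesis by(induction K rule: infinite_finite_induct) (auto simp: finsum_infinite)
qed

definition to_fps :: "'r::comm_ring_1 ps => 'r fps fps fps" where
 "to_fps u = Abs_fps (%a. Abs_fps (%b. Abs_fps (%c. u (a, b, c))))"

lemma to_fps_nth [simp]: "fps_nth (fps_nth (fps_nth (to_fps u) a) b) c = u (a, b, c)"
 by(simp add: to_fps_def)

definition cst :: "'r::comm_ring_1 => 'r fps fps fps" where
 "cst c = fps_const (fps_const (fps_const c))"

lemma cst_mult_nth: "fps_nth (fps_nth (fps_nth (cst r * U) a) b) c = r * fps_nth (fps_nth (fps_nth U a) b) c"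
 by(simp add: cst_def)

lemma cst_mult: "cst (r * s) = cst r * cst s"
 by(simp add: cst_def)

lemma cst_add: "cst (r + s) = cst r + cst s"
 by(simp add: cst_def)

lemma cst_0: "cst 0 = 0"
 by(simp add: cst_def)

lemma cst_sum: "cst (sum f K) = (\<Sum>i\<in>K. cst (f i))"
 by(induction K rule: infinite_finite_induct) (auto simp: cst_add cst_0)

lemma fps3_mult_nth:
 "fps_nth (fps_nth (fps_nth (U * V) a) b) c =
  (\<Sum>e\<in>{..a} \<times> {..b} \<times> {..c}. case e of (i, j, k) =>
   fps_nth (fps_nth (fps_nth U i) j) k * fps_nth (fps_nth (fps_nth V (a - i)) (b - j)) (c - k))"
 by(simp add: fps_mult_nth fps_sum_nth sum.cartesian_product' atLeast0AtMost)

lemma to_fps_mult: "to_fps (ps_mult zring u v) = to_fps u * to_fps v"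
 by(intro fps_ext) (simp add: fps3_mult_nth ps_mult_def finsum_zring)

lemma to_fps_pow: "to_fps (ps_pow zring u n) = to_fps u ^ n"
proof (induction n)
 case 0
 show ?case by(intro fps_ext) (simp add: ps_monom_def fps_one_nth)
next
 case (Suc n) thus ?case by(simp add: to_fps_mult mult.commute)
qed

definition van :: "nat => 'r::comm_ring_1 fps fps fps => bool" where
 "van n U \<longleftrightarrow> (ALL a b c. a + b + c < n --> fps_nth (fps_nth (fps_nth U a) b) c = 0)"

lemma van_mult: "[|van m U; van n V|] ==> van (m + n) (U * V)"
 unfolding van_def
proof (intro allI impI)
 fix a b c assume U: "ALL a b c. a + b + c < m --> fps_nth (fps_nth (fps_nth U a) b) c = 0"
  and V: "ALL a b c. a + b + c < n --> fps_nth (fps_nth (fps_nth V a) b) c = 0" and d: "a + b + c < m + n"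
 have "fps_nth (fps_nth (fps_nth U i) j) k * fps_nth (fps_nth (fps_nth V (a - i)) (b - j)) (c - k) = 0"
  if "i <= a" "j <= b" "k <= c" for i j k
 proof (cases "i + j + k < m")
  case False
  hence "(a - i) + (b - j) + (c - k) < n" using d that by linarith
  thus ?thesis using V by simp
 qed (use U in simp)
 thus "fps_nth (fps_nth (fps_nth (U * V) a) b) c = 0"
  unfolding fps3_mult_nth by(intro sum.neutral) auto
qed

lemma van_0 [simp]: "van 0 U" and van_zero [simp]: "van n 0"
 by(simp_all add: van_def)

lemma van_mono: "[|van n U; m <= n|] ==> van m U"
 by(auto simp: van_def)

lemma van_add: "[|van n U; van n V|] ==> van n (U + V)" and van_diff: "[|van n U; van n V|] ==> van n (U - V)"
 by(simp_all add: van_def)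

lemma van_sum: "(!!i. i : K ==> van n (f i)) ==> van n (sum f K)"
 by(induction K rule: infinite_finite_induct) (auto intro: van_add)

lemma van_power: "van 1 U ==> van n (U ^ n)"
 by(induction n) (use van_mult[of 1 U] in auto)

definition cong_fps :: "nat => 'r::comm_ring_1 fps fps fps => 'r fps fps fps => bool" where
 "cong_fps N U V \<longleftrightarrow> van (Suc N) (U - V)"

lemma cong_fps_iff: "cong_fps N U V \<longleftrightarrow>
 (ALL a b c. a + b + c <= N --> fps_nth (fps_nth (fps_nth U a) b) c = fps_nth (fps_nth (fps_nth V a) b) c)"
 by(auto simp: cong_fps_def van_def less_Suc_eq_le)

lemma cong_refl [simp]: "cong_fps N U U" by(simp add: cong_fps_iff)
lemma cong_sym: "cong_fps N U V ==> cong_fps N V U" by(simp add: cong_fps_iff)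
lemma cong_trans [trans]: "[|cong_fps N U V; cong_fps N V W|] ==> cong_fps N U W" by(simp add: cong_fps_iff)

lemma cong_mult: assumes "cong_fps N U U'" "cong_fps N V V'" shows "cong_fps N (U * V) (U' * V')"
proof -
 have "U * V - U' * V' = (U - U') * V + U' * (V - V')" by(simp add: algebra_simps)
 moreover have "van (Suc N) ((U - U') * V)" using van_mult[of "Suc N" "U - U'" 0 V] assms by(simp add: cong_fps_def)
 moreover have "van (Suc N) (U' * (V - V'))" using van_mult[of 0 U' "Suc N" "V - V'"] assms by(simp add: cong_fps_def)
 ultimately show ?thesis by(simp add: cong_fps_def van_add)
qed

lemma cong_power: "cong_fps N U V ==> cong_fps N (U ^ n) (V ^ n)"
 by(induction n) (auto intro: cong_mult)

lemma cong_sum: "(!!i. i : K ==> cong_fps N (f i) (g i)) ==> cong_fps N (sum f K) (sum g K)"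
 unfolding cong_fps_def sum_subtractf[symmetric] by(rule van_sum)

abbreviation box :: "nat => (nat \<times> nat) set" where "box N == {..N} \<times> {..N}"

text \<open>The truncation bound \<open>N\<close> is fixed in advance, whereas in
  \<open>ps_subst2\<close> it depends on the coefficient. This makes the result a finite expression
  in \<open>U\<close> and \<open>V\<close> that is correct up to total degree
  \<open>N\<close>.\<close>

definition tsub :: "nat => (nat => nat => 'r::comm_ring_1) => 'r fps fps fps => 'r fps fps fps => 'r fps fps fps" where
 "tsub N F U V = (\<Sum>e\<in>box N. cst (F (fst e) (snd e)) * (U ^ fst e * V ^ snd e))"

text \<open>The coefficients of a series as one in \<open>X\<close> and \<open>Y\<close>; terms
  involving \<open>Z\<close> are dropped.\<close>

abbreviation xy :: "'r::comm_ring_1 fps fps fps => nat => nat => 'r" where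
 "xy P i j == fps_nth (fps_nth (fps_nth P i) j) 0"

context
 fixes U V :: "'r::comm_ring_1 fps fps fps"
 assumes U: "van 1 U" and V: "van 1 V"
begin

lemma van_UV: "van (i + j) (U ^ i * V ^ j)"
 by(intro van_mult van_power U V)

lemma van_term: "N < i + j ==> van (Suc N) (cst r * (U ^ i * V ^ j))"
 using van_mult[of 0 "cst r", OF van_0 van_mono[OF van_UV, of "Suc N" i j]] by simp

lemma tsub_cong_P: "cong_fps N P Q ==> cong_fps N (tsub N (xy P) U V) (tsub N (xy Q) U V)"
 unfolding tsub_def
proof (rule cong_sum)
 fix e :: "nat \<times> nat" assume PQ: "cong_fps N P Q"
 obtain i j where e: "e = (i, j)" by(cases e)
 show "cong_fps N (cst (xy P (fst e) (snd e)) * (U ^ fst e * V ^ snd e)) (cst (xy Q (fst e) (snd e)) * (U ^ fst e * V ^ snd e))"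
 proof (cases "i + j <= N")
  case True thus ?thesis using PQ by(simp add: e cong_fps_iff[of N P Q])
 next
  case False thus ?thesis unfolding cong_fps_def e by(intro van_diff van_term) auto
 qed
qed

lemma tsub_add: "tsub N (xy (P + Q)) U V = tsub N (xy P) U V + tsub N (xy Q) U V"
 by(simp add: tsub_def cst_add algebra_simps sum.distrib)

lemma tsub_sum: "tsub N (xy (sum f K)) U V = (\<Sum>i\<in>K. tsub N (xy (f i)) U V)"
proof (induction K rule: infinite_finite_induct)
 case (insert x F) thus ?case using tsub_add[of N "f x" "sum f F"] by simp
qed (simp_all add: tsub_def cst_0)

lemma tsub_scale: "tsub N (xy (cst r * P)) U V = cst r * tsub N (xy P) U V"
 by(simp add: tsub_def cst_mult_nth cst_mult sum_distrib_left mult.assoc)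

lemma tsub_one: "cong_fps N (tsub N (xy 1) U V) 1"
proof -
 have "tsub N (xy (1 :: 'r fps fps fps)) U V = (\<Sum>e\<in>box N. if e = (0, 0) then 1 else 0)"
  unfolding tsub_def by(rule sum.cong) (auto simp: cst_def fps_one_nth)
 thus ?thesis by simp
qed

text \<open>The two sides differ in pairs of exponents whose sum leaves the box, and there
  \<open>U^i V^j\<close> has order above \<open>N\<close>.\<close>

lemma tsub_mult: "cong_fps N (tsub N (xy (P * Q)) U V) (tsub N (xy P) U V * tsub N (xy Q) U V)"
proof -
 define g where "g p q = cst (xy P (fst p) (snd p) * xy Q (fst q) (snd q)) * (U ^ (fst p + fst q) * V ^ (snd p + snd q))"
  for p q
 have xyPQ: "xy (P * Q) m n = (\<Sum>p\<in>{..m} \<times> {..n}. xy P (fst p) (snd p) * xy Q (m - fst p) (n - snd p))" for m n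
  by(simp add: fps3_mult_nth sum.cartesian_product' split: prod.splits)
 have "tsub N (xy (P * Q)) U V = (\<Sum>r\<in>box N. \<Sum>p\<in>{..fst r} \<times> {..snd r}. g p (fst r - fst p, snd r - snd p))"
  unfolding tsub_def xyPQ
  by(intro sum.cong refl) (auto simp: g_def cst_sum sum_distrib_right intro!: sum.cong)
 also have "... = (\<Sum>(r, p)\<in>Sigma (box N) (%r. {..fst r} \<times> {..snd r}). g p (fst r - fst p, snd r - snd p))"
  by(rule sum.Sigma) auto
 also have "... = (\<Sum>(p, q)\<in>{(p, q). p : box N & q : box N & (fst p + fst q, snd p + snd q) : box N}. g p q)"
  by(rule sum.reindex_bij_witness[where i = "%(p, q). ((fst p + fst q, snd p + snd q), p)"
    and j = "%(r, p). (p, (fst r - fst p, snd r - snd p))"]) auto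
 also have "cong_fps N ... (\<Sum>(p, q)\<in>box N \<times> box N. g p q)"
 proof -
  have "(\<Sum>(p, q)\<in>box N \<times> box N. g p q) - (\<Sum>(p, q)\<in>{(p, q). p : box N & q : box N & (fst p + fst q, snd p + snd q) : box N}. g p q)
   = (\<Sum>(p, q)\<in>box N \<times> box N - {(p, q). p : box N & q : box N & (fst p + fst q, snd p + snd q) : box N}. g p q)"
   by(rule sum_diff[symmetric]) auto
  moreover have "van (Suc N) ..."
   by(rule van_sum) (auto simp: g_def intro!: van_term)
  ultimately have "cong_fps N (\<Sum>(p, q)\<in>box N \<times> box N. g p q) (\<Sum>(p, q)\<in>{(p, q). p : box N & q : box N & (fst p + fst q, snd p + snd q) : box N}. g p q)"
   unfolding cong_fps_def by(simp only:)
  thus ?thesis by(rule cong_sym)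
 qed
 also have "(\<Sum>(p, q)\<in>box N \<times> box N. g p q) = tsub N (xy P) U V * tsub N (xy Q) U V"
  by(simp add: tsub_def sum_product sum.cartesian_product g_def cst_mult power_add mult_ac)
 finally show ?thesis .
qed

lemma tsub_pow: "cong_fps N (tsub N (xy (P ^ n)) U V) (tsub N (xy P) U V ^ n)"
proof (induction n)
 case 0 thus ?case using tsub_one by simp
next
 case (Suc n)
 thus ?case using cong_trans[OF tsub_mult cong_mult[OF cong_refl Suc]] by simp
qed

lemma tsub_assoc:
 "cong_fps N (tsub N (xy (tsub N F P Q)) U V) (tsub N F (tsub N (xy P) U V) (tsub N (xy Q) U V))"
 unfolding tsub_def[of N F] tsub_sum tsub_scale
 by(intro cong_sum cong_mult cong_refl cong_trans[OF tsub_mult] tsub_pow)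

end

lemma tsub_cong:
 assumes "cong_fps N U U'" "cong_fps N V V'" shows "cong_fps N (tsub N F U V) (tsub N F U' V')"
 unfolding tsub_def by(intro cong_sum cong_mult cong_refl cong_power assms)

text \<open>In total degree \<open>d \<le> N\<close> the bounds \<open>d\<close> and
  \<open>N\<close> give the same sum, because \<open>U^i V^j\<close> has order at least
  \<open>i + j\<close>.\<close>

lemma to_fps_subst2:
 assumes u: "u (0, 0, 0) = 0" and v: "v (0, 0, 0) = 0"
 shows "cong_fps N (to_fps (sub2 zring F u v)) (tsub N F (to_fps u) (to_fps v))"
 unfolding cong_fps_iff
proof (intro allI impI)
 fix a b c assume d: "a + b + c <= N"
 let ?U = "to_fps u" and ?V = "to_fps v"
 have UV: "van 1 ?U" "van 1 ?V" using u v by(simp_all add: van_def)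
 have "sub2 zring F u v (a, b, c) =
   (\<Sum>e\<in>box (a + b + c). F (fst e) (snd e) * fps_nth (fps_nth (fps_nth (?U ^ fst e * ?V ^ snd e) a) b) c)"
  unfolding ps_subst2_def by(auto simp: finsum_zring to_fps_pow[symmetric] to_fps_mult[symmetric] intro!: sum.cong)
 also have "... = (\<Sum>e\<in>box N. F (fst e) (snd e) * fps_nth (fps_nth (fps_nth (?U ^ fst e * ?V ^ snd e) a) b) c)"
 proof (rule sum.mono_neutral_left)
  show "ALL e:box N - box (a + b + c). F (fst e) (snd e) * fps_nth (fps_nth (fps_nth (?U ^ fst e * ?V ^ snd e) a) b) c = 0"
  proof
   fix e assume e: "e : box N - box (a + b + c)"
   hence "a + b + c < fst e + snd e" by(cases e) auto
   thus "F (fst e) (snd e) * fps_nth (fps_nth (fps_nth (?U ^ fst e * ?V ^ snd e) a) b) c = 0"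
    using van_UV[OF UV, unfolded van_def, rule_format, of a b c "fst e" "snd e"] by simp
  qed
 qed (use d in auto)
 also have "... = fps_nth (fps_nth (fps_nth (tsub N F ?U ?V) a) b) c"
  by(simp add: tsub_def fps_sum_nth cst_mult_nth)
 finally show "fps_nth (fps_nth (fps_nth (to_fps (sub2 zring F u v)) a) b) c =
  fps_nth (fps_nth (fps_nth (tsub N F ?U ?V) a) b) c" by simp
qed

lemma zring_subst2_assoc:
 assumes z: "u (0, 0, 0) = 0" "v (0, 0, 0) = 0" "p (0, 0, 0) = 0" "q (0, 0, 0) = 0"
 shows "sub2 zring (%i j. sub2 zring F p q (i, j, 0)) u v =
  sub2 zring F (sub2 zring (%i j. p (i, j, 0)) u v) (sub2 zring (%i j. q (i, j, 0)) u v)"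
proof
 fix d :: "nat \<times> nat \<times> nat"
 obtain a b c where d: "d = (a, b, c)" by(cases d)
 define N where "N = a + b + c"
 let ?U = "to_fps u" and ?V = "to_fps v" and ?P = "to_fps p" and ?Q = "to_fps q"
 have UV: "van 1 ?U" "van 1 ?V" "van 1 ?P" "van 1 ?Q" using z by(simp_all add: van_def)
 have s: "(%i j. r (i, j, 0)) = xy (to_fps r)" for r :: "'g zpoly ps" by simp
 have z0: "sub2 zring (%i j. r (i, j, 0)) u v (0, 0, 0) = 0" if "r (0, 0, 0) = 0" for r
  using that by(simp add: ps_subst2_def finsum_zring)
 let ?L = "sub2 zring (%i j. sub2 zring F p q (i, j, 0)) u v"
 let ?R = "sub2 zring F (sub2 zring (%i j. p (i, j, 0)) u v) (sub2 zring (%i j. q (i, j, 0)) u v)"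
 have "cong_fps N (to_fps ?L) (tsub N (xy (to_fps (sub2 zring F p q))) ?U ?V)"
  unfolding s by(rule to_fps_subst2) (use z in auto)
 also have "cong_fps N ... (tsub N (xy (tsub N F ?P ?Q)) ?U ?V)"
  by(rule tsub_cong_P[OF UV(1,2)]) (rule to_fps_subst2[of p q N F], use z in auto)
 also have "cong_fps N ... (tsub N F (tsub N (xy ?P) ?U ?V) (tsub N (xy ?Q) ?U ?V))"
  by(rule tsub_assoc[OF UV(1,2)])
 also have "cong_fps N ... (tsub N F (to_fps (sub2 zring (%i j. p (i, j, 0)) u v)) (to_fps (sub2 zring (%i j. q (i, j, 0)) u v)))"
  unfolding s by(intro tsub_cong cong_sym[OF to_fps_subst2]) (use z in auto)
 also have "cong_fps N ... (to_fps ?R)"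
  by(rule cong_sym[OF to_fps_subst2]) (use z z0 in auto)
 finally have "cong_fps N (to_fps ?L) (to_fps ?R)" .
 from this[unfolded cong_fps_iff, rule_format, of a b c] show "?L d = ?R d"
  unfolding d N_def to_fps_nth by simp
qed

section \<open>Substitution over arbitrary commutative rings\<close>

definition ps0 :: "('r, 'm) ring_scheme => 'r ps => bool" where
 "ps0 R u \<longleftrightarrow> (ALL d. u d : car R) & u (0, 0, 0) = 0[R]"

lemma ps0D: "ps0 R u ==> u d : car R" "ps0 R u ==> u (0, 0, 0) = 0[R]"
 by(simp_all only: ps0_def)

text \<open>The series \<open>p(u, v)\<close> for a series \<open>p\<close> in \<open>X\<close> and
  \<open>Y\<close>: substitution into a series rather than into a coefficient family.\<close>

abbreviation psub :: "('r, 'm) ring_scheme => 'r ps => 'r ps => 'r ps => 'r ps" where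
 "psub R u v p == sub2 R (%i j. p (i, j, 0)) u v"

context cring
begin

text \<open>Each coefficient of either side is an integer polynomial in the coefficients of the five
  series, so the identity specializes from generic coefficients.\<close>

lemma psub_subst2:
 assumes F: "!!i j. F i j : car R" and "ps0 R p" "ps0 R q" "ps0 R u" "ps0 R v"
 shows "psub R u v (sub2 R F p q) = sub2 R F (psub R u v p) (psub R u v q)"
proof -
 \<comment> \<open>One assignment of variables holds all coefficients: index \<open>0\<close> stands
   for \<open>F\<close>, and \<open>1\<close> to \<open>4\<close> for \<open>p\<close>,
   \<open>q\<close>, \<open>u\<close>, \<open>v\<close>. The generic series \<open>gv\<close> have
   constant term \<open>0\<close> instead of a variable, since substitution needs it to
   vanish.\<close>
 define f :: "nat \<times> nat \<times> nat \<times> nat => 'a" where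
  "f = (%(n, d). if n = 0 then F (fst d) (fst (snd d)) else if n = 1 then p d else
   if n = 2 then q d else if n = 3 then u d else v d)"
 have f: "f ` UNIV <= car R" using assms by(auto simp: f_def ps0_def)
 define gv where "gv n d = (if d = (0, 0, 0) then 0 else zvar (n, d))" for n :: nat and d :: "nat \<times> nat \<times> nat"
 define FF where "FF i j = zvar (0 :: nat, (i :: nat, j :: nat, 0 :: nat))" for i j
 let ?h = "zeval R f"
 interpret h: ring_hom_cring zring R ?h
  by(rule rh_cringI[OF zpoly_cring cring_axioms zeval_hom[OF f]])
 have hF: "(%i j. ?h (FF i j)) = F" by(intro ext) (use F in "simp add: FF_def zeval_zvar f_def")
 have hg: "?h (gv n d) = (if d = (0, 0, 0) then \<zero> else f (n, d))" for n d
  using zeval_zvar[of f "(n, d)"] subsetD[OF f rangeI] by(auto simp: gv_def)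
 have fv: "f (1, d) = p d" "f (2, d) = q d" "f (3, d) = u d" "f (4, d) = v d" for d
  by(simp_all add: f_def)
 have hp: "(%d. ?h (gv 1 d)) = p" "(%d. ?h (gv 2 d)) = q" "(%d. ?h (gv 3 d)) = u" "(%d. ?h (gv 4 d)) = v"
  unfolding hg fv using assms by(auto simp: ps0_def)
 have hps: "?h (gv 1 d) = p d" "?h (gv 2 d) = q d" for d using hp by metis+
 have S: "(%d. ?h (sub2 zring G x y d)) = sub2 R (%i j. ?h (G i j)) (%d. ?h (x d)) (%d. ?h (y d))" for G x y
  by(rule h.hom_ps_subst2) auto
 have Sd: "?h (sub2 zring G x y d) = sub2 R (%i j. ?h (G i j)) (%d. ?h (x d)) (%d. ?h (y d)) d" for G x y d
  using S by metis
 have "(%d. ?h (psub zring (gv 3) (gv 4) (sub2 zring FF (gv 1) (gv 2)) d)) =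
  (%d. ?h (sub2 zring FF (psub zring (gv 3) (gv 4) (gv 1)) (psub zring (gv 3) (gv 4) (gv 2)) d))"
  by(subst zring_subst2_assoc) (simp_all add: gv_def)
 thus ?thesis unfolding S Sd hF hp hps .
qed

lemma ps_monom_mult:
 assumes v: "!!d. v d : car R"
 shows "ps_mult R (ps_monom R (i, j, k)) v (a, b, c) =
  (if i <= a & j <= b & k <= c then v (a - i, b - j, c - k) else \<zero>)"
proof -
 have "ps_mult R (ps_monom R (i, j, k)) v (a, b, c) =
   (\<Oplus>e\<in>{..a} \<times> {..b} \<times> {..c}. if (i, j, k) = e then v (a - i, b - j, c - k) else \<zero>)"
  unfolding ps_mult_def prod.case by(rule finsum_cong') (use v in "auto simp: ps_monom_def split: if_splits")
 also have "... = (if i <= a & j <= b & k <= c then v (a - i, b - j, c - k) else \<zero>)"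
 proof (cases "i <= a & j <= b & k <= c")
  case True
  thus ?thesis
   using finsum_singleton[of "(i, j, k)" "{..a} \<times> {..b} \<times> {..c}" "%_. v (a - i, b - j, c - k)"] v by simp
 next
  case False
  thus ?thesis by(subst add.finprod_one_eqI) auto
 qed
 finally show ?thesis .
qed

lemma ps_one_mult:
 assumes "!!d. v d : car R" shows "ps_mult R (ps_monom R (0, 0, 0)) v = v"
proof
 fix d :: "nat \<times> nat \<times> nat"
 show "ps_mult R (ps_monom R (0, 0, 0)) v d = v d"
  by(cases d) (simp add: ps_monom_mult[OF assms])
qed

lemma ps_monom_mult_monom: "ps_mult R (ps_monom R (i, j, k)) (ps_monom R (i', j', k')) = ps_monom R (i + i', j + j', k + k')"
 by(rule ext) (auto simp: ps_monom_mult, auto simp: ps_monom_def)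

lemma ps_mult_comm:
 assumes "!!d. u d : car R" "!!d. v d : car R"
 shows "ps_mult R u v = ps_mult R v u"
proof
 fix d :: "nat \<times> nat \<times> nat"
 obtain a b c where d: "d = (a, b, c)" by(cases d)
 let ?K = "{..a} \<times> {..b} \<times> {..c}" and ?r = "%(i, j, k). (a - i, b - j, c - k)"
 have r2: "inj_on ?r ?K" by(auto simp: inj_on_def)
 have r: "?r ` ?K = ?K" "inj_on ?r ?K"
  by(rule endo_inj_surj[OF _ _ r2]) (auto simp: r2)
 have "ps_mult R u v (a, b, c) = (\<Oplus>e\<in>?r ` ?K. (case e of (i, j, k) => u (i, j, k) \<otimes> v (a - i, b - j, c - k)))"
  unfolding r(1) by(simp add: ps_mult_def)
 also have "... = (\<Oplus>e\<in>?K. (case ?r e of (i, j, k) => u (i, j, k) \<otimes> v (a - i, b - j, c - k)))"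
  by(rule finsum_reindex[OF _ r(2)]) (use assms in auto)
 also have "... = ps_mult R v u (a, b, c)"
  unfolding ps_mult_def prod.case by(rule finsum_cong') (use assms in "auto simp: m_comm")
 finally show "ps_mult R u v d = ps_mult R v u d" by(simp add: d)
qed

lemma ps_mult_one: "(!!d. v d : car R) ==> ps_mult R v (ps_monom R (0, 0, 0)) = v"
 using ps_mult_comm[of v "ps_monom R (0, 0, 0)"] by(simp add: ps_one_mult)

lemma ps_pow_monom: "ps_pow R (ps_monom R (i, j, k)) n = ps_monom R (n * i, n * j, n * k)"
 by(induction n) (simp_all add: ps_monom_mult_monom algebra_simps)

definition ps_ord :: "nat => 'a ps => bool" where
 "ps_ord n u \<longleftrightarrow> (ALL a b c. a + b + c < n --> u (a, b, c) = \<zero>)"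

lemma ps_ordD: "[|ps_ord n u; a + b + c < n|] ==> u (a, b, c) = \<zero>"
 by(simp add: ps_ord_def)

lemma ps_ord_mult:
 assumes "!!d. u d : car R" "!!d. v d : car R" "ps_ord m u" "ps_ord n v"
 shows "ps_ord (m + n) (ps_mult R u v)"
 unfolding ps_ord_def
proof (intro allI impI)
 fix a b c assume d: "a + b + c < m + n"
 show "ps_mult R u v (a, b, c) = \<zero>"
  unfolding ps_mult_def prod.case
 proof (rule add.finprod_one_eqI)
  fix e assume "e : {..a} \<times> {..b} \<times> {..c}"
  then obtain i j k where e: "e = (i, j, k)" "i <= a" "j <= b" "k <= c" by auto
  show "(case e of (i, j, k) => u (i, j, k) \<otimes> v (a - i, b - j, c - k)) = \<zero>"
  proof (cases "i + j + k < m")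
   case True thus ?thesis using ps_ordD[OF assms(3)] assms(2) by(simp add: e)
  next
   case False
   hence "(a - i) + (b - j) + (c - k) < n" using d e by linarith
   thus ?thesis using ps_ordD[OF assms(4)] assms(1) by(simp add: e)
  qed
 qed
qed

lemma ps_ord_pow:
 assumes "!!d. u d : car R" "ps_ord m u" shows "ps_ord (n * m) (ps_pow R u n)"
proof (induction n)
 case (Suc n)
 thus ?case using ps_ord_mult[OF ps_pow_closed assms(1) Suc assms(2)] assms(1) by(simp add: add.commute)
qed (simp add: ps_ord_def)

lemma ps0_ord: "ps0 R u ==> ps_ord 1 u"
 by(simp add: ps_ord_def ps0_def)

lemma ps0_X [simp]: "ps0 R (ps_X R)" "ps0 R (ps_Y R)" "ps0 R (ps_zero R)"
 by(auto simp: ps0_def ps_monom_closed[of _ _] ps_monom_def ps_zero_def)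

lemma ps0_subst1: "[|!!i. f i : car R; f 0 = \<zero>; ps0 R u|] ==> ps0 R (sub1 R f u)"
 unfolding ps0_def by(intro conjI allI ps_subst1_closed) (auto simp: ps_subst1_def)

lemma ps0_subst2: "[|!!i j. F i j : car R; F 0 0 = \<zero>; ps0 R u; ps0 R v|] ==> ps0 R (sub2 R F u v)"
 unfolding ps0_def
 by(intro conjI allI ps_subst2_closed)
  (auto simp: ps_subst2_def intro!: add.finprod_one_eqI l_null ps_mult_closed ps_pow_closed)

text \<open>Composition in one variable is the case of two variables with nothing depending on the
  second; this carries associativity over from \<open>psub_subst2\<close>.\<close>

lemma subst1_as_subst2:
 assumes "!!i. f i : car R" "!!d. u d : car R" "!!d. v d : car R"
 shows "sub1 R f u = sub2 R (%i j. if j = 0 then f i else \<zero>) u v"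
proof
 fix d :: "nat \<times> nat \<times> nat"
 obtain a b c where d: "d = (a, b, c)" by(cases d)
 let ?N = "{..a + b + c}"
 let ?t = "%e. case e of (i, j) => (if j = 0 then f i else \<zero>) \<otimes> ps_mult R (ps_pow R u i) (ps_pow R v j) (a, b, c)"
 note pc = ps_pow_closed[of u, OF assms(2)]
 have psc: "ps_mult R (ps_pow R u i) (ps_pow R v j) e : car R" for i j e
  by(intro ps_mult_closed ps_pow_closed assms)
 have one: "ps_mult R (ps_pow R u i) (ps_pow R v 0) = ps_pow R u i" for i
  by(simp add: ps_mult_one[OF pc])
 have "sub1 R f u (a, b, c) = (\<Oplus>i\<in>?N. ?t (i, 0))"
  unfolding ps_subst1_def prod.case one by simp
 also have "... = (\<Oplus>e\<in>(%i. (i, 0)) ` ?N. ?t e)"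
  by(rule finsum_reindex[symmetric]) (use pc assms one in "auto simp: inj_on_def simp del: ps_pow.simps")
 also have "... = (\<Oplus>e\<in>?N \<times> ?N. ?t e)"
 proof (rule add.finprod_mono_neutral_cong_left)
  fix e assume "e : ?N \<times> ?N - (%i. (i, 0)) ` ?N"
  then obtain i j where "e = (i, j)" "j ~= 0" by(cases e) auto
  moreover have "ps_mult R (ps_pow R u i) (ps_pow R v j) (a, b, c) : car R"
   by(intro ps_mult_closed ps_pow_closed assms)
  ultimately show "?t e = \<zero>" by simp
 qed (use psc assms in "auto simp del: ps_pow.simps")
 finally show "sub1 R f u d = sub2 R (%i j. if j = 0 then f i else \<zero>) u v d"
  by(simp add: d ps_subst2_def)
qed

end

declare One_nat_def [simp del]

lemma ps_monom_nth: "ps_monom R e d = (if d = e then 1[R] else 0[R])"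
 by(simp add: ps_monom_def)

context cring
begin

text \<open>If \<open>(m, n)\<close> lies outside the truncation box, all terms of the sum are zero,
  but then the product of powers has order at least \<open>m + n\<close> and vanishes in that degree
  too.\<close>

lemma subst2_coeff:
 assumes "ps0 R u" "ps0 R v"
 shows "sub2 R (%i j. if i = m & j = n then \<one> else \<zero>) u v = ps_mult R (ps_pow R u m) (ps_pow R v n)"
proof
 fix d :: "nat \<times> nat \<times> nat"
 obtain a b c where d: "d = (a, b, c)" by(cases d)
 let ?K = "{..a + b + c} \<times> {..a + b + c}"
 note uc = ps0D(1)[OF assms(1)] and vc = ps0D(1)[OF assms(2)]
 have psc: "ps_mult R (ps_pow R u i) (ps_pow R v j) e : car R" for i j e
  by(intro ps_mult_closed ps_pow_closed uc vc)
 have "sub2 R (%i j. if i = m & j = n then \<one> else \<zero>) u v (a, b, c) =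
  (\<Oplus>e\<in>?K. if (m, n) = e then ps_mult R (ps_pow R u m) (ps_pow R v n) (a, b, c) else \<zero>)"
  unfolding ps_subst2_def prod.case by(rule finsum_cong') (use psc in "auto split: if_splits")
 also have "... = ps_mult R (ps_pow R u m) (ps_pow R v n) (a, b, c)"
 proof (cases "(m, n) : ?K")
  case True
  thus ?thesis
   using finsum_singleton[of "(m, n)" ?K "%_. ps_mult R (ps_pow R u m) (ps_pow R v n) (a, b, c)"] psc by simp
 next
  case False
  have "ps_ord (m * 1 + n * 1) (ps_mult R (ps_pow R u m) (ps_pow R v n))"
   by(intro ps_ord_mult ps_ord_pow ps_pow_closed uc vc ps0_ord assms)
  hence "ps_mult R (ps_pow R u m) (ps_pow R v n) (a, b, c) = \<zero>" using False by(auto simp: ps_ord_def)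
  moreover have "(\<Oplus>e\<in>?K. if (m, n) = e then ps_mult R (ps_pow R u m) (ps_pow R v n) (a, b, c) else \<zero>) = \<zero>"
   by(rule add.finprod_one_eqI) (use False in auto)
  ultimately show ?thesis by simp
 qed
 finally show "sub2 R (%i j. if i = m & j = n then \<one> else \<zero>) u v d = ps_mult R (ps_pow R u m) (ps_pow R v n) d"
  by(simp add: d)
qed

lemma ps_pow_1: "(!!d. u d : car R) ==> ps_pow R u 1 = u"
 by(simp add: One_nat_def ps_one_mult)

lemma psub_X: assumes "ps0 R u" "ps0 R v"
 shows "psub R u v (ps_X R) = u" "psub R u v (ps_Y R) = v" "psub R u v (ps_zero R) = ps_zero R"
proof -
 note uc = ps0D(1)[OF assms(1)] and vc = ps0D(1)[OF assms(2)]
 have "(%i j. ps_X R (i, j, 0)) = (%i j. if i = 1 & j = 0 then \<one> else \<zero>)"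
  "(%i j. ps_Y R (i, j, 0)) = (%i j. if i = 0 & j = 1 then \<one> else \<zero>)"
  by(auto simp: ps_monom_def fun_eq_iff)
 thus "psub R u v (ps_X R) = u" "psub R u v (ps_Y R) = v"
  using subst2_coeff[OF assms, of 1 0] subst2_coeff[OF assms, of 0 1]
  by(simp_all add: ps_one_mult ps_mult_one ps_pow_1 uc vc)
 show "psub R u v (ps_zero R) = ps_zero R"
 proof
  fix d :: "nat \<times> nat \<times> nat"
  show "psub R u v (ps_zero R) d = ps_zero R d"
   by(cases d) (auto simp: ps_subst2_def ps_zero_def
     intro!: add.finprod_one_eqI l_null ps_mult_closed ps_pow_closed uc vc)
 qed
qed

lemma psub_subst1:
 assumes "!!i. f i : car R" "ps0 R p" "ps0 R u" "ps0 R v"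
 shows "psub R u v (sub1 R f p) = sub1 R f (psub R u v p)"
proof -
 have pc: "p d : car R" for d using ps0D(1)[OF assms(2)] .
 have qc: "psub R u v p d : car R" for d
  by(intro ps_subst2_closed) (use assms in "auto simp: ps0_def")
 show ?thesis
  unfolding subst1_as_subst2[of f p p, OF assms(1) pc pc] subst1_as_subst2[of f "psub R u v p" "psub R u v p", OF assms(1) qc qc]
  by(rule psub_subst2) (use assms in auto)
qed

lemma subst1_X:
 assumes "!!i. f i : car R"
 shows "sub1 R f (ps_X R) (a, b, c) = (if b = 0 & c = 0 then f a else \<zero>)"
  and "sub1 R f (ps_Y R) (a, b, c) = (if a = 0 & c = 0 then f b else \<zero>)"
proof -
 have sing: "(\<Oplus>i\<in>{..a + b + c}. if n = i then f n else \<zero>) = f n" if "n <= a + b + c" for n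
  using finsum_singleton[of n "{..a + b + c}" "%_. f n"] that assms by simp
 have "sub1 R f (ps_X R) (a, b, c) = (\<Oplus>i\<in>{..a + b + c}. if a = i then (if b = 0 & c = 0 then f a else \<zero>) else \<zero>)"
  unfolding ps_subst1_def prod.case
  by(rule finsum_cong') (use assms in "auto simp: ps_pow_monom, auto simp: ps_monom_def")
 thus "sub1 R f (ps_X R) (a, b, c) = (if b = 0 & c = 0 then f a else \<zero>)"
  using sing[of a] by(cases "b = 0 & c = 0") (auto simp: add.finprod_one_eqI)
 have "sub1 R f (ps_Y R) (a, b, c) = (\<Oplus>i\<in>{..a + b + c}. if b = i then (if a = 0 & c = 0 then f b else \<zero>) else \<zero>)"
  unfolding ps_subst1_def prod.case
  by(rule finsum_cong') (use assms in "auto simp: ps_pow_monom, auto simp: ps_monom_def")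
 thus "sub1 R f (ps_Y R) (a, b, c) = (if a = 0 & c = 0 then f b else \<zero>)"
  using sing[of b] by(cases "a = 0 & c = 0") (auto simp: add.finprod_one_eqI)
qed

definition xonly :: "'a ps => bool" where
 "xonly u \<longleftrightarrow> (ALL a b c. b ~= 0 | c ~= 0 --> u (a, b, c) = \<zero>)"

lemma xonly_mult:
 assumes c: "!!d. u d : car R" "!!d. v d : car R" and "xonly u" "xonly v"
 shows "xonly (ps_mult R u v)"
 unfolding xonly_def
proof (intro allI impI)
 fix a b c assume "b ~= (0::nat) | c ~= (0::nat)"
 thus "ps_mult R u v (a, b, c) = \<zero>"
  unfolding ps_mult_def prod.case
  by(intro add.finprod_one_eqI) (use assms in "auto simp: xonly_def, (metis c l_null r_null diff_zero neq0_conv)+")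
qed

lemma xonly_pow: "[|!!d. u d : car R; xonly u|] ==> xonly (ps_pow R u n)"
 by(induction n) (auto simp: xonly_mult ps_pow_closed, auto simp: xonly_def ps_monom_def)

lemma xonly_subst1: "[|!!i. f i : car R; !!d. u d : car R; xonly u|] ==> xonly (sub1 R f u)"
 using xonly_pow[of u] by(auto simp: xonly_def ps_subst1_def intro!: add.finprod_one_eqI)

lemma xonly_X: "xonly (ps_X R)"
 by(auto simp: xonly_def ps_monom_def)

text \<open>Lets a series in \<open>X\<close> alone be traded for its coefficient sequence, which is
  the form of \<open>series_comp\<close>.\<close>

lemma xonly_eq:
 assumes "!!d. u d : car R" "xonly u" shows "sub1 R (%i. u (i, 0, 0)) (ps_X R) = u"
proof
 fix d :: "nat \<times> nat \<times> nat"
 show "sub1 R (%i. u (i, 0, 0)) (ps_X R) d = u d"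
  using assms by(cases d) (auto simp: subst1_X xonly_def)
qed

lemma subst1_X_inj:
 assumes "!!i. f i : car R" "!!i. g i : car R" "sub1 R f (ps_X R) = sub1 R g (ps_X R)"
 shows "f = g"
proof
 fix i show "f i = g i" using fun_cong[OF assms(3), of "(i, 0, 0)"] by(simp add: subst1_X assms(1,2))
qed

lemma series_comp_closed: "[|!!i. f i : car R; !!i. g i : car R|] ==> series_comp R f g i : car R"
 unfolding series_comp_def by(intro ps_subst1_closed) auto

lemma subst1_comp_X:
 assumes "!!i. f i : car R" "!!i. g i : car R"
 shows "sub1 R (series_comp R f g) (ps_X R) = sub1 R f (sub1 R g (ps_X R))"
 unfolding series_comp_def
 by(rule xonly_eq) (use assms in "auto intro!: ps_subst1_closed xonly_subst1 xonly_X")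

text \<open>The identity at \<open>X\<close> becomes the one at \<open>u\<close> by substituting
  \<open>(u, 0)\<close> for \<open>(X, Y)\<close>.\<close>

lemma subst1_comp:
 assumes "!!i. f i : car R" "!!i. g i : car R" "g 0 = \<zero>" "ps0 R u"
 shows "sub1 R (series_comp R f g) u = sub1 R f (sub1 R g u)"
proof -
 have z: "ps0 R (ps_zero R)" by simp
 have gX: "ps0 R (sub1 R g (ps_X R))" by(rule ps0_subst1) (use assms in auto)
 have "sub1 R (series_comp R f g) u = psub R u (ps_zero R) (sub1 R (series_comp R f g) (ps_X R))"
  by(subst psub_subst1) (use assms series_comp_closed in "auto simp: psub_X")
 also have "... = sub1 R f (psub R u (ps_zero R) (sub1 R g (ps_X R)))"
  unfolding subst1_comp_X[of f g, OF assms(1,2)] by(rule psub_subst1) (use assms gX in auto)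
 also have "... = sub1 R f (sub1 R g u)"
  by(subst psub_subst1) (use assms in "auto simp: psub_X")
 finally show ?thesis .
qed

lemma subst1_id:
 assumes "ps0 R u" shows "sub1 R (%i. if i = 1 then \<one> else \<zero>) u = u"
proof -
 have uc: "u d : car R" for d using ps0D(1)[OF assms] .
 have "sub1 R (%i. if i = 1 then \<one> else \<zero>) u = psub R u u (ps_X R)"
  by(subst subst1_as_subst2[of _ u u]) (auto simp: uc ps_monom_def intro!: arg_cong[where f = "%F. sub2 R F u u"])
 thus ?thesis using psub_X[OF assms assms] by simp
qed

text \<open>Substitution respects equality up to a total degree. Later this lets an element of the
  completion be replaced by an element of \<open>A\<close> acting in the same way in low
  degrees.\<close>

definition agree :: "nat => 'a ps => 'a ps => bool" where
 "agree N u v \<longleftrightarrow> (ALL a b c. a + b + c <= N --> u (a, b, c) = v (a, b, c))"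

lemma agree_refl [simp]: "agree N u u" by(simp add: agree_def)

lemma agree_mult:
 assumes "!!d. u d : car R" "!!d. v d : car R" "agree N u u'" "agree N v v'"
 shows "agree N (ps_mult R u v) (ps_mult R u' v')"
 unfolding agree_def
proof (intro allI impI)
 fix a b c assume d: "a + b + c <= N"
 have e: "u (i, j, k) = u' (i, j, k)" "v (a - i, b - j, c - k) = v' (a - i, b - j, c - k)"
  if "i <= a" "j <= b" "k <= c" for i j k
  using assms(3,4) d that by(auto simp: agree_def)
 have cl: "u' (i, j, k) : car R" "v' (a - i, b - j, c - k) : car R" if "i <= a" "j <= b" "k <= c" for i j k
  using e[OF that] assms(1,2) by metis+
 show "ps_mult R u v (a, b, c) = ps_mult R u' v' (a, b, c)"
  unfolding ps_mult_def prod.case by(rule finsum_cong') (use e cl in auto)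
qed

lemma agree_pow:
 assumes "!!d. u d : car R" "agree N u u'" shows "agree N (ps_pow R u n) (ps_pow R u' n)"
 by(induction n) (simp_all add: agree_mult[OF ps_pow_closed[OF assms(1)] assms(1) _ assms(2)])

lemma agree_subst1:
 assumes "!!i. f i : car R" "!!d. u d : car R" "!!i. i <= N ==> f i = f' i" "agree N u u'"
 shows "agree N (sub1 R f u) (sub1 R f' u')"
 unfolding agree_def
proof (intro allI impI)
 fix a b c assume d: "a + b + c <= N"
 have p: "ps_pow R u i (a, b, c) = ps_pow R u' i (a, b, c)" for i
  using agree_pow[OF assms(2,4)] d by(simp add: agree_def)
 have pc: "ps_pow R u i (a, b, c) : car R" for i by(rule ps_pow_closed[OF assms(2)])
 show "sub1 R f u (a, b, c) = sub1 R f' u' (a, b, c)"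
  unfolding ps_subst1_def prod.case p[symmetric]
  by(rule finsum_cong') (use d assms(1) pc assms(3)[symmetric] in auto)
qed

lemma agree_subst2:
 assumes "!!i j. F i j : car R" "!!d. u d : car R" "!!d. v d : car R" "agree N u u'" "agree N v v'"
 shows "agree N (sub2 R F u v) (sub2 R F u' v')"
 unfolding agree_def
proof (intro allI impI)
 fix a b c assume d: "a + b + c <= N"
 have p: "ps_mult R (ps_pow R u i) (ps_pow R v j) (a, b, c) = ps_mult R (ps_pow R u' i) (ps_pow R v' j) (a, b, c)" for i j
  using agree_mult[OF ps_pow_closed[OF assms(2)] ps_pow_closed[OF assms(3)] agree_pow[OF assms(2,4)] agree_pow[OF assms(3,5)], of i j] d
  by(simp add: agree_def)
 show "sub2 R F u v (a, b, c) = sub2 R F u' v' (a, b, c)"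
  unfolding ps_subst2_def prod.case p ..
qed

lemma agreeD: "agree N u v ==> a + b + c <= N ==> u (a, b, c) = v (a, b, c)"
 by(simp add: agree_def)

lemma agree_trans: "[|agree N u v; agree N v w|] ==> agree N u w" by(simp add: agree_def)
lemma agree_sym: "agree N u v ==> agree N v u" by(simp add: agree_def)

text \<open>Compositional inverses, by solving a unitriangular system.\<close>

primrec tri :: "(nat => nat => 'a) => (nat => 'a) => nat => nat => 'a" where
 "tri M r 0 = (%_. \<zero>)"
| "tri M r (Suc n) = (tri M r n)(n := r n \<ominus> (\<Oplus>i\<in>{..<n}. tri M r n i \<otimes> M n i))"

definition tsol :: "(nat => nat => 'a) => (nat => 'a) => nat => 'a" where
 "tsol M r n = tri M r (Suc n) n"

lemma tsol:
 assumes M: "!!n i. M n i : car R" and r: "!!n. r n : car R"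
 shows "tsol M r n : car R" "tsol M r n = r n \<ominus> (\<Oplus>i\<in>{..<n}. tsol M r i \<otimes> M n i)"
  "M n n = \<one> ==> (\<Oplus>i\<in>{..n}. tsol M r i \<otimes> M n i) = r n"
proof -
 have cl: "tri M r n i : car R" for n i
  by(induction n arbitrary: i) (use M r in auto)
 have st: "tri M r m i = tri M r (Suc i) i" if "i < m" for m i
  using that by(induction m) (auto simp: less_Suc_eq)
 have gc: "tsol M r n : car R" for n unfolding tsol_def by(rule cl)
 have g: "tsol M r n = r n \<ominus> (\<Oplus>i\<in>{..<n}. tsol M r i \<otimes> M n i)" for n
 proof -
  have "(\<Oplus>i\<in>{..<n}. tri M r n i \<otimes> M n i) = (\<Oplus>i\<in>{..<n}. tsol M r i \<otimes> M n i)"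
  proof (rule finsum_cong'[OF refl])
   show "(%i. tsol M r i \<otimes> M n i) : {..<n} \<rightarrow> car R" using gc M by auto
   show "tri M r n i \<otimes> M n i = tsol M r i \<otimes> M n i" if "i : {..<n}" for i
    using st[of i n] that by(simp only: tsol_def lessThan_iff)
  qed
  thus ?thesis by(simp add: tsol_def)
 qed
 show "tsol M r n : car R" "tsol M r n = r n \<ominus> (\<Oplus>i\<in>{..<n}. tsol M r i \<otimes> M n i)" by(rule gc, rule g)
 assume M1: "M n n = \<one>"
 have s: "(\<Oplus>i\<in>{..<n}. tsol M r i \<otimes> M n i) : car R" using gc M by auto
 have "(\<Oplus>i\<in>{..n}. tsol M r i \<otimes> M n i) = tsol M r n \<otimes> M n n \<oplus> (\<Oplus>i\<in>{..<n}. tsol M r i \<otimes> M n i)"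
  unfolding lessThan_Suc_atMost[symmetric] lessThan_Suc using gc M by(subst finsum_insert) auto
 also have "... = tsol M r n \<oplus> (\<Oplus>i\<in>{..<n}. tsol M r i \<otimes> M n i)" using gc M1 by simp
 also have "... = r n"
  using arg_cong[OF g[of n], of "%x. x \<oplus> (\<Oplus>i\<in>{..<n}. tsol M r i \<otimes> M n i)"] s r
  by(simp only: a_minus_def a_assoc a_inv_closed l_neg r_zero)
 finally show "(\<Oplus>i\<in>{..n}. tsol M r i \<otimes> M n i) = r n" .
qed

lemma tri_unique:
 assumes M: "!!n i. M n i : car R" "!!n. M n n = \<one>" and g: "!!n. g n : car R" "!!n. g' n : car R"
  and eq: "!!n :: nat. (\<Oplus>i\<in>{..n}. g i \<otimes> M n i) = (\<Oplus>i\<in>{..n}. g' i \<otimes> M n i)"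
 shows "g n = g' n"
proof (induction n rule: less_induct)
 case (less n)
 have s: "(\<Oplus>i\<in>{..n}. h i \<otimes> M n i) = h n \<oplus> (\<Oplus>i\<in>{..<n}. h i \<otimes> M n i)" if "!!n. h n : car R" for h
  unfolding lessThan_Suc_atMost[symmetric] lessThan_Suc using that M by(subst finsum_insert) auto
 have e: "(\<Oplus>i\<in>{..<n}. g i \<otimes> M n i) = (\<Oplus>i\<in>{..<n}. g' i \<otimes> M n i)"
  by(rule finsum_cong') (use less g M in auto)
 have c: "(\<Oplus>i\<in>{..<n}. g' i \<otimes> M n i) : car R" using g M by auto
 show ?case using eq[of n] unfolding s[OF g(1)] s[OF g(2)] e using c g by simp
qed

context
 fixes f :: "nat => 'a"
 assumes f: "!!i. f i : car R" "f 0 = \<zero>" "f 1 = \<one>"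
begin

lemma fX: "ps0 R (sub1 R f (ps_X R))"
 by(rule ps0_subst1) (use f in auto)

text \<open>The unit diagonal of the triangular system: for \<open>f = X + ...\<close> the lowest
  term of \<open>f^n\<close> is \<open>X^n\<close>.\<close>

lemma pow_diag: "ps_pow R (sub1 R f (ps_X R)) n (n, 0, 0) = \<one>"
proof (induction n)
 case 0 thus ?case by(simp add: ps_monom_def)
next
 case (Suc n)
 let ?u = "sub1 R f (ps_X R)"
 note uc = ps0D(1)[OF fX] and pc = ps_pow_closed[of ?u, OF ps0D(1)[OF fX]]
 have o: "ps_ord (n * 1) (ps_pow R ?u n)" by(intro ps_ord_pow uc ps0_ord fX)
 have "ps_mult R (ps_pow R ?u n) ?u (Suc n, 0, 0) =
  (\<Oplus>e\<in>{..Suc n} \<times> {..0::nat} \<times> {..0::nat}. if (n, 0, 0) = e then \<one> else \<zero>)"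
  unfolding ps_mult_def prod.case
 proof (rule finsum_cong'[OF refl])
  fix e assume e: "e : {..Suc n} \<times> {..0::nat} \<times> {..0::nat}"
  then obtain i where i: "e = (i, 0, 0)" "i <= Suc n" by auto
  show "(case e of (i, j, k) => ps_pow R ?u n (i, j, k) \<otimes> ?u (Suc n - i, 0 - j, 0 - k)) = (if (n, 0, 0) = e then \<one> else \<zero>)"
  proof (cases "i < n")
   case True
   thus ?thesis using ps_ordD[OF o, of i 0 0] uc i by simp
  next
   case False
   then consider "i = n" | "i = Suc n" using i(2) by linarith
   thus ?thesis
   proof cases
    case 1 thus ?thesis using Suc f(3) by(simp add: i subst1_X[OF f(1)] flip: One_nat_def)
   next
    case 2 thus ?thesis using pc f(2) by(simp add: i subst1_X[OF f(1)])
   qed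
  qed
 qed auto
 also have "... = \<one>" using finsum_singleton[of "(n, 0, 0)" "{..Suc n} \<times> {..0::nat} \<times> {..0::nat}" "%_. \<one>"] by simp
 finally show ?case by simp
qed

text \<open>\<open>M n i\<close> is the coefficient of \<open>X^n\<close> in \<open>f^i\<close>, so
  \<open>g(f(X)) = X\<close> is the triangular system whose right-hand side is \<open>1\<close> at
  \<open>n = 1\<close> and \<open>0\<close> elsewhere.\<close>

lemma sinv_aux:
 defines "M n i == ps_pow R (sub1 R f (ps_X R)) i (n, 0, 0)"
 defines "g == tsol M (%n. if n = 1 then \<one> else \<zero>)"
 shows "g n : car R" "g 0 = \<zero>" "g 1 = \<one>" "sub1 R g (sub1 R f (ps_X R)) = ps_X R"
  "[|!!n. h n : car R; sub1 R h (sub1 R f (ps_X R)) = ps_X R|] ==> h = g"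
proof -
 let ?u = "sub1 R f (ps_X R)"
 note uc = ps0D(1)[OF fX]
 have pc: "M n i : car R" "M n n = \<one>" for n i
  unfolding M_def by(rule ps_pow_closed[OF uc], rule pow_diag)
 have rc: "(if n = 1 then \<one> else \<zero>) : car R" for n :: nat by simp
 note g = tsol[of M "%n. if n = 1 then \<one> else \<zero>", OF pc(1) rc, folded g_def]
 note gsum = g(3)[OF pc(2)]
 have coef: "sub1 R h ?u (n, 0, 0) = (\<Oplus>i\<in>{..n}. h i \<otimes> M n i)" for h n by(simp add: ps_subst1_def M_def)
 show gc: "g n : car R" for n by(rule g(1))
 have M0: "M 1 0 = \<zero>" by(simp add: M_def ps_monom_def)
 show g0: "g 0 = \<zero>" by(subst g(2)) (simp add: a_minus_def)
 have "{..<1::nat} = {0}" by auto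
 thus "g 1 = \<one>" by(subst g(2)) (simp add: a_minus_def M0 g0)
 show "sub1 R g ?u = ps_X R"
 proof
  fix d :: "nat \<times> nat \<times> nat"
  obtain a b c where d: "d = (a, b, c)" by(cases d)
  have ps_X: "ps_X R (a, b, c) = (if a = 1 & b = 0 & c = 0 then \<one> else \<zero>)" by(simp add: ps_monom_def)
  have "xonly (sub1 R g ?u)" by(intro xonly_subst1 g(1) uc f(1) ps_monom_closed xonly_X)
  thus "sub1 R g ?u d = ps_X R d"
   using gsum[of a] ps_X
   by(cases "b = 0 & c = 0") (auto simp: d coef xonly_def)
 qed
 assume h: "!!n. h n : car R" "sub1 R h ?u = ps_X R"
 show "h = g"
 proof
  fix n
  have "(\<Oplus>i\<in>{..n}. h i \<otimes> M n i) = (\<Oplus>i\<in>{..n}. g i \<otimes> M n i)" for n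
   using fun_cong[OF h(2), of "(n, 0, 0)"] gsum[of n] by(simp add: coef ps_monom_nth)
  from tri_unique[of M h g, OF pc h(1) g(1) this] show "h n = g n" .
 qed
qed

lemma series_inverse_eq:
 "series_inverse R f = tsol (%n i. ps_pow R (sub1 R f (ps_X R)) i (n, 0, 0)) (%n. if n = 1 then \<one> else \<zero>)"
 unfolding series_inverse_def
proof (rule the_equality)
 fix h assume "range h <= car R & h 0 = \<zero> & sub1 R h (sub1 R f (ps_X R)) = ps_X R"
 thus "h = tsol (%n i. ps_pow R (sub1 R f (ps_X R)) i (n, 0, 0)) (%n. if n = 1 then \<one> else \<zero>)"
  by(intro sinv_aux(5)) (auto simp: image_subset_iff)
qed (use sinv_aux(1,2,4) in "auto simp: image_subset_iff")

lemma series_inverse: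
 "series_inverse R f n : car R" "series_inverse R f 0 = \<zero>" "series_inverse R f 1 = \<one>"
 "sub1 R (series_inverse R f) (sub1 R f (ps_X R)) = ps_X R"
 "series_inverse R f n = (if n = 1 then \<one> else \<zero>) \<ominus>
  (\<Oplus>i\<in>{..<n}. series_inverse R f i \<otimes> ps_pow R (sub1 R f (ps_X R)) i (n, 0, 0))"
 unfolding series_inverse_eq
 by(rule sinv_aux, rule sinv_aux, rule sinv_aux, rule sinv_aux,
   rule tsol(2)) (auto intro: ps_pow_closed[OF ps0D(1)[OF fX]])

lemma series_inverse_eqI:
 assumes "!!n. h n : car R" "sub1 R h (sub1 R f (ps_X R)) = ps_X R"
 shows "series_inverse R f = h"
 unfolding series_inverse_eq by(rule sinv_aux(5)[OF assms, symmetric])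

lemma series_inverse_left:
 assumes "ps0 R u" shows "sub1 R (series_inverse R f) (sub1 R f u) = u"
proof -
 let ?g = "series_inverse R f"
 have "psub R u u (sub1 R ?g (sub1 R f (ps_X R))) = sub1 R ?g (sub1 R f u)"
  by(subst psub_subst1; (subst psub_subst1)?) (use assms f fX series_inverse(1) in "auto simp: psub_X")
 thus ?thesis using series_inverse(4) psub_X[OF assms assms] by simp
qed

end

text \<open>The left inverse \<open>g\<close> of \<open>f\<close> has a left inverse of its own;
  applying that to \<open>g(f(X)) = X\<close> shows that it is \<open>f\<close>.\<close>

lemma series_inverse_right:
 assumes f: "!!i. f i : car R" "f 0 = \<zero>" "f 1 = \<one>" and u: "ps0 R u"
 shows "sub1 R f (sub1 R (series_inverse R f) u) = u"
proof -
 let ?g = "series_inverse R f"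
 note g = series_inverse[of f, OF f]
 have "sub1 R (series_inverse R ?g) (sub1 R ?g (sub1 R f (ps_X R))) = sub1 R f (ps_X R)"
  by(rule series_inverse_left[OF g(1-3) fX[OF f]])
 hence "sub1 R (series_inverse R ?g) (ps_X R) = sub1 R f (ps_X R)" using g(4) by simp
 hence "series_inverse R ?g = f"
  by(rule subst1_X_inj[OF series_inverse(1)[OF g(1-3)] f(1)])
 thus ?thesis using series_inverse_left[OF g(1-3) u] by simp
qed

end

lemma (in ring_hom_cring) hom_series_comp:
 assumes "!!i. f i : car R" "!!i. g i : car R"
 shows "h (series_comp R f g i) = series_comp S (%i. h (f i)) (%i. h (g i)) i"
proof -
 have "(%d. h (sub1 R f (sub1 R g (ps_X R)) d)) =
  sub1 S (%i. h (f i)) (sub1 S (%i. h (g i)) (ps_X S))"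
  using assms by(simp add: hom_ps R.ps_closed)
 thus ?thesis unfolding series_comp_def by metis
qed

lemma (in ring_hom_cring) hom_series_inverse:
 assumes "!!i. f i : car R" "f 0 = \<zero>" "f 1 = \<one>"
 shows "h (series_inverse R f i) = series_inverse S (%i. h (f i)) i"
proof -
 note g = R.series_inverse[of f, OF assms]
 have "(%d. h (sub1 R (series_inverse R f) (sub1 R f (ps_X R)) d)) = (%d. h (ps_X R d))"
  unfolding g(4) ..
 hence "sub1 S (%i. h (series_inverse R f i)) (sub1 S (%i. h (f i)) (ps_X S)) = ps_X S"
  using assms g(1) by(simp add: hom_ps R.ps_closed)
 hence "series_inverse S (%i. h (f i)) = (%i. h (series_inverse R f i))"
  by(intro S.series_inverse_eqI) (use assms g(1) in auto)
 thus ?thesis by metis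
qed

section \<open>Homogeneous series\<close>

context gfam
begin

text \<open>\<open>p\<close> counts factors: \<open>X\<close> has \<open>p = 1\<close> and its
  \<open>n\<close>-th power has \<open>p = n\<close>. Coefficients below degree \<open>p\<close>
  vanish by the order condition, so the truncated subtraction does no harm.\<close>

definition hsp :: "nat => 'a ps => bool" where
 "hsp p u \<longleftrightarrow> (ALL a b c. u (a, b, c) : H (2 * (a + b + c - p))) & ps_ord p u"

lemma hspD: "hsp p u ==> u (a, b, c) : H (2 * (a + b + c - p))" "hsp p u ==> ps_ord p u"
 by(auto simp: hsp_def)

lemma hsp_closed: "hsp p u ==> u d : car R"
 by(cases d) (auto simp: hsp_def intro: H_carr)

lemma hsp_mult:
 assumes u: "hsp p u" and v: "hsp q v" shows "hsp (p + q) (ps_mult R u v)"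
 unfolding hsp_def
proof (intro conjI allI)
 show "ps_ord (p + q) (ps_mult R u v)"
  by(intro ps_ord_mult hsp_closed[OF u] hsp_closed[OF v] hspD(2)[OF u] hspD(2)[OF v])
 fix a b c
 show "ps_mult R u v (a, b, c) : H (2 * (a + b + c - (p + q)))"
  unfolding ps_mult_def prod.case
 proof (rule H_finsum)
  fix e assume "e : {..a} \<times> {..b} \<times> {..c}"
  then obtain i j k where e: "e = (i, j, k)" "i <= a" "j <= b" "k <= c" by auto
  let ?x = "u (i, j, k) \<otimes> v (a - i, b - j, c - k)"
  show "(case e of (i, j, k) => u (i, j, k) \<otimes> v (a - i, b - j, c - k)) : H (2 * (a + b + c - (p + q)))"
  proof (cases "i + j + k < p | (a - i) + (b - j) + (c - k) < q")
   case True
   hence "?x = \<zero>"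
    using ps_ordD[OF hspD(2)[OF u]] ps_ordD[OF hspD(2)[OF v]] hsp_closed[OF u] hsp_closed[OF v]
    by(metis l_null r_null)
   thus ?thesis using e H_zero by simp
  next
   case False
   hence "2 * (i + j + k - p) + 2 * ((a - i) + (b - j) + (c - k) - q) = 2 * (a + b + c - (p + q))"
    using e by linarith
   thus ?thesis using H_mult[OF hspD(1)[OF u, of i j k] hspD(1)[OF v, of "a - i" "b - j" "c - k"]] e by simp
  qed
 qed
qed

lemma hsp_monom: "hsp (i + j + k) (ps_monom R (i, j, k))"
 by(auto simp: hsp_def ps_ord_def ps_monom_def H_one H_zero)

lemma hsp_pow: "hsp p u ==> hsp (n * p) (ps_pow R u n)"
proof (induction n)
 case 0 show ?case using hsp_monom[of 0 0 0] by simp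
next
 case (Suc n)
 thus ?case using hsp_mult[of "n * p" "ps_pow R u n" p u] by(simp add: add.commute)
qed

lemma hsp_X: "hsp 1 (ps_X R)" "hsp 1 (ps_Y R)" "hsp 1 (ps_Z R)" "hsp 1 (ps_zero R)"
 using hsp_monom[of 1 0 0] hsp_monom[of 0 1 0] hsp_monom[of 0 0 1]
 by(auto simp: hsp_def ps_ord_def ps_zero_def H_zero)

text \<open>The degree \<open>2 (i - 1)\<close> of \<open>f i\<close> and the degree
  \<open>2 (d - i)\<close> of a coefficient of \<open>u^i\<close> add up to
  \<open>2 (d - 1)\<close>. This fails for \<open>i = 0\<close>, hence the condition on
  \<open>f 0\<close>.\<close>

lemma hsp_subst1:
 assumes f: "!!i. f i : H (2 * (i - 1))" "f 0 = \<zero>" and u: "hsp 1 u"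
 shows "hsp 1 (sub1 R f u)"
 unfolding hsp_def
proof (intro conjI allI)
 have fc: "f i : car R" for i using f(1) H_carr by blast
 have pw: "ps_pow R u i (a, b, c) : H (2 * (a + b + c - i))" for i a b c using hspD(1)[OF hsp_pow[OF u, of i]] by simp
 fix a b c
 show "sub1 R f u (a, b, c) : H (2 * (a + b + c - 1))"
  unfolding ps_subst1_def prod.case
 proof (rule H_finsum)
  fix i assume i: "i : {..a + b + c}"
  show "f i \<otimes> ps_pow R u i (a, b, c) : H (2 * (a + b + c - 1))"
  proof (cases "i = 0")
   case True thus ?thesis using f(2) H_zero H_carr[OF pw[of 0]] by(simp del: ps_pow.simps)
  next
   case False
   hence "2 * (i - 1) + 2 * (a + b + c - i) = 2 * (a + b + c - 1)" using i by simp
   thus ?thesis using H_mult[OF f(1)[of i] pw[of i]] by metis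
  qed
 qed
next
 show "ps_ord 1 (sub1 R f u)"
  by(rule ps0_ord, rule ps0_subst1) (use f H_carr hsp_closed[OF u] hspD(2)[OF u] in "auto simp: ps0_def ps_ord_def")
qed

lemma hsp_subst2:
 assumes F: "!!i j. F i j : H (2 * (i + j - 1))" "F 0 0 = \<zero>" and u: "hsp 1 u" and v: "hsp 1 v"
 shows "hsp 1 (sub2 R F u v)"
 unfolding hsp_def
proof (intro conjI allI)
 have Fc: "F i j : car R" for i j using F(1) H_carr by blast
 have pw0: "hsp (i + j) (ps_mult R (ps_pow R u i) (ps_pow R v j))" for i j
  using hsp_mult[OF hsp_pow[OF u, of i] hsp_pow[OF v, of j]] by simp
 fix a b c
 note pw = hspD(1)[OF pw0, of _ _ a b c]
 show "sub2 R F u v (a, b, c) : H (2 * (a + b + c - 1))"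
  unfolding ps_subst2_def prod.case
 proof (rule H_finsum)
  fix e assume "e : {..a + b + c} \<times> {..a + b + c}"
  obtain i j where e: "e = (i, j)" by(cases e)
  have "F i j \<otimes> ps_mult R (ps_pow R u i) (ps_pow R v j) (a, b, c) : H (2 * (a + b + c - 1))"
  proof (cases "i + j = 0 | i + j > a + b + c")
   case True
   hence "F i j = \<zero> | ps_mult R (ps_pow R u i) (ps_pow R v j) (a, b, c) = \<zero>"
    using F(2) ps_ordD[OF hspD(2)[OF pw0]] by auto
   thus ?thesis using H_zero Fc H_carr[OF pw] by(metis l_null r_null)
  next
   case False
   hence "2 * (i + j - 1) + 2 * (a + b + c - (i + j)) = 2 * (a + b + c - 1)" by auto
   thus ?thesis using H_mult[OF F(1)[of i j] pw[of i j]] by metis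
  qed
  thus "(case e of (i, j) => F i j \<otimes> ps_mult R (ps_pow R u i) (ps_pow R v j) (a, b, c)) : H (2 * (a + b + c - 1))"
   by(simp add: e)
 qed
next
 show "ps_ord 1 (sub2 R F u v)"
  by(rule ps0_ord, rule ps0_subst2)
   (use F H_carr hsp_closed[OF u] hspD(2)[OF u] hsp_closed[OF v] hspD(2)[OF v] in "auto simp: ps0_def ps_ord_def")
qed

lemma series_comp_H:
 assumes "!!i. f i : H (2 * (i - 1))" "f 0 = \<zero>" "!!i. g i : H (2 * (i - 1))" "g 0 = \<zero>"
 shows "series_comp R f g i : H (2 * (i - 1))"
 using hspD(1)[OF hsp_subst1[OF assms(1,2) hsp_subst1[OF assms(3,4) hsp_X(1)]], of i 0 0]
 by(simp add: series_comp_def)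

lemma series_inverse_H:
 assumes f: "!!i. f i : H (2 * (i - 1))" "f 0 = \<zero>" "f 1 = \<one>"
 shows "series_inverse R f n : H (2 * (n - 1))"
proof (induction n rule: less_induct)
 case (less n)
 have fc: "f i : car R" for i using f(1) H_carr by blast
 have u: "hsp 1 (sub1 R f (ps_X R))" by(rule hsp_subst1[OF f(1,2) hsp_X(1)])
 have "series_inverse R f i \<otimes> ps_pow R (sub1 R f (ps_X R)) i (n, 0, 0) : H (2 * (n - 1))" if i: "i < n" for i
 proof (cases "i = 0")
  case True
  have "ps_pow R (sub1 R f (ps_X R)) i (n, 0, 0) : car R"
   by(rule hsp_closed[OF hsp_pow[OF u]])
  thus ?thesis using True series_inverse(2)[OF fc f(2,3)] H_zero by simp
 next
  case False
  hence "2 * (i - 1) + 2 * (n - i) = 2 * (n - 1)" using i by simp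
  thus ?thesis using H_mult[OF less[OF i] hspD(1)[OF hsp_pow[OF u, of i], of n 0 0]] by simp
 qed
 thus ?case
  by(subst series_inverse(5)[OF fc f(2,3)]) (auto intro!: H_diff H_finsum H_zero H_one)
qed

end

section \<open>Formal modules as systems of equations\<close>

definition is_fgl :: "('r, 'n) ring_scheme => (nat => nat => 'r) => bool" where
 "is_fgl R F \<longleftrightarrow>
  sub2 R F (ps_X R) (ps_zero R) = ps_X R & sub2 R F (ps_zero R) (ps_Y R) = ps_Y R &
  sub2 R F (ps_X R) (ps_Y R) = sub2 R F (ps_Y R) (ps_X R) &
  sub2 R F (sub2 R F (ps_X R) (ps_Y R)) (ps_Z R) = sub2 R F (ps_X R) (sub2 R F (ps_Y R) (ps_Z R))"

definition is_hom :: "('r, 'n) ring_scheme => (nat => nat => 'r) => (nat => nat => 'r) => (nat => 'r) => bool" where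
 "is_hom R F G f \<longleftrightarrow> f 0 = 0[R] &
  sub1 R f (sub2 R F (ps_X R) (ps_Y R)) = sub2 R G (sub1 R f (ps_X R)) (sub1 R f (ps_Y R))"

lemma ps_eqs_all: "(ALL z:ps_eqs u v. case z of (x, y) => x = y) \<longleftrightarrow> u = v"
proof
 assume *: "ALL z:ps_eqs u v. case z of (x, y) => x = y"
 show "u = v"
 proof
  fix d have "(u d, v d) : ps_eqs u v" unfolding ps_eqs_def by blast
  from bspec[OF * this] show "u d = v d" by simp
 qed
qed (auto simp: ps_eqs_def)

lemma setcompr_all:
 "(ALL z:{(f a b, g a b) | a b. a : A & b : B}. case z of (x, y) => x = y) \<longleftrightarrow> (ALL a:A. ALL b:B. f a b = g a b)"
 "(ALL z:{(f' a, g' a) | a. a : A}. case z of (x, y) => x = y) \<longleftrightarrow> (ALL a:A. f' a = g' a)"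
proof -
 have *: "(ALL z:{(f a b, g a b) | a b. P a b}. case z of (x, y) => x = y) \<longleftrightarrow> (ALL a b. P a b --> f a b = g a b)" for f g P
 proof (intro iffI allI impI)
  fix a b assume *: "ALL z:{(f a b, g a b) | a b. P a b}. case z of (x, y) => x = y" and "P a b"
  hence "(f a b, g a b) : {(f a b, g a b) | a b. P a b}" by blast
  from bspec[OF * this] show "f a b = g a b" by simp
 next
  assume *: "ALL a b. P a b --> f a b = g a b"
  show "ALL z:{(f a b, g a b) | a b. P a b}. case z of (x, y) => x = y"
  proof
   fix z assume "z : {(f a b, g a b) | a b. P a b}"
   then obtain a b where "z = (f a b, g a b)" "P a b" by blast
   thus "case z of (x, y) => x = y" using *[rule_format, of a b] by simp
  qed
 qed
 show "(ALL z:{(f a b, g a b) | a b. a : A & b : B}. case z of (x, y) => x = y) \<longleftrightarrow> (ALL a:A. ALL b:B. f a b = g a b)"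
  unfolding *
 proof -
  have "(ALL a b. a : A & b : B --> P a b) \<longleftrightarrow> (ALL a:A. ALL b:B. P a b)" for P by blast
  thus "(ALL a b. a : A & b : B --> f a b = g a b) \<longleftrightarrow> (ALL a:A. ALL b:B. f a b = g a b)" .
 qed
 show "(ALL z:{(f' a, g' a) | a. a : A}. case z of (x, y) => x = y) \<longleftrightarrow> (ALL a:A. f' a = g' a)"
  using *[of "%a _. f' a" "%a _. g' a" "%a _. a : A"] by(simp add: Ball_def)
qed

text \<open>Replaces sets of pairs by identities between whole series, the form to which the
  substitution lemmas apply.\<close>

lemma formal_module_iff:
 "formal_module A R d \<longleftrightarrow> d ` mod_gens A <= car R &
  (ALL a:car A. ALL b:car A. d (Scal (a +[A] b)) = d (Scal a) +[R] d (Scal b)) &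
  (ALL a:car A. ALL b:car A. d (Scal (a *[A] b)) = d (Scal a) *[R] d (Scal b)) &
  d (Scal 1[A]) = 1[R] &
  is_fgl R (%i j. d (FCoeff i j)) &
  (ALL a:car A. is_hom R (%i j. d (FCoeff i j)) (%i j. d (FCoeff i j)) (%i. d (Act a i))) &
  (ALL a:car A. ALL b:car A. sub1 R (%i. d (Act (a +[A] b) i)) (ps_X R) =
   sub2 R (%i j. d (FCoeff i j)) (sub1 R (%i. d (Act a i)) (ps_X R)) (sub1 R (%i. d (Act b i)) (ps_X R)) &
   sub1 R (%i. d (Act (a *[A] b) i)) (ps_X R) =
   sub1 R (%i. d (Act a i)) (sub1 R (%i. d (Act b i)) (ps_X R))) &
  sub1 R (%i. d (Act 1[A] i)) (ps_X R) = ps_X R &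
  (ALL a:car A. d (Act a 1) = d (Scal a))"
 unfolding formal_module_def module_eqs_def formal_module_eqs_def algebra_eqs_def fgl_eqs_def fgl_hom_eqs_def
  is_fgl_def is_hom_def
 by(simp only: ball_Un ball_UN ps_eqs_all setcompr_all ball_simps(5,7) simp_thms prod.case conj_assoc)

lemma strict_iso_iff:
 "strict_iso A R d \<longleftrightarrow> d ` iso_gens A <= car R &
  formal_module A R (%g. d (Src g)) & formal_module A R (%g. d (Tgt g)) &
  (ALL a:car A. d (Src (Scal a)) = d (Tgt (Scal a))) &
  is_hom R (%i j. d (Src (FCoeff i j))) (%i j. d (Tgt (FCoeff i j))) (%i. d (IsoCoeff i)) &
  d (IsoCoeff 1) = 1[R] &
  (ALL a:car A. sub1 R (%i. d (IsoCoeff i)) (sub1 R (%i. d (Src (Act a i))) (ps_X R)) =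
   sub1 R (%i. d (Tgt (Act a i))) (sub1 R (%i. d (IsoCoeff i)) (ps_X R)))"
proof -
 have sub: "d ` iso_gens A <= car R ==> (%g. d (Src g)) ` mod_gens A <= car R"
  "d ` iso_gens A <= car R ==> (%g. d (Tgt g)) ` mod_gens A <= car R"
  by(auto simp: iso_gens_def)
 show ?thesis
 proof (cases "d ` iso_gens A <= car R")
  case True
  have m: "formal_module A R (%g. d (Src g)) \<longleftrightarrow> (ALL z:module_eqs A R (%g. d (Src g)). case z of (x, y) => x = y)"
   "formal_module A R (%g. d (Tgt g)) \<longleftrightarrow> (ALL z:module_eqs A R (%g. d (Tgt g)). case z of (x, y) => x = y)"
   using sub[OF True] unfolding formal_module_def by simp_all
  show ?thesis
   unfolding m strict_iso_def iso_eqs_def strict_iso_eqs_def fgl_hom_eqs_def is_hom_def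
   by(simp only: ball_Un ball_UN ps_eqs_all setcompr_all ball_simps(5,7) simp_thms prod.case conj_assoc)
 next
  case False thus ?thesis by(simp add: strict_iso_def)
 qed
qed

lemma mod_gens_simps [simp]:
 "Scal a : mod_gens A \<longleftrightarrow> a : car A" "FCoeff i j : mod_gens A" "Act a i : mod_gens A \<longleftrightarrow> a : car A"
 by(auto simp: mod_gens_def)

lemma iso_gens_simps [simp]:
 "Src g : iso_gens A \<longleftrightarrow> g : mod_gens A" "Tgt g : iso_gens A \<longleftrightarrow> g : mod_gens A" "IsoCoeff i : iso_gens A"
 by(auto simp: iso_gens_def)

lemma image_mod_gens: "d ` mod_gens A \<subseteq> C \<longleftrightarrow>
 (ALL a:car A. d (Scal a) : C) & (ALL i j. d (FCoeff i j) : C) & (ALL a:car A. ALL i. d (Act a i) : C)"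
 unfolding mod_gens_def by blast

lemma image_iso_gens: "d ` iso_gens A \<subseteq> C \<longleftrightarrow>
 (%g. d (Src g)) ` mod_gens A \<subseteq> C & (%g. d (Tgt g)) ` mod_gens A \<subseteq> C & (ALL i. d (IsoCoeff i) : C)"
 unfolding iso_gens_def by blast

lemma ball_mod_gens: "(ALL g:mod_gens A. P g) \<longleftrightarrow>
 (ALL a:car A. P (Scal a)) & (ALL i j. P (FCoeff i j)) & (ALL a:car A. ALL i. P (Act a i))"
 unfolding mod_gens_def by blast

lemma mod_gens_cases:
 assumes "g : mod_gens A"
 obtains a where "g = Scal a" "a : car A" | i j where "g = FCoeff i j" | a i where "g = Act a i" "a : car A"
 using assms unfolding mod_gens_def by blast

lemma iso_gens_cases:
 assumes "g : iso_gens A"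
 obtains h where "g = Src h" "h : mod_gens A" | h where "g = Tgt h" "h : mod_gens A" | i where "g = IsoCoeff i"
 using assms unfolding iso_gens_def by blast

lemma formal_module_restrict:
 assumes "h : ring_hom A B" "formal_module B R d"
 shows "formal_module A R (%g. d (map_mod_gen h g))"
proof -
 note h = rh_cl[OF assms(1)] ring_hom_mult[OF assms(1)] ring_hom_add[OF assms(1)] ring_hom_one[OF assms(1)]
 show ?thesis using assms(2) unfolding formal_module_iff image_mod_gens by(simp add: h)
qed

lemma strict_iso_restrict:
 assumes "h : ring_hom A B" "strict_iso B R d"
 shows "strict_iso A R (%g. d (map_iso_gen h g))"
proof -
 note h = rh_cl[OF assms(1)]
 have m: "formal_module A R (%g. d (Src (map_mod_gen h g)))" "formal_module A R (%g. d (Tgt (map_mod_gen h g)))"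
  using assms(2) formal_module_restrict[OF assms(1), of R "%g. d (Src g)"]
   formal_module_restrict[OF assms(1), of R "%g. d (Tgt g)"] unfolding strict_iso_iff by simp_all
 thus ?thesis using assms(2) unfolding strict_iso_iff image_iso_gens by(simp add: h formal_module_def)
qed

lemma formal_module_hom:
 assumes A: "cring A" and R: "cring R" and S: "cring S" and h: "h : ring_hom R S" and d: "formal_module A R d"
 shows "formal_module A S (%g. h (d g))"
proof -
 interpret h: ring_hom_cring R S h by(rule rh_cringI[OF R S h])
 have dc: "d ` mod_gens A <= car R" using d by(simp add: formal_module_def)
 have "(%g. h (d g)) ` mod_gens A <= car S" using dc by auto
 moreover have "\<forall>(x, y)\<in>module_eqs A S (%g. h (d g)). x = y"
  using d unfolding h.image_module_eqs[OF A dc, symmetric] formal_module_def by auto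
 ultimately show ?thesis by(simp add: formal_module_def)
qed

lemma strict_iso_hom:
 assumes A: "cring A" and R: "cring R" and S: "cring S" and h: "h : ring_hom R S" and d: "strict_iso A R d"
 shows "strict_iso A S (%g. h (d g))"
proof -
 interpret h: ring_hom_cring R S h by(rule rh_cringI[OF R S h])
 have dc: "d ` iso_gens A <= car R" using d by(simp add: strict_iso_def)
 have "(%g. h (d g)) ` iso_gens A <= car S" using dc by auto
 moreover have "\<forall>(x, y)\<in>iso_eqs A S (%g. h (d g)). x = y"
  using d unfolding h.image_iso_eqs[OF A dc, symmetric] strict_iso_def by auto
 ultimately show ?thesis by(simp add: strict_iso_def)
qed

context cring
begin

lemma subst2_X_zero_coeff:
 assumes "!!i j. F i j : car R"
 shows "sub2 R F (ps_X R) (ps_zero R) (a, 0, 0) = F a 0" "sub2 R F (ps_zero R) (ps_Y R) (0, a, 0) = F 0 a"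
proof -
 have z: "ps_pow R (ps_zero R) (Suc j) e = \<zero>" for j e
  by(cases e) (auto simp: ps_mult_def ps_zero_def intro!: add.finprod_one_eqI r_null ps_pow_closed)
 have z2: "ps_mult R u (ps_pow R (ps_zero R) (Suc j)) e = \<zero>" "ps_mult R (ps_pow R (ps_zero R) (Suc j)) u e = \<zero>"
  if "!!d. u d : car R" for u j e
  using that by(cases e; auto simp: ps_mult_def z simp del: ps_pow.simps intro!: add.finprod_one_eqI)+
 have s: "(\<Oplus>e\<in>{..a} \<times> {..a}. if (a, 0) = e then F a 0 else \<zero>) = F a 0"
  "(\<Oplus>e\<in>{..a} \<times> {..a}. if (0, a) = e then F 0 a else \<zero>) = F 0 a"
  using finsum_singleton[of "(a, 0)" "{..a} \<times> {..a}" "%_. F a 0"]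
   finsum_singleton[of "(0, a)" "{..a} \<times> {..a}" "%_. F 0 a"] assms by simp_all
 have t1: "F i j \<otimes> ps_mult R (ps_pow R (ps_X R) i) (ps_pow R (ps_zero R) j) (a, 0, 0) = (if (a, 0) = (i, j) then F a 0 else \<zero>)" for i j
 proof (cases j)
  case 0
  thus ?thesis using assms by(simp add: ps_mult_one ps_pow_monom ps_monom_nth)
 next
  case (Suc k)
  have "ps_mult R (ps_pow R (ps_X R) i) (ps_pow R (ps_zero R) (Suc k)) (a, 0, 0) = \<zero>"
   by(rule z2(1)) (rule ps_pow_closed, simp)
  thus ?thesis using Suc assms by(simp del: ps_pow.simps)
 qed
 have t2: "F i j \<otimes> ps_mult R (ps_pow R (ps_zero R) i) (ps_pow R (ps_Y R) j) (0, a, 0) = (if (0, a) = (i, j) then F 0 a else \<zero>)" for i j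
 proof (cases i)
  case 0
  thus ?thesis using assms by(simp add: ps_one_mult ps_pow_monom ps_monom_nth)
 next
  case (Suc k)
  have "ps_mult R (ps_pow R (ps_zero R) (Suc k)) (ps_pow R (ps_Y R) j) (0, a, 0) = \<zero>"
   by(rule z2(2)) (rule ps_pow_closed, simp)
  thus ?thesis using Suc assms by(simp del: ps_pow.simps)
 qed
 show "sub2 R F (ps_X R) (ps_zero R) (a, 0, 0) = F a 0"
  unfolding ps_subst2_def prod.case
  by(rule trans[OF finsum_cong' s(1)]) (use assms in "auto simp: t1 simp del: ps_pow.simps split: if_splits")
 show "sub2 R F (ps_zero R) (ps_Y R) (0, a, 0) = F 0 a"
  unfolding ps_subst2_def prod.case
  by(rule trans[OF finsum_cong' s(2)]) (use assms in "auto simp: t2 simp del: ps_pow.simps split: if_splits")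
qed

lemma fgl_coeff:
 assumes "!!i j. F i j : car R" "is_fgl R F"
 shows "F i 0 = (if i = 1 then \<one> else \<zero>)" "F 0 i = (if i = 1 then \<one> else \<zero>)"
proof -
 have "sub2 R F (ps_X R) (ps_zero R) = ps_X R" "sub2 R F (ps_zero R) (ps_Y R) = ps_Y R"
  using assms(2) by(simp_all add: is_fgl_def)
 from fun_cong[OF this(1), of "(i, 0, 0)"] fun_cong[OF this(2), of "(0, i, 0)"]
 show "F i 0 = (if i = 1 then \<one> else \<zero>)" "F 0 i = (if i = 1 then \<one> else \<zero>)"
  by(simp_all add: subst2_X_zero_coeff assms(1) ps_monom_nth)
qed

lemma fgl_unit:
 assumes F: "!!i j. F i j : car R" "is_fgl R F" and u: "ps0 R u"
 shows "sub2 R F u (ps_zero R) = u"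
proof -
 have z: "ps0 R (ps_zero R)" "ps0 R (ps_X R)" by simp_all
 have "psub R u u (sub2 R F (ps_X R) (ps_zero R)) = sub2 R F u (ps_zero R)"
  by(subst psub_subst2[of F, OF F(1) z(2,1) u u]) (simp add: psub_X u)
 moreover have "sub2 R F (ps_X R) (ps_zero R) = ps_X R" using F(2) by(simp add: is_fgl_def)
 ultimately show ?thesis using psub_X(1)[OF u u] by simp
qed

lemma is_hom_apply:
 assumes F: "!!i j. F i j : car R" "F 0 0 = \<zero>" and G: "!!i j. G i j : car R"
  and f: "!!i. f i : car R" "is_hom R F G f" and u: "ps0 R u" "ps0 R v"
 shows "sub1 R f (sub2 R F u v) = sub2 R G (sub1 R f u) (sub1 R f v)"
proof -
 have f0: "f 0 = \<zero>" using f(2) by(simp add: is_hom_def)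
 have z: "ps0 R (ps_X R)" "ps0 R (ps_Y R)" by simp_all
 have "psub R u v (sub1 R f (sub2 R F (ps_X R) (ps_Y R))) = sub1 R f (sub2 R F u v)"
  by(subst psub_subst1[of f, OF f(1) ps0_subst2[of F, OF F z] u], subst psub_subst2[of F, OF F(1) z u]) (simp add: psub_X u)
 moreover have "psub R u v (sub2 R G (sub1 R f (ps_X R)) (sub1 R f (ps_Y R))) =
   sub2 R G (sub1 R f u) (sub1 R f v)"
  by(subst psub_subst2[of G, OF G ps0_subst1[of f, OF f(1) f0 z(1)] ps0_subst1[of f, OF f(1) f0 z(2)] u])
   (simp add: psub_subst1[of f, OF f(1) _ u] psub_X u)
 ultimately show ?thesis using f(2) by(simp add: is_hom_def)
qed

lemma subst1_eq_apply:
 assumes f: "!!i. f i : car R" "!!i. g i : car R" "g 0 = \<zero>" "!!i. f' i : car R" "!!i. g' i : car R" "g' 0 = \<zero>"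
  and eq: "sub1 R f (sub1 R g (ps_X R)) = sub1 R f' (sub1 R g' (ps_X R))" and u: "ps0 R u"
 shows "sub1 R f (sub1 R g u) = sub1 R f' (sub1 R g' u)"
proof -
 have "series_comp R f g = series_comp R f' g'"
  by(rule subst1_X_inj) (use assms in "auto simp: subst1_comp_X intro: series_comp_closed")
 thus ?thesis using subst1_comp[of f g, OF f(1,2,3) u] subst1_comp[of f' g', OF f(4,5,6) u] by simp
qed

lemma formal_moduleD:
 assumes "formal_module A R d"
 shows "!!a. a : car A ==> d (Scal a) : car R" "!!i j. d (FCoeff i j) : car R"
  "!!a i. a : car A ==> d (Act a i) : car R"
  "is_fgl R (%i j. d (FCoeff i j))" "d (FCoeff i 0) = (if i = 1 then \<one> else \<zero>)" "d (FCoeff 0 i) = (if i = 1 then \<one> else \<zero>)"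
  "!!a. a : car A ==> d (Act a 0) = \<zero>" "!!a. a : car A ==> d (Act a 1) = d (Scal a)"
 using assms fgl_coeff[of "%i j. d (FCoeff i j)"]
 unfolding formal_module_iff image_mod_gens is_hom_def by auto

lemma strict_isoD:
 assumes "strict_iso A R d"
 shows "formal_module A R (%g. d (Src g))" "formal_module A R (%g. d (Tgt g))" "!!i. d (IsoCoeff i) : car R"
  "d (IsoCoeff 0) = \<zero>" "d (IsoCoeff 1) = \<one>" "!!g. g : mod_gens A ==> d (Src g) : car R"
  "!!g. g : mod_gens A ==> d (Tgt g) : car R"
 using assms unfolding strict_iso_iff image_iso_gens is_hom_def by(auto simp: image_subset_iff)

lemma subst1_coeff1:
 assumes "!!i. f i : car R" "!!d. u d : car R"
 shows "sub1 R f u (1, 0, 0) = f 0 \<otimes> ps_pow R u 0 (1, 0, 0) \<oplus> f 1 \<otimes> ps_pow R u 1 (1, 0, 0)"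
proof -
 have s: "{..1 + 0 + 0 :: nat} = insert 1 {0}" by auto
 have c: "f i \<otimes> ps_pow R u i (1, 0, 0) : car R" for i by(intro m_closed assms ps_pow_closed)
 show ?thesis
  unfolding ps_subst1_def prod.case s
  by(subst finsum_insert) (use c in "auto simp: a_comm simp del: ps_pow.simps")
qed

section \<open>Identities, composites and inverses of strict isomorphisms\<close>

lemma strict_iso_id:
 assumes m: "formal_module A R m"
 shows "strict_iso A R (%g. case g of Src h => m h | Tgt h => m h | IsoCoeff i => if i = 1 then \<one> else \<zero>)"
proof -
 note D = formal_moduleD[OF m]
 have F: "ps0 R (sub2 R (%i j. m (FCoeff i j)) (ps_X R) (ps_Y R))"
  by(rule ps0_subst2) (use D(2) D(5)[of 0] in auto)
 have a: "ps0 R (sub1 R (%i. m (Act a i)) (ps_X R))" if "a : car A" for a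
  by(rule ps0_subst1) (use D(3,7)[OF that] in auto)
 have mc: "m ` mod_gens A <= car R" using m by(simp add: formal_module_def)
 show ?thesis
  unfolding strict_iso_iff image_iso_gens is_hom_def
  using m mc F a by(simp add: subst1_id)
qed

text \<open>Makes the comultiplication well defined. The identities for the second isomorphism are
  evaluated at the first one, using that an identity of series at \<open>X\<close> and
  \<open>Y\<close> may be substituted into.\<close>

lemma strict_iso_comp:
 assumes d1: "strict_iso A R d1" and d2: "strict_iso A R d2" and A: "cring A"
  and eq: "!!g. g : mod_gens A ==> d1 (Tgt g) = d2 (Src g)"
 shows "strict_iso A R (%g. case g of Src h => d1 (Src h) | Tgt h => d2 (Tgt h)
  | IsoCoeff i => series_comp R (%j. d2 (IsoCoeff j)) (%j. d1 (IsoCoeff j)) i)"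
proof -
 note D1 = strict_isoD[OF d1] and D2 = strict_isoD[OF d2]
 note S1 = formal_moduleD[OF D1(1)] and T1 = formal_moduleD[OF D1(2)] and T2 = formal_moduleD[OF D2(2)]
 let ?f1 = "%j. d1 (IsoCoeff j)" and ?f2 = "%j. d2 (IsoCoeff j)"
 let ?f = "series_comp R ?f2 ?f1"
 let ?F = "%i j. d1 (Src (FCoeff i j))" and ?G = "%i j. d1 (Tgt (FCoeff i j))" and ?H = "%i j. d2 (Tgt (FCoeff i j))"
 have G: "(%i j. d2 (Src (FCoeff i j))) = ?G" using eq by auto
 have hom1: "is_hom R ?F ?G ?f1" and hom2: "is_hom R ?G ?H ?f2"
  using d1 d2 unfolding strict_iso_iff G by auto
 have F00: "?F 0 0 = \<zero>" "?G 0 0 = \<zero>" "?H 0 0 = \<zero>" using S1(5)[of 0] T1(5)[of 0] T2(5)[of 0] by simp_all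
 have fc: "?f i : car R" for i by(intro series_comp_closed D1 D2)
 have app: "sub1 R ?f u = sub1 R ?f2 (sub1 R ?f1 u)" if "ps0 R u" for u
  by(rule subst1_comp[of ?f2 ?f1, OF D2(3) D1(3,4) that])
 have X: "ps0 R (ps_X R)" "ps0 R (ps_Y R)" by simp_all
 have p1: "ps0 R (sub1 R ?f1 u)" if "ps0 R u" for u by(rule ps0_subst1[of ?f1, OF D1(3,4) that])
 have fX: "sub1 R ?f (ps_X R) (i, 0, 0) = ?f i" for i by(simp add: subst1_X[OF fc])
 have "is_hom R ?F ?H ?f"
  unfolding is_hom_def
 proof
  show "?f 0 = \<zero>" using fX[of 0] app[OF X(1)] ps0D(2)[OF ps0_subst1[of ?f2, OF D2(3,4) p1[OF X(1)]]] by simp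
  have FXY: "ps0 R (sub2 R ?F (ps_X R) (ps_Y R))" by(rule ps0_subst2[of ?F, OF S1(2) F00(1) X])
  have "sub1 R ?f (sub2 R ?F (ps_X R) (ps_Y R)) =
   sub1 R ?f2 (sub2 R ?G (sub1 R ?f1 (ps_X R)) (sub1 R ?f1 (ps_Y R)))"
   unfolding app[OF FXY] using hom1 by(simp add: is_hom_def)
  also have "... = sub2 R ?H (sub1 R ?f (ps_X R)) (sub1 R ?f (ps_Y R))"
   unfolding app[OF X(1)] app[OF X(2)]
   by(rule is_hom_apply[of ?G ?H ?f2, OF T1(2) F00(2) T2(2) D2(3) hom2 p1[OF X(1)] p1[OF X(2)]])
  finally show "sub1 R ?f (sub2 R ?F (ps_X R) (ps_Y R)) =
   sub2 R ?H (sub1 R ?f (ps_X R)) (sub1 R ?f (ps_Y R))" .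
 qed
 moreover have "?f 1 = \<one>"
 proof -
  let ?u = "sub1 R ?f1 (ps_X R)"
  have u: "ps0 R ?u" by(rule p1[OF X(1)])
  have "sub1 R ?f2 ?u (1, 0, 0) = ?f2 0 \<otimes> ps_pow R ?u 0 (1, 0, 0) \<oplus> ?f2 1 \<otimes> ps_pow R ?u 1 (1, 0, 0)"
   by(rule subst1_coeff1) (use D2(3) ps0D(1)[OF u] in auto)
  also have "... = \<one>" using D1(3,5) D2(4,5) by(simp add: ps_pow_1[OF ps0D(1)[OF u]] subst1_X[OF D1(3)] ps_monom_nth)
  finally show ?thesis using fX[of 1] app[OF X(1)] by simp
 qed
 moreover have "sub1 R ?f (sub1 R (%i. d1 (Src (Act a i))) (ps_X R)) =
  sub1 R (%i. d2 (Tgt (Act a i))) (sub1 R ?f (ps_X R))" if a: "a : car A" for a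
 proof -
  have e: "(%i. d2 (Src (Act a i))) = (%i. d1 (Tgt (Act a i)))" using eq a by auto
  have c1: "sub1 R ?f1 (sub1 R (%i. d1 (Src (Act a i))) (ps_X R)) =
   sub1 R (%i. d1 (Tgt (Act a i))) (sub1 R ?f1 (ps_X R))"
   using d1 a unfolding strict_iso_iff by blast
  have c2: "sub1 R ?f2 (sub1 R (%i. d1 (Tgt (Act a i))) (ps_X R)) =
   sub1 R (%i. d2 (Tgt (Act a i))) (sub1 R ?f2 (ps_X R))"
   using d2 a unfolding strict_iso_iff e[symmetric] by blast
  have aX: "ps0 R (sub1 R (%i. d1 (Src (Act a i))) (ps_X R))"
   by(rule ps0_subst1) (use S1(3,7)[OF a] in auto)
  have "sub1 R ?f (sub1 R (%i. d1 (Src (Act a i))) (ps_X R)) =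
   sub1 R ?f2 (sub1 R (%i. d1 (Tgt (Act a i))) (sub1 R ?f1 (ps_X R)))"
   unfolding app[OF aX] c1 ..
  also have "... = sub1 R (%i. d2 (Tgt (Act a i))) (sub1 R ?f2 (sub1 R ?f1 (ps_X R)))"
   by(rule subst1_eq_apply[of ?f2 "%i. d1 (Tgt (Act a i))" "%i. d2 (Tgt (Act a i))" ?f2, OF D2(3) _ _ _ D2(3,4) c2 p1[OF X(1)]])
    (use T1(3,7)[OF a] T2(3)[OF a] in auto)
  finally show ?thesis unfolding app[OF X(1)] .
 qed
 moreover have "d1 (Src (Scal a)) = d2 (Tgt (Scal a))" if "a : car A" for a
 proof -
  have "d1 (Src (Scal a)) = d1 (Tgt (Scal a))" "d2 (Src (Scal a)) = d2 (Tgt (Scal a))"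
   using d1 d2 that unfolding strict_iso_iff by blast+
  thus ?thesis using eq[of "Scal a"] that by simp
 qed
 ultimately show ?thesis
  unfolding strict_iso_iff image_iso_gens using D1(1,6) D2(2,7) fc by(simp add: image_subset_iff)
qed

text \<open>The identities for \<open>f\<close> are evaluated at \<open>g(X)\<close> and
  \<open>g(Y)\<close>; applying \<open>g\<close> on the left then cancels \<open>f\<close>.\<close>

lemma strict_iso_inv:
 assumes d: "strict_iso A R d"
 shows "strict_iso A R (%g. case g of Src h => d (Tgt h) | Tgt h => d (Src h)
  | IsoCoeff i => series_inverse R (%j. d (IsoCoeff j)) i)"
proof -
 note D = strict_isoD[OF d]
 note S = formal_moduleD[OF D(1)] and T = formal_moduleD[OF D(2)]
 let ?f = "%j. d (IsoCoeff j)"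
 let ?g = "series_inverse R ?f"
 let ?F = "%i j. d (Src (FCoeff i j))" and ?G = "%i j. d (Tgt (FCoeff i j))"
 note g = series_inverse[of ?f, OF D(3-5)] and gf = series_inverse_left[of ?f, OF D(3-5)]
  and fg = series_inverse_right[of ?f, OF D(3-5)]
 have hom: "is_hom R ?F ?G ?f" using d unfolding strict_iso_iff by blast
 have F00: "?F 0 0 = \<zero>" "?G 0 0 = \<zero>" using S(5)[of 0] T(5)[of 0] by simp_all
 have X: "ps0 R (ps_X R)" "ps0 R (ps_Y R)" by simp_all
 have gX: "ps0 R (sub1 R ?g u)" if "ps0 R u" for u by(rule ps0_subst1[of ?g, OF g(1,2) that])
 have "is_hom R ?G ?F ?g"
  unfolding is_hom_def
 proof
  show "?g 0 = \<zero>" by(rule g(2))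
  let ?u = "sub2 R ?F (sub1 R ?g (ps_X R)) (sub1 R ?g (ps_Y R))"
  have u: "ps0 R ?u" by(rule ps0_subst2[of ?F, OF S(2) F00(1) gX gX]) (use X in auto)
  have "sub1 R ?f ?u = sub2 R ?G (ps_X R) (ps_Y R)"
   by(subst is_hom_apply[of ?F ?G ?f, OF S(2) F00(1) T(2) D(3) hom gX[OF X(1)] gX[OF X(2)]]) (simp add: fg X)
  thus "sub1 R ?g (sub2 R ?G (ps_X R) (ps_Y R)) = ?u" using gf[OF u] by simp
 qed
 moreover have "sub1 R ?g (sub1 R (%i. d (Tgt (Act a i))) (ps_X R)) =
  sub1 R (%i. d (Src (Act a i))) (sub1 R ?g (ps_X R))" if a: "a : car A" for a
 proof -
  let ?r = "%i. d (Src (Act a i))" and ?s = "%i. d (Tgt (Act a i))"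
  have c: "sub1 R ?f (sub1 R ?r (ps_X R)) = sub1 R ?s (sub1 R ?f (ps_X R))"
   using d a unfolding strict_iso_iff by blast
  have "sub1 R ?f (sub1 R ?r (sub1 R ?g (ps_X R))) = sub1 R ?s (sub1 R ?f (sub1 R ?g (ps_X R)))"
   by(rule subst1_eq_apply[of ?f ?r ?s ?f, OF D(3) _ _ _ D(3,4) c gX[OF X(1)]]) (use S(3,7)[OF a] T(3)[OF a] in auto)
  moreover have "ps0 R (sub1 R ?r (sub1 R ?g (ps_X R)))"
   by(rule ps0_subst1[OF _ _ gX[OF X(1)]]) (use S(3,7)[OF a] in auto)
  ultimately show ?thesis using gf fg[OF X(1)] by metis
 qed
 moreover have "d (Tgt (Scal a)) = d (Src (Scal a))" if "a : car A" for a
  using d that unfolding strict_iso_iff by simp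
 ultimately show ?thesis
  unfolding strict_iso_iff image_iso_gens using D(1,2,6,7) g(1,3) by(simp add: image_subset_iff)
qed

end

section \<open>Homogeneity of the defining equations\<close>

text \<open>An equation whose sides lie in the same homogeneous part can be tested after setting the
  grading variable to \<open>1\<close>; this is how homogeneity of the defining equations is
  exploited.\<close>

definition same_part :: "(nat => 'r set) => ('r \<times> 'r) set" where
 "same_part H = {(x, y). EX n. x : H n & y : H n}"

context gfam
begin

definition hmod :: "('k, 'l) ring_scheme => ('k mod_gen => 'a) => bool" where
 "hmod A d \<longleftrightarrow> (ALL g:mod_gens A. d g : H (mod_weight g)) & d (FCoeff 0 0) = \<zero> & (ALL a:car A. d (Act a 0) = \<zero>)"

lemma ps_eqs_same: "[|hsp 1 u; hsp 1 v|] ==> ps_eqs u v \<subseteq> same_part H"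
 unfolding ps_eqs_def same_part_def
proof clarify
 fix a b c assume "hsp 1 u" "hsp 1 v"
 thus "EX n. u (a, b, c) : H n & v (a, b, c) : H n"
  by(intro exI[of _ "2 * (a + b + c - 1)"]) (auto simp: hsp_def)
qed

lemma fgl_hom_eqs_same:
 assumes "!!i j. F i j : H (2 * (i + j - 1))" "F 0 0 = \<zero>" "!!i j. G i j : H (2 * (i + j - 1))" "G 0 0 = \<zero>"
  "!!i. f i : H (2 * (i - 1))" "f 0 = \<zero>"
 shows "fgl_hom_eqs R F G f \<subseteq> same_part H"
proof -
 have "{(f 0, \<zero>)} \<subseteq> same_part H" using assms(6) H_zero by(auto simp: same_part_def)
 thus ?thesis
  unfolding fgl_hom_eqs_def
  by(intro Un_least ps_eqs_same hsp_subst1 hsp_subst2 hsp_X assms) auto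
qed

lemma module_eqs_same:
 assumes A: "cring A" and d: "hmod A d" shows "module_eqs A R d \<subseteq> same_part H"
proof -
 interpret A: cring A by fact
 have w: "!!i j. d (FCoeff i j) : H (2 * (i + j - 1))" "!!a. a : car A ==> d (Scal a) : H 0"
  "!!a i. a : car A ==> d (Act a i) : H (2 * (i - 1))"
  "d (FCoeff 0 0) = \<zero>" "!!a. a : car A ==> d (Act a 0) = \<zero>"
  using d unfolding hmod_def ball_mod_gens by simp_all
 have 1: "{(d (Act a 1), d (Scal a)) | a. a : car A} \<subseteq> same_part H"
  using w(3)[of _ 1] w(2) by(auto simp: same_part_def)
 have m0: "x \<otimes> y : H 0" if "x : H 0" "y : H 0" for x y using H_mult[OF that] by simp
 have 2: "algebra_eqs A R (%a. d (Scal a)) \<subseteq> same_part H"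
 proof -
  have sp: "(x, y) : same_part H" if "x : H 0" "y : H 0" for x y using that by(auto simp: same_part_def)
  show ?thesis unfolding algebra_eqs_def by(auto intro!: sp w H_add m0 H_one)
 qed
 show ?thesis
  unfolding module_eqs_def formal_module_eqs_def fgl_eqs_def
  by(intro Un_least UN_least 1 2 fgl_hom_eqs_same ps_eqs_same hsp_subst1 hsp_subst2 hsp_X w) auto
qed

lemma iso_eqs_same:
 assumes A: "cring A" and d: "hmod A (%g. d (Src g))" "hmod A (%g. d (Tgt g))" "!!i. d (IsoCoeff i) : H (2 * (i - 1))"
  "d (IsoCoeff 0) = \<zero>"
 shows "iso_eqs A R d \<subseteq> same_part H"
proof -
 have w: "!!i j. d (Src (FCoeff i j)) : H (2 * (i + j - 1))" "!!a. a : car A ==> d (Src (Scal a)) : H 0"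
  "!!a i. a : car A ==> d (Src (Act a i)) : H (2 * (i - 1))"
  "d (Src (FCoeff 0 0)) = \<zero>" "!!a. a : car A ==> d (Src (Act a 0)) = \<zero>"
  "!!i j. d (Tgt (FCoeff i j)) : H (2 * (i + j - 1))" "!!a. a : car A ==> d (Tgt (Scal a)) : H 0"
  "!!a i. a : car A ==> d (Tgt (Act a i)) : H (2 * (i - 1))"
  "d (Tgt (FCoeff 0 0)) = \<zero>" "!!a. a : car A ==> d (Tgt (Act a 0)) = \<zero>"
  using d unfolding hmod_def ball_mod_gens by simp_all
 have 1: "{(d (Src (Scal a)), d (Tgt (Scal a))) | a. a : car A} \<subseteq> same_part H"
  using w by(auto simp: same_part_def intro!: exI[of _ "0 :: nat"])
 have 2: "{(d (IsoCoeff 1), \<one>)} \<subseteq> same_part H" using d(3)[of 1] H_one by(auto simp: same_part_def)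
 show ?thesis
  unfolding iso_eqs_def strict_iso_eqs_def
  by(intro Un_least UN_least module_eqs_same A d 1 2 fgl_hom_eqs_same ps_eqs_same hsp_subst1 hsp_subst2 hsp_X w) auto
qed

text \<open>The family is constant here, so \<open>B\<close> is a subring. Elements of
  \<open>A\<close> whose action has coefficients in \<open>B\<close> are closed under sums and
  products; \<open>-1\<close> is added to the generators so that negatives arise as
  products.\<close>

lemma hmod_closed_generate:
 assumes A: "cring A" and d: "formal_module A R d" and S: "S <= car A"
  and H: "!!n. H n = B" and F: "!!i j. d (FCoeff i j) : B"
  and act: "!!s i. s : insert (-[A] 1[A]) S ==> d (Act s i) : B" and a: "a : generate_ring A S"
 shows "d (Act a i) : B"
proof -
 interpret A: cring A by fact
 note D = formal_moduleD[OF d]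
 have nth: "sub1 R (%i. d (Act a i)) (ps_X R) (i, 0, 0) = d (Act a i)" if "a : car A" for a i
  by(simp add: subst1_X D(3)[OF that])
 have cX: "hsp 1 (sub1 R (%i. d (Act a i)) u)" if "a : car A" "!!i. d (Act a i) : B" "hsp 1 u" for a u
  by(rule hsp_subst1) (use that H D(7) in auto)
 have mult: "d (Act (a *[A] b) i) : B" if ab: "a : car A" "b : car A" "!!i. d (Act a i) : B" "!!i. d (Act b i) : B" for a b i
 proof -
  have "hsp 1 (sub1 R (%i. d (Act a i)) (sub1 R (%i. d (Act b i)) (ps_X R)))"
   by(intro cX ab hsp_X)
  moreover have "sub1 R (%i. d (Act (a *[A] b) i)) (ps_X R) =
   sub1 R (%i. d (Act a i)) (sub1 R (%i. d (Act b i)) (ps_X R))"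
   using d ab unfolding formal_module_iff by blast
  ultimately show ?thesis using hspD(1)[of 1 _ i 0 0] nth[OF A.m_closed[OF ab(1,2)], of i] H by metis
 qed
 show ?thesis using a
 proof (induction arbitrary: i rule: generate_ring.induct)
  case one
  have "sub1 R (%i. d (Act 1[A] i)) (ps_X R) = ps_X R" using d unfolding formal_module_iff by blast
  hence "d (Act 1[A] i) = ps_X R (i, 0, 0)" using nth[OF A.one_closed, of i] by simp
  thus ?case using hspD(1)[OF hsp_X(1), of i 0 0] H by metis
 next
  case (incl s) thus ?case using act by blast
 next
  case (a_inv a)
  have ac: "a : car A" using A.generate_ring_in_carrier[OF S a_inv(1)] .
  hence "-[A] a = -[A] 1[A] *[A] a" by(simp add: A.l_minus)
  thus ?case using mult[OF _ ac _ a_inv(2)] act[of "-[A] 1[A]"] by simp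
 next
  case (eng_add a b)
  have ac: "a : car A" "b : car A" using A.generate_ring_in_carrier[OF S] eng_add by auto
  have "hsp 1 (sub2 R (%i j. d (FCoeff i j)) (sub1 R (%i. d (Act a i)) (ps_X R)) (sub1 R (%i. d (Act b i)) (ps_X R)))"
   by(rule hsp_subst2) (use H F D(5)[of 0] ac eng_add cX hsp_X in auto)
  moreover have "sub1 R (%i. d (Act (a +[A] b) i)) (ps_X R) =
   sub2 R (%i j. d (FCoeff i j)) (sub1 R (%i. d (Act a i)) (ps_X R)) (sub1 R (%i. d (Act b i)) (ps_X R))"
   using d ac unfolding formal_module_iff by blast
  ultimately show ?case using hspD(1)[of 1 _ i 0 0] nth[OF A.a_closed[OF ac], of i] H by metis
 next
  case (eng_mult a b)
  thus ?case using A.generate_ring_in_carrier[OF S] mult by blast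
 qed
qed

end

section \<open>Presented graded rings\<close>

lemma with_grading_simps [simp]:
 "car (with_grading R d) = car R" "monoid.mult (with_grading R d) = monoid.mult R"
 "one (with_grading R d) = one R" "ring.zero (with_grading R d) = ring.zero R" "add (with_grading R d) = add R"
 "hpart (with_grading R d) = d"
 by(simp_all add: with_grading_def)

lemma a_inv_with_grading: "a_inv (with_grading R d) = a_inv R"
 by(simp add: a_inv_def m_inv_def fun_eq_iff)

lemma cring_with_grading:
 assumes "cring R" shows "cring (with_grading R d)"
proof -
 interpret cring R by fact
 show ?thesis
  by(rule cringI, rule abelian_groupI, simp_all add: a_ac l_distr)
   (auto intro!: comm_monoidI bexI[of _ "-[R] x" for x] simp: m_ac l_neg)
qed

lemma aspan_with_grading: "aspan (with_grading R d) V = aspan R V"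
proof -
 have i: "m_inv (add_monoid (with_grading R d)) = m_inv (add_monoid R)" by(simp add: m_inv_def fun_eq_iff)
 have "x : aspan R V" if "x : aspan (with_grading R d) V" for x
  using that
 proof (induction rule: generate.induct)
  case (inv h) thus ?case using generate.inv[of h V "add_monoid R"] i by simp
 next
  case (eng a b) thus ?case using generate.eng[of a "add_monoid R" V b] by simp
 qed (use generate.one[of "add_monoid R" V] generate.incl in auto)
 moreover have "x : aspan (with_grading R d) V" if "x : aspan R V" for x
  using that
 proof (induction rule: generate.induct)
  case (inv h) thus ?case using generate.inv[of h V "add_monoid (with_grading R d)"] i by simp
 next
  case (eng a b) thus ?case using generate.eng[of a "add_monoid (with_grading R d)" V b] by simp
 qed (use generate.one[of "add_monoid (with_grading R d)" V] generate.incl in auto)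
 ultimately show ?thesis by blast
qed

lemma ring_hom_to_with_grading: "ring_hom Q (with_grading R d) = ring_hom Q R"
 by(simp add: ring_hom_def)

context presentation
begin

lemma class_add: "[|p : car (zpolys S); q : car (zpolys S)|] ==>
  pcls S E (p + q) = pcls S E p +[pres S E] pcls S E q"
 using ring_hom_add[OF pres_class_hom, of p q] by simp

lemma class_mult: "[|p : car (zpolys S); q : car (zpolys S)|] ==>
  pcls S E (p * q) = pcls S E p *[pres S E] pcls S E q"
 using ring_hom_mult[OF pres_class_hom, of p q] by simp

lemma class_one: "pcls S E 1 = 1[pres S E]"
 using ring_hom_one[OF pres_class_hom] by simp

lemma class_closed: "p : car (zpolys S) ==> pcls S E p : car (pres S E)"
 using rh_cl[OF pres_class_hom] .

lemma class_hom: "ring_hom_cring (zpolys S) (pres S E) (pcls S E)"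
 by(rule rh_cringI[OF zpoly_cring pres_cring pres_class_hom])

lemma class_const: "p : car (zpolys S) ==> q : pcls S E p ==>
  q : car (zpolys S) & pcls S E q = pcls S E p"
 using pres_class_member(2)[of p q] ring.quotient_eq_iff_same_a_r_cos[OF cring.axioms(1)[OF zpoly_cring] ideal_rels, of q p]
  zpoly_a_minus[of q S p] by(auto simp: pres_class_def)

text \<open>\<open>pres_map\<close> is a definite description, so it is identified through a
  homomorphism already known to have the right values on generators.\<close>

lemma pres_map_eq_hom:
 assumes R: "cring R" and h: "h : ring_hom (pres S E) R" and hf: "!!g. g : S ==> h (pcls S E (zvar g)) = f g"
  and c: "c : car (pres S E)"
 shows "pres_map R f c = h c"
proof -
 have f: "f ` S <= car R"
  by(rule image_subsetI, subst hf[symmetric], assumption, rule rh_cl[OF h class_closed], simp)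
 obtain p where p: "p : car (zpolys S)" "c = pcls S E p" using c carrier_pres by blast
 have hc: "h \<circ> pcls S E : ring_hom (zpolys S) R" by(rule ring_hom_trans[OF pres_class_hom h])
 have e: "zeval R f q = h c" if "q : c" for q
  using zpoly_hom_eq_zeval[OF R f hc, of q] hf class_const[OF p(1), of q] that p(2) by simp
 show ?thesis unfolding pres_map_def
  by(rule the_equality) (use e pres_class_member(1)[OF p(1)] p(2) in auto)
qed

lemma hom_ext:
 assumes R: "cring R" and h: "h : ring_hom (pres S E) R" "h' : ring_hom (pres S E) R"
  and eq: "!!g. g : S ==> h (pcls S E (zvar g)) = h' (pcls S E (zvar g))" and c: "c : car (pres S E)"
 shows "h c = h' c"
 using pres_map_eq_hom[OF R h(1) eq c] pres_map_eq_hom[OF R h(2) refl c] by simp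

end

context presentation
begin

abbreviation "wp w == weighted_pres S E w"

lemma wp_cring: "cring (wp w)"
 unfolding weighted_pres_def by(rule cring_with_grading[OF pres_cring])

lemma wp_carrier: "car (wp w) = car (pres S E)"
 by(simp add: weighted_pres_def)

lemma wp_hom: "ring_hom (wp w) R = ring_hom (pres S E) R" "ring_hom R (wp w) = ring_hom R (pres S E)"
 by(simp_all add: weighted_pres_def ring_hom_with_grading ring_hom_to_with_grading)

lemma wp_hpart: "x : hpart (wp w) n \<longleftrightarrow> (EX p:car (zpolys S). x = pcls S E p & (ALL m:Poly_Mapping.keys p. mwt w m = n))"
 by(auto simp: weighted_pres_def mwt_def)

lemma wp_gen: "g : S ==> pcls S E (zvar g) : hpart (wp w) (w g)"
proof -
 have "Poly_Mapping.keys (zvar g) = {single g 1}" by(simp add: zvar_def)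
 thus "g : S ==> pcls S E (zvar g) : hpart (wp w) (w g)"
  unfolding wp_hpart by(intro bexI[of _ "zvar g"]) (auto simp: mwt_single)
qed

lemma wp_gfam: "gfam (wp w) (hpart (wp w))"
proof (intro gfam.intro gfam_axioms.intro wp_cring)
 interpret P: cring "pres S E" by(rule pres_cring)
 interpret W: cring "wp w" by(rule wp_cring)
 show "additive_subgroup (hpart (wp w) n) (wp w)" for n
 proof (rule additive_subgroupI, rule W.add.subgroupI)
  show "hpart (wp w) n <= car (wp w)" unfolding wp_carrier by(auto simp: wp_hpart intro: class_closed)
  have "pcls S E 0 : hpart (wp w) n" unfolding wp_hpart by(intro bexI[of _ 0]) auto
  thus "hpart (wp w) n ~= {}" by blast
  fix a assume "a : hpart (wp w) n"
  then obtain p where p: "p : car (zpolys S)" "a = pcls S E p" "ALL m:Poly_Mapping.keys p. mwt w m = n"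
   by(auto simp: wp_hpart)
  have "-[wp w] a = pcls S E (- p)"
   using ring_hom_cring.hom_a_inv[OF class_hom p(1)] p by(simp add: weighted_pres_def a_inv_with_grading)
  thus "-[wp w] a : hpart (wp w) n" unfolding wp_hpart using p by(intro bexI[of _ "- p"]) auto
  fix b assume "b : hpart (wp w) n"
  then obtain q where q: "q : car (zpolys S)" "b = pcls S E q" "ALL m:Poly_Mapping.keys q. mwt w m = n"
   by(auto simp: wp_hpart)
  have "a +[wp w] b = pcls S E (p + q)" using class_add[OF p(1) q(1)] p q by(simp add: weighted_pres_def)
  thus "a +[wp w] b : hpart (wp w) n"
   unfolding wp_hpart using p q keys_add[of p q] by(intro bexI[of _ "p + q"]) auto
 qed
 show "1[wp w] : hpart (wp w) 0"
  unfolding wp_hpart using class_one by(intro bexI[of _ 1]) (auto simp: weighted_pres_def)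
 fix x y m n assume "x : hpart (wp w) m" "y : hpart (wp w) n"
 then obtain p q where p: "p : car (zpolys S)" "x = pcls S E p" "ALL k:Poly_Mapping.keys p. mwt w k = m"
  and q: "q : car (zpolys S)" "y = pcls S E q" "ALL k:Poly_Mapping.keys q. mwt w k = n"
  by(auto simp: wp_hpart)
 have "x *[wp w] y = pcls S E (p * q)" using class_mult[OF p(1) q(1)] p q by(simp add: weighted_pres_def)
 moreover have "mwt w k = m + n" if "k : Poly_Mapping.keys (p * q)" for k
  using that keys_mult[of p q] p q by(auto simp: mwt_add)
 ultimately show "x *[wp w] y : hpart (wp w) (m + n)"
  unfolding wp_hpart using p q by(intro bexI[of _ "p * q"]) auto
qed

lemma wp_span: "x : car (wp w) ==> x : aspan (wp w) (\<Union>n. hpart (wp w) n)"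
proof -
 interpret W: cring "wp w" by(rule wp_cring)
 interpret g: gfam "wp w" "hpart (wp w)" by(rule wp_gfam)
 let ?A = "aspan (wp w) (\<Union>n. hpart (wp w) n)"
 assume "x : car (wp w)"
 then obtain p where p: "p : car (zpolys S)" "x = pcls S E p" using wp_carrier carrier_pres by blast
 have s: "single m (lookup p m) : car (zpolys S)" if "m : Poly_Mapping.keys p" for m
  using p(1) that by(auto simp: carrier_zpoly_ring)
 have "pcls S E (\<Sum>m\<in>K. single m (lookup p m)) : ?A &
   (\<Sum>m\<in>K. single m (lookup p m)) : car (zpolys S)"
  if "finite K" "K \<subseteq> Poly_Mapping.keys p" for K
  using that
 proof (induction K)
  case empty
  have "pcls S E 0 : hpart (wp w) 0" unfolding wp_hpart by(intro bexI[of _ 0]) auto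
  hence "pcls S E 0 : ?A" by(rule W.aspan_incl[OF UN_I[OF UNIV_I]])
  thus ?case by simp
 next
  case (insert m K)
  let ?s = "single m (lookup p m)"
  have "pcls S E ?s : hpart (wp w) (mwt w m)"
   unfolding wp_hpart using s insert by(intro bexI[of _ ?s]) auto
  hence "pcls S E ?s : ?A" by(rule W.aspan_incl[OF UN_I[OF UNIV_I]])
  thus ?case
   using insert s class_add[of ?s "\<Sum>m\<in>K. single m (lookup p m)"]
    W.aspan_add[of "pcls S E ?s"] by(auto simp: weighted_pres_def)
 qed
 from this[of "Poly_Mapping.keys p"] show ?thesis using p pm_sum_singles[of p] by simp
qed

text \<open>The target family may be any \<open>gfam\<close>, not only a grading. Applied to the
  identity and a family of spans, the lemma shows that the spans exhaust the homogeneous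
  parts.\<close>

lemma wp_graded_hom:
 assumes Q: "gfam Q H" and h: "h : ring_hom (wp w) Q" and hg: "!!g. g : S ==> h (pcls S E (zvar g)) : H (w g)"
  and x: "x : hpart (wp w) n"
 shows "h x : H n"
proof -
 interpret gfam Q H by fact
 obtain p where p: "p : car (zpolys S)" "x = pcls S E p" "ALL m:Poly_Mapping.keys p. mwt w m = n"
  using x by(auto simp: wp_hpart)
 let ?f = "%g. h (pcls S E (zvar g))"
 have f: "?f ` S <= car Q" using hg H_carr by blast
 have hc: "h \<circ> pcls S E : ring_hom (zpolys S) Q"
  using h unfolding wp_hom by(rule ring_hom_trans[OF pres_class_hom])
 have "h x = zeval Q ?f p" using zpoly_hom_eq_zeval[OF cring_axioms f hc _ p(1)] p(2) by simp
 moreover have "zeval Q ?f p : H n"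
  by(rule zeval_H[where w = w]) (use p hg in "auto simp: carrier_zpoly_ring")
 ultimately show ?thesis by simp
qed

end

section \<open>Directness of gradings\<close>

text \<open>Directness is expressed by projections: additive maps that fix one homogeneous part and
  kill the others.\<close>

locale graded_cring = gfam R "hpart R" for R :: "'a graded_ring" (structure) +
 fixes pr :: "nat => 'a => 'a"
 assumes span: "x : car R ==> x : aspan R (\<Union>n. hpart R n)"
  and pr_carr: "x : car R ==> pr n x : car R"
  and pr_add: "[|x : car R; y : car R|] ==> pr n (x \<oplus> y) = pr n x \<oplus> pr n y"
  and pr_hpart: "x : hpart R m ==> pr n x = (if n = m then x else \<zero>)"
begin

lemma UN_carr: "(\<Union>n. hpart R n) <= car R"
 using H_carr by blast

lemma pr_zero: "pr n \<zero> = \<zero>"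
 using pr_hpart[OF H_zero[of n], of n] by simp

lemma pr_neg: "x : car R ==> pr n (\<ominus> x) = \<ominus> pr n x"
 using pr_add[of "\<ominus> x" x n] pr_zero pr_carr[of x n] pr_carr[of "\<ominus> x" n] minus_equality[of "pr n (\<ominus> x)" "pr n x"]
 by(simp add: l_neg)

lemma pr_in: "x : car R ==> pr n x : hpart R n"
proof -
 assume "x : car R"
 from span[OF this] UN_carr show ?thesis
 proof (induction x rule: aspan_induct)
  case (incl x) thus ?case using pr_hpart H_zero by auto
 qed (auto simp: pr_zero pr_neg pr_add H_zero H_neg H_add)
qed

lemma pr_smult: assumes s: "s : hpart R 0" and x: "x : car R" shows "pr n (s \<otimes> x) = s \<otimes> pr n x"
 using span[OF x] UN_carr
proof (induction x rule: aspan_induct)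
 case zero thus ?case using H_carr[OF s] by(simp add: pr_zero)
next
 case (incl x)
 then obtain m where m: "x : hpart R m" by blast
 show ?case using pr_hpart[OF H_mult[OF s m], of n] pr_hpart[OF m, of n] H_carr[OF s] by auto
next
 case (neg x)
 thus ?case using H_carr[OF s] pr_neg[of "s \<otimes> x"] pr_carr[of x] by(simp add: r_minus pr_neg)
next
 case (add x y)
 thus ?case using H_carr[OF s] pr_carr[of x] pr_carr[of y] by(simp add: r_distr pr_add)
qed

end

text \<open>A grading is direct as soon as there is a homomorphism to polynomials sending homogeneous \<open>x\<close>
 of degree \<open>n\<close> to \<open>x t^n\<close>.\<close>

lemma graded_cringI:
 assumes g: "gfam R (hpart R)" and span: "!!x. x : car R ==> x : aspan R (\<Union>n. hpart R n)"
  and h: "h : ring_hom R (UP R)" and hp: "!!x n. x : hpart R n ==> h x = upm R x n"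
 shows "graded_cring R (%n x. upc R (h x) n)"
proof -
 interpret gfam R "hpart R" by(rule g)
 interpret U: UP_cring R "UP R" by(rule UP_cring.intro) (rule cring_axioms, simp)
 show ?thesis
 proof (intro graded_cring.intro graded_cring_axioms.intro g span)
  fix x n assume "x : car R" thus "upc R (h x) n : car R" using rh_cl[OF h] by simp
 next
  fix x y n assume "x : car R" "y : car R"
  thus "upc R (h (x +[R] y)) n = upc R (h x) n +[R] upc R (h y) n"
   using ring_hom_add[OF h] rh_cl[OF h] by simp
 next
  fix x m n assume "x : hpart R m"
  thus "upc R (h x) n = (if n = m then x else 0[R])" using hp H_carr by auto
 qed simp
qed

section \<open>Rescaling formal modules by a polynomial variable\<close>

context cring
begin

interpretation U: UP_cring R "UP R" by(rule UP_cring.intro) (rule cring_axioms, simp)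

lemma gfam_monom: "gfam (UP R) (%n. {upm R a n | a. a : car R})"
proof (intro gfam.intro gfam_axioms.intro U.UP_cring)
 let ?P = "UP R"
 show "additive_subgroup {up_ring.monom ?P a n | a. a : car R} ?P" for n
 proof (rule additive_subgroupI, rule U.P.add.subgroupI)
  fix x y assume "x : {up_ring.monom ?P a n | a. a : car R}" "y : {up_ring.monom ?P a n | a. a : car R}"
  then obtain a b where "x = up_ring.monom ?P a n" "a : car R" "y = up_ring.monom ?P b n" "b : car R" by blast
  thus "x +[?P] y : {up_ring.monom ?P a n | a. a : car R}"
   using U.monom_add[of a b n] by(auto intro!: exI[of _ "a \<oplus> b"])
 next
  fix x assume "x : {up_ring.monom ?P a n | a. a : car R}"
  then obtain a where "x = up_ring.monom ?P a n" "a : car R" by blast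
  thus "-[?P] x : {up_ring.monom ?P a n | a. a : car R}"
   using U.monom_a_inv[of a n] by(auto intro!: exI[of _ "\<ominus> a"])
 qed auto
 show "1[?P] : {up_ring.monom ?P a 0 | a. a : car R}" using U.monom_one by(auto intro!: exI[of _ "\<one>"])
 fix x y m n assume "x : {up_ring.monom ?P a m | a. a : car R}" "y : {up_ring.monom ?P a n | a. a : car R}"
 then obtain a b where "x = up_ring.monom ?P a m" "a : car R" "y = up_ring.monom ?P b n" "b : car R" by blast
 thus "x *[?P] y : {up_ring.monom ?P a (m + n) | a. a : car R}"
  using U.monom_mult[of a b m n] by(auto intro!: exI[of _ "a \<otimes> b"])
qed

text \<open>Evaluation of polynomials at \<open>t = 1\<close>, a left inverse of every map
  \<open>x \<mapsto> x t^n\<close>.\<close>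

definition ev1 :: "(nat => 'a) => 'a" where "ev1 = UnivPoly.eval R R (%x. x) \<one>"

lemma ev1_hom: "ev1 : ring_hom (UP R) R" and ev1_monom: "a : car R ==> ev1 (upm R a n) = a"
proof -
 have "(%x. x) : ring_hom R R" by(auto simp: ring_hom_def)
 then interpret E: UP_pre_univ_prop R R "%x. x" "UP R"
  by(rule UP_pre_univ_propI[OF cring_axioms cring_axioms]) simp
 show "ev1 : ring_hom (UP R) R" unfolding ev1_def by(rule E.eval_ring_hom[OF one_closed])
 have "a \<otimes> \<one> [^] n = a" if "a : car R" for a using r_one[OF that] by(simp only: nat_pow_one)
 thus "ev1 (upm R a n) = a" if "a : car R"
  unfolding ev1_def using E.eval_monom[OF that one_closed, of n] that by(simp only:)
qed

lemma ev1_same: "[|(x, y) : same_part (%n. {upm R a n | a. a : car R}); ev1 x = ev1 y|] ==> x = y"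
 by(auto simp: same_part_def ev1_monom)

lemma scaled_hmod:
 assumes "formal_module A R d"
 shows "gfam.hmod (UP R) (%n. {upm R a n | a. a : car R}) A (%g. upm R (d g) (mod_weight g))"
proof -
 interpret g: gfam "UP R" "%n. {upm R a n | a. a : car R}" by(rule gfam_monom)
 note D = formal_moduleD[OF assms]
 show ?thesis unfolding g.hmod_def ball_mod_gens using D(1-3,7) D(5)[of 0] by auto
qed

lemma formal_module_eqD: "[|formal_module A Q d; (x, y) : module_eqs A Q d|] ==> x = y"
 unfolding formal_module_def by(drule conjunct2, drule bspec, assumption, simp)

lemma strict_iso_eqD: "[|strict_iso A Q d; (x, y) : iso_eqs A Q d|] ==> x = y"
 unfolding strict_iso_def by(drule conjunct2, drule bspec, assumption, simp)

lemma scaled_formal_module: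
 assumes A: "cring A" and d: "formal_module A R d"
 shows "formal_module A (UP R) (%g. upm R (d g) (mod_weight g))"
proof -
 let ?H = "%n. {upm R a n | a. a : car R}" and ?d = "%g. upm R (d g) (mod_weight g)"
 interpret g: gfam "UP R" ?H by(rule gfam_monom)
 interpret e: ring_hom_cring "UP R" R ev1 by(rule rh_cringI[OF U.UP_cring cring_axioms ev1_hom])
 have dc: "d ` mod_gens A <= car R" using d by(simp add: formal_module_def)
 hence dt: "?d ` mod_gens A <= car (UP R)" by auto
 have im: "map_prod ev1 ev1 ` module_eqs A (UP R) ?d = module_eqs A R d"
  unfolding e.image_module_eqs[OF A dt] by(rule module_eqs_cong[OF A]) (use dc in "auto simp: ev1_monom")
 have "x = y" if xy: "(x, y) : module_eqs A (UP R) ?d" for x y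
 proof (rule ev1_same)
  show "(x, y) : same_part ?H" using g.module_eqs_same[OF A scaled_hmod[OF d]] xy by blast
  have "(ev1 x, ev1 y) : module_eqs A R d" unfolding im[symmetric] using xy by force
  thus "ev1 x = ev1 y" by(rule formal_module_eqD[OF d])
 qed
 hence "\<forall>(x, y)\<in>module_eqs A (UP R) ?d. x = y" by(auto simp only:)
 thus ?thesis unfolding formal_module_def using dt by(intro conjI)
qed

lemma scaled_strict_iso:
 assumes A: "cring A" and d: "strict_iso A R d"
 shows "strict_iso A (UP R) (%g. upm R (d g) (iso_weight g))"
proof -
 let ?H = "%n. {upm R a n | a. a : car R}" and ?d = "%g. upm R (d g) (iso_weight g)"
 interpret g: gfam "UP R" ?H by(rule gfam_monom)
 interpret e: ring_hom_cring "UP R" R ev1 by(rule rh_cringI[OF U.UP_cring cring_axioms ev1_hom])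
 note D = strict_isoD[OF d]
 have dc: "d ` iso_gens A <= car R" using d by(simp add: strict_iso_def)
 hence dt: "?d ` iso_gens A <= car (UP R)" by auto
 have im: "map_prod ev1 ev1 ` iso_eqs A (UP R) ?d = iso_eqs A R d"
  unfolding e.image_iso_eqs[OF A dt] by(rule iso_eqs_cong[OF A]) (use dc in "auto simp: ev1_monom")
 have "x = y" if xy: "(x, y) : iso_eqs A (UP R) ?d" for x y
 proof (rule ev1_same)
  have "iso_eqs A (UP R) ?d \<subseteq> same_part ?H"
   by(rule g.iso_eqs_same[OF A]) (use scaled_hmod[OF D(1)] scaled_hmod[OF D(2)] D(3,4) in auto)
  thus "(x, y) : same_part ?H" using xy by blast
  have "(ev1 x, ev1 y) : iso_eqs A R d" unfolding im[symmetric] using xy by force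
  thus "ev1 x = ev1 y" by(rule strict_iso_eqD[OF d])
 qed
 hence "\<forall>(x, y)\<in>iso_eqs A (UP R) ?d. x = y" by(auto simp only:)
 thus ?thesis unfolding strict_iso_def using dt by(intro conjI)
qed

end

text \<open>Packs a family \<open>H\<close> into one subring of the polynomial ring. Results about
  subrings then yield graded results by way of the rescaled module.\<close>

lemma (in gfam) gfam_coeffs: "gfam (UP R) (%_. {p : car (UP R). ALL n. upc R p n : H n})" (is "gfam _ (%_. ?B)")
proof -
 interpret U: UP_cring R "UP R" by(rule UP_cring.intro) (rule cring_axioms, simp)
 show ?thesis
 proof (intro gfam.intro gfam_axioms.intro U.UP_cring additive_subgroupI U.P.add.subgroupI)
  have "0[UP R] : ?B" using H_zero by auto
  thus "?B ~= {}" by blast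
  show "1[UP R] : ?B" using H_zero H_one by auto
  fix p assume p: "p : ?B"
  thus "-[UP R] p : ?B" using H_neg by auto
  fix q assume q: "q : ?B"
  show "p +[UP R] q : ?B" using p q H_add by auto
  have "upc R (p *[UP R] q) n : H n" for n
  proof -
   have "upc R p i \<otimes> upc R q (n - i) : H n" if "i <= n" for i
    using H_mult[of "upc R p i" i "upc R q (n - i)" "n - i"] p q that by auto
   thus ?thesis using p q by(auto intro!: H_finsum)
  qed
  thus "p *[UP R] q : ?B" using p q by auto
 qed auto
qed

section \<open>Finite generation in each degree\<close>

text \<open>Only factors of positive degree are allowed, which leaves finitely many products in each
  degree; degree zero is supplied by scalars from \<open>A\<close>.\<close>

inductive gprod :: "('r, 'm) ring_scheme => (nat => 'r set) => nat => 'r => bool" for R G where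
 one: "gprod R G 0 1[R]"
| mult: "[|g : G m; m > 0; gprod R G n e|] ==> gprod R G (m + n) (g *[R] e)"

lemma gprod_finite:
 assumes "!!m. m > 0 ==> finite (G m)" shows "finite {e. gprod R G n e}"
proof (induction n rule: less_induct)
 case (less n)
 have "{e. gprod R G n e} \<subseteq> {1[R]} \<union> (\<Union>m\<in>{1..n}. (%(g, e). g *[R] e) ` (G m \<times> {e. gprod R G (n - m) e}))"
 proof
  fix e assume "e : {e. gprod R G n e}"
  hence "gprod R G n e" by simp
  thus "e : {1[R]} \<union> (\<Union>m\<in>{1..n}. (%(g, e). g *[R] e) ` (G m \<times> {e. gprod R G (n - m) e}))"
  proof cases
   case (mult g m k e')
   hence "(g, e') : G m \<times> {e. gprod R G (n - m) e}" "m : {1..n}" by auto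
   thus ?thesis using mult(2) by force
  qed simp
 qed
 moreover have "finite ((%(g, e). g *[R] e) ` (G m \<times> {e. gprod R G (n - m) e}))" if "m : {1..n}" for m
  using assms less that by auto
 ultimately show ?case by(meson finite_UN_I finite_Un finite_atLeastAtMost finite.emptyI finite.insertI finite_subset)
qed

definition fin_deg :: "('k, 'm) ring_scheme => 'r graded_ring => ('k => 'r) => bool" where
 "fin_deg A R s \<longleftrightarrow> (ALL n. EX E. finite E & E \<subseteq> hpart R n & hpart R n \<subseteq> aspan R {s a *[R] e | a e. a : car A & e : E})"

lemma gfam_gprod:
 assumes A: "cring A" and R: "cring R" and s: "s : ring_hom A R" and G: "!!m. G m <= car R"
 shows "gfam R (%n. aspan R {s a *[R] e | a e. a : car A & gprod R G n e})"
proof -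
 interpret A: cring A by fact
 interpret R: cring R by fact
 note sc = rh_cl[OF s]
 let ?V = "%n. {s a *[R] e | a e. a : car A & gprod R G n e}"
 have ec: "e : car R" if "gprod R G n e" for n e
  using that by(induction rule: gprod.induct) (use G in auto)
 have em: "gprod R G (m + n) (e *[R] f)" if "gprod R G m e" "gprod R G n f" for e f m n
  using that
 proof (induction rule: gprod.induct)
  case one thus ?case using ec by simp
 next
  case (mult g m k e)
  have "g *[R] (e *[R] f) = g *[R] e *[R] f"
   using R.m_assoc[OF subsetD[OF G mult(1)] ec[OF mult(3)] ec[OF mult(5)]] by(rule sym)
  thus ?case using gprod.mult[OF mult(1,2) mult(4)[OF mult(5)]] by(simp add: add.assoc)
 qed
 have V: "?V n <= car R" for n using ec sc by auto
 show ?thesis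
 proof (intro gfam.intro gfam_axioms.intro R R.aspan_subgroup V)
  have "s 1[A] *[R] 1[R] : ?V 0" using gprod.one[of R G] A.one_closed by blast
  from R.aspan_incl[OF this] show "1[R] : aspan R (?V 0)" by(simp add: ring_hom_one[OF s])
  fix x y m n assume xy: "x : aspan R (?V m)" "y : aspan R (?V n)"
  show "x *[R] y : aspan R (?V (m + n))"
  proof (rule R.aspan_mult[OF xy V V R.aspan_subgroup[OF V]])
   fix v w assume "v : ?V m" "w : ?V n"
   then obtain a e b f where *: "v = s a *[R] e" "a : car A" "gprod R G m e"
    "w = s b *[R] f" "b : car A" "gprod R G n f" by blast
   have "v *[R] w = s (a *[A] b) *[R] (e *[R] f)"
    using * sc ec by(simp add: ring_hom_mult[OF s] R.m_ac)
   moreover have "s (a *[A] b) *[R] (e *[R] f) : ?V (m + n)" using * em A.m_closed by blast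
   from R.aspan_incl[OF this] have "s (a *[A] b) *[R] (e *[R] f) : aspan R (?V (m + n))" .
   ultimately show "v *[R] w : aspan R (?V (m + n))" by(simp only:)
  qed
 qed
qed

section \<open>The graded rings of formal modules and strict isomorphisms\<close>

locale base_ring = A: cring A for A :: "('a, 'm) ring_scheme"
begin

lemma A_cring: "cring A" ..

sublocale L: presentation "mod_gens A" "mod_rels A"
proof
 interpret Z: cring "zpolys (mod_gens A)" by(rule zpoly_cring)
 show "mod_rels A <= car (zpolys (mod_gens A))"
  using Z.module_eqs_closed[OF A_cring, of zvar] by(auto simp: mod_rels_def image_subset_iff)
qed

sublocale LB: presentation "iso_gens A" "iso_rels A"
proof
 interpret Z: cring "zpolys (iso_gens A)" by(rule zpoly_cring)
 show "iso_rels A <= car (zpolys (iso_gens A))"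
  using Z.iso_eqs_closed[OF A_cring, of zvar] by(auto simp: iso_rels_def image_subset_iff)
qed

lemma L_eq: "L_ring A = L.wp mod_weight" and LB_eq: "LB_ring A = LB.wp iso_weight"
 by(simp_all add: L_ring_def LB_ring_def)

lemma L_cring: "cring (L_ring A)" and LB_cring: "cring (LB_ring A)"
 unfolding L_eq LB_eq by(rule L.wp_cring, rule LB.wp_cring)

sublocale LR: cring "L_ring A" by(rule L_cring)
sublocale LBR: cring "LB_ring A" by(rule LB_cring)

lemma L_univ: "formal_module A (L_ring A) (L_gen A)"
 using L_ring_corepresents(1)[OF A_cring L_cring, of "%x. x"] by(simp add: ring_hom_def)

lemma LB_univ: "strict_iso A (LB_ring A) (LB_gen A)"
 using LB_ring_corepresents(1)[OF A_cring LB_cring, of "%x. x"] by(simp add: ring_hom_def)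

lemma L_hom_module: "[|cring R; h : ring_hom (L_ring A) R|] ==> formal_module A R (%g. h (L_gen A g))"
 by(rule L_ring_corepresents(1)[OF A_cring])

lemma LB_hom_iso: "[|cring R; h : ring_hom (LB_ring A) R|] ==> strict_iso A R (%g. h (LB_gen A g))"
 by(rule LB_ring_corepresents(1)[OF A_cring])

lemma L_gen_closed: "g : mod_gens A ==> L_gen A g : car (L_ring A)"
 using L_univ by(auto simp: formal_module_def)

lemma LB_gen_closed: "g : iso_gens A ==> LB_gen A g : car (LB_ring A)"
 using LB_univ by(auto simp: strict_iso_def)

lemma L_pres_map:
 assumes R: "cring R" and d: "formal_module A R d"
 shows "pres_map R d : ring_hom (L_ring A) R" "g : mod_gens A ==> pres_map R d (L_gen A g) = d g"
proof -
 obtain h where h: "h : ring_hom (L_ring A) R" "ALL g:mod_gens A. h (L_gen A g) = d g"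
  using L_ring_corepresents(2)[OF A_cring R d] by blast
 have e: "pres_map R d x = h x" if "x : car (L_ring A)" for x
  by(rule L.pres_map_eq_hom[OF R]) (use h that in "auto simp: L_eq L.wp_hom L.wp_carrier L_gen_def")
 show "pres_map R d : ring_hom (L_ring A) R"
  using h(1) by(simp add: ring_hom_def Pi_iff e)
 show "g : mod_gens A ==> pres_map R d (L_gen A g) = d g"
  using h(2) e L_gen_closed by simp
qed

lemma LB_pres_map:
 assumes R: "cring R" and d: "strict_iso A R d"
 shows "pres_map R d : ring_hom (LB_ring A) R" "g : iso_gens A ==> pres_map R d (LB_gen A g) = d g"
proof -
 obtain h where h: "h : ring_hom (LB_ring A) R" "ALL g:iso_gens A. h (LB_gen A g) = d g"
  using LB_ring_corepresents(2)[OF A_cring R d] by blast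
 have e: "pres_map R d x = h x" if "x : car (LB_ring A)" for x
  by(rule LB.pres_map_eq_hom[OF R]) (use h that in "auto simp: LB_eq LB.wp_hom LB.wp_carrier LB_gen_def")
 show "pres_map R d : ring_hom (LB_ring A) R"
  using h(1) by(simp add: ring_hom_def Pi_iff e)
 show "g : iso_gens A ==> pres_map R d (LB_gen A g) = d g"
  using h(2) e LB_gen_closed by simp
qed

lemma L_hom_ext:
 assumes "cring R" "h : ring_hom (L_ring A) R" "h' : ring_hom (L_ring A) R"
  "!!g. g : mod_gens A ==> h (L_gen A g) = h' (L_gen A g)" "x : car (L_ring A)"
 shows "h x = h' x"
 using L.hom_ext[OF assms(1), of h h' x] assms by(simp add: L_eq L.wp_hom L.wp_carrier L_gen_def)

lemma LB_hom_ext: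
 assumes "cring R" "h : ring_hom (LB_ring A) R" "h' : ring_hom (LB_ring A) R"
  "!!g. g : iso_gens A ==> h (LB_gen A g) = h' (LB_gen A g)" "x : car (LB_ring A)"
 shows "h x = h' x"
 using LB.hom_ext[OF assms(1), of h h' x] assms by(simp add: LB_eq LB.wp_hom LB.wp_carrier LB_gen_def)

lemma L_gfam: "gfam (L_ring A) (hpart (L_ring A))" and LB_gfam: "gfam (LB_ring A) (hpart (LB_ring A))"
 unfolding L_eq LB_eq by(rule L.wp_gfam, rule LB.wp_gfam)

lemma L_gen_hpart: "g : mod_gens A ==> L_gen A g : hpart (L_ring A) (mod_weight g)"
 unfolding L_eq L_gen_def by(rule L.wp_gen)

lemma LB_gen_hpart: "g : iso_gens A ==> LB_gen A g : hpart (LB_ring A) (iso_weight g)"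
 unfolding LB_eq LB_gen_def by(rule LB.wp_gen)

lemma L_graded_hom:
 assumes "gfam Q H" "h : ring_hom (L_ring A) Q" "!!g. g : mod_gens A ==> h (L_gen A g) : H (mod_weight g)" "x : hpart (L_ring A) n"
 shows "h x : H n"
 by(rule L.wp_graded_hom[OF assms(1), where w = mod_weight]) (use assms in "simp_all add: L_eq L_gen_def")

lemma LB_graded_hom:
 assumes "gfam Q H" "h : ring_hom (LB_ring A) Q" "!!g. g : iso_gens A ==> h (LB_gen A g) : H (iso_weight g)" "x : hpart (LB_ring A) n"
 shows "h x : H n"
 by(rule LB.wp_graded_hom[OF assms(1), where w = iso_weight]) (use assms in "simp_all add: LB_eq LB_gen_def")

text \<open>The rescaled module is classified by a homomorphism \<open>p\<close> to polynomials. At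
  \<open>t = 1\<close> it becomes \<open>h\<close>, and it sends degree \<open>n\<close> to
  multiples of \<open>t^n\<close>; together these determine it on homogeneous elements.\<close>

lemma L_scaled:
 assumes R: "cring R" and h: "h : ring_hom (L_ring A) R"
 defines "p == pres_map (UP R) (%g. upm R (h (L_gen A g)) (mod_weight g))"
 shows "p : ring_hom (L_ring A) (UP R)" "x : hpart (L_ring A) n ==> p x = upm R (h x) n"
  "g : mod_gens A ==> p (L_gen A g) = upm R (h (L_gen A g)) (mod_weight g)"
proof -
 interpret R: cring R by fact
 interpret U: UP_cring R "UP R" by(rule UP_cring.intro) (rule R, simp)
 note s = R.scaled_formal_module[OF A_cring L_hom_module[OF R h]]
 show p: "p : ring_hom (L_ring A) (UP R)" and pg: "g : mod_gens A ==> p (L_gen A g) = upm R (h (L_gen A g)) (mod_weight g)" for g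
  unfolding p_def by(rule L_pres_map[OF U.UP_cring s], rule L_pres_map[OF U.UP_cring s])
 have e: "R.ev1 (p x) = h x" if "x : car (L_ring A)" for x
 proof (rule L_hom_ext[OF R _ h _ that, of "%x. R.ev1 (p x)"])
  show "(%x. R.ev1 (p x)) : ring_hom (L_ring A) R"
   using ring_hom_trans[OF p R.ev1_hom] by(simp add: comp_def)
 qed (use pg L_gen_closed rh_cl[OF h] R.ev1_monom in auto)
 assume x: "x : hpart (L_ring A) n"
 have "p x : {upm R a n | a. a : car R}"
  by(rule L_graded_hom[OF R.gfam_monom p _ x]) (use pg L_gen_closed rh_cl[OF h] in auto)
 then obtain a where a: "p x = upm R a n" "a : car R" by blast
 hence "a = h x" using e[OF gfam.H_carr[OF L_gfam x]] R.ev1_monom by simp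
 thus "p x = upm R (h x) n" using a by simp
qed

lemma LB_scaled:
 assumes R: "cring R" and h: "h : ring_hom (LB_ring A) R"
 defines "p == pres_map (UP R) (%g. upm R (h (LB_gen A g)) (iso_weight g))"
 shows "p : ring_hom (LB_ring A) (UP R)" "x : hpart (LB_ring A) n ==> p x = upm R (h x) n"
  "g : iso_gens A ==> p (LB_gen A g) = upm R (h (LB_gen A g)) (iso_weight g)"
proof -
 interpret R: cring R by fact
 interpret U: UP_cring R "UP R" by(rule UP_cring.intro) (rule R, simp)
 note s = R.scaled_strict_iso[OF A_cring LB_hom_iso[OF R h]]
 show p: "p : ring_hom (LB_ring A) (UP R)" and pg: "g : iso_gens A ==> p (LB_gen A g) = upm R (h (LB_gen A g)) (iso_weight g)" for g
  unfolding p_def by(rule LB_pres_map[OF U.UP_cring s], rule LB_pres_map[OF U.UP_cring s])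
 have e: "R.ev1 (p x) = h x" if "x : car (LB_ring A)" for x
 proof (rule LB_hom_ext[OF R _ h _ that, of "%x. R.ev1 (p x)"])
  show "(%x. R.ev1 (p x)) : ring_hom (LB_ring A) R"
   using ring_hom_trans[OF p R.ev1_hom] by(simp add: comp_def)
 qed (use pg LB_gen_closed rh_cl[OF h] R.ev1_monom in auto)
 assume x: "x : hpart (LB_ring A) n"
 have "p x : {upm R a n | a. a : car R}"
  by(rule LB_graded_hom[OF R.gfam_monom p _ x]) (use pg LB_gen_closed rh_cl[OF h] in auto)
 then obtain a where a: "p x = upm R a n" "a : car R" by blast
 hence "a = h x" using e[OF gfam.H_carr[OF LB_gfam x]] R.ev1_monom by simp
 thus "p x = upm R (h x) n" using a by simp
qed

lemma id_hom: "(%x. x) : ring_hom R R"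
 by(simp add: ring_hom_def)

lemma L_graded: "EX pr. graded_cring (L_ring A) pr"
proof -
 have "x : aspan (L_ring A) (\<Union>n. hpart (L_ring A) n)" if "x : car (L_ring A)" for x
  using L.wp_span that unfolding L_eq .
 thus ?thesis using graded_cringI[OF L_gfam _ L_scaled(1,2)[OF L_cring id_hom]] by blast
qed

lemma LB_graded: "EX pr. graded_cring (LB_ring A) pr"
proof -
 have "x : aspan (LB_ring A) (\<Union>n. hpart (LB_ring A) n)" if "x : car (LB_ring A)" for x
  using LB.wp_span that unfolding LB_eq .
 thus ?thesis using graded_cringI[OF LB_gfam _ LB_scaled(1,2)[OF LB_cring id_hom]] by blast
qed

lemma scal_hom: "formal_module A R d ==> (%a. d (Scal a)) : ring_hom A R"
 unfolding formal_module_iff image_mod_gens by(intro ring_hom_memI) auto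

lemma L_scal_hom: "L_scal A : ring_hom A (L_ring A)"
 using scal_hom[OF L_univ] by(simp add: L_scal_def[abs_def])

lemma LB_scal_hom: "LB_scal A : ring_hom A (LB_ring A)"
 using scal_hom[OF LBR.strict_isoD(1)[OF LB_univ]] by(simp add: LB_scal_def[abs_def])

lemma LB_scal_Tgt: "a : car A ==> LB_gen A (Tgt (Scal a)) = LB_scal A a"
 using LB_univ unfolding strict_iso_iff by(simp add: LB_scal_def)

lemma L_scal_hpart: "a : car A ==> L_scal A a : hpart (L_ring A) 0"
 using L_gen_hpart[of "Scal a"] by(simp add: L_scal_def)

lemma LB_scal_hpart: "a : car A ==> LB_scal A a : hpart (LB_ring A) 0"
 using LB_gen_hpart[of "Src (Scal a)"] by(simp add: LB_scal_def)

text \<open>This is \<open>hmod_closed_generate\<close> for the rescaled module over the polynomial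
  ring and the subring of \<open>gfam_coeffs\<close>.\<close>

lemma Act_mem:
 assumes N: "gfam R N" and d: "formal_module A R d" and S: "S <= car A" "generate_ring A S = car A"
  and F: "!!i j. d (FCoeff i j) : N (2 * (i + j - 1))"
  and act: "!!s i. s : insert (-[A] 1[A]) S ==> d (Act s i) : N (2 * (i - 1))" and a: "a : car A"
 shows "d (Act a i) : N (2 * (i - 1))"
proof -
 interpret N: gfam R N by fact
 interpret U: UP_cring R "UP R" by(rule UP_cring.intro) (rule N.cring_axioms, simp)
 let ?B = "{p : car (UP R). ALL n. upc R p n : N n}"
 interpret B: gfam "UP R" "%_. ?B" by(rule N.gfam_coeffs)
 note sc = N.scaled_formal_module[OF A_cring d]
 have mB: "upm R x n : ?B" if "x : N n" for x n
  using that N.H_carr N.H_zero by auto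
 have mem: "upm R (d (Act a i)) (mod_weight (Act a i)) : ?B"
 proof (rule B.hmod_closed_generate[OF A_cring sc S(1) refl])
  show "a : generate_ring A S" using a S(2) by simp
 qed (use mB F act in simp_all)
 have dc: "d (Act a i) : car R" using d a unfolding formal_module_iff image_mod_gens by blast
 from mem have "upc R (upm R (d (Act a i)) (2 * (i - 1))) n : N n" for n
  unfolding mod_weight.simps by blast
 from this[of "2 * (i - 1)"] show ?thesis using dc by simp
qed

end

locale fg_base_ring = base_ring +
 assumes fg: "EX S. finite S & S <= car A & generate_ring A S = car A"
begin

text \<open>The action of \<open>A\<close> is controlled by that of finitely many elements and of
  \<open>-1\<close>, so only finitely many generators are left in each positive degree.\<close>

definition mgen :: "'a set => nat => 'a mod_gen set" where
 "mgen S n = {g. mod_weight g = n & ((EX i j. g = FCoeff i j) | (EX s:insert (-[A] 1[A]) S. EX i. g = Act s i))}"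

lemma mgen_finite: assumes "finite S" "n > 0" shows "finite (mgen S n)"
proof -
 have "mgen S n \<subseteq> (%(i, j). FCoeff i j) ` ({..n + 1} \<times> {..n + 1}) \<union> (%(s, i). Act s i) ` (insert (-[A] 1[A]) S \<times> {..n + 1})"
  using assms(2) by(force simp: mgen_def)
 thus ?thesis by(rule finite_subset) (use assms(1) in auto)
qed

lemma mgen_sub: "S <= car A ==> mgen S n \<subseteq> mod_gens A"
 by(auto simp: mgen_def)

text \<open>In weight zero the coefficients of \<open>F\<close> and of the action are
  \<open>0\<close>, \<open>1\<close> or scalars, so only positive weights need generators. Arbitrary
  \<open>Act a i\<close> are reached by \<open>Act_mem\<close>.\<close>

lemma gens_mem:
 assumes S: "S <= car A" "generate_ring A S = car A" and R: "cring R" and d: "formal_module A R d"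
  and s: "s : ring_hom A R" "!!a. a : car A ==> d (Scal a) = s a"
  and G: "!!m. G m <= car R" "!!m g. g : mgen S m ==> d g : G m" and g: "g : mod_gens A"
 shows "d g : aspan R {s a *[R] e | a e. a : car A & gprod R G (mod_weight g) e}" (is "_ : ?N (mod_weight g)")
proof -
 interpret R: cring R by fact
 interpret N: gfam R ?N by(rule gfam_gprod[OF A_cring R s(1) G(1)])
 note D = R.formal_moduleD[OF d]
 note sc = rh_cl[OF s(1)]
 have pos: "d g : ?N m" if "g : mgen S m" "m > 0" for g m
 proof -
  have dg: "d g : car R" using that G by blast
  have "gprod R G m (d g *[R] 1[R])" using gprod.mult[of "d g" G m R 0 "1[R]", OF G(2)[OF that(1)] that(2) gprod.one] by simp
  hence "s 1[A] *[R] (d g *[R] 1[R]) : ?N m" by(intro R.aspan_incl) blast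
  thus ?thesis using dg by(simp add: ring_hom_one[OF s(1)])
 qed
 have sN: "s a : ?N 0" if "a : car A" for a
 proof -
  have "s a *[R] 1[R] : ?N 0" using that gprod.one[of R G] by(intro R.aspan_incl) blast
  thus ?thesis using sc[OF that] by simp
 qed
 have F: "d (FCoeff i j) : ?N (2 * (i + j - 1))" for i j
 proof (cases "i + j - 1 > 0")
  case True thus ?thesis using pos[of "FCoeff i j" "2 * (i + j - 1)"] by(auto simp: mgen_def)
 next
  case False
  then consider "i = 0" | "j = 0" by linarith
  hence "d (FCoeff i j) = 0[R] | d (FCoeff i j) = 1[R]" using D(5)[of i] D(6)[of j] by cases simp_all
  moreover have "2 * (i + j - 1) = 0" using False by simp
  ultimately show ?thesis using N.H_zero[of 0] N.H_one by(elim disjE; simp only:)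
 qed
 have act: "d (Act s' i) : ?N (2 * (i - 1))" if s': "s' : insert (-[A] 1[A]) S" for s' i
 proof (cases "i - 1 > 0")
  case True thus ?thesis using pos[of "Act s' i" "2 * (i - 1)"] s' by(auto simp: mgen_def)
 next
  case False
  have "s' : car A" using s' S(1) by auto
  hence v: "d (Act s' 0) = 0[R]" "d (Act s' 1) = s s'" "s s' : ?N 0"
   using D(7,8)[of s'] s(2)[of s'] sN[of s'] by(simp_all only:)
  have e: "2 * (i - 1) = 0" using False by simp
  consider "i = 0" | "i = 1" using False by linarith
  thus ?thesis unfolding e using v N.H_zero[of 0] by cases (simp_all only:)
 qed
 show ?thesis using g
 proof (cases rule: mod_gens_cases)
  case (1 a) thus ?thesis using sN s(2) by simp
 next
  case (2 i j) thus ?thesis using F by simp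
 next
  case (3 a i)
  thus ?thesis using Act_mem[OF N.gfam_axioms d S F act, of a i] by simp
 qed
qed

lemma fin_degI:
 assumes R: "gfam R (hpart R)" and s: "s : ring_hom A R" and fin: "!!m. m > 0 ==> finite (G m)"
  and G: "!!m. G m \<subseteq> hpart R m"
  and sub: "!!n. hpart R n \<subseteq> aspan R {s a *[R] e | a e. a : car A & gprod R G n e}"
 shows "fin_deg A R s"
 unfolding fin_deg_def
proof
 fix n
 interpret gfam R "hpart R" by fact
 have "e : hpart R n" if "gprod R G n e" for e n
  using that by(induction rule: gprod.induct) (use H_one H_mult G in blast)+
 thus "EX E. finite E & E \<subseteq> hpart R n & hpart R n \<subseteq> aspan R {s a *[R] e | a e. a : car A & e : E}"
  using gprod_finite[OF fin, where R = R and n = n] sub[of n] by(intro exI[of _ "{e. gprod R G n e}"]) auto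
qed

lemma L_fin_deg: "fin_deg A (L_ring A) (L_scal A)"
proof -
 obtain S where S: "finite S" "S <= car A" "generate_ring A S = car A" using fg by blast
 let ?G = "%m. L_gen A ` mgen S m"
 have Gh: "?G m \<subseteq> hpart (L_ring A) m" for m
  using mgen_sub[OF S(2), of m] L_gen_hpart by(fastforce simp: mgen_def)
 have Gc: "?G m <= car (L_ring A)" for m
  using order_trans[OF Gh additive_subgroup.a_subset[OF gfam.H_sub[OF L_gfam]]] .
 show ?thesis
 proof (rule fin_degI[OF L_gfam L_scal_hom _ Gh])
  show "finite (?G m)" if "m > 0" for m using mgen_finite[OF S(1) that] by simp
  fix n
  show "hpart (L_ring A) n \<subseteq> aspan (L_ring A) {L_scal A a *[L_ring A] e | a e. a : car A & gprod (L_ring A) ?G n e}"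
  proof
   fix x assume x: "x : hpart (L_ring A) n"
   have sc: "L_gen A (Scal a) = L_scal A a" for a by(simp add: L_scal_def)
   have "L_gen A g : aspan (L_ring A) {L_scal A a *[L_ring A] e | a e. a : car A & gprod (L_ring A) ?G (mod_weight g) e}"
    if "g : mod_gens A" for g
    by(rule gens_mem[OF S(2,3) L_cring L_univ L_scal_hom sc Gc _ that]) (rule imageI)
   from L_graded_hom[OF gfam_gprod[OF A_cring L_cring L_scal_hom Gc] id_hom this x]
   show "x : aspan (L_ring A) {L_scal A a *[L_ring A] e | a e. a : car A & gprod (L_ring A) ?G n e}" .
  qed
 qed
qed

lemma LB_fin_deg: "fin_deg A (LB_ring A) (LB_scal A)"
proof -
 obtain S where S: "finite S" "S <= car A" "generate_ring A S = car A" using fg by blast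
 let ?K = "%m. Src ` mgen S m \<union> Tgt ` mgen S m \<union> {IsoCoeff i | i. 2 * (i - 1) = m}"
 let ?G = "%m. LB_gen A ` ?K m"
 note U = LBR.strict_isoD[OF LB_univ]
 have Kw: "g : iso_gens A & iso_weight g = m" if "g : ?K m" for g m
  using that mgen_sub[OF S(2), of m] by(auto simp: mgen_def)
 have Gh: "?G m \<subseteq> hpart (LB_ring A) m" for m
 proof (rule image_subsetI)
  fix g assume "g : ?K m"
  thus "LB_gen A g : hpart (LB_ring A) m" using Kw[of g m] LB_gen_hpart[of g] by simp
 qed
 have Gc: "?G m <= car (LB_ring A)" for m
  using order_trans[OF Gh additive_subgroup.a_subset[OF gfam.H_sub[OF LB_gfam]]] .
 let ?N = "%n. aspan (LB_ring A) {LB_scal A a *[LB_ring A] e | a e. a : car A & gprod (LB_ring A) ?G n e}"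
 interpret N: gfam "LB_ring A" ?N by(rule gfam_gprod[OF A_cring LB_cring LB_scal_hom Gc])
 show ?thesis
 proof (rule fin_degI[OF LB_gfam LB_scal_hom _ Gh])
  show "finite (?G m)" if "m > 0" for m
  proof -
   have "{IsoCoeff i | i. 2 * (i - 1) = m} \<subseteq> IsoCoeff ` {..m + 1}" using that by force
   hence "finite {IsoCoeff i :: 'a iso_gen | i. 2 * (i - 1) = m}" by(rule finite_subset) simp
   thus ?thesis using mgen_finite[OF S(1) that] by simp
  qed
  fix n
  have "LB_gen A g : ?N (iso_weight g)" if "g : iso_gens A" for g
   using that
  proof (cases rule: iso_gens_cases)
   case (1 h)
   thus ?thesis
    unfolding 1(1) iso_weight.simps
    by(intro gens_mem[OF S(2,3) LB_cring U(1) LB_scal_hom _ Gc _ 1(2)]) (simp_all add: LB_scal_def)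
  next
   case (2 h)
   thus ?thesis
    unfolding 2(1) iso_weight.simps
    by(intro gens_mem[OF S(2,3) LB_cring U(2) LB_scal_hom _ Gc _ 2(2)]) (simp_all add: LB_scal_Tgt)
  next
   case (3 i)
   show ?thesis
   proof (cases "i - 1 > 0")
    case True
    hence g: "LB_gen A (IsoCoeff i) : ?G (2 * (i - 1))" "2 * (i - 1) > 0" by auto
    have gc: "LB_gen A (IsoCoeff i) : car (LB_ring A)" by(rule U(3))
    have "LB_scal A 1[A] *[LB_ring A] (LB_gen A (IsoCoeff i) *[LB_ring A] 1[LB_ring A]) : ?N (2 * (i - 1))"
     using gprod.mult[of "LB_gen A (IsoCoeff i)" ?G "2 * (i - 1)" "LB_ring A" 0 "1[LB_ring A]", OF g gprod.one]
     by(intro LBR.aspan_incl) auto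
    thus ?thesis using gc 3 by(simp add: ring_hom_one[OF LB_scal_hom])
   next
    case False
    hence "i = 0 | i = 1" by linarith
    moreover have "2 * (i - 1) = 0" using False by simp
    ultimately show ?thesis
     unfolding 3 iso_weight.simps using U(4,5) N.H_zero[of 0] N.H_one by(elim disjE) (simp_all only:)
   qed
  qed
  from LB_graded_hom[OF N.gfam_axioms id_hom this]
  show "hpart (LB_ring A) n \<subseteq> ?N n" by(rule subsetI)
 qed
qed

end

section \<open>Limits of quotients\<close>

lemma (in cring) finsum_swap:
 assumes "!!i j. [|i : A; j : B|] ==> g i j : car R"
 shows "(\<Oplus>i\<in>A. \<Oplus>j\<in>B. g i j) = (\<Oplus>j\<in>B. \<Oplus>i\<in>A. g i j)"
 using assms
proof (induction A rule: infinite_finite_induct)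
 case (insert a A)
 have "(\<Oplus>i\<in>insert a A. \<Oplus>j\<in>B. g i j) = (\<Oplus>j\<in>B. g a j) \<oplus> (\<Oplus>j\<in>B. \<Oplus>i\<in>A. g i j)"
  using insert by(subst finsum_insert) auto
 also have "... = (\<Oplus>j\<in>B. g a j \<oplus> (\<Oplus>i\<in>A. g i j))"
  by(rule finsum_addf[symmetric]) (use insert in auto)
 also have "... = (\<Oplus>j\<in>B. \<Oplus>i\<in>insert a A. g i j)"
  by(rule finsum_cong') (use insert in "auto simp: finsum_insert")
 finally show ?case .
qed (simp_all add: finsum_infinite)

lemma add_image_coset:
 assumes R: "ring R" and S: "ring S" and h: "h : ring_hom R S" and J: "ideal J R" and J': "ideal J' S" and hJ: "h ` J \<subseteq> J'"
  and a: "a : car R"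
 shows "J' <+>\<^bsub>S\<^esub> h ` (J +>\<^bsub>R\<^esub> a) = J' +>\<^bsub>S\<^esub> h a"
proof -
 interpret R: ring R by fact
 interpret S: ring S by fact
 interpret J: ideal J R by fact
 interpret J': ideal J' S by fact
 note ha = rh_cl[OF h a]
 have "x : J' +>\<^bsub>S\<^esub> h a" if x: "x : J' <+>\<^bsub>S\<^esub> h ` (J +>\<^bsub>R\<^esub> a)" for x
 proof -
  obtain j' j where j: "j' : J'" "j : J" "x = j' +[S] h (j +[R] a)"
   using x by(auto simp: set_add_def' a_r_coset_def')
  have "h j : J'" using hJ j by blast
  moreover have "x = (j' +[S] h j) +[S] h a"
   using j ring_hom_add[OF h J.Icarr[OF j(2)] a] J'.Icarr `h j : J'` ha by(simp add: S.a_assoc)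
  ultimately show ?thesis using J'.a_closed[OF j(1)] by(auto simp: a_r_coset_def')
 qed
 moreover have "x : J' <+>\<^bsub>S\<^esub> h ` (J +>\<^bsub>R\<^esub> a)" if x: "x : J' +>\<^bsub>S\<^esub> h a" for x
 proof -
  obtain j' where j: "j' : J'" "x = j' +[S] h a" using x by(auto simp: a_r_coset_def')
  have "a : J +>\<^bsub>R\<^esub> a" using J.a_rcos_self[OF a] .
  thus ?thesis using j unfolding set_add_def' by blast
 qed
 ultimately show ?thesis by blast
qed

locale filtered = cring R for R (structure) + fixes J :: "nat => 'a set"
 assumes J_ideal: "ideal (J k) R" and J_Suc: "J (Suc k) \<subseteq> J k"
begin

definition cl :: "nat => 'a => 'a set" where "cl k a = J k +> a"

lemma cl_hom: "cl k : ring_hom R (R Quot J k)"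
 using ideal.rcos_ring_hom[OF J_ideal, of k] by(simp add: cl_def[abs_def])

lemma Q_cring: "cring (R Quot J k)"
 by(rule ideal.quotient_is_cring[OF J_ideal cring_axioms])

lemma Q_carrier: "car (R Quot J k) = cl k ` car R"
 by(auto simp: FactRing_def A_RCOSETS_def' cl_def)

lemma cl_eq: "[|a : car R; b : car R|] ==> cl k a = cl k b \<longleftrightarrow> a \<ominus> b : J k"
 using quotient_eq_iff_same_a_r_cos[OF J_ideal] by(simp add: cl_def)

lemma cl_zero: "a : car R ==> cl k a = cl k \<zero> \<longleftrightarrow> a : J k"
 by(simp add: cl_eq a_minus_def)

lemma J_carr: "x : J k ==> x : car R"
 using ideal.Icarr[OF J_ideal] .

lemma J_mono: "j <= k ==> J k \<subseteq> J j"
 by(rule lift_Suc_antimono_le[of J]) (rule J_Suc)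

lemma cl_mono: "[|cl k a = cl k b; j <= k; a : car R; b : car R|] ==> cl j a = cl j b"
 using J_mono by(auto simp: cl_eq)

text \<open>Elements of the limit are handled through sequences of representatives, on which the
  operations of \<open>R\<close> can be carried out; coherence is required between consecutive
  levels only.\<close>

definition coh :: "(nat => 'a) => bool" where
 "coh rh \<longleftrightarrow> (ALL k. rh k : car R & cl k (rh (Suc k)) = cl k (rh k))"

definition mk :: "(nat => 'a) => nat => 'a set" where
 "mk rh = (%k. cl k (rh k))"

lemma coh_carr: "coh rh ==> rh k : car R"
 by(simp add: coh_def)

lemma coh_le: "[|coh rh; j <= k|] ==> cl j (rh k) = cl j (rh j)"
proof (induction k)
 case (Suc k)
 show ?case
 proof (cases "j <= k")
  case True
  have "cl k (rh (Suc k)) = cl k (rh k)" using Suc by(simp add: coh_def)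
  hence "cl j (rh (Suc k)) = cl j (rh k)" by(rule cl_mono[OF _ True]) (use Suc in "auto simp: coh_def")
  thus ?thesis using Suc True by simp
 qed (use Suc in "auto simp: le_Suc_eq")
qed simp

lemma set_add_cl: "a : car R ==> J k <+> cl (Suc k) a = cl k a"
 using add_image_coset[OF ring_axioms ring_axioms _ J_ideal J_ideal, of "%x. x" "Suc k" k a] J_Suc
 by(simp add: cl_def ring_hom_def)

abbreviation "LR == adic_limit R J"

lemma lim_carrier: "x : car LR \<longleftrightarrow> (EX rh. coh rh & x = mk rh)"
proof
 assume "x : car LR"
 hence x: "!!k. x k : cl k ` car R" "!!k. J k <+> x (Suc k) = x k" by(auto simp: adic_limit_def Q_carrier)
 hence "ALL k. EX a. a : car R & x k = cl k a" by blast
 then obtain rh where rh: "!!k. rh k : car R" "!!k. x k = cl k (rh k)" by metis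
 have "cl k (rh (Suc k)) = cl k (rh k)" for k
  using x(2)[of k] set_add_cl[OF rh(1), of k "Suc k"] unfolding rh(2) by simp
 thus "EX rh. coh rh & x = mk rh" using rh by(intro exI[of _ rh]) (auto simp: coh_def mk_def)
next
 assume "EX rh. coh rh & x = mk rh"
 then obtain rh where "coh rh" "x = mk rh" by blast
 thus "x : car LR" by(auto simp: adic_limit_def Q_carrier mk_def coh_def set_add_cl)
qed

lemma limE: assumes "x : car LR" obtains rh where "coh rh" "x = mk rh"
 using assms lim_carrier by blast

lemma mk_closed: "coh rh ==> mk rh : car LR"
 using lim_carrier by blast

lemma lim_ops:
 assumes "!!k. rh k : car R" "!!k. \<xi> k : car R"
 shows "mk rh *[LR] mk \<xi> = mk (%k. rh k \<otimes> \<xi> k)" "mk rh +[LR] mk \<xi> = mk (%k. rh k \<oplus> \<xi> k)"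
 using assms ring_hom_mult[OF cl_hom] ring_hom_add[OF cl_hom] by(auto simp: adic_limit_def mk_def)

lemma lim_consts: "1[LR] = mk (%_. \<one>)" "0[LR] = mk (%_. \<zero>)"
proof -
 show "1[LR] = mk (%_. \<one>)" using ring_hom_one[OF cl_hom] by(simp add: adic_limit_def mk_def)
 have "0[R Quot J k] = cl k \<zero>" for k
  using ring_hom_zero[OF cl_hom ring_axioms cring.axioms(1)[OF Q_cring], of k] by simp
 thus "0[LR] = mk (%_. \<zero>)" by(simp add: adic_limit_def mk_def)
qed

lemma coh_const: "a : car R ==> coh (%_. a)"
 by(simp add: coh_def)

lemma cl_ring:
 assumes "a : car R" "b : car R" "a' : car R" "b' : car R" "cl k a = cl k a'" "cl k b = cl k b'"
 shows "cl k (a \<oplus> b) = cl k (a' \<oplus> b')" "cl k (a \<otimes> b) = cl k (a' \<otimes> b')" "cl k (\<ominus> a) = cl k (\<ominus> a')"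
proof -
 interpret h: ring_hom_cring R "R Quot J k" "cl k" by(rule rh_cringI[OF cring_axioms Q_cring cl_hom])
 show "cl k (a \<oplus> b) = cl k (a' \<oplus> b')" "cl k (a \<otimes> b) = cl k (a' \<otimes> b')" "cl k (\<ominus> a) = cl k (\<ominus> a')"
  using assms by(simp_all)
qed

lemma coh_ops:
 assumes "coh rh" "coh \<xi>"
 shows "coh (%k. rh k \<oplus> \<xi> k)" "coh (%k. rh k \<otimes> \<xi> k)" "coh (%k. \<ominus> rh k)"
proof -
 note r = coh_carr[OF assms(1)] coh_carr[OF assms(2)]
 have e: "cl k (rh (Suc k)) = cl k (rh k)" "cl k (\<xi> (Suc k)) = cl k (\<xi> k)" for k using assms by(simp_all add: coh_def)
 show "coh (%k. rh k \<oplus> \<xi> k)" "coh (%k. rh k \<otimes> \<xi> k)" "coh (%k. \<ominus> rh k)"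
  unfolding coh_def using r cl_ring[OF r(1) r(2) r(1) r(2) e] by simp_all
qed

lemma lim_cring: "cring LR"
proof (rule cringI)
 show "abelian_group LR"
 proof (rule abelian_groupI)
  fix x assume "x : car LR"
  then obtain rh where rh: "coh rh" "x = mk rh" by(rule limE)
  show "0[LR] +[LR] x = x" using rh coh_carr by(simp add: lim_consts lim_ops)
  show "EX y:car LR. y +[LR] x = 0[LR]"
   using rh coh_carr mk_closed[OF coh_ops(3)[OF rh(1,1)]]
   by(intro bexI[of _ "mk (%k. \<ominus> rh k)"]) (auto simp: lim_consts lim_ops l_neg)
  fix y assume "y : car LR"
  then obtain \<xi> where \<xi>: "coh \<xi>" "y = mk \<xi>" by(rule limE)
  show "x +[LR] y : car LR" using rh \<xi> coh_carr mk_closed[OF coh_ops(1)] by(simp add: lim_ops)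
  show "x +[LR] y = y +[LR] x" using rh \<xi> coh_carr by(simp add: lim_ops a_comm)
  fix z assume "z : car LR"
  then obtain ta where ta: "coh ta" "z = mk ta" by(rule limE)
  show "x +[LR] y +[LR] z = x +[LR] (y +[LR] z)" using rh \<xi> ta coh_carr by(simp add: lim_ops a_assoc)
 next
  show "0[LR] : car LR" unfolding lim_consts by(rule mk_closed) (simp add: coh_const)
 qed
 show "comm_monoid LR"
 proof (rule comm_monoidI)
  fix x assume "x : car LR"
  then obtain rh where rh: "coh rh" "x = mk rh" by(rule limE)
  show "1[LR] *[LR] x = x" using rh coh_carr by(simp add: lim_consts lim_ops)
  fix y assume "y : car LR"
  then obtain \<xi> where \<xi>: "coh \<xi>" "y = mk \<xi>" by(rule limE)
  show "x *[LR] y : car LR" using rh \<xi> coh_carr mk_closed[OF coh_ops(2)] by(simp add: lim_ops)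
  show "x *[LR] y = y *[LR] x" using rh \<xi> coh_carr by(simp add: lim_ops m_comm)
  fix z assume "z : car LR"
  then obtain ta where ta: "coh ta" "z = mk ta" by(rule limE)
  show "x *[LR] y *[LR] z = x *[LR] (y *[LR] z)" using rh \<xi> ta coh_carr by(simp add: lim_ops m_assoc)
 next
  show "1[LR] : car LR" unfolding lim_consts by(rule mk_closed) (simp add: coh_const)
 qed
 fix x y z assume "x : car LR" "y : car LR" "z : car LR"
 then obtain rh \<xi> ta where "coh rh" "x = mk rh" "coh \<xi>" "y = mk \<xi>" "coh ta" "z = mk ta" by(elim limE) blast
 thus "(x +[LR] y) *[LR] z = x *[LR] z +[LR] y *[LR] z"
  using coh_carr by(simp add: lim_ops l_distr)
qed

sublocale LR: cring LR by(rule lim_cring)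

lemma lim_neg: "coh rh ==> -[LR] mk rh = mk (%k. \<ominus> rh k)"
 by(rule LR.minus_equality) (auto simp: lim_ops lim_consts l_neg coh_carr mk_closed coh_ops)

lemma coh_finsum: "(!!i. i : I ==> coh (rh i)) ==> coh (%k. \<Oplus>i\<in>I. rh i k)"
 and lim_finsum: "(!!i. i : I ==> coh (rh i)) ==> (\<Oplus>\<^bsub>LR\<^esub>i\<in>I. mk (rh i)) = mk (%k. \<Oplus>i\<in>I. rh i k)"
proof -
 have "coh (%k. \<Oplus>i\<in>I. rh i k) & (\<Oplus>\<^bsub>LR\<^esub>i\<in>I. mk (rh i)) = mk (%k. \<Oplus>i\<in>I. rh i k)" if "!!i. i : I ==> coh (rh i)"
  using that
 proof (induction I rule: infinite_finite_induct)
  case (insert i I)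
  have e: "(%k. \<Oplus>i\<in>insert i I. rh i k) = (%k. rh i k \<oplus> (\<Oplus>i\<in>I. rh i k))"
   using insert coh_carr by(intro ext finsum_insert) auto
  have "(\<Oplus>\<^bsub>LR\<^esub>i\<in>insert i I. mk (rh i)) = mk (rh i) +[LR] (\<Oplus>\<^bsub>LR\<^esub>i\<in>I. mk (rh i))"
   using insert mk_closed by(intro LR.finsum_insert) auto
  thus ?case unfolding e using insert coh_ops(1)[of "rh i"] by(simp add: lim_ops coh_carr)
 qed (auto simp: finsum_infinite LR.finsum_infinite lim_consts coh_const)
 thus "(!!i. i : I ==> coh (rh i)) ==> coh (%k. \<Oplus>i\<in>I. rh i k)"
  "(!!i. i : I ==> coh (rh i)) ==> (\<Oplus>\<^bsub>LR\<^esub>i\<in>I. mk (rh i)) = mk (%k. \<Oplus>i\<in>I. rh i k)" by blast+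
qed

lemma mk_eq: "[|!!k. rh k : car R; !!k. \<xi> k : car R|] ==> mk rh = mk \<xi> \<longleftrightarrow> (ALL k. rh k \<ominus> \<xi> k : J k)"
 by(simp add: mk_def fun_eq_iff cl_eq)

lemma mk_zero: "(!!k. rh k : car R) ==> mk rh = 0[LR] \<longleftrightarrow> (ALL k. rh k : J k)"
 by(simp add: mk_def lim_consts fun_eq_iff cl_zero)

lemma to_limit_mk: "to_limit R J r = mk (%_. r)"
 by(simp add: to_limit_def mk_def cl_def)

lemma to_limit_hom: "to_limit R J : ring_hom R LR"
 by(rule ring_hom_memI) (auto simp: to_limit_mk lim_ops lim_consts mk_closed coh_const)

lemma proj_hom: "(%x. x k) : ring_hom LR (R Quot J k)"
 by(rule ring_hom_memI) (auto simp: adic_limit_def)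

text \<open>Convergent series: the partial sums of \<open>D\<close> are coherent when \<open>D (Suc k)\<close> is in \<open>J k\<close>.\<close>

definition psum :: "(nat => 'a) => nat => 'a" where "psum D k = (\<Oplus>j\<in>{..k}. D j)"

lemma psum_Suc: "(!!j. D j : car R) ==> psum D (Suc k) = D (Suc k) \<oplus> psum D k"
 unfolding psum_def by(rule finsum_Suc) auto

lemma psum_0: "D 0 : car R ==> psum D 0 = D 0"
 unfolding psum_def using finsum_0[of D] by simp

lemma psum_closed: "(!!j. D j : car R) ==> psum D k : car R"
 by(auto simp: psum_def)

lemma psum_coh:
 assumes "D 0 : car R" "!!k. D (Suc k) : J k" shows "coh (psum D)"
proof -
 have D: "D j : car R" for j by(cases j) (use assms J_carr in auto)
 have "psum D (Suc k) \<ominus> psum D k = D (Suc k)" for k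
  using D psum_closed[of D k] by(simp add: psum_Suc a_minus_def a_assoc r_neg)
 thus ?thesis unfolding coh_def using assms(2) D psum_closed[of D] by(simp add: cl_eq)
qed

end

text \<open>\<open>limit_map\<close> is defined by images of cosets; this computes it on sequences
  of representatives.\<close>

lemma limit_map_mk:
 assumes R: "filtered R J" and S: "filtered S J'" and h: "h : ring_hom R S" and hJ: "!!k. h ` J k \<subseteq> J' k"
 shows "(!!k. rh k : car R) ==> lmap S J' h (filtered.mk R J rh) = filtered.mk S J' (%k. h (rh k))"
  and "filtered.coh R J rh ==> filtered.coh S J' (%k. h (rh k))"
  and "lmap S J' h : ring_hom (adic_limit R J) (adic_limit S J')"
proof -
 interpret R: filtered R J by fact
 interpret S: filtered S J' by fact
 note hc = rh_cl[OF h]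
 show m: "lmap S J' h (R.mk rh) = S.mk (%k. h (rh k))" if "!!k. rh k : car R" for rh
  unfolding limit_map_def R.mk_def S.mk_def R.cl_def S.cl_def
  by(rule ext, rule add_image_coset[OF R.ring_axioms S.ring_axioms h R.J_ideal S.J_ideal hJ that])
 have hcl: "S.cl k (h a) = S.cl k (h b)" if "R.cl k a = R.cl k b" "a : car R" "b : car R" for a b k
 proof -
  interpret h: ring_hom_cring R S h by(rule rh_cringI[OF R.cring_axioms S.cring_axioms h])
  have "a -[R] b : J k" using that by(simp add: R.cl_eq)
  hence "h (a -[R] b) : J' k" using hJ by blast
  thus ?thesis using that by(simp add: S.cl_eq a_minus_def)
 qed
 show c: "S.coh (%k. h (rh k))" if "R.coh rh" for rh
  using that hc hcl unfolding R.coh_def S.coh_def by blast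
 show "lmap S J' h : ring_hom (adic_limit R J) (adic_limit S J')"
 proof (rule ring_hom_memI)
  fix x assume "x : car (adic_limit R J)"
  then obtain rh where r: "R.coh rh" "x = R.mk rh" by(rule R.limE)
  note rc = R.coh_carr[OF r(1)]
  show "lmap S J' h x : car (adic_limit S J')" using S.mk_closed[OF c[OF r(1)]] m[OF rc] r(2) by simp
  fix y assume "y : car (adic_limit R J)"
  then obtain \<xi> where s: "R.coh \<xi>" "y = R.mk \<xi>" by(rule R.limE)
  note sc = R.coh_carr[OF s(1)]
  show "lmap S J' h (x *[adic_limit R J] y) = lmap S J' h x *[adic_limit S J'] lmap S J' h y"
   using rc sc hc by(simp add: r s R.lim_ops S.lim_ops m ring_hom_mult[OF h])
  show "lmap S J' h (x +[adic_limit R J] y) = lmap S J' h x +[adic_limit S J'] lmap S J' h y"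
   using rc sc hc by(simp add: r s R.lim_ops S.lim_ops m ring_hom_add[OF h])
 qed (simp add: R.lim_consts S.lim_consts m ring_hom_one[OF h])
qed

section \<open>Graded limits\<close>

text \<open>The carrier of a graded limit is defined by finite sums of homogeneous elements; as an
  additive span it has the closure and induction rules proved above.\<close>

lemma (in gfam) finsums_eq_aspan: "{finsum R y {..N} | y N. ALL n. y n : H n} = aspan R (\<Union>n. H n)" (is "?D = ?A")
proof
 have UH: "(\<Union>n. H n) <= car R" using H_carr by blast
 interpret A: additive_subgroup ?A R by(rule aspan_subgroup[OF UH])
 show "?D \<subseteq> ?A"
 proof
  fix x assume "x : ?D"
  then obtain y N where y: "x = finsum R y {..N}" "ALL n. y n : H n" by blast
  have yc: "y n : car R" for n using H_carr[OF spec[OF y(2)]] .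
  have yA: "y n : ?A" for n by(rule aspan_incl, rule UN_I[OF UNIV_I]) (rule spec[OF y(2)])
  have "finsum R y {..N} : ?A"
  proof (induction N)
   case 0 thus ?case using finsum_0[of y] yc yA by simp
  next
   case (Suc N) thus ?case using finsum_Suc[of y N] yc yA aspan_add by auto
  qed
  thus "x : ?A" using y by simp
 qed
 show "?A \<subseteq> ?D"
 proof
  have pad: "EX y. x = finsum R y {..M} & (ALL n. y n : H n)" if "x = finsum R y {..N}" "ALL n. y n : H n" "N <= M" for x y N M
  proof (intro exI conjI)
   show "x = finsum R (%n. if n <= N then y n else \<zero>) {..M}"
    unfolding that(1) by(rule add.finprod_mono_neutral_cong_left) (use that(3) H_carr[OF spec[OF that(2)]] in auto)
   show "ALL n. (if n <= N then y n else \<zero>) : H n" using that H_zero by auto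
  qed
  fix x assume "x : ?A"
  from this UH have "EX y N. x = finsum R y {..N} & (ALL n. y n : H n)"
  proof (induction x rule: aspan_induct)
   case zero show ?case by(intro exI[of _ "%_. \<zero>"] exI[of _ 0]) (auto simp: H_zero)
  next
   case (incl x)
   then obtain m where m: "x : H m" by blast
   show ?case
    using finsum_singleton[of m "{..m}" "%_. x"] m H_carr[OF m] H_zero
    by(intro exI[of _ "%n. if m = n then x else \<zero>"] exI[of _ m]) auto
  next
   case (neg x)
   then obtain y N where y: "x = finsum R y {..N}" "ALL n. y n : H n" by blast
   have yc: "y n : car R" for n using y(2) H_carr by blast
   have "(\<Oplus>n\<in>{..N}. \<ominus> y n) \<oplus> finsum R y {..N} = (\<Oplus>n\<in>{..N}. \<ominus> y n \<oplus> y n)"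
    by(rule finsum_addf[symmetric]) (use yc in auto)
   also have "... = \<zero>" by(rule add.finprod_one_eqI) (simp add: l_neg yc)
   finally have "\<ominus> x = (\<Oplus>n\<in>{..N}. \<ominus> y n)" using minus_equality[of "\<Oplus>n\<in>{..N}. \<ominus> y n" x] y yc by simp
   thus ?case using y(2) H_neg by(intro exI[of _ "%n. \<ominus> y n"] exI[of _ N]) auto
  next
   case (add x z)
   then obtain y N y' M where y: "x = finsum R y {..N}" "ALL n. y n : H n" and y': "z = finsum R y' {..M}" "ALL n. y' n : H n" by blast
   obtain u where u: "x = finsum R u {..max M N}" "ALL n. u n : H n" using pad[OF y, of "max M N"] by auto
   obtain v where v: "z = finsum R v {..max M N}" "ALL n. v n : H n" using pad[OF y', of "max M N"] by auto
   have "x \<oplus> z = (\<Oplus>n\<in>{..max M N}. u n \<oplus> v n)"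
    unfolding u(1) v(1) by(rule finsum_addf[symmetric]) (use u v H_carr in auto)
   thus ?case using u v H_add by(intro exI[of _ "%n. u n \<oplus> v n"] exI[of _ "max M N"]) auto
  qed
  thus "x : ?D" by blast
 qed
qed

locale graded_filtered = graded_cring R pr + filtered R J for R :: "'a graded_ring" (structure) and pr J +
 assumes J_hom: "x : J k ==> pr n x : J k"
begin

text \<open>Homogeneity and coherence can be had at once: homogeneous representatives define the
  same cosets as coherent ones, and coherence depends on the cosets only.\<close>

lemma lpart_mk: "x : lpart R J n \<longleftrightarrow> (EX rh. coh rh & (ALL k. rh k : hpart R n) & x = mk rh)"
proof
 assume x: "x : lpart R J n"
 hence "ALL k. EX r. r : hpart R n & x k = cl k r" by(auto simp: limit_part_def cl_def)
 then obtain rh where r: "!!k. rh k : hpart R n" "!!k. x k = cl k (rh k)" by metis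
 obtain \<xi> where s: "coh \<xi>" "x = mk \<xi>" using x limE by(auto simp: limit_part_def)
 have e: "cl k (rh k) = cl k (\<xi> k)" for k using r(2)[of k] s(2) by(simp add: mk_def)
 have "coh rh"
  unfolding coh_def
 proof (intro allI conjI)
  fix k
  show "rh k : car R" using H_carr[OF r(1)] .
  have "cl k (rh (Suc k)) = cl k (\<xi> (Suc k))"
   by(rule cl_mono[OF e]) (use H_carr[OF r(1)] coh_carr[OF s(1)] in auto)
  thus "cl k (rh (Suc k)) = cl k (rh k)" using s(1) e[of k] by(simp add: coh_def)
 qed
 moreover have "x = mk rh" using r(2) by(auto simp: mk_def)
 ultimately show "EX rh. coh rh & (ALL k. rh k : hpart R n) & x = mk rh" using r(1) by blast
next
 assume "EX rh. coh rh & (ALL k. rh k : hpart R n) & x = mk rh"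
 thus "x : lpart R J n" using mk_closed by(auto simp: limit_part_def mk_def cl_def)
qed

lemma limit_part_gfam: "gfam LR (lpart R J)"
proof (intro gfam.intro gfam_axioms.intro lim_cring additive_subgroupI LR.add.subgroupI)
 fix n
 show "lpart R J n <= car LR" by(auto simp: limit_part_def)
 have "mk (%_. \<zero>) : lpart R J n" unfolding lpart_mk using coh_const H_zero by(intro exI[of _ "%_. \<zero>"]) auto
 thus "lpart R J n ~= {}" by blast
 fix x assume "x : lpart R J n"
 then obtain rh where r: "coh rh" "ALL k. rh k : hpart R n" "x = mk rh" using lpart_mk by blast
 show "-[LR] x : lpart R J n"
  unfolding lpart_mk using r H_neg coh_ops(3)[OF r(1,1)]
  by(intro exI[of _ "%k. \<ominus> rh k"]) (auto simp: lim_neg)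
 fix y assume "y : lpart R J n"
 then obtain \<xi> where s: "coh \<xi>" "ALL k. \<xi> k : hpart R n" "y = mk \<xi>" using lpart_mk by blast
 show "x +[LR] y : lpart R J n"
  unfolding lpart_mk using r s H_add coh_ops(1)[OF r(1) s(1)] coh_carr
  by(intro exI[of _ "%k. rh k \<oplus> \<xi> k"]) (auto simp: lim_ops)
next
 show "1[LR] : lpart R J 0"
  unfolding lpart_mk using coh_const H_one by(intro exI[of _ "%_. \<one>"]) (auto simp: lim_consts)
 fix x y m n assume "x : lpart R J m" "y : lpart R J n"
 then obtain rh \<xi> where r: "coh rh" "ALL k. rh k : hpart R m" "x = mk rh" and s: "coh \<xi>" "ALL k. \<xi> k : hpart R n" "y = mk \<xi>"
  using lpart_mk by blast
 show "x *[LR] y : lpart R J (m + n)"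
  unfolding lpart_mk using r s H_mult coh_ops(2)[OF r(1) s(1)] coh_carr
  by(intro exI[of _ "%k. rh k \<otimes> \<xi> k"]) (auto simp: lim_ops)
qed

sublocale LP: gfam LR "lpart R J" by(rule limit_part_gfam)

abbreviation "GL == graded_limit R J"

lemma GL_simps [simp]: "monoid.mult GL = monoid.mult LR" "one GL = one LR" "ring.zero GL = ring.zero LR" "add GL = add LR"
 "hpart GL = lpart R J"
 by(simp_all add: graded_limit_def)

lemma GL_carrier: "car GL = aspan LR (\<Union>n. lpart R J n)"
 unfolding LP.finsums_eq_aspan[symmetric] by(simp add: graded_limit_def)

lemma LP_sub: "(\<Union>n. lpart R J n) <= car LR"
 using LP.H_carr by blast

lemma GL_sub: "x : car GL ==> x : car LR"
 unfolding GL_carrier using LR.aspan_closed[OF _ LP_sub] .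

lemma limit_part_GL: "x : lpart R J n ==> x : car GL"
 unfolding GL_carrier using LR.aspan_incl[OF UN_I[OF UNIV_I]] .

lemma GL_subring: "subring (car GL) LR"
proof -
 interpret D: additive_subgroup "car GL" LR unfolding GL_carrier by(rule LR.aspan_subgroup[OF LP_sub])
 show ?thesis
 proof (rule LR.subringI)
  show "car GL <= car LR" using GL_sub by blast
  show "1[LR] : car GL" by(rule limit_part_GL[OF LP.H_one])
  show "-[LR] h : car GL" if "h : car GL" for h using D.a_inv_closed that by simp
  show "h1 +[LR] h2 : car GL" if "h1 : car GL" "h2 : car GL" for h1 h2 using D.a_closed that by simp
  fix h1 h2 assume h: "h1 : car GL" "h2 : car GL"
  show "h1 *[LR] h2 : car GL"
   by(rule LR.aspan_mult[OF h[unfolded GL_carrier] LP_sub LP_sub D.additive_subgroup_axioms])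
    (use LP.H_mult limit_part_GL in blast)
 qed
qed

lemma GL_eq: "GL = with_grading (LR\<lparr>carrier := car GL\<rparr>) (lpart R J)"
 by(simp add: graded_limit_def with_grading_def)

lemma GL_cring: "cring GL"
proof -
 have "cring (LR\<lparr>carrier := car GL\<rparr>)"
  using LR.subcring_iff[of "car GL"] LR.subcringI'[OF GL_subring] GL_sub by blast
 from cring_with_grading[OF this] show ?thesis using GL_eq by metis
qed

sublocale GL: cring GL by(rule GL_cring)

lemma GL_a_inv: "x : car GL ==> -[GL] x = -[LR] x"
 using GL.minus_equality[of "-[LR] x" x] GL_sub[of x] LR.l_neg[of x]
  subringE(5)[OF GL_subring] by simp

lemma GL_gfam: "gfam GL (lpart R J)"
proof (intro gfam.intro gfam_axioms.intro GL_cring additive_subgroupI GL.add.subgroupI)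
 fix n
 show "lpart R J n <= car GL" using limit_part_GL by blast
 show "lpart R J n ~= {}" using LP.H_zero by blast
 fix x assume x: "x : lpart R J n"
 thus "-[GL] x : lpart R J n" using LP.H_neg GL_a_inv[OF limit_part_GL] by simp
qed (use LP.H_add LP.H_one LP.H_mult in auto)

lemma GL_aspan: "x : car GL ==> x : aspan GL (\<Union>n. lpart R J n)"
proof -
 interpret G: gfam GL "lpart R J" by(rule GL_gfam)
 assume "x : car GL"
 from this[unfolded GL_carrier] LP_sub show ?thesis
 proof (induction x rule: LR.aspan_induct)
  case zero thus ?case using GL.aspan_zero by simp
 next
  case (incl x) thus ?case by(rule GL.aspan_incl)
 next
  case (neg x)
  have s: "(\<Union>n. lpart R J n) <= car GL" using limit_part_GL by blast
  have "x : car GL" using GL.aspan_closed[OF neg(3) s] .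
  thus ?case using additive_subgroup.a_inv_closed[OF GL.aspan_subgroup[OF s] neg(3)] GL_a_inv by simp
 next
  case (add x y) thus ?case using GL.aspan_add[of x _ y] by simp
 qed
qed

lemma GL_finsum: "(!!i. i : I ==> f i : car GL) ==> finsum GL f I = finsum LR f I"
proof (induction I rule: infinite_finite_induct)
 case (insert i I)
 thus ?case using GL_sub by(subst GL.finsum_insert, simp, simp, auto simp: LR.finsum_insert)
qed (auto simp: GL.finsum_infinite LR.finsum_infinite)

text \<open>Directness holds at each level separately: if a sum of homogeneous elements lies in a
  homogeneous ideal, so do its components.\<close>

lemma GL_direct:
 assumes y: "!!n. y n : lpart R J n" and z: "finsum GL y {..N} k = cl k \<zero>" and n: "n <= N"
 shows "y n k = cl k \<zero>"
proof -
 have "ALL n. EX rh. coh rh & (ALL k. rh k : hpart R n) & y n = mk rh" using y lpart_mk by blast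
 then obtain rh where r: "!!n. coh (rh n)" "!!n k. rh n k : hpart R n" "!!n. y n = mk (rh n)" by metis
 have "y = (%n. mk (rh n))" using r(3) by(rule ext)
 hence "finsum LR y {..N} = mk (%k. \<Oplus>n\<in>{..N}. rh n k)" using lim_finsum[of "{..N}" rh] r(1) by simp
 hence "cl k (\<Oplus>n\<in>{..N}. rh n k) = cl k \<zero>" using z GL_finsum[of "{..N}" y] limit_part_GL[OF y] by(simp add: mk_def)
 hence inJ: "(\<Oplus>n\<in>{..N}. rh n k) : J k" using cl_zero H_carr[OF r(2)] by simp
 have prs: "pr n (\<Oplus>m\<in>{..M}. rh m k) = (if n <= M then rh n k else \<zero>)" for M
 proof (induction M)
  case 0 thus ?case using finsum_0[of "%m. rh m k"] H_carr[OF r(2)] pr_hpart[OF r(2)] by simp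
 next
  case (Suc M)
  thus ?case using finsum_Suc[of "%m. rh m k" M] H_carr[OF r(2)] pr_hpart[OF r(2)]
   by(auto simp: pr_add le_Suc_eq)
 qed
 have "rh n k : J k" using J_hom[OF inJ, of n] prs n by simp
 thus ?thesis using r(3) cl_zero H_carr[OF r(2)] by(simp add: mk_def)
qed

lemma to_limit_part: "x : hpart R n ==> to_limit R J x : lpart R J n"
 unfolding lpart_mk to_limit_mk using coh_const[OF H_carr] by blast

lemma to_limit_GL: "to_limit R J : ring_hom R GL"
proof -
 have "to_limit R J x : car GL" if x: "x : car R" for x
  using span[OF x] UN_carr
 proof (induction x rule: aspan_induct)
  case zero
  have "to_limit R J \<zero> = 0[LR]" by(simp add: to_limit_mk lim_consts)
  thus ?case using GL.zero_closed by simp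
 next
  case (incl x) thus ?case using to_limit_part limit_part_GL by blast
 next
  case (neg x)
  thus ?case using lim_neg[OF coh_const, of x] GL_a_inv[OF neg(3)] GL.a_inv_closed[OF neg(3)]
   by(simp add: to_limit_mk)
 next
  case (add x y)
  thus ?case using ring_hom_add[OF to_limit_hom, of x y] GL.a_closed[of "to_limit R J x" "to_limit R J y"] by simp
 qed
 thus ?thesis using to_limit_hom by(auto simp: ring_hom_def)
qed

end

section \<open>Completion of graded algebras that are finite in each degree\<close>

lemma cl_hom_adic:
 assumes A: "cring A" and I: "ideal I A" and R: "cring R" and s: "s : ring_hom A R"
 shows "filtered R (adic A I R s)" and "filtered A (%k::nat. ipow A I k)"
  and "s ` (ipow A I (k::nat)) \<subseteq> adic A I R s k"
proof -
 interpret A: cring A by fact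
 interpret R: cring R by fact
 have c: "ipow A I (k::nat) <= car A" for k using A.ideals_pow(1)[OF I] by(rule additive_subgroup.a_subset[OF ideal.axioms(1)])
 hence sc: "s ` (ipow A I (k::nat)) <= car R" for k using rh_cl[OF s] by blast
 have m: "ipow A I (Suc k) \<subseteq> ipow A I k" for k by(rule A.ideal_pow_mono[OF I]) simp
 show "filtered A (%k::nat. ipow A I k)"
  by(intro filtered.intro filtered_axioms.intro A.cring_axioms A.ideals_pow(1)[OF I] m)
 show "s ` (ipow A I (k::nat)) \<subseteq> adic A I R s k" for k
  unfolding adic_def by(rule R.genideal_self[OF sc])
 show "filtered R (adic A I R s)"
 proof (intro filtered.intro filtered_axioms.intro R.cring_axioms)
  fix k
  show "ideal (adic A I R s k) R" unfolding adic_def by(rule R.genideal_ideal[OF sc])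
  show "adic A I R s (Suc k) \<subseteq> adic A I R s k"
   unfolding adic_def
   by(rule R.genideal_minimal[OF R.genideal_ideal[OF sc]]) (rule order_trans[OF image_mono[OF m] R.genideal_self[OF sc]])
 qed
qed

context filtered
begin

lemma coh_shift: "coh b ==> coh (%l. b (l + k))" "coh b ==> mk (%l. b (l + k)) = mk b"
proof -
 assume b: "coh b"
 have e: "cl l (b (l + k)) = cl l (b l)" for l by(rule coh_le[OF b]) simp
 thus "mk (%l. b (l + k)) = mk b" by(simp add: mk_def)
 have "cl l (b (Suc l + k)) = cl l (b l)" for l by(rule coh_le[OF b]) simp
 thus "coh (%l. b (l + k))" using e coh_carr[OF b] by(simp add: coh_def)
qed

definition diffs :: "(nat => 'a) => nat => 'a" where
 "diffs b j = (case j of 0 => b 0 | Suc l => b (Suc l) \<ominus> b l)"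

lemma diffs_simps: "diffs b 0 = b 0" "diffs b (Suc l) = b (Suc l) \<ominus> b l" by(simp_all add: diffs_def)

lemma psum_diffs: assumes b: "!!l. b l : car R" shows "psum (diffs b) l = b l"
proof (induction l)
 case 0 thus ?case using psum_0[of "diffs b"] b by(simp add: diffs_simps)
next
 case (Suc l)
 have "diffs b j : car R" for j using b by(cases j) (auto simp: diffs_simps)
 thus ?case using Suc psum_Suc[of "diffs b" l] b by(simp add: diffs_simps a_minus_def a_assoc l_neg)
qed

lemma psum_finsum:
 assumes q: "!!j f. f : F ==> q j f : car R" and n: "!!f. f : F ==> n f : car R"
  and D: "!!j. D j = (\<Oplus>f\<in>F. q j f \<otimes> n f)"
 shows "psum D l = (\<Oplus>f\<in>F. psum (%j. q j f) l \<otimes> n f)"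
proof -
 have "psum D l = (\<Oplus>j\<in>{..l}. \<Oplus>f\<in>F. q j f \<otimes> n f)" by(simp add: psum_def D)
 also have "... = (\<Oplus>f\<in>F. \<Oplus>j\<in>{..l}. q j f \<otimes> n f)" by(rule finsum_swap) (use q n in auto)
 also have "... = (\<Oplus>f\<in>F. psum (%j. q j f) l \<otimes> n f)"
  unfolding psum_def by(rule finsum_cong') (use q n in "auto intro!: finsum_ldistr[symmetric]")
 finally show ?thesis .
qed

end

locale adic_algebra = graded_cring R pr + A: cring A
 for A :: "('k, 'l) ring_scheme" and R :: "'a graded_ring" (structure) and pr +
 fixes I :: "'k set" and s :: "'k => 'a"
 assumes fg: "EX S. finite S & S <= car A & generate_ring A S = car A"
  and I: "ideal I A" and s: "s : ring_hom A R" and s0: "a : car A ==> s a : hpart R 0"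
  and fin: "fin_deg A R s"
begin

abbreviation K :: "nat => 'k set" where "K k == ipow A I k"
abbreviation J :: "nat => 'a set" where "J == adic A I R s"

sublocale AK: filtered A K by(rule cl_hom_adic(2)[OF A.cring_axioms I cring_axioms s])

sublocale AKg: gfam A K by(rule A.gfam_ideal_pow[OF I])

sublocale s: ring_hom_cring A R s by(rule rh_cringI[OF A.cring_axioms cring_axioms s])

lemma completion_eq: "completion A I = AK.LR"
 by(simp add: completion_def)

lemma to_completion_mk: "to_completion A I a = AK.mk (%_. a)"
 by(simp add: to_completion_def AK.to_limit_mk)

lemma K0: "K 0 = car A"
 by(rule A.ideals_pow(2)[OF I])

text \<open>A finite set of generators of the degree \<open>n\<close> part as an
  \<open>A\<close>-module. It need not be free; its syzygies are what the injectivity proof has to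
  deal with.\<close>

definition basis :: "nat => 'a set" where
 "basis n = (SOME E. finite E & E \<subseteq> hpart R n & hpart R n \<subseteq> aspan R {s a \<otimes> e | a e. a : car A & e : E})"

lemma basis: "finite (basis n)" "e : basis n ==> e : hpart R n"
  "hpart R n \<subseteq> aspan R {s a \<otimes> e | a e. a : car A & e : basis n}"
proof -
 have "EX E. finite E & E \<subseteq> hpart R n & hpart R n \<subseteq> aspan R {s a \<otimes> e | a e. a : car A & e : E}"
  using fin unfolding fin_deg_def by(rule spec)
 from someI_ex[OF this] show "finite (basis n)" "e : basis n ==> e : hpart R n"
  "hpart R n \<subseteq> aspan R {s a \<otimes> e | a e. a : car A & e : basis n}"
  unfolding basis_def by blast+
qed

lemma bcarr: "e : basis n ==> e : car R"
 using basis(2) H_carr by blast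

definition comb :: "nat => ('a => 'k) => 'a" where
 "comb n a = (\<Oplus>e\<in>basis n. s (a e) \<otimes> e)"

lemma comb_closed: "a : basis n \<rightarrow> car A ==> comb n a : hpart R n"
 unfolding comb_def by(rule H_finsum) (use H_mult[OF s0 basis(2), of "a e" e n for e] funcset_mem in force)

lemma comb_carr: "a : basis n \<rightarrow> car A ==> comb n a : car R"
 using comb_closed H_carr by blast

lemma comb_add:
 assumes "a : basis n \<rightarrow> car A" "b : basis n \<rightarrow> car A"
 shows "comb n (%e. a e +[A] b e) = comb n a \<oplus> comb n b"
proof -
 note c = funcset_mem[OF assms(1)] funcset_mem[OF assms(2)]
 have "comb n (%e. a e +[A] b e) = (\<Oplus>e\<in>basis n. s (a e) \<otimes> e \<oplus> s (b e) \<otimes> e)"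
  unfolding comb_def by(rule finsum_cong') (use c bcarr in "auto simp: l_distr")
 also have "... = comb n a \<oplus> comb n b" unfolding comb_def by(rule finsum_addf) (use c bcarr in auto)
 finally show ?thesis .
qed

lemma comb_neg:
 assumes "a : basis n \<rightarrow> car A" shows "comb n (%e. -[A] a e) = \<ominus> comb n a"
proof -
 note c = funcset_mem[OF assms(1)]
 have "comb n (%e. -[A] a e) \<oplus> comb n a = comb n (%e. -[A] a e +[A] a e)"
  by(rule comb_add[symmetric]) (use c in auto)
 also have "... = \<zero>" unfolding comb_def by(rule add.finprod_one_eqI) (use c bcarr in "simp add: A.l_neg")
 finally show ?thesis using minus_equality[of "comb n (%e. -[A] a e)" "comb n a"] comb_carr c by auto
qed

lemma comb_diff:
 assumes "a : basis n \<rightarrow> car A" "b : basis n \<rightarrow> car A"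
 shows "comb n (%e. a e -[A] b e) = comb n a \<ominus> comb n b"
proof -
 have "(%e. -[A] b e) : basis n \<rightarrow> car A" using funcset_mem[OF assms(2)] by auto
 from comb_add[OF assms(1) this] show ?thesis by(simp add: comb_neg[OF assms(2)] a_minus_def)
qed

lemma comb_smult:
 assumes "a : basis n \<rightarrow> car A" "t : car A"
 shows "comb n (%e. t *[A] a e) = s t \<otimes> comb n a"
proof -
 note c = funcset_mem[OF assms(1)]
 have "s t \<otimes> comb n a = (\<Oplus>e\<in>basis n. s t \<otimes> (s (a e) \<otimes> e))"
  unfolding comb_def by(rule finsum_rdistr) (use basis(1) assms(2) c bcarr in auto)
 also have "... = comb n (%e. t *[A] a e)"
  unfolding comb_def by(rule finsum_cong') (use c bcarr assms(2) in "auto simp: m_assoc")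
 finally show ?thesis ..
qed

lemma comb_single: "[|a : car A; e : basis n|] ==> comb n (%e'. if e = e' then a else 0[A]) = s a \<otimes> e"
proof -
 assume a: "a : car A" "e : basis n"
 have "comb n (%e'. if e = e' then a else 0[A]) = (\<Oplus>e'\<in>basis n. if e = e' then s a \<otimes> e' else \<zero>)"
  unfolding comb_def by(rule finsum_cong') (use a bcarr in auto)
 also have "... = s a \<otimes> e" by(rule finsum_singleton) (use a basis(1) bcarr in auto)
 finally show ?thesis .
qed

lemma comb_subgroup: "additive_subgroup {comb n a | a. a : basis n \<rightarrow> K k} R"
proof (intro additive_subgroupI add.subgroupI)
 have Kc: "a : basis n \<rightarrow> car A" if "a : basis n \<rightarrow> K k" for a using that AK.J_carr by blast
 show "{comb n a | a. a : basis n \<rightarrow> K k} <= car R" using Kc comb_carr by blast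
 have "(%_. 0[A]) : basis n \<rightarrow> K k" using AKg.H_zero by auto
 thus "{comb n a | a. a : basis n \<rightarrow> K k} ~= {}" by blast
 fix x assume "x : {comb n a | a. a : basis n \<rightarrow> K k}"
 then obtain a where a: "x = comb n a" "a : basis n \<rightarrow> K k" by blast
 have "(%e. -[A] a e) : basis n \<rightarrow> K k" using funcset_mem[OF a(2)] AKg.H_neg by auto
 thus "\<ominus> x : {comb n a | a. a : basis n \<rightarrow> K k}" unfolding a(1) comb_neg[OF Kc[OF a(2)], symmetric] by blast
 fix y assume "y : {comb n a | a. a : basis n \<rightarrow> K k}"
 then obtain b where b: "y = comb n b" "b : basis n \<rightarrow> K k" by blast
 have "(%e. a e +[A] b e) : basis n \<rightarrow> K k" using funcset_mem[OF a(2)] funcset_mem[OF b(2)] AKg.H_add by auto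
 thus "x \<oplus> y : {comb n a | a. a : basis n \<rightarrow> K k}"
  unfolding a(1) b(1) comb_add[OF Kc[OF a(2)] Kc[OF b(2)], symmetric] by blast
qed

lemma hpart_comb: "x : hpart R n ==> EX a:basis n \<rightarrow> car A. x = comb n a"
proof -
 assume x: "x : hpart R n"
 have "aspan R {s a \<otimes> e | a e. a : car A & e : basis n} \<subseteq> {comb n a | a. a : basis n \<rightarrow> K 0}"
 proof (rule aspan_min[OF comb_subgroup], rule subsetI)
  fix v assume "v : {s a \<otimes> e | a e. a : car A & e : basis n}"
  then obtain a e where ae: "v = s a \<otimes> e" "a : car A" "e : basis n" by blast
  thus "v : {comb n a | a. a : basis n \<rightarrow> K 0}"
   unfolding K0 using comb_single[OF ae(2,3)] by(intro CollectI exI[of _ "%e'. if e = e' then a else 0[A]"]) auto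
 qed
 thus ?thesis using basis(3)[of n] x unfolding K0 by blast
qed

lemma J_eq: "J k = Idl (s ` K k)" by(simp add: adic_def)

text \<open>Scalars have degree zero, so the projection of \<open>s t \<otimes> r\<close> is
  \<open>s t\<close> times that of \<open>r\<close>. Hence in degree \<open>n\<close> the filtration
  of \<open>R\<close> is the \<open>I\<close>-adic one of a finitely generated
  \<open>A\<close>-module.\<close>

lemma J_pr_comb: assumes x: "x : J k" shows "EX a:basis n \<rightarrow> K k. pr n x = comb n a"
proof -
 interpret S: additive_subgroup "{comb n a | a. a : basis n \<rightarrow> K k}" R by(rule comb_subgroup)
 have sK: "s ` K k <= car R" using AK.J_carr by auto
 have "pr n x : {comb n a | a. a : basis n \<rightarrow> K k}"
  using x[unfolded J_eq] sK cring_axioms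
 proof (induction x rule: Idl_induct)
  case zero thus ?case using S.zero_closed pr_zero by simp
 next
  case (smult v r)
  then obtain t where t: "t : K k" "v = s t" by blast
  have tA: "t : car A" using AK.J_carr[OF t(1)] .
  obtain a where a: "a : basis n \<rightarrow> car A" "pr n r = comb n a" using hpart_comb[OF pr_in[OF smult(2)]] by blast
  have "pr n (v \<otimes> r) = comb n (%e. t *[A] a e)"
   using pr_smult[OF s0[OF tA] smult(2)] comb_smult[OF a(1) tA] a(2) t by simp
  moreover have "(%e. t *[A] a e) : basis n \<rightarrow> K k"
   using funcset_mem[OF a(1)] ideal.I_r_closed[OF AK.J_ideal t(1)] by auto
  ultimately show ?case by blast
 next
  case (add x y)
  have "x : car R" "y : car R" using add(1,2) ideal.Icarr[OF genideal_ideal[OF sK]] by auto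
  thus ?case using add S.a_closed by(simp add: pr_add)
 qed
 thus ?thesis by blast
qed

lemma s_K: "s ` K k \<subseteq> J k"
 by(rule cl_hom_adic(3)[OF A.cring_axioms I cring_axioms s])

lemma J_filtered: "filtered R J" by(rule cl_hom_adic(1)[OF A.cring_axioms I cring_axioms s])

lemma comb_J: "a : basis n \<rightarrow> K k ==> comb n a : J k"
proof -
 assume a: "a : basis n \<rightarrow> K k"
 interpret j: ideal "J k" R by(rule filtered.J_ideal[OF J_filtered])
 have "(\<Oplus>e\<in>B. s (a e) \<otimes> e) : J k" if "B \<subseteq> basis n" for B
  using finite_subset[OF that basis(1)] that
 proof (induction B)
  case (insert e B)
  have m: "s (a e') \<otimes> e' : J k" if "e' : basis n" for e'
   using j.I_r_closed[OF subsetD[OF s_K imageI[OF funcset_mem[OF a that]]] bcarr[OF that]] .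
  have "(\<Oplus>e\<in>insert e B. s (a e) \<otimes> e) = s (a e) \<otimes> e \<oplus> (\<Oplus>e\<in>B. s (a e) \<otimes> e)"
   by(rule finsum_insert) (use insert m j.Icarr in blast)+
  thus ?case using insert m j.a_closed by simp
 qed simp
 thus ?thesis by(simp add: comb_def)
qed

sublocale graded_filtered R pr J
proof (intro graded_filtered.intro graded_filtered_axioms.intro J_filtered graded_cring_axioms)
 fix x k n assume "x : J k"
 from J_pr_comb[OF this, of n] obtain a where "a : basis n \<rightarrow> K k" "pr n x = comb n a" ..
 thus "pr n x : J k" using comb_J by simp
qed

lemma J_comb: assumes "x : J k" "x : hpart R n" shows "EX a:basis n \<rightarrow> K k. x = comb n a"
 using J_pr_comb[OF assms(1), of n] pr_hpart[OF assms(2), of n] by simp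

lemma limit_map_s:
 "(!!k. b k : car A) ==> lmap R J s (AK.mk b) = mk (%k. s (b k))" "AK.coh b ==> coh (%k. s (b k))"
 "lmap R J s : ring_hom (completion A I) LR"
 using limit_map_mk[OF AK.filtered_axioms filtered_axioms s s_K] by(simp_all add: completion_eq)

lemma limit_map_s_part: "b : car (completion A I) ==> lmap R J s b : lpart R J 0"
proof -
 assume "b : car (completion A I)"
 then obtain c where c: "AK.coh c" "b = AK.mk c" unfolding completion_eq by(rule AK.limE)
 show ?thesis
  unfolding lpart_mk c(2) using limit_map_s(1)[OF AK.coh_carr[OF c(1)]] limit_map_s(2)[OF c(1)] s0[OF AK.coh_carr[OF c(1)]]
  by(intro exI[of _ "%k. s (c k)"]) auto
qed

lemma limit_map_s_GL: "lmap R J s : ring_hom (completion A I) GL"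
 using limit_map_s(3) limit_part_GL[OF limit_map_s_part] by(auto simp: ring_hom_def)

text \<open>An element of the limit is a convergent series of differences lying ever deeper in the
  filtration; summing the coefficients of its terms gives coefficients in the completion of
  \<open>A\<close>. This is the source of surjectivity.\<close>

lemma limit_part_comb:
 assumes "y : lpart R J n"
 shows "EX b. (ALL e:basis n. AK.coh (b e)) & y = mk (%k. comb n (%e. b e k))"
proof -
 obtain rh where r: "coh rh" "!!k. rh k : hpart R n" "y = mk rh" using assms lpart_mk by blast
 note rc = coh_carr[OF r(1)]
 define D where "D = diffs rh"
 have Dn: "D j : hpart R n" for j using r(2) H_diff by(cases j) (auto simp: D_def diffs_simps)
 have DJ: "D (Suc k) : J k" for k using r(1) cl_eq[OF rc rc] by(simp add: D_def diffs_simps coh_def)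
 have ps: "psum D k = rh k" for k unfolding D_def by(rule psum_diffs[OF rc])
 \<comment> \<open>Difference \<open>k + 1\<close> is only known to lie in \<open>J k\<close>. The
   truncated \<open>j - 1\<close> also covers the initial term, whose coefficients lie in
   \<open>K 0\<close>, which is all of \<open>A\<close>.\<close>
 have "EX a. a : basis n \<rightarrow> K (j - 1) & D j = comb n a" for j
 proof (cases j)
  case 0
  thus ?thesis using hpart_comb[OF Dn[of 0]] K0 by auto
 next
  case (Suc k)
  thus ?thesis using J_comb[OF DJ Dn, of k] by auto
 qed
 then obtain a where a: "!!j. a j : basis n \<rightarrow> K (j - 1)" "!!j. D j = comb n (a j)" by metis
 have ac: "a j e : car A" if "e : basis n" for j e using AK.J_carr[OF funcset_mem[OF a(1) that]] .
 define b where "b e = AK.psum (%j. a j e)" for e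
 have bcoh: "AK.coh (b e)" if e: "e : basis n" for e
  unfolding b_def by(rule AK.psum_coh) (use ac[OF e] funcset_mem[OF a(1) e, of "Suc k" for k] in auto)
 have "comb n (%e. b e k) = psum D k" for k
 proof (induction k)
  case 0
  have "comb n (%e. b e 0) = comb n (a 0)" unfolding comb_def
   by(rule finsum_cong') (use ac bcarr in "auto simp: b_def AK.psum_0")
  thus ?case using psum_0[of D, OF H_carr[OF Dn]] a(2)[of 0] by(simp only:)
 next
  case (Suc k)
  have "comb n (%e. b e (Suc k)) = comb n (%e. a (Suc k) e +[A] b e k)" unfolding comb_def
   by(rule finsum_cong') (use ac bcarr in "auto simp: b_def AK.psum_Suc AK.psum_closed")
  also have "... = comb n (a (Suc k)) \<oplus> comb n (%e. b e k)"
   by(rule comb_add) (use ac in "auto simp: b_def AK.psum_closed")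
  finally show ?case using Suc psum_Suc[of D k, OF H_carr[OF Dn]] a(2)[of "Suc k"] by(simp only:)
 qed
 hence "y = mk (%k. comb n (%e. b e k))" using r(3) ps by simp
 thus ?thesis using bcoh by blast
qed

lemma comb_coh:
 assumes b: "!!e. e : basis n ==> AK.coh (b e)"
 shows "coh (%k. comb n (%e. b e k))" "mk (%k. comb n (%e. b e k)) : lpart R J n"
  "mk (%k. comb n (%e. b e k)) = (\<Oplus>\<^bsub>GL\<^esub>e\<in>basis n. lmap R J s (AK.mk (b e)) *[GL] to_limit R J e)"
proof -
 have t: "coh (%k. s (b e k) \<otimes> e)" if "e : basis n" for e
  using coh_ops(2)[OF limit_map_s(2)[OF b[OF that]] coh_const[OF bcarr[OF that]]] .
 show c: "coh (%k. comb n (%e. b e k))" unfolding comb_def by(rule coh_finsum) (rule t)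
 have h: "comb n (%e. b e k) : hpart R n" for k by(rule comb_closed) (use AK.coh_carr[OF b] in auto)
 show "mk (%k. comb n (%e. b e k)) : lpart R J n" unfolding lpart_mk using c h by blast
 have GLc: "lmap R J s (AK.mk (b e)) *[GL] to_limit R J e : car GL" if "e : basis n" for e
  using GL.m_closed[OF rh_cl[OF limit_map_s_GL] rh_cl[OF to_limit_GL bcarr[OF that]]]
   AK.mk_closed[OF b[OF that]] by(simp add: completion_eq)
 have e: "lmap R J s (AK.mk (b e)) *[GL] to_limit R J e = mk (%k. s (b e k) \<otimes> e)" if "e : basis n" for e
  using limit_map_s(1)[OF AK.coh_carr[OF b[OF that]]] AK.coh_carr[OF b[OF that]] bcarr[OF that]
  by(simp add: to_limit_mk lim_ops)
 have "(\<Oplus>\<^bsub>GL\<^esub>e\<in>basis n. lmap R J s (AK.mk (b e)) *[GL] to_limit R J e) =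
   (\<Oplus>\<^bsub>LR\<^esub>e\<in>basis n. lmap R J s (AK.mk (b e)) *[GL] to_limit R J e)"
  by(rule GL_finsum) (rule GLc)
 also have "... = (\<Oplus>\<^bsub>LR\<^esub>e\<in>basis n. mk (%k. s (b e k) \<otimes> e))"
  by(rule LR.finsum_cong') (use e mk_closed[OF t] in auto)
 also have "... = mk (%k. comb n (%e. b e k))" unfolding comb_def by(rule lim_finsum) (rule t)
 finally show "mk (%k. comb n (%e. b e k)) = (\<Oplus>\<^bsub>GL\<^esub>e\<in>basis n. lmap R J s (AK.mk (b e)) *[GL] to_limit R J e)" ..
qed

text \<open>By \<open>limit_part_comb\<close> the images of \<open>R\<close> and of the completion
  of \<open>A\<close> generate the graded completion algebraically, so the homomorphisms need not be
  continuous.\<close>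

lemma GL_hom_ext:
 assumes Q: "cring Q" and h: "h : ring_hom GL Q" "h' : ring_hom GL Q"
  and r: "!!r. r : car R ==> h (to_limit R J r) = h' (to_limit R J r)"
  and b: "!!b. b : car (completion A I) ==> h (lmap R J s b) = h' (lmap R J s b)"
  and x: "x : car GL"
 shows "h x = h' x"
proof -
 interpret h: ring_hom_cring GL Q h by(rule rh_cringI[OF GL.cring_axioms Q h(1)])
 interpret h': ring_hom_cring GL Q h' by(rule rh_cringI[OF GL.cring_axioms Q h(2)])
 have s: "(\<Union>n. lpart R J n) <= car GL" using limit_part_GL by blast
 show ?thesis
  using GL_aspan[OF x] s
 proof (induction x rule: GL.aspan_induct)
  case zero thus ?case using h.hom_zero h'.hom_zero by simp
 next
  case (neg x) thus ?case using h.hom_a_inv h'.hom_a_inv by simp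
 next
  case (add x y) thus ?case using h.hom_add h'.hom_add by simp
 next
  case (incl x)
  then obtain n where "x : lpart R J n" by blast
  from limit_part_comb[OF this] obtain c where c: "!!e. e : basis n ==> AK.coh (c e)" "x = mk (%k. comb n (%e. c e k))" by blast
  have m: "lmap R J s (AK.mk (c e)) : car GL" "to_limit R J e : car GL" "AK.mk (c e) : car (completion A I)"
   if "e : basis n" for e
   using AK.mk_closed[OF c(1)[OF that]] rh_cl[OF limit_map_s_GL] rh_cl[OF to_limit_GL bcarr[OF that]]
   by(simp_all add: completion_eq)
  let ?t = "%e. lmap R J s (AK.mk (c e)) *[GL] to_limit R J e"
  have tc: "?t : basis n \<rightarrow> car GL" by(intro Pi_I GL.m_closed m)
  have x: "x = finsum GL ?t (basis n)" unfolding c(2) by(rule comb_coh(3)[OF c(1)])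
  have "(h \<circ> ?t) e = (h' \<circ> ?t) e" if "e : basis n" for e
   unfolding comp_apply using h.hom_mult[OF m(1,2)[OF that]] h'.hom_mult[OF m(1,2)[OF that]] r[OF bcarr[OF that]] b[OF m(3)[OF that]] by(simp del: GL_simps)
  moreover have "(h' \<circ> ?t) : basis n \<rightarrow> car Q" unfolding comp_def by(intro Pi_I h'.hom_closed funcset_mem[OF tc])
  ultimately have "finsum Q (h \<circ> ?t) (basis n) = finsum Q (h' \<circ> ?t) (basis n)"
   by(intro h.S.finsum_cong' refl)
  thus ?case unfolding x h.hom_finsum[OF tc] h'.hom_finsum[OF tc] .
 qed
qed

end

lemma (in gfam) finsum_rep:
 assumes "x : aspan R (\<Union>n. H n)" obtains y N where "!!n. y n : H n" "x = finsum R y {..N}"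
proof -
 have "x : {finsum R y {..N} | y N. ALL n. y n : H n}" using assms unfolding finsums_eq_aspan .
 thus thesis using that by blast
qed

text \<open>From \<open>I^(k+l) = I^k I^l\<close>: the factor in \<open>I^l\<close> is absorbed into
  the coefficients of the generators of \<open>I^k\<close>.\<close>

lemma (in cring) ideal_pow_rep:
 assumes I: "ideal I R" and T: "finite T" "T <= car R" "I [^]\<^bsub>ideals_set R\<^esub> (k::nat) = Idl T"
  and x: "x : I [^]\<^bsub>ideals_set R\<^esub> (k + l :: nat)"
 shows "EX q:T \<rightarrow> I [^]\<^bsub>ideals_set R\<^esub> l. x = (\<Oplus>t\<in>T. q t \<otimes> t)"
proof -
 let ?K = "%k::nat. I [^]\<^bsub>ideals_set R\<^esub> k"
 interpret K: ideal "?K l" R by(rule ideals_pow(1)[OF I])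
 have "x : (?K k) \<cdot> (?K l)" using x ideals_pow(3)[OF I, of k l] by simp
 thus ?thesis
 proof (induction x rule: ideal_prod.induct)
  case (prod i j)
  have i: "i : Idl T" using prod(1) T(3) by simp
  obtain c where c: "c : T \<rightarrow> car R" "i = (\<Oplus>t\<in>T. c t \<otimes> t)" by(rule Idl_finite_rep[OF T(1,2) i cring_axioms])
  note cc = funcset_mem[OF c(1)]
  have jc: "j : car R" using prod(2) K.Icarr by simp
  have "i \<otimes> j = (\<Oplus>t\<in>T. c t \<otimes> t \<otimes> j)"
   unfolding c(2) by(rule finsum_ldistr) (use T cc jc in auto)
  also have "... = (\<Oplus>t\<in>T. (c t \<otimes> j) \<otimes> t)"
   by(rule finsum_cong') (use T(2) cc jc in "auto simp: m_ac subset_iff")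
  finally show ?case using cc K.I_l_closed[OF prod(2)] by(intro bexI[of _ "%t. c t \<otimes> j"]) auto
 next
  case (sum x y)
  then obtain q r where q: "q : T \<rightarrow> ?K l" "x = (\<Oplus>t\<in>T. q t \<otimes> t)" and r: "r : T \<rightarrow> ?K l" "y = (\<Oplus>t\<in>T. r t \<otimes> t)" by blast
  note qc = funcset_mem[OF q(1)] and rc = funcset_mem[OF r(1)]
  have "x \<oplus> y = (\<Oplus>t\<in>T. q t \<otimes> t \<oplus> r t \<otimes> t)"
   unfolding q(2) r(2) by(rule finsum_addf[symmetric]) (use T(2) K.Icarr[OF qc] K.Icarr[OF rc] in auto)
  also have "... = (\<Oplus>t\<in>T. (q t \<oplus> r t) \<otimes> t)"
   by(rule finsum_cong') (use T(2) K.Icarr[OF qc] K.Icarr[OF rc] in "auto simp: l_distr subset_iff")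
  finally show ?case using qc rc K.a_closed by(intro bexI[of _ "%t. q t \<oplus> r t"]) auto
 qed
qed

context adic_algebra
begin

lemma in_compl: "AK.coh b ==> AK.mk b : car (completion A I)"
 using AK.mk_closed by(simp add: completion_eq)

lemma completionE: assumes "x : car (completion A I)" obtains b where "AK.coh b" "x = AK.mk b"
 using AK.limE[of x] assms by(auto simp: completion_eq)

lemma compl_cring: "cring (completion A I)"
 unfolding completion_eq by(rule AK.lim_cring)

lemma to_completion_hom: "to_completion A I : ring_hom A (completion A I)"
 unfolding to_completion_def completion_eq by(rule AK.to_limit_hom)

lemma mk_lincomb:
 assumes q: "!!f. f : F ==> AK.coh (y f)" and n: "!!f. f : F ==> n f : car A"
  and b: "!!l. b l = (\<Oplus>\<^bsub>A\<^esub>f\<in>F. y f l *[A] n f)"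
  and Q: "cring Q" and bt: "bt : ring_hom (completion A I) Q"
 shows "bt (AK.mk b) = (\<Oplus>\<^bsub>Q\<^esub>f\<in>F. bt (AK.mk (y f)) *[Q] bt (to_completion A I (n f)))"
proof -
 interpret h: ring_hom_cring "completion A I" Q bt by(rule rh_cringI[OF compl_cring Q bt])
 have t: "AK.coh (%l. y f l *[A] n f)" if "f : F" for f
  using AK.coh_ops(2)[OF q[OF that] AK.coh_const[OF n[OF that]]] .
 have bb: "b = (%l. \<Oplus>\<^bsub>A\<^esub>f\<in>F. y f l *[A] n f)" by(rule ext) (rule b)
 have s1: "AK.mk b = (\<Oplus>\<^bsub>completion A I\<^esub>f\<in>F. AK.mk (%l. y f l *[A] n f))"
  unfolding completion_eq bb by(rule AK.lim_finsum[symmetric]) (rule t)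
 have "bt (AK.mk b) = (\<Oplus>\<^bsub>Q\<^esub>f\<in>F. bt (AK.mk (%l. y f l *[A] n f)))"
  unfolding s1 by(subst h.hom_finsum) (use in_compl[OF t] in "auto simp: comp_def")
 also have "... = (\<Oplus>\<^bsub>Q\<^esub>f\<in>F. bt (AK.mk (y f)) *[Q] bt (to_completion A I (n f)))"
 proof (rule h.S.finsum_cong'[OF refl])
  fix f assume f: "f : F"
  have "AK.mk (%l. y f l *[A] n f) = AK.mk (y f) *[completion A I] to_completion A I (n f)"
   unfolding completion_eq to_completion_mk by(rule AK.lim_ops(1)[symmetric]) (use AK.coh_carr[OF q[OF f]] n[OF f] in auto)
  thus "bt (AK.mk (%l. y f l *[A] n f)) = bt (AK.mk (y f)) *[Q] bt (to_completion A I (n f))"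
   using h.hom_mult[OF in_compl[OF q[OF f]] rh_cl[OF to_completion_hom n[OF f]]] by simp
 qed (use in_compl[OF q] rh_cl[OF to_completion_hom n] in auto)
 finally show ?thesis .
qed

text \<open>The coefficients of an element of the completion of \<open>A\<close> whose image modulo \<open>I^k\<close> vanishes
 can be chosen convergent with respect to finitely many generators of \<open>I^k\<close>.\<close>

lemma completion_vanish:
 assumes b: "AK.coh b" "b k : K k"
 obtains T y where "finite T" "T \<subseteq> K k" "!!t. t : T ==> AK.coh (y t)"
  "!!l. b (l + k) = (\<Oplus>\<^bsub>A\<^esub>t\<in>T. y t l *[A] t)"
proof -
 obtain S where S: "finite S" "S <= car A" "generate_ring A S = car A" using fg by blast
 interpret N: noetherian_ring A by(rule A.fin_gen_noetherian[OF S])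
 obtain T where T: "T <= car A" "finite T" "K k = Idl\<^bsub>A\<^esub> T" using N.finetely_gen[OF AK.J_ideal] by blast
 have TK: "T \<subseteq> K k" unfolding T(3) by(rule A.genideal_self[OF T(1)])
 note Tc = subsetD[OF T(1)]
 let ?b = "%l. b (l + k)"
 note bs = AK.coh_shift(1)[OF b(1), of k]
 \<comment> \<open>Difference \<open>j\<close> of the sequence shifted by \<open>k\<close> lies
   \<open>j - 1\<close> steps deeper than \<open>I^k\<close>, which leaves coefficients in
   \<open>I^(j-1)\<close> whose sums converge.\<close>
 have d: "AK.diffs ?b j : K (k + (j - 1))" for j
 proof (cases j)
  case 0 thus ?thesis using b(2) by(simp add: AK.diffs_simps)
 next
  case (Suc l)
  have "AK.cl (l + k) (b (Suc (l + k))) = AK.cl (l + k) (b (l + k))" using b(1) by(simp add: AK.coh_def)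
  thus ?thesis using AK.cl_eq AK.coh_carr[OF b(1)] by(simp add: Suc AK.diffs_simps add.commute)
 qed
 have "ALL j. EX q. q : T \<rightarrow> K (j - 1) & AK.diffs ?b j = (\<Oplus>\<^bsub>A\<^esub>t\<in>T. q t *[A] t)"
  using A.ideal_pow_rep[OF I T(2,1,3) d] unfolding Bex_def by(rule allI)
 from choice[OF this] obtain q where "ALL j. q j : T \<rightarrow> K (j - 1) & AK.diffs ?b j = (\<Oplus>\<^bsub>A\<^esub>t\<in>T. q j t *[A] t)" ..
 hence q: "!!j. q j : T \<rightarrow> K (j - 1)" "!!j. AK.diffs ?b j = (\<Oplus>\<^bsub>A\<^esub>t\<in>T. q j t *[A] t)" by simp_all
 have qc: "q j t : car A" if "t : T" for j t using AK.J_carr[OF funcset_mem[OF q(1) that]] .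
 show thesis
 proof (rule that[OF T(2) TK])
  show "AK.coh (AK.psum (%j. q j t))" if "t : T" for t
   by(rule AK.psum_coh) (use qc[OF that] funcset_mem[OF q(1) that, of "Suc l" for l] in auto)
  show "b (l + k) = (\<Oplus>\<^bsub>A\<^esub>t\<in>T. AK.psum (%j. q j t) l *[A] t)" for l
  proof -
   have "AK.psum (AK.diffs ?b) l = (\<Oplus>\<^bsub>A\<^esub>t\<in>T. AK.psum (%j. q j t) l *[A] t)"
    by(rule AK.psum_finsum, erule qc, erule Tc, rule q(2))
   thus ?thesis using AK.psum_diffs[of ?b] AK.coh_carr[OF b(1)] by simp
  qed
 qed
qed

end

text \<open>\<open>C\<close> is a candidate for the completion of \<open>R\<close>:
  \<open>al\<close> and \<open>bt\<close> map \<open>R\<close> and the completion of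
  \<open>A\<close> into it, and \<open>ga\<close> compares it with the graded completion. The
  decisive assumption is \<open>C_part\<close>, which keeps \<open>C\<close> small enough for
  \<open>ga\<close> to be injective.\<close>

locale adic_span = adic_algebra A R pr I s
 for A :: "('k, 'l) ring_scheme" and R :: "'a graded_ring" (structure) and pr I s +
 fixes C :: "'c graded_ring" and al :: "'a => 'c" and bt :: "(nat => 'k set) => 'c" and ga :: "'c => nat => 'a set"
 assumes C_gfam: "gfam C (hpart C)" and C_span: "x : car C ==> x : aspan C (\<Union>n. hpart C n)"
  and al: "al : ring_hom R C" and bt: "bt : ring_hom (completion A I) C"
  and als: "a : car A ==> al (s a) = bt (to_completion A I a)"
  and C_part: "hpart C n \<subseteq> aspan C {al r *[C] bt b | r b. r : hpart R n & b : car (completion A I)}"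
  and C_part': "[|r : hpart R n; b : car (completion A I)|] ==> al r *[C] bt b : hpart C n"
  and ga: "ga : ring_hom C (graded_limit R (adic A I R s))"
  and gaal: "r : car R ==> ga (al r) = to_limit R (adic A I R s) r"
  and gabt: "b : car (completion A I) ==> ga (bt b) = lmap R (adic A I R s) s b"
begin

sublocale C: gfam C "hpart C" by(rule C_gfam)
sublocale al: ring_hom_cring R C al by(rule rh_cringI[OF cring_axioms C.cring_axioms al])
sublocale bt: ring_hom_cring "completion A I" C bt by(rule rh_cringI[OF compl_cring C.cring_axioms bt])
sublocale ga: ring_hom_cring C GL ga by(rule rh_cringI[OF C.cring_axioms GL_cring ga])

definition Comb :: "nat => ('a => nat => 'k) => 'c" where
 "Comb n b = (\<Oplus>\<^bsub>C\<^esub>e\<in>basis n. bt (AK.mk (b e)) *[C] al e)"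

lemma Comb_hpart: assumes "!!e. e : basis n ==> AK.coh (b e)" shows "Comb n b : hpart C n"
 unfolding Comb_def
proof (rule C.H_finsum)
 fix e assume e: "e : basis n"
 show "bt (AK.mk (b e)) *[C] al e : hpart C n"
  using C_part'[OF basis(2)[OF e] in_compl[OF assms[OF e]]]
   C.m_comm[OF bt.hom_closed[OF in_compl[OF assms[OF e]]] al.hom_closed[OF bcarr[OF e]]] by simp
qed

lemma ga_Comb: assumes b: "!!e. e : basis n ==> AK.coh (b e)" shows "ga (Comb n b) = mk (%k. comb n (%e. b e k))"
proof -
 have c: "bt (AK.mk (b e)) : car C" "al e : car C" if "e : basis n" for e
  using bt.hom_closed[OF in_compl[OF b[OF that]]] al.hom_closed[OF bcarr[OF that]] .
 have "ga (Comb n b) = (\<Oplus>\<^bsub>GL\<^esub>e\<in>basis n. ga (bt (AK.mk (b e)) *[C] al e))"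
  unfolding Comb_def by(subst ga.hom_finsum) (use c in "auto simp: comp_def")
 also have "... = (\<Oplus>\<^bsub>GL\<^esub>e\<in>basis n. lmap R J s (AK.mk (b e)) *[GL] to_limit R J e)"
 proof (rule GL.finsum_cong'[OF refl])
  have "lmap R J s (AK.mk (b e)) *[GL] to_limit R J e : car GL" if "e : basis n" for e
   using GL.m_closed[OF rh_cl[OF limit_map_s_GL in_compl[OF b[OF that]]] rh_cl[OF to_limit_GL bcarr[OF that]]] .
  thus "(%e. lmap R J s (AK.mk (b e)) *[GL] to_limit R J e) : basis n \<rightarrow> car GL" by(rule Pi_I)
  fix e assume e: "e : basis n"
  show "ga (bt (AK.mk (b e)) *[C] al e) = lmap R J s (AK.mk (b e)) *[GL] to_limit R J e"
   using ga.hom_mult[OF c[OF e]] gaal[OF bcarr[OF e]] gabt[OF in_compl[OF b[OF e]]] by(simp del: GL_simps)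
 qed
 also have "... = mk (%k. comb n (%e. b e k))" by(rule comb_coh(3)[OF b, symmetric])
 finally show ?thesis .
qed

lemma Comb_add:
 assumes "!!e. e : basis n ==> AK.coh (b e)" "!!e. e : basis n ==> AK.coh (c e)"
 shows "Comb n (%e k. b e k +[A] c e k) = Comb n b +[C] Comb n c"
proof -
 have cl: "bt (AK.mk (b e)) : car C" "bt (AK.mk (c e)) : car C" "al e : car C" if "e : basis n" for e
  using bt.hom_closed[OF in_compl[OF assms(1)[OF that]]] bt.hom_closed[OF in_compl[OF assms(2)[OF that]]]
   al.hom_closed[OF bcarr[OF that]] .
 have "Comb n (%e k. b e k +[A] c e k) =
   (\<Oplus>\<^bsub>C\<^esub>e\<in>basis n. bt (AK.mk (b e)) *[C] al e +[C] bt (AK.mk (c e)) *[C] al e)"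
  unfolding Comb_def
 proof (rule C.finsum_cong'[OF refl])
  fix e assume e: "e : basis n"
  have "AK.mk (%k. b e k +[A] c e k) = AK.mk (b e) +[completion A I] AK.mk (c e)"
   unfolding completion_eq by(rule AK.lim_ops(2)[symmetric]) (use AK.coh_carr assms e in auto)
  thus "bt (AK.mk (%k. b e k +[A] c e k)) *[C] al e =
   bt (AK.mk (b e)) *[C] al e +[C] bt (AK.mk (c e)) *[C] al e"
   using bt.hom_add[OF in_compl[OF assms(1)[OF e]] in_compl[OF assms(2)[OF e]]] cl[OF e] by(simp add: C.l_distr)
 qed (use cl in auto)
 also have "... = Comb n b +[C] Comb n c"
  unfolding Comb_def by(rule C.finsum_addf) (use cl in auto)
 finally show ?thesis .
qed

lemma Comb_const: assumes "a : basis n \<rightarrow> car A" shows "Comb n (%e k. a e) = al (comb n a)"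
proof -
 note ac = funcset_mem[OF assms]
 have "al (comb n a) = (\<Oplus>\<^bsub>C\<^esub>e\<in>basis n. al (s (a e) \<otimes> e))"
  unfolding comb_def by(subst al.hom_finsum) (use ac bcarr in "auto simp: comp_def")
 also have "... = Comb n (%e k. a e)" unfolding Comb_def
 proof (rule C.finsum_cong'[OF refl])
  fix e assume e: "e : basis n"
  show "al (s (a e) \<otimes> e) = bt (AK.mk (%k. a e)) *[C] al e"
   using al.hom_mult[OF s.hom_closed[OF ac[OF e]] bcarr[OF e]] als[OF ac[OF e]] by(simp add: to_completion_mk)
 qed (use bt.hom_closed[OF in_compl[OF AK.coh_const[OF ac]]] al.hom_closed[OF bcarr] in auto)
 finally show ?thesis ..
qed

lemma Comb_mult:
 assumes a: "a : basis n \<rightarrow> car A" and c: "AK.coh c"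
 shows "al (comb n a) *[C] bt (AK.mk c) = Comb n (%e k. c k *[A] a e)"
proof -
 note ac = funcset_mem[OF a]
 have m: "bt (AK.mk (%k. a e)) : car C" "al e : car C" if "e : basis n" for e
  using bt.hom_closed[OF in_compl[OF AK.coh_const[OF ac[OF that]]]] al.hom_closed[OF bcarr[OF that]] .
 note cc = bt.hom_closed[OF in_compl[OF c]]
 have "al (comb n a) *[C] bt (AK.mk c) = (\<Oplus>\<^bsub>C\<^esub>e\<in>basis n. bt (AK.mk (%k. a e)) *[C] al e *[C] bt (AK.mk c))"
  unfolding Comb_const[OF a, symmetric] Comb_def by(rule C.finsum_ldistr) (use basis(1) m cc in auto)
 also have "... = Comb n (%e k. c k *[A] a e)"
  unfolding Comb_def
 proof (rule C.finsum_cong'[OF refl])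
  fix e assume e: "e : basis n"
  have "AK.mk (%k. c k *[A] a e) = AK.mk c *[completion A I] AK.mk (%k. a e)"
   unfolding completion_eq by(rule AK.lim_ops(1)[symmetric]) (use AK.coh_carr[OF c] ac[OF e] in auto)
  thus "bt (AK.mk (%k. a e)) *[C] al e *[C] bt (AK.mk c) = bt (AK.mk (%k. c k *[A] a e)) *[C] al e"
   using bt.hom_mult[OF in_compl[OF c] in_compl[OF AK.coh_const[OF ac[OF e]]]] m[OF e] cc by(simp add: C.m_ac)
 qed (use bt.hom_closed[OF in_compl[OF AK.coh_ops(2)[OF c AK.coh_const[OF ac]]]] m(2) in auto)
 finally show ?thesis .
qed

lemma hpart_Comb: "x : hpart C n ==> EX b. (ALL e:basis n. AK.coh (b e)) & x = Comb n b"
proof -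
 assume x: "x : hpart C n"
 let ?V = "{al r *[C] bt b | r b. r : hpart R n & b : car (completion A I)}"
 have V: "?V <= car C" using C_part' C.H_carr by blast
 have inclI: "EX b. (ALL e:basis n. AK.coh (b e)) & x = Comb n b" if x: "x : ?V" for x
 proof -
  obtain r b where rb: "x = al r *[C] bt b" "r : hpart R n" "b : car (completion A I)" using x by blast
  obtain c where c: "AK.coh c" "b = AK.mk c" by(rule completionE[OF rb(3)])
  obtain a where a: "a : basis n \<rightarrow> car A" "r = comb n a" using hpart_comb[OF rb(2)] by blast
  have "ALL e:basis n. AK.coh (%k. c k *[A] a e)" using AK.coh_ops(2)[OF c(1) AK.coh_const[OF funcset_mem[OF a(1)]]] by blast
  moreover have "x = Comb n (%e k. c k *[A] a e)" unfolding rb(1) c(2) a(2) by(rule Comb_mult[OF a(1) c(1)])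
  ultimately show ?thesis by(intro exI[of _ "%e k. c k *[A] a e"] conjI)
 qed
 have Czero: "Comb n (%e k. 0[A]) = 0[C]"
 proof -
  have "comb n (%e. 0[A]) = \<zero>" unfolding comb_def by(rule add.finprod_one_eqI) (use bcarr in simp)
  thus ?thesis using Comb_const[of "%e. 0[A]" n] by simp
 qed
 show ?thesis
  using subsetD[OF C_part x] V
 proof (induction x rule: C.aspan_induct)
  case zero
  show ?case by(intro exI[of _ "%e k. 0[A]"]) (simp add: Czero AK.coh_const)
 next
  case (incl x) thus ?case by(rule inclI)
 next
  case (neg x)
  then obtain b where b: "!!e. e : basis n ==> AK.coh (b e)" "x = Comb n b" by blast
  have nb: "AK.coh (%k. -[A] b e k)" if "e : basis n" for e using AK.coh_ops(3)[OF b(1)[OF that] b(1)[OF that]] .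
  have "Comb n (%e k. -[A] b e k) +[C] x = Comb n (%e k. -[A] b e k +[A] b e k)"
   unfolding b(2) by(rule Comb_add[OF nb b(1), symmetric])
  also have "... = Comb n (%e k. 0[A])" unfolding Comb_def
   by(rule C.finsum_cong'[OF refl]) (use AK.coh_carr[OF b(1)] bt.hom_closed[OF in_compl[OF AK.coh_const[OF A.zero_closed]]] al.hom_closed[OF bcarr] in "auto simp: A.l_neg")
  finally have "-[C] x = Comb n (%e k. -[A] b e k)"
   using C.minus_equality[of "Comb n (%e k. -[A] b e k)" x] neg(1) C.H_carr[OF Comb_hpart[OF nb]] Czero by simp
  thus ?case using nb by(intro exI[of _ "%e k. -[A] b e k"]) simp
 next
  case (add x y)
  then obtain b c where b: "!!e. e : basis n ==> AK.coh (b e)" "x = Comb n b" "!!e. e : basis n ==> AK.coh (c e)" "y = Comb n c" by blast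
  have "x +[C] y = Comb n (%e k. b e k +[A] c e k)" using Comb_add[OF b(1) b(3)] b(2,4) by(simp only:)
  moreover have "ALL e:basis n. AK.coh (%k. b e k +[A] c e k)" using AK.coh_ops(1)[OF b(1) b(3)] by blast
  ultimately show ?case by(intro exI[of _ "%e k. b e k +[A] c e k"] conjI)
 qed
qed

text \<open>Injectivity of \<open>ga\<close> in degree \<open>n\<close>: the coefficients can be corrected to syzygies of
 \<open>basis n\<close>, which by Artin--Rees are convergent combinations of finitely many syzygies over \<open>A\<close>.\<close>

lemma Comb_zero:
 assumes b: "!!e. e : basis n ==> AK.coh (b e)" and z: "!!k. comb n (%e. b e k) : J k"
 shows "Comb n b = 0[C]"
proof -
 note bc = AK.coh_carr[OF b]
 have bP: "(%e. b e k) : basis n \<rightarrow> car A" for k using bc by auto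
 have "EX d. d : basis n \<rightarrow> K k & comb n (%e. b e k) = comb n d" for k
  using J_comb[OF z comb_closed[OF bP], of k] by blast
 then obtain d where d: "!!k. d k : basis n \<rightarrow> K k" "!!k. comb n (%e. b e k) = comb n (d k)" by metis
 have dc: "d k e : car A" if "e : basis n" for k e using AK.J_carr[OF funcset_mem[OF d(1) that]] .
 \<comment> \<open>The coefficients at level \<open>k\<close> are corrected by elements of
   \<open>I^k\<close>; this does not change their limit, and every level becomes an exact
   syzygy.\<close>
 define u where "u e k = b e k -[A] d k e" for e k
 have uc: "u e k : car A" if "e : basis n" for e k using bc[OF that] dc[OF that] by(simp add: u_def)
 have ub: "AK.cl k (u e k) = AK.cl k (b e k)" if e: "e : basis n" for e k
 proof -
  have "u e k -[A] b e k = (-[A] d k e +[A] b e k) +[A] -[A] b e k"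
   unfolding u_def a_minus_def using A.a_comm[OF bc[OF e, of k] A.a_inv_closed[OF dc[OF e, of k]]] by(simp only:)
  hence "u e k -[A] b e k = -[A] d k e"
   using bc[OF e] dc[OF e] by(simp add: A.a_assoc A.r_neg)
  thus ?thesis using AKg.H_neg[OF funcset_mem[OF d(1) e]] uc[OF e] bc[OF e] by(simp add: AK.cl_eq)
 qed
 have ucoh: "AK.coh (u e)" if e: "e : basis n" for e
  unfolding AK.coh_def
 proof (intro allI conjI uc[OF e])
  fix k
  have "AK.cl k (u e (Suc k)) = AK.cl k (b e (Suc k))" by(rule AK.cl_mono[OF ub[OF e]]) (use uc[OF e] bc[OF e] in auto)
  also have "... = AK.cl k (b e k)" using b[OF e] by(simp add: AK.coh_def)
  finally show "AK.cl k (u e (Suc k)) = AK.cl k (u e k)" using ub[OF e] by simp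
 qed
 have umk: "AK.mk (u e) = AK.mk (b e)" if "e : basis n" for e using ub[OF that] by(simp add: AK.mk_def)
 have u0: "comb n (%e. u e k) = \<zero>" for k
  using comb_diff[of "%e. b e k" n "d k"] d(2)[of k] bc dc comb_carr[of "d k" n] by(simp add: u_def r_neg a_minus_def Pi_iff)
 have E: "finite (basis n)" "basis n <= car R" using basis(1) bcarr by auto
 obtain F :: "('k + 'k + 'a) zpoly set" and \<nu> c
  where F: "finite F" "!!f e. [|f : F; e : basis n|] ==> \<nu> f e : car A"
   "!!f. f : F ==> (\<Oplus>e\<in>basis n. s (\<nu> f e) \<otimes> e) = \<zero>"
   "!!k b. [|b : basis n \<rightarrow> K k; (\<Oplus>e\<in>basis n. s (b e) \<otimes> e) = \<zero>|] ==>
    EX q. q : F \<rightarrow> K (k - c) & (ALL e:basis n. b e = (\<Oplus>\<^bsub>A\<^esub>f\<in>F. q f *[A] \<nu> f e))"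
  by(rule artin_rees[OF A.cring_axioms fg I cring_axioms s E]) blast
 \<comment> \<open>The shift by \<open>c + 1\<close> puts difference \<open>j \<ge> 1\<close> into
   \<open>I^(j+c)\<close>, so that Artin-Rees leaves coefficients in \<open>I^j\<close>.\<close>
 define v where "v e l = u e (l + c + 1)" for e l
 have vcoh: "AK.coh (v e)" and vmk: "AK.mk (v e) = AK.mk (b e)" if "e : basis n" for e
  using AK.coh_shift[OF ucoh[OF that], of "c + 1"] umk[OF that] by(simp_all add: v_def[abs_def] add.assoc)
 have vc: "v e l : car A" if "e : basis n" for e l using AK.coh_carr[OF vcoh[OF that]] .
 have dv: "(%e. AK.diffs (v e) j) : basis n \<rightarrow> K (j + c)" "(\<Oplus>e\<in>basis n. s (AK.diffs (v e) j) \<otimes> e) = \<zero>"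
  if jp: "j > 0" for j
 proof -
  obtain l where l: "j = Suc l" using jp by(cases j) auto
  show "(%e. AK.diffs (v e) j) : basis n \<rightarrow> K (j + c)"
  proof
   fix e assume e: "e : basis n"
   have "AK.cl (l + c + 1) (u e (Suc (l + c + 1))) = AK.cl (l + c + 1) (u e (l + c + 1))" using ucoh[OF e] by(simp add: AK.coh_def)
   hence "u e (Suc (l + c + 1)) -[A] u e (l + c + 1) : K (l + c + 1)" using AK.cl_eq[OF uc[OF e] uc[OF e]] by blast
   moreover have "j + c = l + c + 1" using l by simp
   ultimately show "AK.diffs (v e) j : K (j + c)" unfolding l AK.diffs_simps v_def by(simp only: add_Suc Suc_eq_plus1)
  qed
  have "(\<Oplus>e\<in>basis n. s (AK.diffs (v e) j) \<otimes> e) = comb n (%e. v e (Suc l) -[A] v e l)" by(simp add: comb_def l AK.diffs_simps)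
  also have "... = comb n (%e. v e (Suc l)) \<ominus> comb n (%e. v e l)" by(rule comb_diff) (use vc in auto)
  also have "... = \<zero>" using u0 by(simp add: v_def a_minus_def)
  finally show "(\<Oplus>e\<in>basis n. s (AK.diffs (v e) j) \<otimes> e) = \<zero>" .
 qed
 have qp: "EX q. q : F \<rightarrow> K j & (ALL e:basis n. AK.diffs (v e) j = (\<Oplus>\<^bsub>A\<^esub>f\<in>F. q f *[A] \<nu> f e))" if "j > 0" for j
  using F(4)[OF dv[OF that]] by(simp only: diff_add_inverse2)
 \<comment> \<open>The initial term lies in no particular power of \<open>I\<close>; since
   \<open>0 - c\<close> is \<open>0\<close>, only coefficients in \<open>A\<close> are asked
   for.\<close>
 have q0: "EX q. q : F \<rightarrow> K 0 & (ALL e:basis n. AK.diffs (v e) 0 = (\<Oplus>\<^bsub>A\<^esub>f\<in>F. q f *[A] \<nu> f e))"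
 proof -
  have h0: "(%e. v e 0) : basis n \<rightarrow> K 0" unfolding K0 by(rule Pi_I) (rule vc)
  have z0: "(\<Oplus>e\<in>basis n. s (v e 0) \<otimes> e) = \<zero>" using u0[of "0 + c + 1"] by(simp add: v_def comb_def)
  show ?thesis using F(4)[OF h0 z0] by(simp only: AK.diffs_simps diff_0_eq_0)
 qed
 have "EX q. q : F \<rightarrow> K j & (ALL e:basis n. AK.diffs (v e) j = (\<Oplus>\<^bsub>A\<^esub>f\<in>F. q f *[A] \<nu> f e))" for j
 proof (cases "j = 0")
  case True show ?thesis unfolding True by(rule q0)
 qed (rule qp, simp)
 hence "ALL j. EX q. q : F \<rightarrow> K j & (ALL e:basis n. AK.diffs (v e) j = (\<Oplus>\<^bsub>A\<^esub>f\<in>F. q f *[A] \<nu> f e))" by(rule allI)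
 from choice[OF this] obtain q
  where qq: "ALL j. q j : F \<rightarrow> K j & (ALL e:basis n. AK.diffs (v e) j = (\<Oplus>\<^bsub>A\<^esub>f\<in>F. q j f *[A] \<nu> f e))" ..
 have q: "q j : F \<rightarrow> K j" for j using spec[OF qq, of j] by(rule conjunct1)
 have q2: "AK.diffs (v e) j = (\<Oplus>\<^bsub>A\<^esub>f\<in>F. q j f *[A] \<nu> f e)" if "e : basis n" for j e
  using bspec[OF conjunct2[OF spec[OF qq, of j]] that] .
 have qK: "q j f : K j" if "f : F" for j f using funcset_mem[OF q that] .
 have qc: "q j f : car A" if "f : F" for j f using AK.J_carr[OF qK[OF that]] .
 define y where "y f = AK.psum (%j. q j f)" for f
 have y: "AK.coh (y f)" if f: "f : F" for f
  unfolding y_def by(rule AK.psum_coh) (use qc[OF f] qK[OF f] AK.J_Suc in blast)+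
 have vy: "v e l = (\<Oplus>\<^bsub>A\<^esub>f\<in>F. y f l *[A] \<nu> f e)" if e: "e : basis n" for e l
 proof -
  have "AK.psum (AK.diffs (v e)) l = (\<Oplus>\<^bsub>A\<^esub>f\<in>F. AK.psum (%j. q j f) l *[A] \<nu> f e)"
   by(rule AK.psum_finsum, erule qc, erule F(2)[OF _ e], rule q2[OF e])
  thus ?thesis using AK.psum_diffs[of "v e"] vc[OF e] by(simp add: y_def)
 qed
 have bv: "bt (AK.mk (b e)) = (\<Oplus>\<^bsub>C\<^esub>f\<in>F. bt (AK.mk (y f)) *[C] al (s (\<nu> f e)))" if e: "e : basis n" for e
 proof -
  have "bt (AK.mk (v e)) = (\<Oplus>\<^bsub>C\<^esub>f\<in>F. bt (AK.mk (y f)) *[C] bt (to_completion A I (\<nu> f e)))"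
   by(rule mk_lincomb[OF y F(2)[OF _ e] vy[OF e] C.cring_axioms bt])
  also have "... = (\<Oplus>\<^bsub>C\<^esub>f\<in>F. bt (AK.mk (y f)) *[C] al (s (\<nu> f e)))"
   by(rule C.finsum_cong'[OF refl])
    (use als[OF F(2)[OF _ e]] bt.hom_closed[OF in_compl[OF y]] al.hom_closed[OF s.hom_closed[OF F(2)[OF _ e]]] in auto)
  finally show ?thesis using vmk[OF e] by simp
 qed
 have cl: "bt (AK.mk (y f)) : car C" "al (s (\<nu> f e)) : car C" "al e : car C" if "f : F" "e : basis n" for f e
  using bt.hom_closed[OF in_compl[OF y[OF that(1)]]] al.hom_closed[OF s.hom_closed[OF F(2)[OF that]]] al.hom_closed[OF bcarr[OF that(2)]] .
 have ae: "al e : car C" if "e : basis n" for e using al.hom_closed[OF bcarr[OF that]] .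
 \<comment> \<open>After exchanging the sums, each generating syzygy can be applied inside
   \<open>C\<close>, where it holds as the image under \<open>al\<close> of a relation in
   \<open>R\<close>.\<close>
 have "Comb n b = (\<Oplus>\<^bsub>C\<^esub>e\<in>basis n. \<Oplus>\<^bsub>C\<^esub>f\<in>F. bt (AK.mk (y f)) *[C] al (s (\<nu> f e)) *[C] al e)"
  unfolding Comb_def
 proof (rule C.finsum_cong'[OF refl])
  fix e assume e: "e : basis n"
  show "bt (AK.mk (b e)) *[C] al e = (\<Oplus>\<^bsub>C\<^esub>f\<in>F. bt (AK.mk (y f)) *[C] al (s (\<nu> f e)) *[C] al e)"
   unfolding bv[OF e] by(rule C.finsum_ldistr) (use F(1) ae[OF e] cl(1,2)[OF _ e] in auto)
 qed (use cl in auto)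
 also have "... = (\<Oplus>\<^bsub>C\<^esub>f\<in>F. \<Oplus>\<^bsub>C\<^esub>e\<in>basis n. bt (AK.mk (y f)) *[C] al (s (\<nu> f e)) *[C] al e)"
  by(rule C.finsum_swap) (use cl in auto)
 also have "... = 0[C]"
 proof (rule C.add.finprod_one_eqI)
  fix f assume f: "f : F"
  note yf = bt.hom_closed[OF in_compl[OF y[OF f]]]
  have "(\<Oplus>\<^bsub>C\<^esub>e\<in>basis n. bt (AK.mk (y f)) *[C] al (s (\<nu> f e)) *[C] al e) =
    (\<Oplus>\<^bsub>C\<^esub>e\<in>basis n. bt (AK.mk (y f)) *[C] al (s (\<nu> f e) \<otimes> e))"
   by(rule C.finsum_cong'[OF refl]) (use cl[OF f] al.hom_closed F(2)[OF f] bcarr yf in "auto simp: C.m_assoc")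
  also have "... = bt (AK.mk (y f)) *[C] (\<Oplus>\<^bsub>C\<^esub>e\<in>basis n. al (s (\<nu> f e) \<otimes> e))"
   by(rule C.finsum_rdistr[symmetric]) (use basis(1) F(2)[OF f] bcarr yf in auto)
  also have "(\<Oplus>\<^bsub>C\<^esub>e\<in>basis n. al (s (\<nu> f e) \<otimes> e)) = al (\<Oplus>e\<in>basis n. s (\<nu> f e) \<otimes> e)"
   by(subst al.hom_finsum) (use F(2)[OF f] bcarr in "auto simp: comp_def")
  also have "... = 0[C]" by(simp add: F(3)[OF f])
  finally show "(\<Oplus>\<^bsub>C\<^esub>e\<in>basis n. bt (AK.mk (y f)) *[C] al (s (\<nu> f e)) *[C] al e) = 0[C]" using yf by simp
 qed
 finally show ?thesis .
qed

lemma ga_hpart: "x : hpart C n ==> ga x : lpart R J n"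
 using hpart_Comb[of x n] ga_Comb[of n] comb_coh(2)[of n] by auto

lemma ga_hpart_zero: assumes x: "x : hpart C n" and z: "ga x = 0[GL]" shows "x = 0[C]"
proof -
 obtain b where b: "!!e. e : basis n ==> AK.coh (b e)" "x = Comb n b" using hpart_Comb[OF x] by blast
 have "mk (%k. comb n (%e. b e k)) = 0[LR]" using z ga_Comb[OF b(1)] b(2) by simp
 hence "comb n (%e. b e k) : J k" for k
  using mk_zero[of "%k. comb n (%e. b e k)"] coh_carr[OF comb_coh(1)[OF b(1)]] by simp
 from Comb_zero[OF b(1) this] show ?thesis unfolding b(2) .
qed

lemma ga_hpart_surj: assumes y: "y : lpart R J n" obtains x where "x : hpart C n" "ga x = y"
proof -
 obtain b where b: "!!e. e : basis n ==> AK.coh (b e)" "y = mk (%k. comb n (%e. b e k))" using limit_part_comb[OF y] by blast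
 show thesis by(rule that[OF Comb_hpart[OF b(1)]]) (use ga_Comb[OF b(1)] b(2) in auto)
qed

lemma ga_finsum: assumes "!!n. y n : hpart C n" shows "ga (finsum C y {..N}) = finsum GL (%n. ga (y n)) {..N}"
 by(subst ga.hom_finsum) (use C.H_carr[OF assms] in "auto simp: comp_def")

lemma zero_comp: "x : car GL ==> x = 0[GL] \<longleftrightarrow> (ALL k. x k = cl k \<zero>)"
 by(simp add: lim_consts mk_def fun_eq_iff)

text \<open>By \<open>GL_direct\<close> at every level, the homogeneous components have zero image
  one by one.\<close>

lemma ga_zero: assumes x: "x : car C" and z: "ga x = 0[GL]" shows "x = 0[C]"
proof -
 obtain y N where y: "!!n. y n : hpart C n" "x = finsum C y {..N}" by(rule C.finsum_rep[OF C_span[OF x]]) blast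
 have fs: "finsum GL (%n. ga (y n)) {..N} = 0[GL]" using z ga_finsum[OF y(1)] y(2) by simp
 have "y n = 0[C]" if n: "n <= N" for n
 proof (rule ga_hpart_zero[OF y(1)])
  have "ga (y n) k = cl k \<zero>" for k
   by(rule GL_direct[where y = "%n. ga (y n)", OF ga_hpart[OF y(1)] _ n]) (use fs zero_comp[OF GL.zero_closed] in simp)
  thus "ga (y n) = 0[GL]" using zero_comp[OF limit_part_GL[OF ga_hpart[OF y(1)]]] by blast
 qed
 thus ?thesis unfolding y(2) by(intro C.add.finprod_one_eqI) simp
qed

lemma ga_inj: "inj_on ga (car C)"
proof (rule inj_onI)
 fix x y assume xy: "x : car C" "y : car C" "ga x = ga y"
 have "ga (x -[C] y) = 0[GL]" using xy ga.hom_closed[OF xy(2)] by(simp add: a_minus_def GL.r_neg del: GL_simps)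
 thus "x = y" using ga_zero[OF C.minus_closed[OF xy(1,2)]] C.r_right_minus_eq[OF xy(1,2)] by simp
qed

theorem ga_bij: "bij_betw ga (car C) (car GL)" and ga_bij_hpart: "bij_betw ga (hpart C n) (lpart R J n)"
proof -
 have "z : ga ` car C" if z: "z : car GL" for z
 proof -
  interpret G: gfam GL "lpart R J" by(rule GL_gfam)
  obtain y N where y: "!!n. y n : lpart R J n" "z = finsum GL y {..N}" by(rule G.finsum_rep[OF GL_aspan[OF z]]) blast
  have "EX x. x : hpart C n & ga x = y n" for n using ga_hpart_surj[OF y(1)] by metis
  then obtain x where x: "!!n. x n : hpart C n" "!!n. ga (x n) = y n" by metis
  have "z = ga (finsum C x {..N})" using ga_finsum[OF x(1)] x(2) y(2) by simp
  thus ?thesis using C.finsum_closed[of x "{..N}"] C.H_carr[OF x(1)] by blast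
 qed
 thus "bij_betw ga (car C) (car GL)"
  unfolding bij_betw_def using ga_inj ga.hom_closed by blast
 have "lpart R J n \<subseteq> ga ` hpart C n" using ga_hpart_surj by blast
 thus "bij_betw ga (hpart C n) (lpart R J n)"
  unfolding bij_betw_def using inj_on_subset[OF ga_inj, of "hpart C n"] C.H_carr ga_hpart by blast
qed

section \<open>Completeness of \<open>C\<close> for its own adic filtration\<close>

abbreviation JC :: "nat => 'c set" where "JC == adic A I C (%a. al (s a))"

lemma als_hom: "(%a. al (s a)) : ring_hom A C"
 using ring_hom_trans[OF s al] by(simp add: comp_def)

lemma JC_filtered: "filtered C JC" and als_JC: "a : K k ==> al (s a) : JC k"
 using cl_hom_adic[OF A.cring_axioms I C.cring_axioms als_hom] by blast+

sublocale CF: filtered C JC by(rule JC_filtered)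

lemma al_J: "al ` J k \<subseteq> JC k"
proof -
 interpret j: ideal "JC k" C by(rule CF.J_ideal)
 have sK: "s ` K k <= car R" using AK.J_carr by auto
 have "al x : JC k" if "x : J k" for x
  using that[unfolded J_eq] sK cring_axioms
 proof (induction x rule: Idl_induct)
  case zero thus ?case by simp
 next
  case (smult v r)
  hence "v : car R" "al v : JC k" using sK als_JC by auto
  thus ?case using smult j.I_r_closed by simp
 next
  case (add x y)
  have "x : car R" "y : car R" using add(1,2) ideal.Icarr[OF genideal_ideal[OF sK]] by auto
  thus ?case using add by simp
 qed
 thus ?thesis by blast
qed

text \<open>By \<open>completion_vanish\<close>, an element of the completion vanishing modulo
  \<open>I^k\<close> is a finite combination of elements of \<open>I^k\<close> with coefficients in
  the completion, and \<open>bt\<close> carries it into the ideal generated by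
  \<open>I^k\<close>.\<close>

lemma bt_vanish: assumes b: "AK.coh b" "b k : K k" shows "bt (AK.mk b) : JC k"
proof -
 interpret j: ideal "JC k" C by(rule CF.J_ideal)
 interpret jg: additive_subgroup "JC k" C ..
 obtain T y where T: "finite T" "T \<subseteq> K k" "!!t. t : T ==> AK.coh (y t)"
  "!!l. b (l + k) = (\<Oplus>\<^bsub>A\<^esub>t\<in>T. y t l *[A] t)" by(rule completion_vanish[OF b]) blast
 have Tc: "t : car A" if "t : T" for t using AK.J_carr[OF subsetD[OF T(2) that]] .
 have e: "bt (AK.mk b) = (\<Oplus>\<^bsub>C\<^esub>t\<in>T. bt (AK.mk (y t)) *[C] bt (to_completion A I t))"
  using mk_lincomb[OF T(3) Tc T(4) C.cring_axioms bt] AK.coh_shift(2)[OF b(1)] by simp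
 have m: "bt (AK.mk (y t)) *[C] bt (to_completion A I t) : JC k" if "t : T" for t
  using j.I_l_closed[OF als_JC[OF subsetD[OF T(2) that]] bt.hom_closed[OF in_compl[OF T(3)[OF that]]]] als[OF Tc[OF that]] by simp
 show ?thesis
  unfolding e using T(1) m
 proof (induction T)
  case (insert t T)
  thus ?case using j.Icarr j.a_closed by(subst C.finsum_insert) auto
 qed simp
qed

lemma ga_JC: assumes "x : JC k" shows "ga x k = cl k \<zero>"
proof -
 have sK: "(%a. al (s a)) ` K k <= car C" using AK.J_carr by auto
 interpret p: ring_hom_cring LR "R Quot J k" "%x. x k"
  by(rule rh_cringI[OF lim_cring Q_cring proj_hom])
 have z: "0[R Quot J k] = cl k \<zero>" using p.hom_zero by(simp add: lim_consts mk_def)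
 note gc = GL_sub[OF ga.hom_closed]
 show ?thesis
  using assms[unfolded adic_def] sK C.cring_axioms
 proof (induction x rule: C.Idl_induct)
  case zero thus ?case using ga.hom_zero by(simp add: lim_consts mk_def)
 next
  case (smult v r)
  then obtain a where a: "a : K k" "v = al (s a)" by blast
  have "ga v k = cl k \<zero>" using gaal[OF s.hom_closed[OF AK.J_carr[OF a(1)]]] a s_K cl_zero[OF s.hom_closed[OF AK.J_carr[OF a(1)]]]
   by(auto simp: to_limit_mk mk_def)
  moreover have "v : car C" using a AK.J_carr by simp
  ultimately show ?case using ga.hom_mult[of v r] smult(2) p.hom_mult[OF gc gc, of v r] p.hom_closed[OF gc, of r] z
    p.S.l_null[of "ga r k", unfolded z] by simp
 next
  case (add x y)
  have "x : car C" "y : car C" using add(1,2) ideal.Icarr[OF C.genideal_ideal[OF sK]] by auto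
  thus ?case using add ga.hom_add[of x y] p.hom_add[OF gc gc, of x y] z[symmetric] by simp
 qed
qed

text \<open>Split the coefficients as \<open>(b - b k) + b k\<close>. The first part vanishes at
  level \<open>k\<close> and falls under \<open>bt_vanish\<close>; the constant part is the image of
  an element of \<open>R\<close> that lies in \<open>J k\<close>.\<close>

lemma JC_hpart: assumes x: "x : hpart C n" and z: "ga x k = cl k \<zero>" shows "x : JC k"
proof -
 interpret j: ideal "JC k" C by(rule CF.J_ideal)
 obtain b where b: "!!e. e : basis n ==> AK.coh (b e)" "x = Comb n b" using hpart_Comb[OF x] by blast
 note bc = AK.coh_carr[OF b(1)]
 have bP: "(%e. b e k) : basis n \<rightarrow> car A" using bc by auto
 have "comb n (%e. b e k) : J k" using z ga_Comb[OF b(1)] b(2) cl_zero[OF comb_carr[OF bP]] by(simp add: mk_def)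
 from J_comb[OF this comb_closed[OF bP]] obtain d where d: "d : basis n \<rightarrow> K k" "comb n (%e. b e k) = comb n d" by blast
 have dJ: "comb n d : J k" by(rule comb_J[OF d(1)])
 have nk: "AK.coh (%l. b e l +[A] -[A] b e k)" if "e : basis n" for e
  using AK.coh_ops(1)[OF b(1)[OF that] AK.coh_const[of "-[A] b e k"]] bc[OF that] by simp
 have ck: "AK.coh (%l. b e k)" if "e : basis n" for e using AK.coh_const[OF bc[OF that]] .
 have "Comb n b = Comb n (%e l. (b e l +[A] -[A] b e k) +[A] b e k)" unfolding Comb_def
 proof (rule C.finsum_cong'[OF refl])
  fix e assume e: "e : basis n"
  have "(%l. (b e l +[A] -[A] b e k) +[A] b e k) = b e" using bc[OF e] by(intro ext) (simp add: A.a_assoc A.l_neg)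
  thus "bt (AK.mk (b e)) *[C] al e = bt (AK.mk (%l. (b e l +[A] -[A] b e k) +[A] b e k)) *[C] al e"
   by(simp only:)
 qed (intro Pi_I C.m_closed bt.hom_closed in_compl AK.coh_ops(1) nk ck al.hom_closed bcarr; assumption)
 also have "... = Comb n (%e l. b e l +[A] -[A] b e k) +[C] al (comb n d)"
  using Comb_add[of n "%e l. b e l +[A] -[A] b e k" "%e l. b e k", OF nk ck] Comb_const[OF bP] d(2) by(simp only:)
 also have "Comb n (%e l. b e l +[A] -[A] b e k) : JC k"
 proof -
  have m: "bt (AK.mk (%l. b e l +[A] -[A] b e k)) *[C] al e : JC k" if e: "e : basis n" for e
   by(rule j.I_r_closed[OF bt_vanish[OF nk[OF e]] al.hom_closed[OF bcarr[OF e]]]) (use bc[OF e] AKg.H_zero in "simp add: A.r_neg")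
  have "(\<Oplus>\<^bsub>C\<^esub>e\<in>B. bt (AK.mk (%l. b e l +[A] -[A] b e k)) *[C] al e) : JC k" if "B \<subseteq> basis n" for B
   using finite_subset[OF that basis(1)] that
  proof (induction B)
   case (insert e B)
   thus ?case using m j.Icarr[OF m] j.a_closed by(subst C.finsum_insert) (auto simp: subset_iff)
  qed simp
  thus ?thesis unfolding Comb_def by blast
 qed
 ultimately show ?thesis unfolding b(2) using al_J[of k] dJ j.a_closed by auto
qed

text \<open>Consequently \<open>C\<close> and \<open>R\<close> have the same quotients at each
  level; completeness of \<open>C\<close> then follows from the bijectivity of
  \<open>ga\<close>.\<close>

lemma JC_iff: assumes x: "x : car C" shows "x : JC k \<longleftrightarrow> ga x k = cl k \<zero>"
proof
 assume z: "ga x k = cl k \<zero>"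
 interpret j: ideal "JC k" C by(rule CF.J_ideal)
 obtain y N where y: "!!n. y n : hpart C n" "x = finsum C y {..N}" by(rule C.finsum_rep[OF C_span[OF x]]) blast
 have fs: "finsum GL (%n. ga (y n)) {..N} k = cl k \<zero>" using z ga_finsum[OF y(1)] y(2) by simp
 have m: "y n : JC k" if "n <= N" for n
  by(rule JC_hpart[OF y(1)]) (rule GL_direct[where y = "%n. ga (y n)", OF ga_hpart[OF y(1)] fs that])
 have "finsum C y {..M} : JC k" if "M <= N" for M
  using that
 proof (induction M)
  case 0 thus ?case using C.finsum_0[of y] C.H_carr[OF y(1)] m by simp
 next
  case (Suc M) thus ?case using C.finsum_Suc[of y M] C.H_carr[OF y(1)] m j.a_closed by simp
 qed
 thus "x : JC k" using y(2) by simp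
qed (rule ga_JC)

lemma JC_diff:
 assumes x: "x : car C" and y: "y : car C" shows "CF.cl k x = CF.cl k y \<longleftrightarrow> ga x k = ga y k"
proof -
 interpret p: ring_hom_cring LR "R Quot J k" "%x. x k"
  by(rule rh_cringI[OF lim_cring Q_cring proj_hom])
 have z: "0[R Quot J k] = cl k \<zero>" using p.hom_zero by(simp add: lim_consts mk_def)
 note gx = GL_sub[OF ga.hom_closed[OF x]] and gy = GL_sub[OF ga.hom_closed[OF y]]
 have "ga (x -[C] y) k = ga x k -[R Quot J k] ga y k"
  using x y gx gy p.hom_add[OF gx LR.a_inv_closed[OF gy]] GL_a_inv[OF ga.hom_closed[OF y]] by(simp add: a_minus_def)
 thus ?thesis
  using JC_iff[OF C.minus_closed[OF x y]] p.S.r_right_minus_eq[OF p.hom_closed[OF gx] p.hom_closed[OF gy]] z x y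
  by(simp add: CF.cl_eq)
qed

lemma ga_inv_limit_map: assumes x: "x : car C" shows "lmap C JC al (ga x) = to_limit C JC x"
proof -
 obtain rh where r: "coh rh" "ga x = mk rh" by(rule limE[OF GL_sub[OF ga.hom_closed[OF x]]])
 note rc = coh_carr[OF r(1)]
 have "lmap C JC al (mk rh) = CF.mk (%k. al (rh k))"
  by(rule limit_map_mk(1)[OF filtered_axioms CF.filtered_axioms al al_J rc])
 also have "... = CF.mk (%_. x)"
  unfolding CF.mk_def
 proof
  fix k
  have "ga (al (rh k)) k = ga x k" using gaal[OF rc] r(2) by(simp add: to_limit_mk mk_def)
  thus "CF.cl k (al (rh k)) = CF.cl k x" using JC_diff[OF al.hom_closed[OF rc] x] by simp
 qed
 finally show ?thesis using r(2) by(simp add: CF.to_limit_mk)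
qed

lemma C_complete: "graded_complete C JC"
proof -
 interpret t: ring_hom_cring C CF.LR "to_limit C JC"
  by(rule rh_cringI[OF C.cring_axioms CF.lim_cring CF.to_limit_hom])
 have inj: "inj_on (to_limit C JC) (car C)"
 proof (rule inj_onI)
  fix x y assume xy: "x : car C" "y : car C" "to_limit C JC x = to_limit C JC y"
  hence "CF.cl k x = CF.cl k y" for k by(simp add: CF.to_limit_mk CF.mk_def fun_eq_iff)
  hence "ga x = ga y" using JC_diff[OF xy(1,2)] by blast
  thus "x = y" using ga_inj xy by(simp add: inj_on_def)
 qed
 have tp: "to_limit C JC x : lpart C JC n" if "x : hpart C n" for x n
  using that t.hom_closed[OF C.H_carr[OF that]] by(auto simp: limit_part_def to_limit_def)
 have pt: "EX x. x : hpart C n & to_limit C JC x = z" if z: "z : lpart C JC n" for z n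
 proof -
  have zc: "z : car CF.LR" "ALL k. EX c. c : hpart C n & z k = CF.cl k c" using z by(auto simp: limit_part_def CF.cl_def)
  obtain c where c: "!!k. c k : hpart C n" "!!k. z k = CF.cl k (c k)" using zc(2) by metis
  note cc = C.H_carr[OF c(1)]
  obtain w where w: "CF.coh w" "z = CF.mk w" by(rule CF.limE[OF zc(1)])
  have cw: "CF.cl k (c k) = CF.cl k (w k)" for k using c(2)[of k] w(2) by(simp add: CF.mk_def)
  have cs: "CF.cl k (c (Suc k)) = CF.cl k (c k)" for k
  proof -
   have "CF.cl k (c (Suc k)) = CF.cl k (w (Suc k))" by(rule CF.cl_mono[OF cw]) (use cc CF.coh_carr[OF w(1)] in auto)
   thus ?thesis using w(1) cw[of k] by(simp add: CF.coh_def)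
  qed
  have "EX rh. coh rh & (ALL l. rh l : hpart R n) & ga (c k) = mk rh" for k using ga_hpart[OF c(1)] lpart_mk by blast
  then obtain rh where r: "!!k. coh (rh k)" "!!k l. rh k l : hpart R n" "!!k. ga (c k) = mk (rh k)" by metis
  have rk: "ga (c k) k = cl k (rh k k)" for k using r(3) by(simp add: mk_def)
  \<comment> \<open>A diagonal sequence: level \<open>k\<close> of the limit is represented by level
    \<open>k\<close> of the image of \<open>c k\<close>. The preimage of its limit under
    \<open>ga\<close> is the required element of \<open>C\<close>.\<close>
  have coh: "coh (%k. rh k k)"
   unfolding coh_def
  proof (intro allI conjI H_carr[OF r(2)])
   fix k
   have "cl k (rh (Suc k) (Suc k)) = cl k (rh (Suc k) k)" using r(1) by(simp add: coh_def)
   also have "... = ga (c (Suc k)) k" using r(3) by(simp add: mk_def)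
   also have "... = ga (c k) k" using JC_diff[OF cc cc] cs by blast
   finally show "cl k (rh (Suc k) (Suc k)) = cl k (rh k k)" using rk by simp
  qed
  have "mk (%k. rh k k) : lpart R J n" unfolding lpart_mk using coh r(2) by blast
  then obtain x where x: "x : hpart C n" "ga x = mk (%k. rh k k)" by(rule ga_hpart_surj)
  have "CF.cl k x = CF.cl k (c k)" for k using JC_diff[OF C.H_carr[OF x(1)] cc] x(2) rk by(simp add: mk_def)
  hence "to_limit C JC x = z" using c(2) by(simp add: CF.to_limit_mk CF.mk_def fun_eq_iff)
  thus ?thesis using x(1) by blast
 qed
 have fs: "to_limit C JC (finsum C y {..N}) = finsum CF.LR (%n. to_limit C JC (y n)) {..N}" if "!!n. y n : hpart C n" for y N
  by(subst t.hom_finsum) (use C.H_carr[OF that] in "auto simp: comp_def")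
 have GC: "car (graded_limit C JC) = {finsum CF.LR y {..N} | y N. ALL n. y n : lpart C JC n}"
  by(simp add: graded_limit_def)
 have "to_limit C JC ` car C = car (graded_limit C JC)"
 proof (rule equalityI; rule subsetI)
  fix z assume "z : to_limit C JC ` car C"
  then obtain x where x: "x : car C" "z = to_limit C JC x" by blast
  obtain y N where y: "!!n. y n : hpart C n" "x = finsum C y {..N}" by(rule C.finsum_rep[OF C_span[OF x(1)]]) blast
  have "z = finsum CF.LR (%n. to_limit C JC (y n)) {..N}" unfolding x(2) y(2) by(rule fs[OF y(1)])
  thus "z : car (graded_limit C JC)" unfolding GC using tp[OF y(1)] by blast
 next
  fix z assume "z : car (graded_limit C JC)"
  then obtain y N where y: "z = finsum CF.LR y {..N}" "!!n. y n : lpart C JC n" unfolding GC by blast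
  have "ALL n. EX x. x : hpart C n & to_limit C JC x = y n" using pt[OF y(2)] by blast
  then obtain x where x: "!!n. x n : hpart C n" "!!n. to_limit C JC (x n) = y n" by metis
  have "z = to_limit C JC (finsum C x {..N})" unfolding fs[OF x(1)] x(2) y(1) ..
  thus "z : to_limit C JC ` car C" using C.finsum_closed[of x "{..N}"] C.H_carr[OF x(1)] by blast
 qed
 thus ?thesis unfolding graded_complete_def bij_betw_def using inj by blast
qed

text \<open>Identifies the continuous extension of \<open>al\<close> as the inverse of
  \<open>ga\<close>; the extension maps of the theorem are computed through this.\<close>

lemma extend_limit_ga: "x : car C ==> extend_limit C JC al (ga x) = x"
 unfolding extend_limit_def
 using ga_inv_limit_map[of x] inv_into_f_f[of "to_limit C JC" "car C" x] C_complete[unfolded graded_complete_def bij_betw_def] by simp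

end

section \<open>Tensor products\<close>

locale tensor_algebra = B: cring B + C: cring C
 for B :: "'b graded_ring" and C :: "'c graded_ring" +
 fixes K :: "('k, 'o) ring_scheme" and f :: "'k => 'b" and g :: "'k => 'c"
 assumes f: "k : car K ==> f k : car B" and g: "k : car K ==> g k : car C"
begin

abbreviation "TT == tensor B C K f g"
abbreviation "tt == tensor_elem B C K f g"
abbreviation "TP == pres (car B \<times> car C) (tensor_rels B C K f g)"

sublocale P: presentation "car B \<times> car C" "tensor_rels B C K f g"
 by unfold_locales (auto simp: tensor_rels_def intro!: zpoly_diff zpoly_closed f g)

lemma tensor_eq: "TT = with_grading TP (hpart TT)"
 by(simp add: tensor_def Let_def)

lemma T_simps: "car TT = car TP" "monoid.mult TT = monoid.mult TP" "one TT = one TP" "ring.zero TT = ring.zero TP" "add TT = add TP"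
 by(simp_all add: tensor_def Let_def)

lemma T_cring: "cring TT"
 by(subst tensor_eq) (rule cring_with_grading[OF P.pres_cring])

sublocale T: cring TT by(rule T_cring)

lemma T_hom: "ring_hom TT Q = ring_hom TP Q"
 by(subst tensor_eq) (rule ring_hom_with_grading)

lemma tt_class: "tt b c = pcls (car B \<times> car C) (tensor_rels B C K f g) (zvar (b, c))"
 by(simp add: tensor_elem_def)

lemma tt_closed: "[|b : car B; c : car C|] ==> tt b c : car TT"
 unfolding tt_class T_simps by(rule P.class_closed) simp

lemma tt_add1: "[|b : car B; b' : car B; c : car C|] ==> tt (b +[B] b') c = tt b c +[TT] tt b' c"
 unfolding tt_class T_simps
 by(subst P.class_add[symmetric], simp, simp, rule P.pres_class_rel) (auto simp: tensor_rels_def)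

lemma tt_add2: "[|b : car B; c : car C; c' : car C|] ==> tt b (c +[C] c') = tt b c +[TT] tt b c'"
 unfolding tt_class T_simps
 by(subst P.class_add[symmetric], simp, simp, rule P.pres_class_rel) (auto simp: tensor_rels_def)

lemma tt_bal: "[|b : car B; c : car C; k : car K|] ==> tt (b *[B] f k) c = tt b (g k *[C] c)"
 unfolding tt_class
 by(rule P.pres_class_rel) (use f[of k] g[of k] in "auto simp: tensor_rels_def")

lemma tt_mult: "[|b : car B; b' : car B; c : car C; c' : car C|] ==>
  tt b c *[TT] tt b' c' = tt (b *[B] b') (c *[C] c')"
 unfolding tt_class T_simps
 by(subst P.class_mult[symmetric], simp, simp, rule P.pres_class_rel) (auto simp: tensor_rels_def)

lemma tt_one: "tt 1[B] 1[C] = 1[TT]"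
 unfolding tt_class T_simps P.class_one[symmetric]
 by(rule P.pres_class_rel) (auto simp: tensor_rels_def)

lemma in1_hom: "(%b. tt b 1[C]) : ring_hom B TT"
 by(rule ring_hom_memI) (simp_all add: tt_closed tt_mult tt_add1 tt_one)

lemma in2_hom: "(%c. tt 1[B] c) : ring_hom C TT"
 by(rule ring_hom_memI) (simp_all add: tt_closed tt_mult tt_add2 tt_one)

sublocale in1: ring_hom_cring B TT "%b. tt b 1[C]" by(rule rh_cringI[OF B.cring_axioms T_cring in1_hom])
sublocale in2: ring_hom_cring C TT "%c. tt 1[B] c" by(rule rh_cringI[OF C.cring_axioms T_cring in2_hom])

lemma tt_split: "[|b : car B; c : car C|] ==> tt b c = tt b 1[C] *[TT] tt 1[B] c"
 by(simp add: tt_mult)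

lemma in1_in2: "k : car K ==> tt (f k) 1[C] = tt 1[B] (g k)"
 using tt_bal[of "1[B]" "1[C]" k] f g by simp

lemma tensor_span: "x : car TT ==> x : aspan TT {tt b c | b c. b : car B & c : car C}"
proof -
 let ?V = "{tt b c | b c. b : car B & c : car C}"
 let ?c = "pcls (car B \<times> car C) (tensor_rels B C K f g)"
 have V: "?V <= car TT" using tt_closed by blast
 interpret A: additive_subgroup "aspan TT ?V" TT by(rule T.aspan_subgroup[OF V])
 interpret c: ring_hom_cring "zpolys (car B \<times> car C)" TP ?c by(rule P.class_hom)
 assume "x : car TT"
 then obtain p where p: "p : car (zpolys (car B \<times> car C))" "x = ?c p" by(auto simp: T_simps P.carrier_pres)
 have "?c p : aspan TT ?V"
  using p(1)
 proof (induction p rule: zpoly_induct)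
  case zero thus ?case using A.zero_closed c.hom_zero by(simp add: T_simps)
 next
  case one
  have "tt 1[B] 1[C] : aspan TT ?V" by(rule T.aspan_incl) blast
  thus ?case using tt_one P.class_one by(simp add: T_simps)
 next
  case (var h)
  obtain b d where h: "h = (b, d)" "b : car B" "d : car C" using var by blast
  have "tt b d : aspan TT ?V" by(rule T.aspan_incl) (use h in blast)
  thus ?case by(simp add: h(1) tt_class)
 next
  case (add p q) thus ?case using A.a_closed P.class_add by(simp add: T_simps)
 next
  case (diff p)
  have m: "- p : car (zpolys (car B \<times> car C))" using zpoly_diff[OF zpoly_consts(1) diff(1)] by simp
  have z: "?c (- p) +[TT] ?c p = 0[TT]" using P.class_add[OF m diff(1)] c.hom_zero by(simp add: T_simps)
  have "?c p : car TT" "?c (- p) : car TT" using P.class_closed[OF diff(1)] P.class_closed[OF m] by(simp_all add: T_simps)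
  from T.minus_equality[OF z this] have "?c (- p) = -[TT] ?c p" by simp
  thus ?case using A.a_inv_closed[OF diff(2)] by(simp only:)
 next
  case (mult p q)
  have "?c p *[TT] ?c q : aspan TT ?V"
  proof (rule T.aspan_mult[OF _ _ V V A.additive_subgroup_axioms])
   show "?c p : aspan TT ?V" "?c q : aspan TT ?V" using mult by blast+
   fix v w assume "v : ?V" "w : ?V"
   then obtain b d b' d' where vw: "v = tt b d" "b : car B" "d : car C" "w = tt b' d'" "b' : car B" "d' : car C" by blast
   have "tt (b *[B] b') (d *[C] d') : aspan TT ?V" by(rule T.aspan_incl) (use vw in blast)
   thus "v *[TT] w : aspan TT ?V" using vw by(simp add: tt_mult)
  qed
  thus ?case using P.class_mult mult by(simp add: T_simps)
 qed
 thus ?thesis using p(2) by simp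
qed

lemma tensor_hom_ext:
 assumes Q: "cring Q" and h: "h : ring_hom TT Q" "h' : ring_hom TT Q"
  and e1: "!!b. b : car B ==> h (tt b 1[C]) = h' (tt b 1[C])" and e2: "!!c. c : car C ==> h (tt 1[B] c) = h' (tt 1[B] c)"
  and x: "x : car TT"
 shows "h x = h' x"
proof (rule P.hom_ext[OF Q h[unfolded T_hom] _ x[unfolded T_simps]])
 fix u assume "u : car B \<times> car C"
 then obtain b c where u: "u = (b, c)" "b : car B" "c : car C" by blast
 have "h (tt b c) = h' (tt b c)"
  unfolding tt_split[OF u(2,3)] using ring_hom_mult[OF h(1)] ring_hom_mult[OF h(2)] u e1 e2 by simp
 thus "h (pcls (car B \<times> car C) (tensor_rels B C K f g) (zvar u)) =
  h' (pcls (car B \<times> car C) (tensor_rels B C K f g) (zvar u))" by(simp add: u(1) tt_class)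
qed

text \<open>The universal property, with the map on generators left as a parameter
  \<open>\<phi>\<close>, because the structure maps are defined by various expressions on pairs that
  split as a product on the carriers only.\<close>

lemma tensor_lift:
 assumes Q: "cring Q" and p: "p : ring_hom B Q" and q: "q : ring_hom C Q"
  and bal: "!!k. k : car K ==> p (f k) = q (g k)"
  and \<phi>: "!!b c. [|b : car B; c : car C|] ==> \<phi> (b, c) = p b *[Q] q c"
 shows "pres_map Q \<phi> : ring_hom TT Q"
  and "[|b : car B; c : car C|] ==> pres_map Q \<phi> (tt b c) = p b *[Q] q c"
  and "b : car B ==> pres_map Q \<phi> (tt b 1[C]) = p b"
  and "c : car C ==> pres_map Q \<phi> (tt 1[B] c) = q c"
proof -
 interpret Q: cring Q by fact
 interpret p: ring_hom_cring B Q p by(rule rh_cringI[OF B.cring_axioms Q p])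
 interpret q: ring_hom_cring C Q q by(rule rh_cringI[OF C.cring_axioms Q q])
 let ?Z = "zpolys (car B \<times> car C)"
 have im: "\<phi> ` (car B \<times> car C) <= car Q" using \<phi> by auto
 interpret e: ring_hom_cring ?Z Q "zeval Q \<phi>"
  by(rule rh_cringI[OF zpoly_cring Q Q.zeval_hom[OF im]])
 have z: "zeval Q \<phi> (zvar (b, c)) = p b *[Q] q c" if "b : car B" "c : car C" for b c
  using Q.zeval_zvar[of \<phi> "(b, c)"] \<phi>[OF that] that by simp
 have d: "zeval Q \<phi> (x - y) = 0[Q]" if "x : car ?Z" "y : car ?Z" "zeval Q \<phi> x = zeval Q \<phi> y" for x y
 proof -
  have "zeval Q \<phi> (x - y) +[Q] zeval Q \<phi> y = 0[Q] +[Q] zeval Q \<phi> y"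
   using e.hom_add[of "x - y" y] that e.hom_closed[of y] by simp
  thus ?thesis using Q.add.r_cancel[of "zeval Q \<phi> y" "zeval Q \<phi> (x - y)" "0[Q]"] e.hom_closed that by auto
 qed
 have van: "zeval Q \<phi> r = 0[Q]" if "r : tensor_rels B C K f g" for r
  using that unfolding tensor_rels_def
 proof (elim UnE CollectE exE conjE)
  fix b b' c assume r: "r = zvar (b +[B] b', c) - (zvar (b, c) + zvar (b', c))" "b : car B" "b' : car B" "c : car C"
  have "zeval Q \<phi> (zvar (b, c) + zvar (b', c)) = p b *[Q] q c +[Q] p b' *[Q] q c"
   using e.hom_add[of "zvar (b, c)" "zvar (b', c)"] z r by simp
  thus ?thesis unfolding r(1) by(intro d) (use r z in "auto simp: Q.l_distr")
 next
  fix b c c' assume r: "r = zvar (b, c +[C] c') - (zvar (b, c) + zvar (b, c'))" "b : car B" "c : car C" "c' : car C"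
  have "zeval Q \<phi> (zvar (b, c) + zvar (b, c')) = p b *[Q] q c +[Q] p b *[Q] q c'"
   using e.hom_add[of "zvar (b, c)" "zvar (b, c')"] z r by simp
  thus ?thesis unfolding r(1) by(intro d) (use r z in "auto simp: Q.r_distr")
 next
  fix b c k assume r: "r = zvar (b *[B] f k, c) - zvar (b, g k *[C] c)" "b : car B" "c : car C" "k : car K"
  show ?thesis unfolding r(1)
   by(rule d) (use r z f[OF r(4)] g[OF r(4)] bal[OF r(4)] in "auto simp: Q.m_assoc")
 next
  fix b b' c c' assume r: "r = zvar (b, c) * zvar (b', c') - zvar (b *[B] b', c *[C] c')"
   "b : car B" "b' : car B" "c : car C" "c' : car C"
  have "zeval Q \<phi> (zvar (b, c) * zvar (b', c')) = (p b *[Q] q c) *[Q] (p b' *[Q] q c')"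
   using e.hom_mult[of "zvar (b, c)" "zvar (b', c')"] z r by simp
  thus ?thesis unfolding r(1) by(intro d) (use r z in "auto simp: Q.m_ac")
 next
  assume "r : {zvar (1[B], 1[C]) - 1}"
  hence r: "r = zvar (1[B], 1[C]) - 1" by simp
  show ?thesis unfolding r by(rule d) (use z[of "1[B]" "1[C]"] e.hom_one in auto)
 qed
 show "pres_map Q \<phi> : ring_hom TT Q" unfolding T_hom by(rule P.pres_map_hom[OF Q im van])
 show t: "pres_map Q \<phi> (tt b c) = p b *[Q] q c" if "b : car B" "c : car C" for b c
  unfolding tt_class using P.pres_map_gen[OF Q im van, of "(b, c)"] \<phi> that by simp
 show "pres_map Q \<phi> (tt b 1[C]) = p b" if "b : car B" using t[OF that C.one_closed] that by simp
 show "pres_map Q \<phi> (tt 1[B] c) = q c" if "c : car C" using t[OF B.one_closed that] that by simp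
qed

end

locale graded_tensor = tensor_algebra B C K f g + GB: gfam B "hpart B" + GC: gfam C "hpart C"
 for B :: "'b graded_ring" and C :: "'c graded_ring" and K :: "('k, 'o) ring_scheme" and f g +
 assumes B_span: "x : car B ==> x : aspan B (\<Union>n. hpart B n)"
  and C_span: "y : car C ==> y : aspan C (\<Union>n. hpart C n)"
begin

lemma T_hpart: "hpart TT n = aspan TT {tt b c | b c i j. i + j = n & b : hpart B i & c : hpart C j}"
proof -
 have "hpart TT n = aspan TP {tt b c | b c i j. i + j = n & b : hpart B i & c : hpart C j}"
  by(simp add: tensor_def Let_def)
 also have "... = aspan TT {tt b c | b c i j. i + j = n & b : hpart B i & c : hpart C j}"
  using aspan_with_grading[of TP "hpart TT"] tensor_eq by metis
 finally show ?thesis .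
qed

lemma hom_tensors_carr: "{tt b c | b c i j. i + j = n & b : hpart B i & c : hpart C j} <= car TT"
 using tt_closed GB.H_carr GC.H_carr by blast

lemma tt_hpart: "[|b : hpart B i; c : hpart C j; n = i + j|] ==> tt b c : hpart TT n"
 unfolding T_hpart by(rule T.aspan_incl) blast

lemma T_gfam: "gfam TT (hpart TT)"
proof (intro gfam.intro gfam_axioms.intro T_cring)
 show s: "additive_subgroup (hpart TT n) TT" for n unfolding T_hpart by(rule T.aspan_subgroup[OF hom_tensors_carr])
 show "1[TT] : hpart TT 0" using tt_hpart[OF GB.H_one GC.H_one, of 0] tt_one by simp
 fix x y m n assume x: "x : hpart TT m" and y: "y : hpart TT n"
 show "x *[TT] y : hpart TT (m + n)"
 proof (rule T.aspan_mult[OF x[unfolded T_hpart] y[unfolded T_hpart] hom_tensors_carr hom_tensors_carr s])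
  fix v w assume "v : {tt b c | b c i j. i + j = m & b : hpart B i & c : hpart C j}"
   "w : {tt b c | b c i j. i + j = n & b : hpart B i & c : hpart C j}"
  then obtain b c i j b' c' i' j' where v: "v = tt b c" "i + j = m" "b : hpart B i" "c : hpart C j"
   and w: "w = tt b' c'" "i' + j' = n" "b' : hpart B i'" "c' : hpart C j'" by blast
  show "v *[TT] w : hpart TT (m + n)"
   unfolding v(1) w(1) tt_mult[OF GB.H_carr[OF v(3)] GB.H_carr[OF w(3)] GC.H_carr[OF v(4)] GC.H_carr[OF w(4)]]
   by(rule tt_hpart[OF GB.H_mult[OF v(3) w(3)] GC.H_mult[OF v(4) w(4)]]) (use v(2) w(2) in simp)
 qed
qed

sublocale GT: gfam TT "hpart TT" by(rule T_gfam)

lemma T_span: assumes x: "x : car TT" shows "x : aspan TT (\<Union>n. hpart TT n)"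
proof -
 have U: "(\<Union>n. hpart TT n) <= car TT" using GT.H_carr by blast
 interpret A: additive_subgroup "aspan TT (\<Union>n. hpart TT n)" TT by(rule T.aspan_subgroup[OF U])
 have UB: "(\<Union>n. hpart B n) <= car B" and UC: "(\<Union>n. hpart C n) <= car C" using GB.H_carr GC.H_carr by blast+
 have 1: "tt b 1[C] : aspan TT (\<Union>n. hpart TT n)" if b: "b : car B" for b
  using B_span[OF b] UB
 proof (induction b rule: B.aspan_induct)
  case zero show ?case using A.zero_closed in1.hom_zero by simp
 next
  case (incl b)
  then obtain i where "b : hpart B i" by blast
  from tt_hpart[OF this GC.H_one refl] show ?case by(rule T.aspan_incl[OF UN_I[OF UNIV_I]])
 next
  case (neg b) thus ?case using A.a_inv_closed by simp
 next
  case (add b b') thus ?case using A.a_closed by simp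
 qed
 have 2: "tt 1[B] c : aspan TT (\<Union>n. hpart TT n)" if c: "c : car C" for c
  using C_span[OF c] UC
 proof (induction c rule: C.aspan_induct)
  case zero show ?case using A.zero_closed in2.hom_zero by simp
 next
  case (incl c)
  then obtain i where "c : hpart C i" by blast
  from tt_hpart[OF GB.H_one this refl] show ?case by(rule T.aspan_incl[OF UN_I[OF UNIV_I]])
 next
  case (neg c) thus ?case using A.a_inv_closed by simp
 next
  case (add c c') thus ?case using A.a_closed by simp
 qed
 have "{tt b c | b c. b : car B & c : car C} \<subseteq> aspan TT (\<Union>n. hpart TT n)"
 proof
  fix v assume "v : {tt b c | b c. b : car B & c : car C}"
  then obtain b c where v: "v = tt b c" "b : car B" "c : car C" by blast
  have "tt b 1[C] *[TT] tt 1[B] c : aspan TT (\<Union>n. hpart TT n)"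
   by(rule T.aspan_mult[OF 1[OF v(2)] 2[OF v(3)] U U A.additive_subgroup_axioms])
    (erule UN_E, erule UN_E, rule T.aspan_incl, rule UN_I[OF UNIV_I], rule GT.H_mult)
  thus "v : aspan TT (\<Union>n. hpart TT n)" unfolding v(1) by(subst tt_split[OF v(2,3)])
 qed
 thus ?thesis using tensor_span[OF x] T.aspan_min[OF A.additive_subgroup_axioms] by blast
qed

lemma tensor_graded_hom:
 assumes Q: "gfam Q H" and h: "h : ring_hom TT Q"
  and p: "!!b i. b : hpart B i ==> h (tt b 1[C]) : H i" and q: "!!c j. c : hpart C j ==> h (tt 1[B] c) : H j"
  and x: "x : hpart TT n"
 shows "h x : H n"
proof -
 interpret Q: gfam Q H by fact
 interpret h: ring_hom_cring TT Q h by(rule rh_cringI[OF T_cring Q.cring_axioms h])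
 show ?thesis
  using x[unfolded T_hpart] hom_tensors_carr
 proof (induction x rule: T.aspan_induct)
  case zero show ?case using Q.H_zero by simp
 next
  case (incl x)
  then obtain b c i j where v: "x = tt b c" "i + j = n" "b : hpart B i" "c : hpart C j" by blast
  show ?case unfolding v(1) tt_split[OF GB.H_carr[OF v(3)] GC.H_carr[OF v(4)]]
   using Q.H_mult[OF p[OF v(3)] q[OF v(4)]] v(2) h.hom_mult[OF in1.hom_closed[OF GB.H_carr[OF v(3)]] in2.hom_closed[OF GC.H_carr[OF v(4)]]] by simp
 next
  case (neg x) thus ?case using Q.H_neg by simp
 next
  case (add x y) thus ?case using Q.H_add by simp
 qed
qed

end

lemma degree_zero_simps [simp]: "car (deg0 B) = car B" "monoid.mult (deg0 B) = monoid.mult B"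
 "one (deg0 B) = one B" "ring.zero (deg0 B) = ring.zero B" "add (deg0 B) = add B"
 "hpart (deg0 B) n = (if n = 0 then car B else {0[B]})"
 by(simp_all add: degree_zero_def)

lemma degree_zero_hom: "ring_hom (deg0 B) Q = ring_hom B Q" "ring_hom Q (deg0 B) = ring_hom Q B"
 by(simp_all add: ring_hom_def)

lemma degree_zero_gfam: assumes "cring B" shows "gfam (deg0 B) (hpart (deg0 B))"
  "x : car (deg0 B) ==> x : aspan (deg0 B) (\<Union>n. hpart (deg0 B) n)"
proof -
 interpret B: cring "deg0 B" unfolding degree_zero_def by(rule cring_with_grading[OF assms])
 show "gfam (deg0 B) (hpart (deg0 B))"
 proof (intro gfam.intro gfam_axioms.intro B.cring_axioms additive_subgroupI B.add.subgroupI)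
  fix n x assume "x : hpart (deg0 B) n"
  thus "-[deg0 B] x : hpart (deg0 B) n"
   using B.a_inv_closed[of x] B.minus_zero by(auto split: if_splits)
 next
  fix n x y assume "x : hpart (deg0 B) n" "y : hpart (deg0 B) n"
  thus "x +[deg0 B] y : hpart (deg0 B) n"
   using B.a_closed[of x y] B.l_zero[OF B.zero_closed] by(auto split: if_splits)
 next
  fix x y m n assume "x : hpart (deg0 B) m" "y : hpart (deg0 B) n"
  thus "x *[deg0 B] y : hpart (deg0 B) (m + n)"
   using B.m_closed[of x y] B.l_null[of y] B.r_null[of x] B.zero_closed by(auto split: if_splits)
 qed (use B.zero_closed B.one_closed in auto)
 assume "x : car (deg0 B)"
 thus "x : aspan (deg0 B) (\<Union>n. hpart (deg0 B) n)"
  by(intro B.aspan_incl[OF UN_I[OF UNIV_I, of _ _ 0]]) simp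
qed

section \<open>Base change to the completion of \<open>A\<close>\<close>

context adic_algebra
begin

abbreviation "BC == tensor R (deg0 (completion A I)) A s (to_completion A I)"
abbreviation "bc == tensor_elem R (deg0 (completion A I)) A s (to_completion A I)"

sublocale BCT: graded_tensor R "deg0 (completion A I)" A s "to_completion A I"
 using rh_cl[OF to_completion_hom] s.hom_closed span degree_zero_gfam[OF compl_cring]
  gfam_axioms gfam.axioms(1)[OF degree_zero_gfam(1)[OF compl_cring]] cring_axioms
 by(intro graded_tensor.intro graded_tensor_axioms.intro tensor_algebra.intro tensor_algebra_axioms.intro) auto

lemma base_change_map:
 shows "bc_to_compl A I R s : ring_hom BC GL"
  and "r : car R ==> bc_to_compl A I R s (bc r 1[completion A I]) = to_limit R J r"
  and "b : car (completion A I) ==> bc_to_compl A I R s (bc \<one> b) = lmap R J s b"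
proof -
 let ?\<phi> = "%(x, b). to_limit R J x *[GL] lmap R J s b"
 have q: "lmap R J s : ring_hom (deg0 (completion A I)) GL" unfolding degree_zero_hom by(rule limit_map_s_GL)
 have bal: "to_limit R J (s a) = lmap R J s (to_completion A I a)" if "a : car A" for a
  using limit_map_s(1)[of "%_. a"] that by(simp add: to_completion_mk to_limit_mk)
 have e: "bc_to_compl A I R s = pres_map GL ?\<phi>" by(simp add: base_change_to_completion_def Let_def)
 note l = BCT.tensor_lift[OF GL_cring to_limit_GL q bal, of ?\<phi>, OF _ prod.case]
 show "bc_to_compl A I R s : ring_hom BC GL" unfolding e by(rule l(1))
 show "r : car R ==> bc_to_compl A I R s (bc r 1[completion A I]) = to_limit R J r"
  unfolding e using l(3) by(simp del: GL_simps)
 show "b : car (completion A I) ==> bc_to_compl A I R s (bc \<one> b) = lmap R J s b"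
  unfolding e using l(4) by(simp del: GL_simps)
qed

text \<open>Here the spanning condition is immediate, elementary tensors being products of the two
  kinds of elements; tensors whose second factor has positive degree vanish.\<close>

lemma base_change_span:
 "adic_span A R pr I s BC (%r. bc r 1[completion A I]) (%b. bc \<one> b) (bc_to_compl A I R s)"
proof (intro adic_span.intro adic_span_axioms.intro adic_algebra_axioms BCT.T_gfam BCT.T_span base_change_map)
 note t = BCT.in1_hom BCT.in2_hom
 show "(%r. bc r 1[completion A I]) : ring_hom R BC" "(%b. bc \<one> b) : ring_hom (completion A I) BC"
  using t unfolding degree_zero_hom by simp_all
 show "bc (s a) 1[completion A I] = bc \<one> (to_completion A I a)" if "a : car A" for a
  using BCT.in1_in2[OF that] by simp
 have sp: "bc r 1[completion A I] *[BC] bc \<one> b = bc r b" if "r : car R" "b : car (completion A I)" for r b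
  using BCT.tt_split[of r b] that by simp
 show "bc r 1[completion A I] *[BC] bc \<one> b : hpart BC n" if "r : hpart R n" "b : car (completion A I)" for n r b
  unfolding sp[OF H_carr[OF that(1)] that(2)] by(rule BCT.tt_hpart[OF that(1), of _ 0]) (use that(2) in auto)
 fix n
 show "hpart BC n \<subseteq> aspan BC {bc r 1[completion A I] *[BC] bc \<one> b | r b. r : hpart R n & b : car (completion A I)}" (is "_ \<subseteq> aspan BC ?V")
  unfolding BCT.T_hpart
 proof (rule BCT.T.aspan_min[OF BCT.T.aspan_subgroup])
  show V: "?V <= car BC"
  proof
   fix v assume "v : ?V"
   then obtain r b where rb: "v = bc r 1[completion A I] *[BC] bc \<one> b" "r : hpart R n" "b : car (completion A I)" by blast
   show "v : car BC" unfolding rb(1)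
    using BCT.T.m_closed[OF BCT.in1.hom_closed[OF H_carr[OF rb(2)]] BCT.in2.hom_closed[of b]] rb(3) by simp
  qed
  show "{bc b c | b c i j. i + j = n & b : hpart R i & c : hpart (deg0 (completion A I)) j} \<subseteq> aspan BC ?V"
  proof
   fix v assume "v : {bc b c | b c i j. i + j = n & b : hpart R i & c : hpart (deg0 (completion A I)) j}"
   then obtain b c i j where v: "v = bc b c" "i + j = n" "b : hpart R i" "c : hpart (deg0 (completion A I)) j" by blast
   note bC = H_carr[OF v(3)]
   show "v : aspan BC ?V"
   proof (cases "j = 0")
    case True
    hence "b : hpart R n" "c : car (completion A I)" using v by auto
    thus ?thesis unfolding v(1) by(intro BCT.T.aspan_incl CollectI exI[of _ b] exI[of _ c]) (use sp bC in auto)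
   next
    case False
    hence c: "c = 0[completion A I]" using v(4) by simp
    have "bc \<one> c = 0[BC]" using BCT.in2.hom_zero c by simp
    hence "v = 0[BC]" unfolding v(1) using BCT.tt_split[of b c] bC BCT.in1.hom_closed[OF bC] c cring.cring_simprules(2)[OF compl_cring] by simp
    thus ?thesis using BCT.T.aspan_zero by simp
   qed
  qed
 qed
qed

end

section \<open>Continuity of the action\<close>

lemma (in cring) finsum_two:
 assumes "finite K" "a : K" "b : K" "a ~= b" "!!e. e : K ==> t e : car R"
 shows "finsum R t K = t a \<oplus> (t b \<oplus> finsum R t (K - {a, b}))"
proof -
 have K: "insert a (insert b (K - {a, b})) = K" using assms by blast
 have "finsum R t (insert a (insert b (K - {a, b}))) = t a \<oplus> finsum R t (insert b (K - {a, b}))"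
  by(rule finsum_insert) (use assms in auto)
 also have "finsum R t (insert b (K - {a, b})) = t b \<oplus> finsum R t (K - {a, b})"
  by(rule finsum_insert) (use assms in auto)
 finally show ?thesis unfolding K .
qed

context cring
begin

lemma agree_all: "(!!N. agree N u v) ==> u = v"
proof
 fix d :: "nat \<times> nat \<times> nat"
 assume a: "!!N. agree N u v"
 obtain x y z where d: "d = (x, y, z)" by(cases d)
 show "u d = v d" unfolding d by(rule agreeD[OF a[of "x + y + z"]]) simp
qed

lemma agree_zero_X:
 assumes "!!i. f i : car R"
 shows "agree N (sub1 R f (ps_X R)) (ps_zero R) \<longleftrightarrow> (\<forall>i\<le>N. f i = \<zero>)"
proof
 assume a: "agree N (sub1 R f (ps_X R)) (ps_zero R)"
 show "\<forall>i\<le>N. f i = \<zero>"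
 proof (intro allI impI)
  fix i assume "i <= N"
  thus "f i = \<zero>" using agreeD[OF a, of i 0 0] subst1_X(1)[of f i 0 0] assms by(simp add: ps_zero_def)
 qed
next
 assume "\<forall>i\<le>N. f i = \<zero>"
 thus "agree N (sub1 R f (ps_X R)) (ps_zero R)"
  using assms by(simp add: agree_def subst1_X(1) ps_zero_def)
qed

text \<open>A series starting in degree \<open>2\<close> at least doubles orders: order
  \<open>n + 1\<close> becomes at least \<open>2 n + 2\<close>, which exceeds
  \<open>n + 1\<close>.\<close>

lemma agree_zero_subst1:
 assumes f: "!!i. f i : car R" "f 0 = \<zero>" "f 1 = \<zero>" and u: "ps0 R u" "agree n u (ps_zero R)"
 shows "agree (Suc n) (sub1 R f u) (ps_zero R)"
 unfolding agree_def
proof (intro allI impI)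
 fix a b c :: nat assume d: "a + b + c <= Suc n"
 have o: "ps_ord (Suc n) u" using u(2) by(simp add: agree_def ps_ord_def ps_zero_def)
 have "f i \<otimes> ps_pow R u i (a, b, c) = \<zero>" for i
 proof -
  consider "i = 0" | "i = 1" | "i >= 2" by linarith
  thus ?thesis
  proof cases
   case 3
   hence "2 * Suc n <= i * Suc n" by(rule mult_le_mono1)
   hence "a + b + c < i * Suc n" using d by simp
   hence "ps_pow R u i (a, b, c) = \<zero>" by(rule ps_ordD[OF ps_ord_pow[OF ps0D(1)[OF u(1)] o]])
   thus ?thesis using f(1) by simp
  qed (use f ps_pow_closed[OF ps0D(1)[OF u(1)]] in "simp_all")
 qed
 thus "sub1 R f u (a, b, c) = ps_zero R (a, b, c)"
  unfolding ps_subst1_def prod.case ps_zero_def by(intro add.finprod_one_eqI) simp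
qed

context
 fixes A :: "('k, 'l) ring_scheme" and d :: "'k mod_gen => 'a"
 assumes A: "cring A" and d: "formal_module A R d"
begin

private abbreviation "U a == sub1 R (%i. d (Act a i)) (ps_X R)"

lemma action_ps0: "a : car A ==> ps0 R (U a)"
 using formal_moduleD(3,7)[OF d] by(intro ps0_subst1) auto

lemma action_add: "[|a : car A; b : car A|] ==> U (a +[A] b) = sub2 R (%i j. d (FCoeff i j)) (U a) (U b)"
 and action_mult: "[|a : car A; b : car A|] ==> U (a *[A] b) = sub1 R (%i. d (Act a i)) (U b)"
 using d unfolding formal_module_iff by blast+

text \<open>Elements of \<open>I^k\<close> act without linear term, so each factor from
  \<open>I^k\<close> raises the order by at least one. Sums cause no trouble because
  \<open>F(0, 0) = 0\<close>.\<close>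

lemma action_vanish:
 fixes k n :: nat
 assumes I: "ideal I A" and z: "!!a. a : ipow A I k ==> d (Scal a) = \<zero>" and a: "a : ipow A I (k * n)"
 shows "a : car A & agree n (U a) (ps_zero R)"
 using a
proof (induction n arbitrary: a)
 case 0
 interpret A: cring A by(rule A)
 have "a : car A" using 0 A.ideals_pow(2)[OF I] by simp
 thus ?case using formal_moduleD(3,7)[OF d] by(simp add: agree_zero_X)
next
 case (Suc n)
 interpret A: cring A by(rule A)
 note D = formal_moduleD[OF d]
 have "a : (ipow A I k) \<cdot>\<^bsub>A\<^esub> (ipow A I (k * n))"
  using Suc.prems A.ideals_pow(3)[OF I, of k "k * n"] by simp
 thus ?case
 proof (induction a rule: ideal_prod.induct)
  case (prod a b)
  have ac: "a : car A" using ideal.Icarr[OF A.ideals_pow(1)[OF I] prod(1)] .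
  note b = Suc.IH[OF prod(2)]
  have "agree (Suc n) (sub1 R (%i. d (Act a i)) (U b)) (ps_zero R)"
   by(rule agree_zero_subst1) (use D(3)[OF ac] D(7)[OF ac] D(8)[OF ac] z[OF prod(1)] action_ps0 b in auto)
  thus ?case using action_mult[OF ac conjunct1[OF b]] ac b by simp
 next
  case (sum a b)
  have "agree (Suc n) (sub2 R (%i j. d (FCoeff i j)) (U a) (U b)) (sub2 R (%i j. d (FCoeff i j)) (ps_zero R) (ps_zero R))"
   by(rule agree_subst2) (use sum D(2) ps0D(1)[OF action_ps0] in auto)
  thus ?case using sum action_add[of a b] fgl_unit[of "%i j. d (FCoeff i j)" "ps_zero R"] D(2,4) by simp
 qed
qed

text \<open>\<open>\<rho>(a) = F(\<rho>(b), \<rho>(a - b))\<close>, and the second argument vanishes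
  up to degree \<open>i\<close>.\<close>

lemma action_continuous:
 fixes k i :: nat
 assumes I: "ideal I A" and z: "!!a. a : ipow A I k ==> d (Scal a) = \<zero>"
  and ab: "a : car A" "b : car A" "a -[A] b : ipow A I (k * i)"
 shows "d (Act a i) = d (Act b i)"
proof -
 interpret A: cring A by(rule A)
 note D = formal_moduleD[OF d]
 let ?e = "a -[A] b"
 note e = action_vanish[OF I z ab(3)]
 have "b +[A] ?e = ?e +[A] b" using A.a_comm[OF ab(2) conjunct1[OF e]] .
 also have "... = a" using ab by(simp add: a_minus_def A.a_assoc A.l_neg)
 finally have "U a = sub2 R (%i j. d (FCoeff i j)) (U b) (U ?e)" using action_add[OF ab(2) conjunct1[OF e]] by simp
 moreover have "agree i (sub2 R (%i j. d (FCoeff i j)) (U b) (U ?e)) (sub2 R (%i j. d (FCoeff i j)) (U b) (ps_zero R))"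
  by(rule agree_subst2) (use e D(2) ps0D(1)[OF action_ps0] ab in auto)
 ultimately have "agree i (U a) (U b)"
  using fgl_unit[of "%i j. d (FCoeff i j)" "U b", OF D(2,4) action_ps0[OF ab(2)]] by simp
 from agreeD[OF this, of i 0 0] show ?thesis
  using subst1_X(1)[of "%i. d (Act a i)" i 0 0] subst1_X(1)[of "%i. d (Act b i)" i 0 0] D(3) ab by simp
qed

end

text \<open>In each degree an axiom involves finitely many coefficients of the action only. So it
  passes from \<open>A\<close> to \<open>B\<close> if elements of \<open>B\<close> are matched, up
  to any degree \<open>N\<close>, by elements of \<open>A\<close>; \<open>P N x a\<close> is such a
  matching that respects the ring operations.\<close>

lemma formal_module_approx:
 fixes A :: "('k, 'l) ring_scheme" and B :: "('h, 'j) ring_scheme"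
 assumes B: "cring B" and d: "formal_module A R d" and F: "!!i j. D (FCoeff i j) = d (FCoeff i j)"
  and P: "!!N x a. P N x a ==> a : car A & D (Scal x) = d (Scal a) & (\<forall>i\<le>N. D (Act x i) = d (Act a i))"
  and ex: "!!N x. x : car B ==> EX a. P N x a"
  and add: "!!N x a y b. [|P N x a; P N y b|] ==> P N (x +[B] y) (a +[A] b)"
  and mult: "!!N x a y b. [|P N x a; P N y b|] ==> P N (x *[B] y) (a *[A] b)"
  and one: "!!N. P N 1[B] 1[A]"
 shows "formal_module B R D"
proof -
 note d' = d[unfolded formal_module_iff] and Dd = formal_moduleD[OF d]
 let ?F = "%i j. d (FCoeff i j)"
 note Fc = Dd(2)
 have F00: "?F 0 0 = \<zero>" using Dd(5)[of 0] by simp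
 have DF: "(%i j. D (FCoeff i j)) = ?F" using F by(intro ext)
 have cl: "D (Scal x) : car R" "D (Act x i) : car R" "D (Act x 0) = \<zero>" "D (Act x 1) = D (Scal x)"
  if x: "x : car B" for x i
 proof -
  obtain a where a: "P (i + 1) x a" using ex[OF x] by blast
  show "D (Scal x) : car R" "D (Act x i) : car R" "D (Act x 0) = \<zero>" "D (Act x 1) = D (Scal x)"
   using P[OF a] Dd(1,3,7,8) by(simp_all)
 qed
 let ?U = "%x. sub1 R (%i. D (Act x i)) (ps_X R)" and ?V = "%a. sub1 R (%i. d (Act a i)) (ps_X R)"
 have sub: "agree N (sub1 R (%i. D (Act x i)) u) (sub1 R (%i. d (Act a i)) v)"
  if "P N x a" "x : car B" "!!e. u e : car R" "agree N u v" for N x a u v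
  by(rule agree_subst1) (use that P[OF that(1)] cl in auto)
 have U0: "ps0 R (?U x)" if "x : car B" for x by(rule ps0_subst1) (use cl[OF that] in auto)
 have V0: "ps0 R (?V a)" if "a : car A" for a by(rule ps0_subst1) (use Dd(3,7)[OF that] in auto)
 have Xc: "ps_X R e : car R" "ps_Y R e : car R" for e by simp_all
 have FXY: "sub2 R ?F (ps_X R) (ps_Y R) e : car R" for e by(rule ps_subst2_closed) (simp_all add: Fc)
 have hom: "is_hom R ?F ?F (%i. D (Act x i))" if x: "x : car B" for x
  unfolding is_hom_def
 proof (intro conjI cl(3)[OF x] agree_all)
  fix N
  obtain a where a: "P N x a" using ex[OF x] by blast
  have aA: "a : car A" using P[OF a] by blast
  have "is_hom R ?F ?F (%i. d (Act a i))" using d' aA by blast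
  hence e: "sub1 R (%i. d (Act a i)) (sub2 R ?F (ps_X R) (ps_Y R)) =
   sub2 R ?F (?V a) (sub1 R (%i. d (Act a i)) (ps_Y R))" by(simp add: is_hom_def)
  have "agree N (sub1 R (%i. D (Act x i)) (sub2 R ?F (ps_X R) (ps_Y R)))
   (sub2 R ?F (?V a) (sub1 R (%i. d (Act a i)) (ps_Y R)))"
   unfolding e[symmetric] by(rule sub[OF a x FXY agree_refl])
  moreover have "agree N (sub2 R ?F (?U x) (sub1 R (%i. D (Act x i)) (ps_Y R)))
   (sub2 R ?F (?V a) (sub1 R (%i. d (Act a i)) (ps_Y R)))"
   by(rule agree_subst2) (use Fc sub[OF a x Xc(1) agree_refl] sub[OF a x Xc(2) agree_refl] ps_subst1_closed[OF cl(2)[OF x]] in auto)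
  ultimately show "agree N (sub1 R (%i. D (Act x i)) (sub2 R ?F (ps_X R) (ps_Y R)))
   (sub2 R ?F (?U x) (sub1 R (%i. D (Act x i)) (ps_Y R)))" using agree_trans agree_sym by blast
 qed
 have am: "D (Scal (x +[B] y)) = D (Scal x) \<oplus> D (Scal y) & D (Scal (x *[B] y)) = D (Scal x) \<otimes> D (Scal y) &
   ?U (x +[B] y) = sub2 R ?F (?U x) (?U y) & ?U (x *[B] y) = sub1 R (%i. D (Act x i)) (?U y)"
  if x: "x : car B" and y: "y : car B" and xy: "x +[B] y : car B" "x *[B] y : car B" for x y
 proof (intro conjI agree_all)
  obtain a b where a: "P 0 x a" and b: "P 0 y b" using ex[OF x] ex[OF y] by blast
  show "D (Scal (x +[B] y)) = D (Scal x) \<oplus> D (Scal y)" "D (Scal (x *[B] y)) = D (Scal x) \<otimes> D (Scal y)"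
   using P[OF a] P[OF b] P[OF add[OF a b]] P[OF mult[OF a b]] d' by simp_all
 next
  fix N
  obtain a b where a: "P N x a" and b: "P N y b" using ex[OF x] ex[OF y] by blast
  have aA: "a : car A" "b : car A" using P[OF a] P[OF b] by blast+
  note sx = sub[OF a x Xc(1) agree_refl] and sy = sub[OF b y Xc(1) agree_refl]
  have e: "?V (a +[A] b) = sub2 R ?F (?V a) (?V b)" "?V (a *[A] b) = sub1 R (%i. d (Act a i)) (?V b)"
   using d' aA by blast+
  have "agree N (?U (x +[B] y)) (sub2 R ?F (?V a) (?V b))"
   unfolding e(1)[symmetric] by(rule sub[OF add[OF a b] xy(1) Xc(1) agree_refl])
  moreover have "agree N (sub2 R ?F (?U x) (?U y)) (sub2 R ?F (?V a) (?V b))"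
   by(rule agree_subst2) (use Fc sx sy ps0D(1)[OF U0[OF x]] ps0D(1)[OF U0[OF y]] in auto)
  ultimately show "agree N (?U (x +[B] y)) (sub2 R ?F (?U x) (?U y))" using agree_trans agree_sym by blast
  have "agree N (?U (x *[B] y)) (sub1 R (%i. d (Act a i)) (?V b))"
   unfolding e(2)[symmetric] by(rule sub[OF mult[OF a b] xy(2) Xc(1) agree_refl])
  moreover have "agree N (sub1 R (%i. D (Act x i)) (?U y)) (sub1 R (%i. d (Act a i)) (?V b))"
   by(rule sub[OF a x ps0D(1)[OF U0[OF y]] sy])
  ultimately show "agree N (?U (x *[B] y)) (sub1 R (%i. D (Act x i)) (?U y))" using agree_trans agree_sym by blast
 qed
 interpret B: cring B by(rule B)
 have one1: "D (Scal 1[B]) = \<one>" using P[OF one[of 0]] d' by simp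
 have oneU: "?U 1[B] = ps_X R" if "1[B] : car B"
 proof (rule agree_all)
  fix N
  have "?V 1[A] = ps_X R" using d' by blast
  moreover have "agree N (?U 1[B]) (?V 1[A])" by(rule sub[OF one that Xc(1) agree_refl])
  ultimately show "agree N (?U 1[B]) (ps_X R)" by simp
 qed
 show ?thesis
  unfolding formal_module_iff image_mod_gens DF
  using cl(1,2) F am one1 oneU[OF B.one_closed] hom Dd(2,4) by(simp add: cl(4))
qed

text \<open>The elements of a subring \<open>P\<close>, seen modulo \<open>P\<close>: once all coefficients of the action of index
 less than \<open>i\<close> are in \<open>P\<close>, the coefficient \<open>c\<close> of index \<open>i\<close> satisfies \<open>c (x + y) = c x + c y\<close> and
 \<open>c (x y) = x c y + y^i c x\<close> modulo \<open>P\<close>.\<close>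

context
 fixes P :: "'a set" and i :: nat
 assumes P: "gfam R (%_. P)"
begin

interpretation P: gfam R "%_. P" by(rule P)

private definition "below n u \<longleftrightarrow> (ALL a b c. a + b + c < n --> u (a, b, c) : P)"

text \<open>When both constant terms vanish, nonzero terms of a coefficient of degree
  \<open>i\<close> have both factors of degree below \<open>i\<close>; this gains one
  degree.\<close>

private lemma below_mult:
 assumes u: "ps0 R u" "below i u" and v: "!!d. v d : car R" "below i v"
 shows "below i (ps_mult R u v)" and "v (0, 0, 0) = \<zero> ==> below (Suc i) (ps_mult R u v)"
proof -
 have uc: "u d : car R" for d using ps0D(1)[OF u(1)] .
 show "below i (ps_mult R u v)"
  unfolding below_def ps_mult_def
  using u(2) v(2) by(auto simp: below_def intro!: P.H_finsum P.H_mult)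
 assume v0: "v (0, 0, 0) = \<zero>"
 have t: "u (a', b', c') \<otimes> v (a - a', b - b', c - c') : P"
  if d: "a + b + c < Suc i" "a' <= a" "b' <= b" "c' <= c" for a b c a' b' c'
 proof -
  consider "a' + b' + c' = 0" | "(a - a') + (b - b') + (c - c') = 0"
   | "a' + b' + c' < i & (a - a') + (b - b') + (c - c') < i" using d by linarith
  thus ?thesis
  proof cases
   case 1 thus ?thesis using ps0D(2)[OF u(1)] v(1) P.H_zero by simp
  next
   case 2
   hence "v (a - a', b - b', c - c') = \<zero>" using v0 by simp
   thus ?thesis using uc P.H_zero by simp
  next
   case 3 thus ?thesis using u(2) v(2) P.H_mult unfolding below_def by blast
  qed
 qed
 show "below (Suc i) (ps_mult R u v)"
  unfolding below_def ps_mult_def using t by(auto intro!: P.H_finsum)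
qed

private lemma below_pow:
 assumes u: "ps0 R u" "below i u"
 shows "below i (ps_pow R u n)" and "n >= 2 ==> below (Suc i) (ps_pow R u n)" and "n >= 1 ==> ps0 R (ps_pow R u n)"
proof -
 have pc: "ps_pow R u n d : car R" for n d using ps_pow_closed[OF ps0D(1)[OF u(1)]] .
 show b: "below i (ps_pow R u n)" for n
 proof (induction n)
  case 0 thus ?case using P.H_one P.H_zero by(auto simp: below_def ps_monom_def)
 next
  case (Suc n) thus ?case using below_mult(1)[OF u pc] ps_mult_comm[OF ps0D(1)[OF u(1)] pc] by simp
 qed
 show z: "ps0 R (ps_pow R u n)" if "n >= 1" for n
  using ps_ordD[OF ps_ord_pow[OF ps0D(1)[OF u(1)] ps0_ord[OF u(1)]], of 0 0 0 n] that pc by(simp add: ps0_def)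
 assume n: "n >= 2"
 then obtain m where m: "n = Suc m" "m >= 1" by(cases n) auto
 show "below (Suc i) (ps_pow R u n)"
  using below_mult(2)[OF u pc b ps0D(2)[OF z[OF m(2)]]] ps_mult_comm[OF ps0D(1)[OF u(1)] pc] m(1) by simp
qed

text \<open>Apart from \<open>X\<close> and \<open>Y\<close>, the terms of the formal group law are
  at least quadratic, so in degree \<open>i\<close> they involve only coefficients of
  \<open>u\<close> and \<open>v\<close> of smaller degree.\<close>

lemma subst2_mod:
 assumes F: "!!k l. F k l : P" "!!k. F k 0 = (if k = 1 then \<one> else \<zero>)" "!!k. F 0 k = (if k = 1 then \<one> else \<zero>)"
  and u: "ps0 R u" "!!a. a < i ==> u (a, 0, 0) : P" "xonly u" and v: "ps0 R v" "!!a. a < i ==> v (a, 0, 0) : P" "xonly v"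
 shows "sub2 R F u v (i, 0, 0) \<ominus> (u (i, 0, 0) \<oplus> v (i, 0, 0)) : P"
proof -
 have ub: "below i u" using u(2,3) P.H_zero unfolding below_def xonly_def by(metis add.right_neutral)
 have vb: "below i v" using v(2,3) P.H_zero unfolding below_def xonly_def by(metis add.right_neutral)
 have uc: "u d : car R" and vc: "v d : car R" for d using ps0D(1)[OF u(1)] ps0D(1)[OF v(1)] by simp_all
 have pu: "ps_pow R u n d : car R" and pv: "ps_pow R v n d : car R" for n d using ps_pow_closed[OF uc] ps_pow_closed[OF vc] by simp_all
 have Fc: "F k l : car R" for k l using F(1) P.H_carr by blast
 let ?t = "%(k, l). F k l \<otimes> ps_mult R (ps_pow R u k) (ps_pow R v l) (i, 0, 0)"
 let ?K = "{..i} \<times> {..i}"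
 have tc: "?t e : car R" for e using Fc ps_mult_closed[OF pu pv] by(cases e) simp
 have tP: "?t (k, l) : P" if "(k, l) ~= (1, 0)" "(k, l) ~= (0, 1)" for k l
 proof -
  consider "k = 0" "l = 0" | "k >= 2" "l = 0" | "k = 0" "l >= 2" | "k >= 1" "l >= 1"
   using `(k, l) ~= (1, 0)` `(k, l) ~= (0, 1)` by(cases k; cases l; simp; linarith?)
  thus ?thesis
  proof cases
   case 1
   have "ps_mult R (ps_pow R u 0) (ps_pow R v 0) (i, 0, 0) : car R" by(rule ps_mult_closed[OF pu pv])
   thus ?thesis using 1 F(2)[of 0] P.H_zero by simp
  next
   case 2
   thus ?thesis using below_pow(2)[OF u(1) ub, of k] P.H_mult[OF F(1)] ps_mult_one[OF pu] by(simp add: below_def)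
  next
   case 3
   thus ?thesis using below_pow(2)[OF v(1) vb, of l] P.H_mult[OF F(1)] ps_one_mult[OF pv] by(simp add: below_def)
  next
   case 4
   have "below (Suc i) (ps_mult R (ps_pow R u k) (ps_pow R v l))"
    by(rule below_mult(2)[OF below_pow(3)[OF u(1) ub 4(1)] below_pow(1)[OF u(1) ub] pv below_pow(1)[OF v(1) vb] ps0D(2)[OF below_pow(3)[OF v(1) vb 4(2)]]])
   thus ?thesis using P.H_mult[OF F(1)] by(simp add: below_def)
  qed
 qed
 show ?thesis
 proof (cases "i = 0")
  case True
  have "sub2 R F u v (0, 0, 0) = \<zero>" using ps0D(2)[OF ps0_subst2[of F, OF Fc _ u(1) v(1)]] F(2)[of 0] by simp
  thus ?thesis using True ps0D(2)[OF u(1)] ps0D(2)[OF v(1)] P.H_zero by(simp add: a_minus_def)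
 next
  case False
  hence K: "(1, 0) : ?K" "(0, 1) : ?K" by auto
  let ?r = "finsum R ?t (?K - {(1, 0), (0, 1)})"
  have rP: "?r : P"
  proof (rule P.H_finsum)
   fix e assume e: "e : ?K - {(1, 0), (0, 1)}"
   obtain k l where kl: "e = (k, l)" by(cases e)
   have "?t (k, l) : P" by(rule tP) (use e kl in auto)
   thus "?t e : P" by(simp only: kl)
  qed
  have "sub2 R F u v (i, 0, 0) = finsum R ?t ?K"
   unfolding ps_subst2_def by(simp add: case_prod_unfold)
  also have "... = ?t (1, 0) \<oplus> (?t (0, 1) \<oplus> ?r)"
   by(rule finsum_two[OF _ K]) (use tc in auto)
  also have "?t (1, 0) = u (i, 0, 0)" using F(2)[of 1] ps_mult_one[OF uc] ps_pow_1[OF uc] uc by simp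
  also have "?t (0, 1) = v (i, 0, 0)" using F(3)[of 1] ps_one_mult[OF vc] ps_pow_1[OF vc] vc by simp
  finally have "sub2 R F u v (i, 0, 0) = ?r \<oplus> (u (i, 0, 0) \<oplus> v (i, 0, 0))" using uc vc P.H_carr[OF rP] by(simp add: a_ac)
  hence "sub2 R F u v (i, 0, 0) \<ominus> (u (i, 0, 0) \<oplus> v (i, 0, 0)) = ?r"
   using uc vc P.H_carr[OF rP] by(simp add: a_minus_def a_assoc r_neg)
  thus ?thesis using rP by simp
 qed
qed

text \<open>In degree \<open>i\<close> only the linear term of \<open>f\<close> and its term of
  degree \<open>i\<close> can leave \<open>P\<close>: for exponents in between, both
  \<open>f k\<close> and the coefficient of \<open>u^k\<close> are in \<open>P\<close>.\<close>

lemma subst1_mod: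
 assumes f: "!!k. f k : car R" "f 0 = \<zero>" "!!k. k < i ==> f k : P" and i: "i >= 2"
  and u: "ps0 R u" "!!a. a < i ==> u (a, 0, 0) : P" "xonly u"
 shows "sub1 R f u (i, 0, 0) \<ominus> (f 1 \<otimes> u (i, 0, 0) \<oplus> f i \<otimes> ps_pow R u i (i, 0, 0)) : P"
proof -
 have ub: "below i u" using u(2,3) P.H_zero unfolding below_def xonly_def by(metis add.right_neutral)
 have uc: "u d : car R" for d using ps0D(1)[OF u(1)] .
 have pu: "ps_pow R u n d : car R" for n d using ps_pow_closed[OF uc] .
 let ?t = "%k. f k \<otimes> ps_pow R u k (i, 0, 0)"
 have tc: "?t k : car R" for k using f(1) pu by simp
 let ?r = "finsum R ?t ({..i} - {1, i})"
 have "?t k : P" if "k : {..i} - {1, i}" for k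
 proof (cases "k = 0")
  case True thus ?thesis using f(2) pu[of 0] P.H_zero by(simp del: ps_pow.simps)
 next
  case False
  hence "k >= 2" "k < i" using that by auto
  thus ?thesis using below_pow(2)[OF u(1) ub, of k] P.H_mult[OF f(3)] by(simp add: below_def)
 qed
 hence rP: "?r : P" by(rule P.H_finsum)
 have "sub1 R f u (i, 0, 0) = ?t 1 \<oplus> (?t i \<oplus> ?r)"
  unfolding ps_subst1_def prod.case add_0_right
  by(rule finsum_two) (use i tc in auto)
 also have "?t 1 = f 1 \<otimes> u (i, 0, 0)" by(simp add: ps_pow_1[OF uc])
 finally have "sub1 R f u (i, 0, 0) = ?r \<oplus> (f 1 \<otimes> u (i, 0, 0) \<oplus> ?t i)" using uc tc f(1) P.H_carr[OF rP] pu by(simp add: a_ac)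
 hence "sub1 R f u (i, 0, 0) \<ominus> (f 1 \<otimes> u (i, 0, 0) \<oplus> ?t i) = ?r"
  using uc pu f(1) P.H_carr[OF rP] by(simp add: a_minus_def a_assoc r_neg)
 thus ?thesis using rP by simp
qed

end

text \<open>The source of the factor \<open>y^i\<close> in the product rule: for the action of
  \<open>y\<close> the linear coefficient is the scalar \<open>y\<close>.\<close>

lemma pow_diag_coeff:
 assumes f: "!!k. f k : car R" "f 0 = \<zero>"
 shows "ps_pow R (sub1 R f (ps_X R)) n (n, 0, 0) = f 1 [^] n"
proof (induction n)
 case 0 thus ?case by(simp add: ps_monom_def)
next
 case (Suc n)
 let ?u = "sub1 R f (ps_X R)"
 have u0: "ps0 R ?u" by(rule ps0_subst1) (use f in auto)
 note uc = ps0D(1)[OF u0] and pc = ps_pow_closed[of ?u, OF ps0D(1)[OF u0]]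
 have ux: "?u (a, 0, 0) = f a" for a using subst1_X(1)[of f a 0 0, OF f(1)] by simp
 have po: "ps_pow R ?u n (a, 0, 0) = \<zero>" if "a < n" for a
  using ps_ordD[OF ps_ord_pow[OF uc ps0_ord[OF u0]], of a 0 0 n] that by simp
 have m: "ps_mult R ?u (ps_pow R ?u n) (Suc n, 0, 0) = f 1 \<otimes> ps_pow R ?u n (n, 0, 0)"
 proof -
  have inj: "inj_on (%a::nat. (a, 0::nat, 0::nat)) {..Suc n}" by(auto simp: inj_on_def)
  have im: "{..Suc n} \<times> {..0::nat} \<times> {..0::nat} = (%a. (a, 0, 0)) ` {..Suc n}" by auto
  have "ps_mult R ?u (ps_pow R ?u n) (Suc n, 0, 0) = (\<Oplus>a\<in>{..Suc n}. ?u (a, 0, 0) \<otimes> ps_pow R ?u n (Suc n - a, 0, 0))"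
   unfolding ps_mult_def prod.case im by(subst finsum_reindex) (use inj uc pc in auto)
  also have "... = (\<Oplus>a\<in>{..Suc n}. if 1 = a then f 1 \<otimes> ps_pow R ?u n (n, 0, 0) else \<zero>)"
  proof (rule finsum_cong'[OF refl])
   fix a assume a: "a : {..Suc n}"
   show "?u (a, 0, 0) \<otimes> ps_pow R ?u n (Suc n - a, 0, 0) = (if 1 = a then f 1 \<otimes> ps_pow R ?u n (n, 0, 0) else \<zero>)"
   proof (cases "a = 0")
    case True thus ?thesis using ux f(2) pc by simp
   next
    case False
    show ?thesis
    proof (cases "a = 1")
     case True thus ?thesis using ux by simp
    next
     case F2: False
     have "Suc n - a < n" using False F2 a by(auto)
     thus ?thesis using po[of "Suc n - a"] F2 uc by auto
    qed
   qed
  qed (use f pc in auto)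
  also have "... = f 1 \<otimes> ps_pow R ?u n (n, 0, 0)" by(rule finsum_singleton) (use f pc in auto)
  finally show ?thesis .
 qed
 have "ps_pow R ?u (Suc n) = ps_mult R ?u (ps_pow R ?u n)" using ps_mult_comm[OF uc pc] by simp
 thus ?case using m Suc f(1) by(simp add: m_comm)
qed

end

text \<open>As for formal modules: the commutation with the action is what has to be
  approximated.\<close>

lemma (in cring) strict_iso_approx:
 fixes A :: "('k, 'l) ring_scheme" and B :: "('h, 'j) ring_scheme"
 assumes d: "strict_iso A R d" and src: "formal_module B R (%g. D (Src g))" and tgt: "formal_module B R (%g. D (Tgt g))"
  and F: "!!i j. D (Src (FCoeff i j)) = d (Src (FCoeff i j))" "!!i j. D (Tgt (FCoeff i j)) = d (Tgt (FCoeff i j))"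
   "!!i. D (IsoCoeff i) = d (IsoCoeff i)"
  and sc: "!!x. x : car B ==> D (Src (Scal x)) = D (Tgt (Scal x))"
  and ex: "!!N x. x : car B ==> EX a:car A. \<forall>i\<le>N. D (Src (Act x i)) = d (Src (Act a i)) & D (Tgt (Act x i)) = d (Tgt (Act a i))"
 shows "strict_iso B R D"
proof -
 note d' = d[unfolded strict_iso_iff] and di = strict_isoD[OF d]
 note S = formal_moduleD[OF src] and T = formal_moduleD[OF tgt]
 have DF: "(%i j. D (Src (FCoeff i j))) = (%i j. d (Src (FCoeff i j)))" "(%i j. D (Tgt (FCoeff i j))) = (%i j. d (Tgt (FCoeff i j)))"
  "(%i. D (IsoCoeff i)) = (%i. d (IsoCoeff i))" using F by(intro ext; simp)+
 let ?f = "%i. d (IsoCoeff i)"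
 have eq: "sub1 R ?f (sub1 R (%i. D (Src (Act x i))) (ps_X R)) =
   sub1 R (%i. D (Tgt (Act x i))) (sub1 R ?f (ps_X R))" if x: "x : car B" for x
 proof (rule agree_all)
  fix N
  obtain a where a: "a : car A" "\<forall>i\<le>N. D (Src (Act x i)) = d (Src (Act a i)) & D (Tgt (Act x i)) = d (Tgt (Act a i))"
   using ex[OF x] by blast
  have e: "sub1 R ?f (sub1 R (%i. d (Src (Act a i))) (ps_X R)) =
   sub1 R (%i. d (Tgt (Act a i))) (sub1 R ?f (ps_X R))" using d' a(1) by blast
  have "agree N (sub1 R ?f (sub1 R (%i. D (Src (Act x i))) (ps_X R))) (sub1 R ?f (sub1 R (%i. d (Src (Act a i))) (ps_X R)))"
   by(intro agree_subst1 agree_refl di(3) refl ps_subst1_closed S(3)[OF x] ps_monom_closed) (use a(2) in auto)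
  moreover have "agree N (sub1 R (%i. D (Tgt (Act x i))) (sub1 R ?f (ps_X R))) (sub1 R (%i. d (Tgt (Act a i))) (sub1 R ?f (ps_X R)))"
   by(intro agree_subst1 agree_refl ps_subst1_closed T(3)[OF x] ps_monom_closed di(3)) (use a(2) in auto)
  ultimately show "agree N (sub1 R ?f (sub1 R (%i. D (Src (Act x i))) (ps_X R))) (sub1 R (%i. D (Tgt (Act x i))) (sub1 R ?f (ps_X R)))"
   unfolding e using agree_trans agree_sym by blast
 qed
 have sub: "(%g. D (Src g)) ` mod_gens B <= car R" "(%g. D (Tgt g)) ` mod_gens B <= car R"
  using src tgt by(simp_all add: formal_module_def)
 have h: "is_hom R (%i j. d (Src (FCoeff i j))) (%i j. d (Tgt (FCoeff i j))) ?f" "?f 1 = \<one>" using d' by blast+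
 show ?thesis
  unfolding strict_iso_iff image_iso_gens DF F(3)
  by(intro conjI ballI allI sub src tgt sc h eq di(3))
qed

context graded_filtered
begin

lemma GL_proj: "(%x. x k) : ring_hom GL (R Quot J k)"
 using proj_hom[of k] GL_sub by(auto simp: ring_hom_def)

text \<open>Equality in the limit is equality at every level, so the axioms may be checked modulo
  each \<open>J k\<close>.\<close>

lemma GL_formal_module:
 fixes B :: "('h, 'j) ring_scheme"
 assumes B: "cring B" and cl: "!!g. g : mod_gens B ==> D g : car GL"
  and k: "!!k. formal_module B (R Quot J k) (%g. D g k)"
 shows "formal_module B GL D"
 unfolding formal_module_def
proof (intro conjI ballI)
 show D: "D ` mod_gens B <= car GL" using cl by blast
 fix z assume z: "z : module_eqs B GL D"
 obtain x y where xy: "z = (x, y)" by(cases z)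
 have "x k = y k" for k
 proof -
  interpret p: ring_hom_cring GL "R Quot J k" "%x. x k" by(rule rh_cringI[OF GL_cring Q_cring GL_proj])
  have "(x k, y k) : map_prod (%x. x k) (%x. x k) ` module_eqs B GL D" using z xy by force
  hence "(x k, y k) : module_eqs B (R Quot J k) (%g. D g k)" unfolding p.image_module_eqs[OF B D] .
  thus ?thesis by(rule p.S.formal_module_eqD[OF k])
 qed
 thus "case z of (x, y) => x = y" by(simp add: xy fun_eq_iff)
qed

lemma GL_strict_iso:
 fixes B :: "('h, 'j) ring_scheme"
 assumes B: "cring B" and cl: "!!g. g : iso_gens B ==> D g : car GL"
  and k: "!!k. strict_iso B (R Quot J k) (%g. D g k)"
 shows "strict_iso B GL D"
 unfolding strict_iso_def
proof (intro conjI ballI)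
 show D: "D ` iso_gens B <= car GL" using cl by blast
 fix z assume z: "z : iso_eqs B GL D"
 obtain x y where xy: "z = (x, y)" by(cases z)
 have "x k = y k" for k
 proof -
  interpret p: ring_hom_cring GL "R Quot J k" "%x. x k" by(rule rh_cringI[OF GL_cring Q_cring GL_proj])
  have "(x k, y k) : map_prod (%x. x k) (%x. x k) ` iso_eqs B GL D" using z xy by force
  hence "(x k, y k) : iso_eqs B (R Quot J k) (%g. D g k)" unfolding p.image_iso_eqs[OF B D] .
  thus ?thesis by(rule p.S.strict_iso_eqD[OF k])
 qed
 thus "case z of (x, y) => x = y" by(simp add: xy fun_eq_iff)
qed

end

section \<open>The action of the completion\<close>

lemma scal_hom0: "formal_module A Q d ==> (%a. d (Scal a)) : ring_hom A Q"
 unfolding formal_module_iff image_mod_gens by(intro ring_hom_memI) auto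

context adic_algebra
begin

abbreviation "Ah == completion A I"

definition rp :: "(nat => 'k set) => nat => 'k" where
 "rp x = (SOME b. AK.coh b & x = AK.mk b)"

lemma rp: assumes "x : car Ah" shows "AK.coh (rp x)" "AK.mk (rp x) = x"
proof -
 have "EX b. AK.coh b & x = AK.mk b" by(rule completionE[OF assms]) blast
 from someI_ex[OF this] show "AK.coh (rp x)" "AK.mk (rp x) = x" unfolding rp_def by simp_all
qed

lemma rp_at: "x : car Ah ==> AK.cl m (rp x m) = x m" and rp_carr: "x : car Ah ==> rp x m : car A"
 using fun_cong[OF rp(2), of x m] AK.coh_carr[OF rp(1)] by(simp_all add: AK.mk_def)

text \<open>At level \<open>k\<close> the coefficient of degree \<open>i\<close> uses a
  representative modulo \<open>I^(k i)\<close>: with this precision \<open>action_continuous\<close>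
  makes its class modulo \<open>J k\<close> independent of the choice.\<close>

definition hatm :: "('k mod_gen => 'a) => (nat => 'k set) mod_gen => nat => 'a set" where
 "hatm d g = (case g of Scal x => lmap R J s x | FCoeff i j => to_limit R J (d (FCoeff i j))
  | Act x i => mk (%k. d (Act (rp x (k * i)) i)))"

text \<open>The exponent \<open>k (N + 1)\<close> dominates \<open>k i\<close> for all
  \<open>i \<le> N\<close>, and also \<open>k\<close>, the precision needed for the scalars even if
  \<open>N = 0\<close>.\<close>

definition near :: "nat => nat => (nat => 'k set) => 'k => bool" where
 "near k N x a \<longleftrightarrow> x : car Ah & a : car A & AK.cl (k * (N + 1)) a = x (k * (N + 1))"

lemma near_ops:
 assumes "near k N x a" "near k N y b"
 shows "near k N (x +[Ah] y) (a +[A] b)" "near k N (x *[Ah] y) (a *[A] b)"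
proof -
 interpret Ah: cring Ah by(rule compl_cring)
 have xy: "x : car AK.LR" "y : car AK.LR" "a : car A" "b : car A" using assms by(simp_all add: near_def completion_eq)
 show "near k N (x +[Ah] y) (a +[A] b)" "near k N (x *[Ah] y) (a *[A] b)"
  using assms xy ring_hom_add[OF AK.cl_hom] ring_hom_mult[OF AK.cl_hom] ring_hom_add[OF AK.proj_hom xy(1,2)] ring_hom_mult[OF AK.proj_hom xy(1,2)]
  by(simp_all add: near_def completion_eq)
qed

lemma near_one: "near k N 1[Ah] 1[A]"
proof -
 interpret Ah: cring Ah by(rule compl_cring)
 show ?thesis using Ah.one_closed AK.lim_consts(1) by(simp add: near_def completion_eq AK.mk_def)
qed

lemma near_ex: "x : car Ah ==> EX a. near k N x a"
 using rp_at rp_carr unfolding near_def by blast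

context
 fixes d :: "'k mod_gen => 'a"
 assumes d: "formal_module A R d" and ds: "!!a. a : car A ==> d (Scal a) = s a"
begin

lemma quot_module: "formal_module A (R Quot J k) (%g. cl k (d g))"
 by(rule formal_module_hom[OF A.cring_axioms cring_axioms Q_cring cl_hom d])

text \<open>Modulo \<open>J k\<close> the scalars from \<open>I^k\<close> become zero, so
  \<open>action_continuous\<close> applies to the reduced module.\<close>

lemma quot_cont:
 assumes ab: "a : car A" "b : car A" "AK.cl m a = AK.cl m b" "k * i <= m"
 shows "cl k (d (Act a i)) = cl k (d (Act b i))"
proof (rule cring.action_continuous[OF Q_cring A.cring_axioms quot_module I])
 have z: "cl k \<zero> = 0[R Quot J k]" using ring_hom_zero[OF cl_hom ring_axioms cring.axioms(1)[OF Q_cring]] .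
 show "cl k (d (Scal a)) = 0[R Quot J k]" if "a : K k" for a
 proof -
  have "s a : J k" using s_K that by blast
  hence "cl k (s a) = cl k \<zero>" using cl_zero[OF s.hom_closed[OF AK.J_carr[OF that]]] by blast
  thus ?thesis unfolding ds[OF AK.J_carr[OF that]] z .
 qed
 show "a -[A] b : K (k * i)"
  using AK.cl_mono[OF ab(3,4,1,2)] AK.cl_eq[OF ab(1,2)] by blast
qed (use ab in simp_all)

lemma dclosed: "a : car A ==> d (Act a i) : car R"
 using formal_moduleD(3)[OF d] .

lemma hat_coh: assumes x: "x : car Ah" shows "coh (%k. d (Act (rp x (k * i)) i))"
 unfolding coh_def
proof (intro allI conjI dclosed rp_carr[OF x])
 fix k
 have "AK.cl (k * i) (rp x (Suc k * i)) = AK.cl (k * i) (rp x (k * i))" by(rule AK.coh_le[OF rp(1)[OF x]]) simp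
 thus "cl k (d (Act (rp x (Suc k * i)) i)) = cl k (d (Act (rp x (k * i)) i))"
  by(intro quot_cont[of _ _ "k * i"] rp_carr[OF x]) auto
qed

lemma hat_near:
 assumes n: "near k N x a"
 shows "hatm d (Scal x) k = cl k (d (Scal a))" "i <= N ==> hatm d (Act x i) k = cl k (d (Act a i))"
proof -
 let ?M = "k * (N + 1)"
 have x: "x : car Ah" and a: "a : car A" and e: "AK.cl ?M a = AK.cl ?M (rp x ?M)" using n rp_at[of x ?M] by(simp_all add: near_def)
 note rc = rp_carr[OF x]
 have le: "AK.cl m a = AK.cl m (rp x m)" if "m <= ?M" for m
  using AK.cl_mono[OF e that a rc] AK.coh_le[OF rp(1)[OF x] that] by simp
 show "hatm d (Act x i) k = cl k (d (Act a i))" if i: "i <= N"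
 proof -
  have m: "k * i <= ?M" using i by(intro mult_le_mono) auto
  have "cl k (d (Act (rp x (k * i)) i)) = cl k (d (Act a i))"
   by(rule quot_cont[of _ _ "k * i"]) (use le[OF m] a rc in auto)
  thus ?thesis by(simp add: hatm_def mk_def)
 qed
 have "lmap R J s x = mk (%k. s (rp x k))" using limit_map_s(1)[of "rp x"] rc rp(2)[OF x] by simp
 moreover have "cl k (s (rp x k)) = cl k (s a)"
 proof -
  have "AK.cl k a = AK.cl k (rp x k)" by(rule le) simp
  hence "rp x k -[A] a : K k" using AK.cl_eq[OF rc a, of k k] by simp
  hence "s (rp x k -[A] a) : J k" using s_K by blast
  thus ?thesis using rc[of k] a by(simp add: cl_eq a_minus_def)
 qed
 ultimately show "hatm d (Scal x) k = cl k (d (Scal a))" by(simp add: hatm_def mk_def ds[OF a])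
qed

lemma hat_quot: "formal_module Ah (R Quot J k) (%g. hatm d g k)"
proof (rule cring.formal_module_approx[OF Q_cring compl_cring quot_module, where P = "near k"])
 show "hatm d (FCoeff i j) k = cl k (d (FCoeff i j))" for i j by(simp add: hatm_def to_limit_mk mk_def)
 show "a : car A & hatm d (Scal x) k = cl k (d (Scal a)) & (\<forall>i\<le>N. hatm d (Act x i) k = cl k (d (Act a i)))"
  if "near k N x a" for N x a using hat_near[OF that] that by(simp add: near_def)
qed (use near_ex near_ops near_one in blast)+

lemma hat_hpart:
 assumes dh: "!!g. g : mod_gens A ==> d g : hpart R (mod_weight g)" and g: "g : mod_gens Ah"
 shows "hatm d g : lpart R J (mod_weight g)"
 using g
proof (cases rule: mod_gens_cases)
 case (1 x) thus ?thesis using limit_map_s_part by(simp add: hatm_def)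
next
 case (2 i j) thus ?thesis using to_limit_part[OF dh[of "FCoeff i j"]] by(simp add: hatm_def)
next
 case (3 x i)
 thus ?thesis unfolding lpart_mk using hat_coh[OF 3(2), of i] dh[of "Act (rp x (k * i)) i" for k] rp_carr[OF 3(2)]
  by(intro exI[of _ "%k. d (Act (rp x (k * i)) i)"]) (auto simp: hatm_def)
qed

lemma hat_module:
 assumes dh: "!!g. g : mod_gens A ==> d g : hpart R (mod_weight g)"
 shows "formal_module Ah GL (hatm d)"
 using GL_formal_module[OF compl_cring limit_part_GL[OF hat_hpart[OF dh]] hat_quot] by blast

lemma hat_phi: assumes g: "g : mod_gens A" shows "hatm d (map_mod_gen (to_completion A I) g) = to_limit R J (d g)"
 using g
proof (cases rule: mod_gens_cases)
 case (1 a)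
 thus ?thesis using limit_map_s(1)[of "%_. a"] ds by(simp add: hatm_def to_completion_mk to_limit_mk)
next
 case (2 i j) thus ?thesis by(simp add: hatm_def)
next
 case (3 a i)
 have x: "to_completion A I a : car Ah" using rh_cl[OF to_completion_hom 3(2)] .
 have "cl k (d (Act (rp (to_completion A I a) (k * i)) i)) = cl k (d (Act a i))" for k
  using rp_at[OF x, of "k * i"] by(intro quot_cont[of _ _ "k * i"] rp_carr[OF x] 3(2)) (auto simp: to_completion_mk AK.mk_def)
 thus ?thesis by(simp add: 3(1) hatm_def to_limit_mk mk_def)
qed

end

definition hati :: "('k iso_gen => 'a) => (nat => 'k set) iso_gen => nat => 'a set" where
 "hati d g = (case g of Src h => hatm (%g. d (Src g)) h | Tgt h => hatm (%g. d (Tgt g)) h | IsoCoeff i => to_limit R J (d (IsoCoeff i)))"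

context
 fixes d :: "'k iso_gen => 'a"
 assumes d: "strict_iso A R d" and ds: "!!a. a : car A ==> d (Src (Scal a)) = s a"
  and dh: "!!g. g : iso_gens A ==> d g : hpart R (iso_weight g)"
begin

lemma ds': "a : car A ==> d (Tgt (Scal a)) = s a"
 using d ds unfolding strict_iso_iff by simp

lemma hati_hpart: assumes g: "g : iso_gens Ah" shows "hati d g : lpart R J (iso_weight g)"
 using g
proof (cases rule: iso_gens_cases)
 case (1 h) thus ?thesis using hat_hpart[OF strict_isoD(1)[OF d] ds, of h] dh[of "Src g" for g] by(simp add: hati_def)
next
 case (2 h) thus ?thesis using hat_hpart[OF strict_isoD(2)[OF d] ds', of h] dh[of "Tgt g" for g] by(simp add: hati_def)
next
 case (3 i) thus ?thesis using to_limit_part[OF dh[of "IsoCoeff i"]] by(simp add: hati_def)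
qed

lemma hati_iso: "strict_iso Ah GL (hati d)"
proof (rule GL_strict_iso[OF compl_cring limit_part_GL[OF hati_hpart]])
 fix k
 note m = hat_quot[OF strict_isoD(1)[OF d] ds] hat_quot[OF strict_isoD(2)[OF d] ds']
 show "strict_iso Ah (R Quot J k) (%g. hati d g k)"
 proof (rule cring.strict_iso_approx[OF Q_cring strict_iso_hom[OF A.cring_axioms cring_axioms Q_cring cl_hom d]])
  fix N x assume x: "x : car Ah"
  obtain a where a: "near k N x a" using near_ex[OF x] by blast
  show "EX a:car A. \<forall>i\<le>N. hati d (Src (Act x i)) k = cl k (d (Src (Act a i))) & hati d (Tgt (Act x i)) k = cl k (d (Tgt (Act a i)))"
   using a hat_near(2)[OF strict_isoD(1)[OF d] ds a] hat_near(2)[OF strict_isoD(2)[OF d] ds' a]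
   by(intro bexI[of _ a]) (auto simp: hati_def near_def)
 qed (use m in "simp_all add: hati_def hatm_def to_limit_mk mk_def")
qed

lemma hati_phi: assumes g: "g : iso_gens A" shows "hati d (map_iso_gen (to_completion A I) g) = to_limit R J (d g)"
 using g
proof (cases rule: iso_gens_cases)
 case (1 h) thus ?thesis using hat_phi[OF strict_isoD(1)[OF d] ds, of h] by(simp add: hati_def)
next
 case (2 h) thus ?thesis using hat_phi[OF strict_isoD(2)[OF d] ds', of h] by(simp add: hati_def)
next
 case (3 i) thus ?thesis by(simp add: hati_def)
qed

end

text \<open>The inverse is the geometric series in \<open>r\<close>, convergent because
  \<open>r^(l+1)\<close> is in \<open>I^l\<close>.\<close>

lemma one_minus_unit: assumes r: "r : K 1" shows "EX w:car Ah. w *[Ah] (1[Ah] -[Ah] to_completion A I r) = 1[Ah]"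
proof -
 have rA: "r : car A" using AK.J_carr[OF r] .
 have rp: "r [^]\<^bsub>A\<^esub> Suc l : K l" for l
  using AKg.H_pow[OF r, of "Suc l"] AK.J_Suc[of l] by auto
 let ?p = "AK.psum (%j. r [^]\<^bsub>A\<^esub> j)"
 have pc: "AK.coh ?p" by(rule AK.psum_coh) (use rA rp in simp_all)
 have id: "?p l *[A] (1[A] +[A] -[A] r) = 1[A] +[A] -[A] (r [^]\<^bsub>A\<^esub> Suc l)" for l
 proof (induction l)
  case 0 thus ?case using rA AK.psum_0[of "%j. r [^]\<^bsub>A\<^esub> j"] by simp
 next
  case (Suc l)
  let ?q = "r [^]\<^bsub>A\<^esub> Suc l"
  have q: "?q : car A" using rA by simp
  have "?p (Suc l) *[A] (1[A] +[A] -[A] r) = ?q *[A] (1[A] +[A] -[A] r) +[A] (1[A] +[A] -[A] ?q)"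
   using AK.psum_Suc[of "%j. r [^]\<^bsub>A\<^esub> j" l] rA Suc q AK.coh_carr[OF pc, of l] by(simp add: A.l_distr del: A.nat_pow_Suc)
  also have "... = (?q +[A] -[A] (?q *[A] r)) +[A] (-[A] ?q +[A] 1[A])"
   using rA q by(simp add: A.r_distr A.r_minus A.a_comm del: A.nat_pow_Suc)
  also have "... = 1[A] +[A] -[A] (?q *[A] r)"
  proof -
   have "(a +[A] b) +[A] (-[A] a +[A] c) = c +[A] b" if "a : car A" "b : car A" "c : car A" for a b c
   proof -
    have "(a +[A] b) +[A] (-[A] a +[A] c) = (b +[A] a) +[A] (-[A] a +[A] c)"
     using A.a_comm[OF that(1,2)] by(simp only:)
    also have "... = b +[A] c" using that by(simp add: A.a_assoc A.r_neg2)
    also have "... = c +[A] b" by(rule A.a_comm[OF that(2,3)])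
    finally show ?thesis .
   qed
   from this[of ?q "-[A] (?q *[A] r)" "1[A]"] show ?thesis using q rA by(simp del: A.nat_pow_Suc)
  qed
  finally show ?case by simp
 qed
 have k1: "AK.coh (%_. 1[A])" "AK.coh (%_. r)" using AK.coh_const rA by simp_all
 have "AK.mk ?p *[AK.LR] (1[AK.LR] -[AK.LR] AK.mk (%_. r)) = AK.mk (%l. 1[A] +[A] -[A] (r [^]\<^bsub>A\<^esub> Suc l))"
  using AK.coh_carr[OF pc] rA id by(simp add: a_minus_def AK.lim_consts AK.lim_neg[OF k1(2)] AK.lim_ops del: A.nat_pow_Suc)
 also have "... = 1[AK.LR]"
 proof -
  have "(1[A] +[A] -[A] (r [^]\<^bsub>A\<^esub> Suc l)) -[A] 1[A] : K l" for l
  proof -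
   have q: "r [^]\<^bsub>A\<^esub> Suc l : car A" using rA by simp
   have "(1[A] +[A] -[A] (r [^]\<^bsub>A\<^esub> Suc l)) -[A] 1[A] = -[A] (r [^]\<^bsub>A\<^esub> Suc l)"
    using q by(simp add: a_minus_def A.a_comm[of "1[A]"] A.a_assoc A.r_neg del: A.nat_pow_Suc)
   thus ?thesis using AKg.H_neg[OF rp] by simp
  qed
  thus ?thesis unfolding AK.lim_consts(1) using rA by(subst AK.mk_eq) (auto simp del: A.nat_pow_Suc)
 qed
 finally show ?thesis using AK.mk_closed[OF pc] by(intro bexI[of _ "AK.mk ?p"]) (simp_all add: completion_eq to_completion_mk)
qed

text \<open>Uniqueness of the extended action, in the form that its coefficients lie in every
  subring \<open>P\<close> containing the scalars, the formal group law and the action of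
  \<open>A\<close>. By induction on \<open>i\<close>, the lower coefficients may be ignored modulo
  \<open>P\<close>.\<close>

lemma Act_completion:
 assumes Q: "cring Q" and D: "formal_module Ah Q D" and P: "gfam Q (%_. P)"
  and Sc: "!!x. x : car Ah ==> D (Scal x) : P" and F: "!!k l. D (FCoeff k l) : P"
  and ph: "!!a i. a : car A ==> D (Act (to_completion A I a) i) : P" and x: "x : car Ah"
 shows "D (Act x i) : P"
 using x
proof (induction i arbitrary: x rule: less_induct)
 case (less i)
 interpret Q: cring Q by fact
 interpret P: gfam Q "%_. P" by fact
 interpret Ah: cring Ah by(rule compl_cring)
 note DD = Q.formal_moduleD[OF D]
 consider "i = 0" | "i = 1" | "i >= 2" by linarith
 thus ?case
 proof cases
  case 1 thus ?thesis using DD(7)[OF less.prems] P.H_zero by simp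
 next
  case 2 thus ?thesis using DD(8)[OF less.prems] Sc[OF less.prems] by simp
 next
  case i: 3
  let ?c = "%x. D (Act x i)" and ?S = "%x. D (Scal x)" and ?U = "%x. sub1 Q (%i. D (Act x i)) (ps_X Q)"
  interpret S: ring_hom_cring Ah Q ?S
   by(rule rh_cringI[OF compl_cring Q scal_hom0[OF D]])
  have U: "ps0 Q (?U x)" "Q.xonly (?U x)" "!!a. ?U x (a, 0, 0) = D (Act x a)" if "x : car Ah" for x
   using Q.action_ps0[OF compl_cring D that] DD(3)[OF that] Q.xonly_subst1[OF DD(3)[OF that] _ Q.xonly_X] Q.subst1_X(1)[of "%i. D (Act x i)" _ 0 0]
   by simp_all
  have cC: "?c x : car Q" if "x : car Ah" for x using DD(3)[OF that] .
  have PD: "y : P" if "y -[Q] z : P" "z : P" "y : car Q" for y z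
  proof -
   have "(y -[Q] z) +[Q] z = y" using that(3) P.H_carr[OF that(2)] by(simp add: a_minus_def Q.a_assoc Q.l_neg)
   thus ?thesis using P.H_add[OF that(1,2)] by simp
  qed
  have add: "?c (x +[Ah] y) : P" if x: "x : car Ah" and y: "y : car Ah" and c: "?c x : P" "?c y : P" for x y
  proof (rule PD)
   have "sub2 Q (%k l. D (FCoeff k l)) (?U x) (?U y) (i, 0, 0) -[Q] (?U x (i, 0, 0) +[Q] ?U y (i, 0, 0)) : P"
    by(rule Q.subst2_mod[OF P]) (use F DD(5,6) U[OF x] U[OF y] less.IH x y in auto)
   thus "?c (x +[Ah] y) -[Q] (?c x +[Q] ?c y) : P"
    using Q.action_add[OF compl_cring D x y] U(3)[OF x] U(3)[OF y] U(3)[OF Ah.a_closed[OF x y]] by metis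
  qed (use c P.H_add cC x y in auto)
  have mult: "?c (x *[Ah] y) -[Q] (?S x *[Q] ?c y +[Q] ?c x *[Q] ?S y [^]\<^bsub>Q\<^esub> i) : P" if x: "x : car Ah" and y: "y : car Ah" for x y
  proof -
   have "sub1 Q (%i. D (Act x i)) (?U y) (i, 0, 0) -[Q] (D (Act x 1) *[Q] ?U y (i, 0, 0) +[Q] ?c x *[Q] ps_pow Q (?U y) i (i, 0, 0)) : P"
    by(rule Q.subst1_mod[OF P]) (use DD(3,7) U[OF y] less.IH x y i in auto)
   moreover have "ps_pow Q (?U y) i (i, 0, 0) = ?S y [^]\<^bsub>Q\<^esub> i"
    using Q.pow_diag_coeff[of "%i. D (Act y i)" i] DD(3,7,8)[OF y] by simp
   ultimately show ?thesis
    using Q.action_mult[OF compl_cring D x y] U(3)[OF y] U(3)[OF Ah.m_closed[OF x y]] DD(8)[OF x] by metis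
  qed
  \<comment> \<open>With \<open>x\<close> the image of \<open>t\<close>, expanding
    \<open>?c (x y)\<close> in the two orders gives \<open>x c(y)\<close> and
    \<open>x^i c(y)\<close> modulo \<open>P\<close>, since \<open>c(x)\<close> is in
    \<open>P\<close>. The difference is \<open>(1 - x^(i-1)) x c(y)\<close>, so
    \<open>x c(y)\<close> is in \<open>P\<close>, and with it \<open>?c (x y)\<close>.\<close>
  have prod: "?c (to_completion A I t *[Ah] y) : P" if t: "t : K 1" and y: "y : car Ah" for t y
  proof -
   let ?x = "to_completion A I t"
   have tA: "t : car A" using AK.J_carr[OF t] .
   have xc: "?x : car Ah" using rh_cl[OF to_completion_hom tA] .
   have cx: "?c ?x : P" by(rule ph[OF tA])
   note Sx = S.hom_closed[OF xc] and Sy = S.hom_closed[OF y] and cy = cC[OF y] and cxC = cC[OF xc]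
   let ?a = "?S ?x *[Q] ?c y" and ?b = "?c ?x *[Q] ?S y [^]\<^bsub>Q\<^esub> i" and ?e = "?S y *[Q] ?c ?x" and ?f = "?c y *[Q] ?S ?x [^]\<^bsub>Q\<^esub> i"
   have bP: "?b : P" and eP: "?e : P" using P.H_mult[OF cx P.H_pow[OF Sc[OF y]]] P.H_mult[OF Sc[OF y] cx] by simp_all
   have abef: "?a : car Q" "?b : car Q" "?e : car Q" "?f : car Q" using Sx Sy cy cxC by simp_all
   let ?z = "?c (?x *[Ah] y)"
   have zc: "?z : car Q" using cC xc y by simp
   have 1: "?z -[Q] (?a +[Q] ?b) : P" by(rule mult[OF xc y])
   have 2: "?z -[Q] (?e +[Q] ?f) : P" using mult[OF y xc] Ah.m_comm[OF xc y] by simp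
   have za: "?z -[Q] ?a : P"
   proof -
    have "?z -[Q] ?a = (?z -[Q] (?a +[Q] ?b)) +[Q] ?b"
     using zc abef by(simp add: a_minus_def Q.minus_add Q.a_assoc Q.l_neg)
    thus ?thesis using P.H_add[OF 1 bP] by simp
   qed
   have zf: "?z -[Q] ?f : P"
   proof -
    have "?z -[Q] ?f = (?z -[Q] (?e +[Q] ?f)) +[Q] ?e"
     using zc abef by(simp add: a_minus_def Q.minus_add Q.a_comm[of "-[Q] ?e"] Q.a_assoc Q.l_neg)
    thus ?thesis using P.H_add[OF 2 eP] by simp
   qed
   have af: "?a -[Q] ?f : P"
   proof -
    have "?a -[Q] ?f = -[Q] (?z -[Q] ?a) +[Q] (?z -[Q] ?f)"
     using zc abef by(simp add: a_minus_def Q.minus_add Q.a_comm[of "-[Q] ?z"] Q.a_assoc Q.r_neg1)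
    thus ?thesis using P.H_add[OF P.H_neg[OF za] zf] by simp
   qed
   obtain m where m: "i = Suc m" "m >= 1" using i by(cases i) auto
   have tm: "t [^]\<^bsub>A\<^esub> m : K 1" using AKg.H_pow[OF t, of m] AK.J_mono[of 1 "m * 1"] m(2) by auto
   obtain w where w: "w : car Ah" "w *[Ah] (1[Ah] -[Ah] to_completion A I (t [^]\<^bsub>A\<^esub> m)) = 1[Ah]" using one_minus_unit[OF tm] by blast
   interpret ph: ring_hom_cring A Ah "to_completion A I" by(rule rh_cringI[OF A.cring_axioms compl_cring to_completion_hom])
   have xm: "to_completion A I (t [^]\<^bsub>A\<^esub> m) = ?x [^]\<^bsub>Ah\<^esub> m" using tA by(simp add: ph.hom_pow)
   have Sm: "?S (?x [^]\<^bsub>Ah\<^esub> m) = ?S ?x [^]\<^bsub>Q\<^esub> m" using S.hom_pow[OF xc] .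
   have Sw: "?S w *[Q] (1[Q] +[Q] -[Q] (?S ?x [^]\<^bsub>Q\<^esub> m)) = 1[Q]"
    using arg_cong[OF w(2), of ?S] w(1) xc by(simp add: xm a_minus_def Sm)
   have "?a = ?S w *[Q] (?a -[Q] ?f)"
   proof -
    let ?q = "?S ?x [^]\<^bsub>Q\<^esub> m"
    have q: "?q : car Q" using Sx by simp
    have "?a -[Q] ?f = (1[Q] +[Q] -[Q] ?q) *[Q] ?a"
    proof -
     have "(1[Q] +[Q] -[Q] ?q) *[Q] ?a = ?a +[Q] -[Q] (?q *[Q] ?a)"
      using q abef(1) by(simp add: Q.l_distr Q.l_minus del: Q.m_closed)
     moreover have "?q *[Q] ?a = ?f" using Sx cy q by(simp add: m(1) Q.m_ac)
     ultimately show ?thesis by(simp only: a_minus_def)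
    qed
    hence "?S w *[Q] (?a -[Q] ?f) = (?S w *[Q] (1[Q] +[Q] -[Q] ?q)) *[Q] ?a"
     using q abef(1) S.hom_closed[OF w(1)] by(simp add: Q.m_assoc)
    thus ?thesis using Sw abef(1) by simp
   qed
   hence "?a : P" using P.H_mult[OF Sc[OF w(1)] af] by simp
   thus ?thesis using PD[OF za _ zc] by blast
  qed
  \<comment> \<open>\<open>x\<close> is its representative \<open>rp x 1\<close> from
    \<open>A\<close> plus an element vanishing modulo \<open>I\<close>; the latter is a finite sum
    of products with elements of \<open>I\<close>, to which \<open>prod\<close> applies.\<close>
  define b where "b l = rp x l -[A] rp x 1" for l
  note rc = rp_carr[OF less.prems]
  have bm: "b = (%l. rp x l +[A] -[A] rp x 1)" by(simp add: b_def[abs_def] a_minus_def)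
  have bcoh: "AK.coh b" unfolding bm using AK.coh_ops(1)[OF rp(1)[OF less.prems] AK.coh_const[of "-[A] rp x 1"]] rc by simp
  have b1: "b 1 : K 1" using rc AKg.H_zero by(simp add: bm A.r_neg)
  obtain T y where T: "finite T" "T \<subseteq> K 1" "!!t. t : T ==> AK.coh (y t)" "!!l. b (l + 1) = (\<Oplus>\<^bsub>A\<^esub>t\<in>T. y t l *[A] t)"
   by(rule completion_vanish[OF bcoh b1]) blast
  have Tc: "t : car A" if "t : T" for t using AK.J_carr[OF subsetD[OF T(2) that]] .
  have tc: "AK.mk (y t) : car Ah" "to_completion A I t : car Ah" if "t : T" for t
   using in_compl[OF T(3)[OF that]] rh_cl[OF to_completion_hom Tc[OF that]] .
  have z: "AK.mk b = (\<Oplus>\<^bsub>Ah\<^esub>t\<in>T. AK.mk (y t) *[Ah] to_completion A I t)"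
   using mk_lincomb[OF T(3) Tc T(4) compl_cring, of "%x. x"] AK.coh_shift(2)[OF bcoh, of 1] by(simp add: ring_hom_def)
  have "(\<Oplus>\<^bsub>Ah\<^esub>t\<in>T'. AK.mk (y t) *[Ah] to_completion A I t) : car Ah & ?c (\<Oplus>\<^bsub>Ah\<^esub>t\<in>T'. AK.mk (y t) *[Ah] to_completion A I t) : P" if "T' \<subseteq> T" for T'
   using finite_subset[OF that T(1)] that
  proof (induction T')
   case empty
   have "to_completion A I 0[A] = 0[Ah]" using ring_hom_zero[OF to_completion_hom A.ring_axioms Ah.ring_axioms] .
   thus ?case using ph[of "0[A]" i] by simp
  next
   case (insert t T')
   have e: "(\<Oplus>\<^bsub>Ah\<^esub>t\<in>insert t T'. AK.mk (y t) *[Ah] to_completion A I t) =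
     AK.mk (y t) *[Ah] to_completion A I t +[Ah] (\<Oplus>\<^bsub>Ah\<^esub>t\<in>T'. AK.mk (y t) *[Ah] to_completion A I t)"
    by(rule Ah.finsum_insert) (use insert tc in auto)
   have tT: "t : T" using insert by simp
   have "?c (AK.mk (y t) *[Ah] to_completion A I t) : P"
    using prod[OF subsetD[OF T(2) tT] tc(1)[OF tT]] Ah.m_comm[OF tc[OF tT]] by simp
   thus ?case unfolding e using insert add[OF Ah.m_closed[OF tc[OF tT]]] Ah.m_closed[OF tc[OF tT]] by simp
  qed
  from this[OF subset_refl] have cz: "AK.mk b : car Ah" "?c (AK.mk b) : P" unfolding z by simp_all
  have xe: "AK.mk b +[Ah] to_completion A I (rp x 1) = x"
  proof -
   have "AK.mk b +[AK.LR] AK.mk (%_. rp x 1) = AK.mk (%l. b l +[A] rp x 1)"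
    using AK.coh_carr[OF bcoh] rc by(simp add: AK.lim_ops)
   also have "(%l. b l +[A] rp x 1) = rp x" using rc by(intro ext) (simp add: bm A.a_assoc A.l_neg)
   finally show ?thesis using rp(2)[OF less.prems] by(simp add: completion_eq to_completion_mk)
  qed
  show ?thesis using add[OF cz(1) rh_cl[OF to_completion_hom rc] cz(2) ph[OF rc], of 1] unfolding xe .
 qed
qed

text \<open>Degrees are obtained from the rescaled module and the subring of polynomials whose
  coefficient at \<open>t^n\<close> lies in \<open>N n\<close>.\<close>

lemma Act_completion_graded:
 assumes N: "gfam Q N" and D: "formal_module Ah Q D" and Sc: "!!x. x : car Ah ==> D (Scal x) : N 0"
  and F: "!!i j. D (FCoeff i j) : N (2 * (i + j - 1))"
  and ph: "!!a i. a : car A ==> D (Act (to_completion A I a) i) : N (2 * (i - 1))" and x: "x : car Ah"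
 shows "D (Act x i) : N (2 * (i - 1))"
proof -
 interpret N: gfam Q N by fact
 interpret U: UP_cring Q "UP Q" by(rule UP_cring.intro) (rule N.cring_axioms, simp)
 let ?B = "{p : car (UP Q). ALL n. upc Q p n : N n}"
 have mB: "upm Q x n : ?B" if "x : N n" for x n
  using that N.H_carr N.H_zero by auto
 have mem: "upm Q (D (Act x i)) (mod_weight (Act x i)) : ?B"
  by(rule Act_completion[OF U.UP_cring N.scaled_formal_module[OF compl_cring D] N.gfam_coeffs _ _ _ x])
   (use mB Sc F ph in simp_all)
 have dc: "D (Act x i) : car Q" using N.formal_moduleD(3)[OF D x] .
 from mem have "upc Q (upm Q (D (Act x i)) (2 * (i - 1))) n : N n" for n
  unfolding mod_weight.simps by blast
 from this[of "2 * (i - 1)"] show ?thesis using dc by simp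
qed

end

section \<open>Spans over the completion and functoriality of completion and base change\<close>

lemma adic_cong:
 assumes A: "cring A" and I: "ideal I A" and e: "!!a. a : car A ==> u a = v a" shows "adic A I R u = adic A I R v"
proof
 fix k :: nat
 have "ipow A I k <= car A"
  using additive_subgroup.a_subset[OF ideal.axioms(1)[OF cring.ideals_pow(1)[OF A I]]] .
 hence "u ` (ipow A I k) = v ` (ipow A I k)" using e by(intro image_cong) auto
 thus "adic A I R u k = adic A I R v k" by(simp add: adic_def)
qed

lemma ring_hom_inverse:
 assumes C: "cring C" and h: "h : ring_hom C D" and b: "bij_betw h (car C) (car D)" and g: "!!x. x : car C ==> g (h x) = x"
 shows "g : ring_hom D C" and "bij_betw g (car D) (car C)"
  and "[|X' <= car C; bij_betw h X' Y'|] ==> bij_betw g Y' X'"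
proof -
 interpret C: cring C by fact
 have s: "car D = h ` car C" using b by(simp add: bij_betw_def)
 show bb: "bij_betw g Y' X'" if "X' <= car C" "bij_betw h X' Y'" for X' Y'
  by(rule bij_betwI[where g = h]) (use that g in "auto simp: bij_betw_def subset_iff")
 show "bij_betw g (car D) (car C)" by(rule bb[OF subset_refl b])
 show "g : ring_hom D C"
 proof (rule ring_hom_memI)
  fix x assume "x : car D"
  then obtain u where u: "u : car C" "x = h u" unfolding s by blast
  thus "g x : car C" using g by simp
  fix y assume "y : car D"
  then obtain v where v: "v : car C" "y = h v" unfolding s by blast
  show "g (x *[D] y) = g x *[C] g y" "g (x +[D] y) = g x +[C] g y"
   using g u v ring_hom_mult[OF h u(1) v(1), symmetric] ring_hom_add[OF h u(1) v(1), symmetric] by simp_all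
 next
  show "g 1[D] = 1[C]" using g[OF C.one_closed] ring_hom_one[OF h] by simp
 qed
qed

lemma rh_comp: "[|f : ring_hom R S; g : ring_hom S T|] ==> (%x. g (f x)) : ring_hom R T"
 using ring_hom_trans[of f R S g T] by(simp add: comp_def)

lemma (in cring) m_swap:
 "[|a : car R; b : car R; c : car R; d : car R|] ==> (a \<otimes> b) \<otimes> (c \<otimes> d) = (a \<otimes> c) \<otimes> (b \<otimes> d)"
 by(simp add: m_ac)

context adic_algebra
begin

text \<open>As these spans form a multiplicative family, the spanning condition of
  \<open>adic_span\<close> need only be verified for generators of \<open>C\<close>.\<close>

lemma span_gfam:
 assumes C: "cring C" and al: "al : ring_hom R C" and bt: "bt : ring_hom Ah C"
 defines "N n == aspan C {al r *[C] bt b | r b. r : hpart R n & b : car Ah}"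
 shows "gfam C N" and "r : hpart R n ==> al r : N n" and "b : car Ah ==> bt b : N 0"
proof -
 interpret C: cring C by fact
 interpret Ah: cring Ah by(rule compl_cring)
 let ?V = "%n. {al r *[C] bt b | r b. r : hpart R n & b : car Ah}"
 have ac: "al r : car C" if "r : hpart R n" for r n using rh_cl[OF al H_carr[OF that]] .
 note bc = rh_cl[OF bt]
 have V: "?V n <= car C" for n using ac bc by blast
 have inN: "al r *[C] bt b : N n" if "r : hpart R n" "b : car Ah" for r b n
  unfolding N_def by(rule C.aspan_incl) (use that in blast)
 show a: "al r : N n" if "r : hpart R n" for r n
  using inN[OF that Ah.one_closed] ring_hom_one[OF bt] ac[OF that] by simp
 show "bt b : N 0" if "b : car Ah" for b
  using inN[OF H_one that] ring_hom_one[OF al] bc[OF that] by simp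
 show "gfam C N"
 proof (intro gfam.intro gfam_axioms.intro C)
  show s: "additive_subgroup (N n) C" for n unfolding N_def by(rule C.aspan_subgroup[OF V])
  show "1[C] : N 0" using a[OF H_one] ring_hom_one[OF al] by simp
  fix x y m n assume x: "x : N m" and y: "y : N n"
  show "x *[C] y : N (m + n)"
  proof (rule C.aspan_mult[OF x[unfolded N_def] y[unfolded N_def] V V s])
   fix v w assume "v : ?V m" "w : ?V n"
   then obtain r b r' b' where v: "v = al r *[C] bt b" "r : hpart R m" "b : car Ah"
    and w: "w = al r' *[C] bt b'" "r' : hpart R n" "b' : car Ah" by blast
   have "v *[C] w = (al r *[C] al r') *[C] (bt b *[C] bt b')"
    unfolding v(1) w(1) by(rule C.m_swap[OF ac[OF v(2)] bc[OF v(3)] ac[OF w(2)] bc[OF w(3)]])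
   also have "... = al (r \<otimes> r') *[C] bt (b *[Ah] b')"
    using ring_hom_mult[OF al H_carr[OF v(2)] H_carr[OF w(2)]] ring_hom_mult[OF bt v(3) w(3)] by simp
   finally show "v *[C] w : N (m + n)" using inN[OF H_mult[OF v(2) w(2)] Ah.m_closed[OF v(3) w(3)]] by simp
  qed
 qed
qed

lemma limit_map_s_phi: "a : car A ==> lmap R J s (to_completion A I a) = to_limit R J (s a)"
 using limit_map_s(1)[of "%_. a"] by(simp add: to_completion_mk to_limit_mk)

end

text \<open>The common frame for the structure maps of the Hopf algebroid: such a map induces one on
  completions and one on base changes, and these are compatible with the comparison maps.\<close>

locale adic_hom = R: adic_algebra A R pr I s + S: adic_algebra A S pr' I s'
 for A :: "('k, 'l) ring_scheme" and R :: "'a graded_ring" and pr I s and S :: "'b graded_ring" and pr' s' +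
 fixes h :: "'a => 'b"
 assumes h: "h : ring_hom R S" and hs: "a : car A ==> h (s a) = s' a" and hh: "x : hpart R n ==> h x : hpart S n"
begin

sublocale h: ring_hom_cring R S h by(rule rh_cringI[OF R.cring_axioms S.cring_axioms h])

abbreviation "lh == lmap S S.J h"

lemma h_J: "h ` R.J k \<subseteq> S.J k"
proof -
 interpret j: ideal "S.J k" S by(rule S.J_ideal)
 have sK: "s ` R.K k <= car R" using R.AK.J_carr by auto
 have "h x : S.J k" if "x : R.J k" for x
  using that[unfolded R.J_eq] sK R.cring_axioms
 proof (induction x rule: R.Idl_induct)
  case zero thus ?case by simp
 next
  case (smult v r)
  then obtain a where a: "a : R.K k" "v = s a" by blast
  have "h v : S.J k" unfolding a(2) hs[OF R.AK.J_carr[OF a(1)]] using S.s_K a(1) by blast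
  moreover have "v : car R" using sK smult(1) by blast
  ultimately show ?case using smult j.I_r_closed by simp
 next
  case (add x y)
  have "x : car R" "y : car R" using add(1,2) ideal.Icarr[OF R.genideal_ideal[OF sK]] by auto
  thus ?case using add by simp
 qed
 thus ?thesis by blast
qed

lemmas lh_mk = limit_map_mk[OF R.filtered_axioms S.filtered_axioms h h_J]

lemma lh_part: assumes "x : lpart R R.J n" shows "lh x : lpart S S.J n"
proof -
 obtain rh where r: "R.coh rh" "!!k. rh k : hpart R n" "x = R.mk rh" using assms R.lpart_mk by blast
 show ?thesis unfolding S.lpart_mk r(3) lh_mk(1)[OF R.H_carr[OF r(2)]]
  using lh_mk(2)[OF r(1)] hh[OF r(2)] by blast
qed

lemma lh_GL: "lh : ring_hom R.GL S.GL"
proof -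
 note l = lh_mk(3)
 have "lh x : car S.GL" if x: "x : car R.GL" for x
 proof -
  interpret l: ring_hom_cring R.LR S.LR lh by(rule rh_cringI[OF R.lim_cring S.lim_cring l])
  show ?thesis
   using x[unfolded R.GL_carrier] R.LP_sub
  proof (induction x rule: R.LR.aspan_induct)
   case zero thus ?case using S.GL.zero_closed by simp
  next
   case (incl x) thus ?case using lh_part S.limit_part_GL by blast
  next
   case (neg x) thus ?case using S.GL.a_inv_closed[OF neg(3)] S.GL_a_inv[OF neg(3)] by simp
  next
   case (add x y) thus ?case using S.GL.a_closed[of "lh x" "lh y"] by simp
  qed
 qed
 thus ?thesis using l R.GL_sub unfolding ring_hom_def by(auto simp: Pi_iff)
qed

lemma lh_to_limit: "r : car R ==> lh (to_limit R R.J r) = to_limit S S.J (h r)"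
 using lh_mk(1)[of "%_. r"] by(simp add: R.to_limit_mk S.to_limit_mk)

lemma lh_scal: assumes b: "b : car (completion A I)" shows "lh (lmap R R.J s b) = lmap S S.J s' b"
proof -
 obtain c where c: "R.AK.coh c" "b = R.AK.mk c" by(rule R.completionE[OF b])
 note cc = R.AK.coh_carr[OF c(1)]
 show ?thesis unfolding c(2) R.limit_map_s(1)[OF cc] S.limit_map_s(1)[OF cc]
  using lh_mk(1)[of "%k. s (c k)"] cc hs by simp
qed

definition bm :: "('a \<times> (nat => 'k set)) zpoly set => ('b \<times> (nat => 'k set)) zpoly set" where
 "bm = pres_map S.BC (%(x, b). S.bc (h x) b)"

lemma bm: "bm : ring_hom R.BC S.BC"
  "r : car R ==> bm (R.bc r 1[completion A I]) = S.bc (h r) 1[completion A I]"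
  "b : car (completion A I) ==> bm (R.bc 1[R] b) = S.bc 1[S] b"
proof -
 have p: "(%x. S.bc (h x) 1[completion A I]) : ring_hom R S.BC"
  using rh_comp[OF h S.BCT.in1_hom] by simp
 have bal: "S.bc (h (s a)) 1[completion A I] = S.bc 1[S] (to_completion A I a)" if "a : car A" for a
  using S.BCT.in1_in2[OF that] hs[OF that] by simp
 have \<phi>: "(case (x, b) of (x, b) => S.bc (h x) b) = S.bc (h x) 1[completion A I] *[S.BC] S.bc 1[S] b"
  if "x : car R" "b : car (deg0 (completion A I))" for x b
  using S.BCT.tt_split[of "h x" b] that by simp
 note l = R.BCT.tensor_lift[OF S.BCT.T_cring p S.BCT.in2_hom bal \<phi>]
 show "bm : ring_hom R.BC S.BC" unfolding bm_def by(rule l(1))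
 show "r : car R ==> bm (R.bc r 1[completion A I]) = S.bc (h r) 1[completion A I]" unfolding bm_def using l(3) by simp
 show "b : car (completion A I) ==> bm (R.bc 1[R] b) = S.bc 1[S] b" unfolding bm_def using l(4) by simp
qed

lemma bm_completion:
 assumes x: "x : car R.BC"
 shows "bc_to_compl A I S s' (bm x) = lh (bc_to_compl A I R s x)"
proof (rule R.BCT.tensor_hom_ext[OF S.GL_cring rh_comp[OF bm(1) S.base_change_map(1)] rh_comp[OF R.base_change_map(1) lh_GL] _ _ x])
 fix r assume r: "r : car R"
 show "bc_to_compl A I S s' (bm (R.bc r 1[deg0 (completion A I)])) =
  lh (bc_to_compl A I R s (R.bc r 1[deg0 (completion A I)]))"
  using bm(2)[OF r] S.base_change_map(2)[of "h r"] R.base_change_map(2)[OF r] lh_to_limit[OF r] r by simp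
next
 fix b assume "b : car (deg0 (completion A I))"
 hence b: "b : car (completion A I)" by simp
 show "bc_to_compl A I S s' (bm (R.bc 1[R] b)) = lh (bc_to_compl A I R s (R.bc 1[R] b))"
  using bm(3)[OF b] S.base_change_map(3)[OF b] R.base_change_map(3)[OF b] lh_scal[OF b] by simp
qed

end

section \<open>The structure maps\<close>

context base_ring
begin

abbreviation "G == LB_ring A"

lemma lunit: "L_lunit A : ring_hom (L_ring A) G" "g : mod_gens A ==> L_lunit A (L_gen A g) = LB_gen A (Src g)"
 using L_pres_map[OF LB_cring LBR.strict_isoD(1)[OF LB_univ]] unfolding L_lunit_def by blast+

lemma runit: "L_runit A : ring_hom (L_ring A) G" "g : mod_gens A ==> L_runit A (L_gen A g) = LB_gen A (Tgt g)"
 using L_pres_map[OF LB_cring LBR.strict_isoD(2)[OF LB_univ]] unfolding L_runit_def by blast+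

lemma counit: "L_counit A : ring_hom G (L_ring A)"
  "h : mod_gens A ==> L_counit A (LB_gen A (Src h)) = L_gen A h" "h : mod_gens A ==> L_counit A (LB_gen A (Tgt h)) = L_gen A h"
  "L_counit A (LB_gen A (IsoCoeff i)) = (if i = 1 then 1[L_ring A] else 0[L_ring A])"
 using LB_pres_map(1)[OF L_cring LR.strict_iso_id[OF L_univ]] LB_pres_map(2)[OF L_cring LR.strict_iso_id[OF L_univ], of "Src h"]
  LB_pres_map(2)[OF L_cring LR.strict_iso_id[OF L_univ], of "Tgt h"] LB_pres_map(2)[OF L_cring LR.strict_iso_id[OF L_univ], of "IsoCoeff i"]
 unfolding L_counit_def by simp_all

lemma conj: "L_conjugation A : ring_hom G G"
  "h : mod_gens A ==> L_conjugation A (LB_gen A (Src h)) = LB_gen A (Tgt h)" "h : mod_gens A ==> L_conjugation A (LB_gen A (Tgt h)) = LB_gen A (Src h)"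
  "L_conjugation A (LB_gen A (IsoCoeff i)) = series_inverse G (%j. LB_gen A (IsoCoeff j)) i"
 using LB_pres_map(1)[OF LB_cring LBR.strict_iso_inv[OF LB_univ]] LB_pres_map(2)[OF LB_cring LBR.strict_iso_inv[OF LB_univ], of "Src h"]
  LB_pres_map(2)[OF LB_cring LBR.strict_iso_inv[OF LB_univ], of "Tgt h"] LB_pres_map(2)[OF LB_cring LBR.strict_iso_inv[OF LB_univ], of "IsoCoeff i"]
 unfolding L_conjugation_def by simp_all

lemma G_span: "x : car G ==> x : aspan G (\<Union>n. hpart G n)"
 using LB.wp_span unfolding LB_eq .

lemma L_span: "x : car (L_ring A) ==> x : aspan (L_ring A) (\<Union>n. hpart (L_ring A) n)"
 using L.wp_span unfolding L_eq .

sublocale TL: graded_tensor G G "L_ring A" "L_runit A" "L_lunit A"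
 by(intro graded_tensor.intro graded_tensor_axioms.intro tensor_algebra.intro tensor_algebra_axioms.intro LB_cring LB_gfam G_span
   rh_cl[OF lunit(1)] rh_cl[OF runit(1)])

abbreviation "in1 u == TL.tt u 1[G]"
abbreviation "in2 v == TL.tt 1[G] v"

lemma comp_ring_L: "comp_ring (L_hopf A) = TL.TT" "comp_elem (L_hopf A) = TL.tt"
 by(simp_all add: comp_ring_def comp_elem_def L_hopf_def)

text \<open>The universal composable pair: the first isomorphism lives on the left tensor factor,
  and the balancing relation identifies its target with the source of the second.\<close>

lemma comult_iso: "strict_iso A TL.TT (%g. case g of Src h => in1 (LB_gen A (Src h)) | Tgt h => in2 (LB_gen A (Tgt h))
  | IsoCoeff i => series_comp TL.TT (%j. in2 (LB_gen A (IsoCoeff j))) (%j. in1 (LB_gen A (IsoCoeff j))) i)"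
proof (rule TL.T.strict_iso_comp[OF LB_hom_iso[OF TL.T_cring TL.in1_hom] LB_hom_iso[OF TL.T_cring TL.in2_hom] A_cring])
 show "in1 (LB_gen A (Tgt g)) = in2 (LB_gen A (Src g))" if "g : mod_gens A" for g
  using TL.in1_in2[OF L_gen_closed[OF that]] lunit(2)[OF that] runit(2)[OF that] by simp
qed

lemma comult: "L_comult A : ring_hom G TL.TT"
  "h : mod_gens A ==> L_comult A (LB_gen A (Src h)) = in1 (LB_gen A (Src h))" "h : mod_gens A ==> L_comult A (LB_gen A (Tgt h)) = in2 (LB_gen A (Tgt h))"
  "L_comult A (LB_gen A (IsoCoeff i)) = series_comp TL.TT (%j. in2 (LB_gen A (IsoCoeff j))) (%j. in1 (LB_gen A (IsoCoeff j))) i"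
 using LB_pres_map(1)[OF TL.T_cring comult_iso] LB_pres_map(2)[OF TL.T_cring comult_iso, of "Src h"]
  LB_pres_map(2)[OF TL.T_cring comult_iso, of "Tgt h"] LB_pres_map(2)[OF TL.T_cring comult_iso, of "IsoCoeff i"]
 unfolding L_comult_def Let_def by simp_all

lemma scal_maps:
 assumes a: "a : car A"
 shows "L_lunit A (L_scal A a) = LB_scal A a" "L_runit A (L_scal A a) = LB_scal A a" "L_counit A (LB_scal A a) = L_scal A a"
  "L_conjugation A (LB_scal A a) = LB_scal A a" "L_comult A (LB_scal A a) = in1 (LB_scal A a)" "in2 (LB_scal A a) = in1 (LB_scal A a)"
proof -
 have g: "Scal a : mod_gens A" using a by simp
 show 1: "L_lunit A (L_scal A a) = LB_scal A a" "L_runit A (L_scal A a) = LB_scal A a" "L_counit A (LB_scal A a) = L_scal A a"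
  "L_conjugation A (LB_scal A a) = LB_scal A a" "L_comult A (LB_scal A a) = in1 (LB_scal A a)"
  using lunit(2)[OF g] runit(2)[OF g] counit(2)[OF g] conj(2)[OF g] comult(2)[OF g] LB_scal_Tgt[OF a] by(simp_all add: L_scal_def LB_scal_def)
 show "in2 (LB_scal A a) = in1 (LB_scal A a)"
  using TL.in1_in2[OF rh_cl[OF L_scal_hom a]] 1 by simp
qed

lemma iso_coeff_hpart: "LB_gen A (IsoCoeff i) : hpart G (2 * (i - 1))"
 using LB_gen_hpart[of "IsoCoeff i"] by simp

lemma lunit_graded: "x : hpart (L_ring A) n ==> L_lunit A x : hpart G n"
 by(rule L_graded_hom[OF LB_gfam lunit(1)]) (use lunit(2) LB_gen_hpart[of "Src g" for g] in auto)

lemma runit_graded: "x : hpart (L_ring A) n ==> L_runit A x : hpart G n"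
 by(rule L_graded_hom[OF LB_gfam runit(1)]) (use runit(2) LB_gen_hpart[of "Tgt g" for g] in auto)

lemma counit_graded: "x : hpart G n ==> L_counit A x : hpart (L_ring A) n"
proof (rule LB_graded_hom[OF L_gfam counit(1)])
 fix g assume "g : iso_gens A"
 thus "L_counit A (LB_gen A g) : hpart (L_ring A) (iso_weight g)"
  by(cases rule: iso_gens_cases) (use counit L_gen_hpart gfam.H_one[OF L_gfam] gfam.H_zero[OF L_gfam] in auto)
qed

lemma conj_graded: "x : hpart G n ==> L_conjugation A x : hpart G n"
proof (rule LB_graded_hom[OF LB_gfam conj(1)])
 fix g assume "g : iso_gens A"
 thus "L_conjugation A (LB_gen A g) : hpart G (iso_weight g)"
 proof (cases rule: iso_gens_cases)
  case (3 i)
  have "series_inverse G (%j. LB_gen A (IsoCoeff j)) i : hpart G (2 * (i - 1))"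
   by(rule gfam.series_inverse_H[OF LB_gfam]) (use iso_coeff_hpart LBR.strict_isoD(4,5)[OF LB_univ] in auto)
  thus ?thesis using conj(4) 3 by simp
 qed (use conj(2,3) LB_gen_hpart[of "Src h" for h] LB_gen_hpart[of "Tgt h" for h] in auto)
qed

lemma in_hpart: "x : hpart G n ==> in1 x : hpart TL.TT n" "x : hpart G n ==> in2 x : hpart TL.TT n"
 using TL.tt_hpart[OF _ gfam.H_one[OF LB_gfam], of x n n] TL.tt_hpart[OF gfam.H_one[OF LB_gfam], of x n n] by simp_all

lemma comult_graded: "x : hpart G n ==> L_comult A x : hpart TL.TT n"
proof (rule LB_graded_hom[OF TL.T_gfam comult(1)])
 fix g assume "g : iso_gens A"
 thus "L_comult A (LB_gen A g) : hpart TL.TT (iso_weight g)"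
 proof (cases rule: iso_gens_cases)
  case (3 i)
  have "series_comp TL.TT (%j. in2 (LB_gen A (IsoCoeff j))) (%j. in1 (LB_gen A (IsoCoeff j))) i : hpart TL.TT (2 * (i - 1))"
   by(rule gfam.series_comp_H[OF TL.T_gfam]) (use iso_coeff_hpart in_hpart LBR.strict_isoD(4)[OF LB_univ] in auto)
  thus ?thesis using comult(4) 3 by simp
 qed (use comult(2,3) in_hpart LB_gen_hpart[of "Src h" for h] LB_gen_hpart[of "Tgt h" for h] in auto)
qed

text \<open>Both factors are rescaled by the same variable \<open>t\<close>. The two rescalings
  agree on \<open>L_ring A\<close> because corresponding source and target generators have equal
  weights, and so they induce a map on the tensor product.\<close>

lemma T_graded: "EX pr. graded_cring TL.TT pr"
proof -
 interpret U: UP_cring TL.TT "UP TL.TT" by(rule UP_cring.intro) (rule TL.T_cring, simp)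
 let ?p = "%h. pres_map (UP TL.TT) (%g. up_ring.monom (UP TL.TT) (h (LB_gen A g)) (iso_weight g))"
 note p1 = LB_scaled[OF TL.T_cring TL.in1_hom] and p2 = LB_scaled[OF TL.T_cring TL.in2_hom]
 have bal: "?p (%u. in1 u) (L_runit A k) = ?p (%u. in2 u) (L_lunit A k)" if k: "k : car (L_ring A)" for k
 proof (rule L_hom_ext[OF U.UP_cring rh_comp[OF runit(1) p1(1)] rh_comp[OF lunit(1) p2(1)] _ k])
  fix g assume g: "g : mod_gens A"
  have "in1 (LB_gen A (Tgt g)) = in2 (LB_gen A (Src g))"
   using TL.in1_in2[OF L_gen_closed[OF g]] lunit(2)[OF g] runit(2)[OF g] by simp
  thus "?p (%u. in1 u) (L_runit A (L_gen A g)) = ?p (%u. in2 u) (L_lunit A (L_gen A g))"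
   unfolding lunit(2)[OF g] runit(2)[OF g] using p1(3)[of "Tgt g"] p2(3)[of "Src g"] g by simp
 qed
 let ?h = "pres_map (UP TL.TT) (%(u, v). ?p (%u. in1 u) u *[UP TL.TT] ?p (%u. in2 u) v)"
 note lift = TL.tensor_lift[where \<phi> = "%(u, v). ?p (%u. in1 u) u *[UP TL.TT] ?p (%u. in2 u) v",
   OF U.UP_cring p1(1) p2(1) bal prod.case]
 have l1: "?h : ring_hom TL.TT (UP TL.TT)" by(rule lift(1))
 have l3: "?h (in1 b) = ?p (%u. in1 u) b" if "b : car G" for b by(rule lift(3)) (use that in simp_all)
 have l4: "?h (in2 b) = ?p (%u. in2 u) b" if "b : car G" for b by(rule lift(4)) (use that in simp_all)
 have e: "TL.T.ev1 (?h x) = x" if x: "x : car TL.TT" for x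
 proof (rule TL.tensor_hom_ext[OF TL.T_cring rh_comp[OF l1 TL.T.ev1_hom] id_hom _ _ x])
  have "TL.T.ev1 (?p (%u. in1 u) b) = in1 b" if b: "b : car G" for b
   by(rule LB_hom_ext[OF TL.T_cring rh_comp[OF p1(1) TL.T.ev1_hom] TL.in1_hom _ b])
    (use p1(3) TL.T.ev1_monom TL.in1.hom_closed[OF LB_gen_closed] in auto)
  thus "TL.T.ev1 (?h (in1 b)) = in1 b" if "b : car G" for b using l3[OF that] that by simp
  have "TL.T.ev1 (?p (%u. in2 u) b) = in2 b" if b: "b : car G" for b
   by(rule LB_hom_ext[OF TL.T_cring rh_comp[OF p2(1) TL.T.ev1_hom] TL.in2_hom _ b])
    (use p2(3) TL.T.ev1_monom TL.in2.hom_closed[OF LB_gen_closed] in auto)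
  thus "TL.T.ev1 (?h (in2 b)) = in2 b" if "b : car G" for b using l4[OF that] that by simp
 qed
 have hp: "?h x = up_ring.monom (UP TL.TT) x n" if x: "x : hpart TL.TT n" for x n
 proof -
  have "?h x : {up_ring.monom (UP TL.TT) a n | a. a : car TL.TT}"
  proof (rule TL.tensor_graded_hom[OF TL.T.gfam_monom l1 _ _ x])
   fix b i assume b: "b : hpart G i"
   note bC = gfam.H_carr[OF LB_gfam b]
   show "?h (in1 b) : {up_ring.monom (UP TL.TT) a i | a. a : car TL.TT}" "?h (in2 b) : {up_ring.monom (UP TL.TT) a i | a. a : car TL.TT}"
    unfolding l3[OF bC] l4[OF bC] p1(2)[OF b] p2(2)[OF b] using TL.in1.hom_closed[OF bC] TL.in2.hom_closed[OF bC] by blast+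
  qed
  then obtain a where a: "?h x = up_ring.monom (UP TL.TT) a n" "a : car TL.TT" by blast
  hence "a = x" using e[OF TL.GT.H_carr[OF x]] TL.T.ev1_monom by simp
  thus ?thesis using a by simp
 qed
 show ?thesis using graded_cringI[OF TL.T_gfam TL.T_span l1 hp] by blast
qed

end

lemma (in ring_hom_cring) hom_aspan:
 assumes "x : aspan R V" "V <= car R" shows "h x : aspan S (h ` V)"
proof -
 have hV: "h ` V <= car S" using assms(2) by auto
 interpret H: additive_subgroup "aspan S (h ` V)" S by(rule S.aspan_subgroup[OF hV])
 show ?thesis
  using assms
 proof (induction x rule: R.aspan_induct)
  case zero thus ?case using H.zero_closed by simp
 next
  case (incl x) thus ?case by(intro S.aspan_incl) blast
 next
  case (neg x) thus ?case using H.a_inv_closed by simp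
 next
  case (add x y) thus ?case using H.a_closed by simp
 qed
qed

context fg_base_ring
begin

text \<open>Tensors of generators of degrees \<open>i\<close> and \<open>n - i\<close> suffice,
  since scalars can be moved to the left factor.\<close>

lemma T_fin_deg: "fin_deg A TL.TT (%a. in1 (LB_scal A a))"
 unfolding fin_deg_def
proof
 fix n
 have "ALL i. EX E. finite E & E \<subseteq> hpart G i & hpart G i \<subseteq> aspan G {LB_scal A a *[G] e | a e. a : car A & e : E}"
  using LB_fin_deg unfolding fin_deg_def .
 from choice[OF this] obtain E where E: "!!i. finite (E i)" "!!i. E i \<subseteq> hpart G i"
  "!!i. hpart G i \<subseteq> aspan G {LB_scal A a *[G] e | a e. a : car A & e : E i}" by blast
 let ?W = "%i. {LB_scal A a *[G] e | a e. a : car A & e : E i}"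
 let ?s = "%a. in1 (LB_scal A a)"
 define EE where "EE = (\<Union>i\<in>{..n}. (%(u, v). TL.tt u v) ` (E i \<times> E (n - i)))"
 let ?V = "{?s a *[TL.TT] e | a e. a : car A & e : EE}"
 have Ec: "e : car G" if "e : E i" for e i using gfam.H_carr[OF LB_gfam subsetD[OF E(2) that]] .
 note sc = rh_cl[OF LB_scal_hom]
 have fin: "finite EE" using E(1) by(simp add: EE_def)
 have EEh: "EE \<subseteq> hpart TL.TT n"
 proof
  fix e assume "e : EE"
  then obtain i u v where e: "i <= n" "u : E i" "v : E (n - i)" "e = TL.tt u v" by(auto simp: EE_def)
  show "e : hpart TL.TT n" unfolding e(4)
   by(rule TL.tt_hpart[OF subsetD[OF E(2) e(2)] subsetD[OF E(2) e(3)]]) (use e(1) in simp)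
 qed
 have V: "?V <= car TL.TT" using TL.GT.H_carr EEh TL.in1.hom_closed[OF sc] by blast
 have W: "?W i <= car G" for i using Ec sc by blast
 have "hpart TL.TT n \<subseteq> aspan TL.TT ?V"
  unfolding TL.T_hpart
 proof (rule TL.T.aspan_min[OF TL.T.aspan_subgroup[OF V]], rule subsetI)
  fix x assume "x : {TL.tt b c | b c i j. i + j = n & b : hpart G i & c : hpart G j}"
  then obtain b c i j where x: "x = TL.tt b c" "i + j = n" "b : hpart G i" "c : hpart G j" by blast
  have 1: "in1 b : aspan TL.TT ((%u. in1 u) ` ?W i)" by(rule TL.in1.hom_aspan[OF subsetD[OF E(3) x(3)] W])
  have 2: "in2 c : aspan TL.TT ((%u. in2 u) ` ?W j)" by(rule TL.in2.hom_aspan[OF subsetD[OF E(3) x(4)] W])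
  have "in1 b *[TL.TT] in2 c : aspan TL.TT ?V"
  proof (rule TL.T.aspan_mult[OF 1 2 _ _ TL.T.aspan_subgroup[OF V]])
   show "(%u. in1 u) ` ?W i <= car TL.TT" "(%u. in2 u) ` ?W j <= car TL.TT"
    using W TL.in1.hom_closed TL.in2.hom_closed by blast+
   fix v w assume "v : (%u. in1 u) ` ?W i" "w : (%u. in2 u) ` ?W j"
   then obtain a e a' e' where v: "v = in1 (LB_scal A a *[G] e)" "a : car A" "e : E i"
    and w: "w = in2 (LB_scal A a' *[G] e')" "a' : car A" "e' : E j" by blast
   have ee: "TL.tt e e' : EE" unfolding EE_def using v(3) w(3) x(2) by(intro UN_I[of i]) force+
   have c: "in1 (LB_scal A a) : car TL.TT" "in1 e : car TL.TT" "in1 (LB_scal A a') : car TL.TT" "in2 e' : car TL.TT"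
    using TL.in1.hom_closed TL.in2.hom_closed sc v(2) w(2) Ec[OF v(3)] Ec[OF w(3)] by simp_all
   have "v *[TL.TT] w = (in1 (LB_scal A a) *[TL.TT] in1 e) *[TL.TT] (in1 (LB_scal A a') *[TL.TT] in2 e')"
    unfolding v(1) w(1) TL.in1.hom_mult[OF sc[OF v(2)] Ec[OF v(3)]] TL.in2.hom_mult[OF sc[OF w(2)] Ec[OF w(3)]] scal_maps(6)[OF w(2)] ..
   also have "... = (in1 (LB_scal A a) *[TL.TT] in1 (LB_scal A a')) *[TL.TT] (in1 e *[TL.TT] in2 e')"
    by(rule TL.T.m_swap[OF c(1,2,3,4)])
   also have "... = ?s (a *[A] a') *[TL.TT] TL.tt e e'"
    using TL.tt_split[OF Ec[OF v(3)] Ec[OF w(3)]] TL.in1.hom_mult[OF sc[OF v(2)] sc[OF w(2)]] ring_hom_mult[OF LB_scal_hom v(2) w(2)] by(simp only:)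
   finally show "v *[TL.TT] w : aspan TL.TT ?V"
    using ee A.m_closed[OF v(2) w(2)] by(intro TL.T.aspan_incl) blast
  qed
  thus "x : aspan TL.TT ?V" unfolding x(1) TL.tt_split[OF gfam.H_carr[OF LB_gfam x(3)] gfam.H_carr[OF LB_gfam x(4)]] .
 qed
 thus "EX E. finite E & E \<subseteq> hpart TL.TT n & hpart TL.TT n \<subseteq> aspan TL.TT {?s a *[TL.TT] e | a e. a : car A & e : E}"
  using fin EEh by blast
qed

end

lemma ring_hom_eq_on:
 assumes R: "cring R" and f: "f : ring_hom R S" and e: "!!x. x : car R ==> g x = f x" shows "g : ring_hom R S"
proof -
 interpret R: cring R by fact
 show ?thesis
  by(rule ring_hom_memI) (use e rh_cl[OF f] ring_hom_mult[OF f] ring_hom_add[OF f] ring_hom_one[OF f] in simp_all)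
qed

text \<open>Degrees are checked on the images of \<open>R\<close> and of the completion of
  \<open>A\<close>, from which each homogeneous part is built.\<close>

lemma (in adic_algebra) GL_graded_hom:
 assumes N: "gfam Q N" and h: "h : ring_hom GL Q" and b: "!!b. b : car Ah ==> h (lmap R J s b) : N 0"
  and r: "!!r n. r : hpart R n ==> h (to_limit R J r) : N n" and x: "x : lpart R J n"
 shows "h x : N n"
proof -
 interpret N: gfam Q N by fact
 interpret h: ring_hom_cring GL Q h by(rule rh_cringI[OF GL_cring N.cring_axioms h])
 obtain c where c: "!!e. e : basis n ==> AK.coh (c e)" "x = mk (%k. comb n (%e. c e k))" using limit_part_comb[OF x] by blast
 let ?t = "%e. lmap R J s (AK.mk (c e)) *[GL] to_limit R J e"
 have m: "lmap R J s (AK.mk (c e)) : car GL" "to_limit R J e : car GL" if "e : basis n" for e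
  using rh_cl[OF limit_map_s_GL in_compl[OF c(1)[OF that]]] rh_cl[OF to_limit_GL bcarr[OF that]] .
 have tc: "?t : basis n \<rightarrow> car GL" by(intro Pi_I GL.m_closed m)
 have x: "x = finsum GL ?t (basis n)" unfolding c(2) by(rule comb_coh(3)[OF c(1)])
 have t: "h (?t e) : N n" if e: "e : basis n" for e
  unfolding h.hom_mult[OF m[OF e]] using N.H_mult[OF b[OF in_compl[OF c(1)[OF e]]] r[OF basis(2)[OF e]]] by simp
 show ?thesis unfolding x h.hom_finsum[OF tc] comp_def by(rule N.H_finsum) (rule t)
qed

locale completed_base = fg_base_ring A for A :: "('a, 'm) ring_scheme" +
 fixes I :: "'a set" assumes I: "ideal I A"
begin

text \<open>Rescaling shows that projections exist; they are fixed here because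
  \<open>adic_algebra\<close> takes them as a parameter.\<close>

definition "prL = (SOME pr. graded_cring (L_ring A) pr)"
definition "prG = (SOME pr. graded_cring G pr)"
definition "prT = (SOME pr. graded_cring TL.TT pr)"

sublocale LA: adic_algebra A "L_ring A" prL I "L_scal A"
 unfolding prL_def
 by(intro adic_algebra.intro adic_algebra_axioms.intro someI_ex[OF L_graded] A_cring fg I L_scal_hom L_scal_hpart L_fin_deg)

sublocale GA: adic_algebra A G prG I "LB_scal A"
 unfolding prG_def
 by(intro adic_algebra.intro adic_algebra_axioms.intro someI_ex[OF LB_graded] A_cring fg I LB_scal_hom LB_scal_hpart LB_fin_deg)

sublocale TA: adic_algebra A TL.TT prT I "%a. in1 (LB_scal A a)"
 unfolding prT_def
 by(intro adic_algebra.intro adic_algebra_axioms.intro someI_ex[OF T_graded] A_cring fg I rh_comp[OF LB_scal_hom TL.in1_hom]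
   in_hpart(1) LB_scal_hpart T_fin_deg)

abbreviation "Ac == completion A I"
abbreviation "ph == to_completion A I"
abbreviation "c0 == to_limit (L_ring A) LA.J"
abbreviation "c1 == to_limit G GA.J"
abbreviation "m0 == lmap (L_ring A) LA.J (L_scal A)"
abbreviation "m1 == lmap G GA.J (LB_scal A)"
abbreviation "LH == graded_limit (L_ring A) LA.J"
abbreviation "GH == graded_limit G GA.J"
abbreviation "TH == graded_limit TL.TT TA.J"

sublocale Ab: base_ring Ac by(rule base_ring.intro) (rule LA.compl_cring)

lemma gens_map: "g : mod_gens A ==> map_mod_gen ph g : mod_gens Ac" "h : iso_gens A ==> map_iso_gen ph h : iso_gens Ac"
  "mod_weight (map_mod_gen ph g) = mod_weight g" "iso_weight (map_iso_gen ph h) = iso_weight h"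
proof -
 have m: "map_mod_gen ph g : mod_gens Ac" if "g : mod_gens A" for g
  using that by(cases rule: mod_gens_cases) (use rh_cl[OF LA.to_completion_hom] in auto)
 thus "g : mod_gens A ==> map_mod_gen ph g : mod_gens Ac" .
 show "h : iso_gens A ==> map_iso_gen ph h : iso_gens Ac"
  by(cases rule: iso_gens_cases) (use m in auto)
 have w: "mod_weight (map_mod_gen ph g) = mod_weight g" for g by(cases g) auto
 thus "mod_weight (map_mod_gen ph g) = mod_weight g" .
 show "iso_weight (map_iso_gen ph h) = iso_weight h" using w by(cases h) auto
qed

section \<open>The ring of formal modules over the completion\<close>

text \<open>Classifies the universal module with its action extended to the completion. It runs
  against the natural map and turns out to be its inverse.\<close>

definition "gam0 = pres_map LH (LA.hatm (L_gen A))"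
definition "gam1 = pres_map GH (GA.hati (LB_gen A))"
abbreviation "alp0 == L_map Ac ph"
abbreviation "alp1 == LB_map Ac ph"

lemma gam0: "gam0 : ring_hom (L_ring Ac) LH" "g : mod_gens Ac ==> gam0 (L_gen Ac g) = LA.hatm (L_gen A) g"
 using Ab.L_pres_map[OF LA.GL_cring LA.hat_module[OF L_univ L_scal_def[symmetric] L_gen_hpart]] unfolding gam0_def by blast+

lemma gam1: "gam1 : ring_hom (LB_ring Ac) GH" "g : iso_gens Ac ==> gam1 (LB_gen Ac g) = GA.hati (LB_gen A) g"
 using Ab.LB_pres_map[OF GA.GL_cring GA.hati_iso[OF LB_univ LB_scal_def[symmetric] LB_gen_hpart]] unfolding gam1_def by blast+

lemma alp0: "alp0 : ring_hom (L_ring A) (L_ring Ac)" "g : mod_gens A ==> alp0 (L_gen A g) = L_gen Ac (map_mod_gen ph g)"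
 using L_pres_map[OF Ab.L_cring formal_module_restrict[OF LA.to_completion_hom Ab.L_univ]] unfolding L_map_def by blast+

lemma alp1: "alp1 : ring_hom G (LB_ring Ac)" "g : iso_gens A ==> alp1 (LB_gen A g) = LB_gen Ac (map_iso_gen ph g)"
 using LB_pres_map[OF Ab.LB_cring strict_iso_restrict[OF LA.to_completion_hom Ab.LB_univ]] unfolding LB_map_def by blast+

lemma alp_scal: assumes a: "a : car A" shows "alp0 (L_scal A a) = L_scal Ac (ph a)" "alp1 (LB_scal A a) = LB_scal Ac (ph a)"
 using alp0(2)[of "Scal a"] alp1(2)[of "Src (Scal a)"] a by(simp_all add: L_scal_def LB_scal_def)

lemma alp0_graded: "x : hpart (L_ring A) n ==> alp0 x : hpart (L_ring Ac) n"
 by(rule L_graded_hom[OF Ab.L_gfam alp0(1)]) (use alp0(2) Ab.L_gen_hpart[OF gens_map(1)] gens_map(3) in auto)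

lemma alp1_graded: "x : hpart G n ==> alp1 x : hpart (LB_ring Ac) n"
 by(rule LB_graded_hom[OF Ab.LB_gfam alp1(1)]) (use alp1(2) Ab.LB_gen_hpart[OF gens_map(2)] gens_map(4) in auto)

lemma gam_alp: "r : car (L_ring A) ==> gam0 (alp0 r) = c0 r" "u : car G ==> gam1 (alp1 u) = c1 u"
proof -
 show "gam0 (alp0 r) = c0 r" if "r : car (L_ring A)"
 proof (rule L_hom_ext[OF LA.GL_cring rh_comp[OF alp0(1) gam0(1)] LA.to_limit_GL _ that])
  fix g assume g: "g : mod_gens A"
  show "gam0 (alp0 (L_gen A g)) = c0 (L_gen A g)"
   unfolding alp0(2)[OF g] gam0(2)[OF gens_map(1)[OF g]] by(rule LA.hat_phi[OF L_univ L_scal_def[symmetric] g])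
 qed
 show "gam1 (alp1 u) = c1 u" if "u : car G"
 proof (rule LB_hom_ext[OF GA.GL_cring rh_comp[OF alp1(1) gam1(1)] GA.to_limit_GL _ that])
  fix g assume g: "g : iso_gens A"
  show "gam1 (alp1 (LB_gen A g)) = c1 (LB_gen A g)"
   unfolding alp1(2)[OF g] gam1(2)[OF gens_map(2)[OF g]] by(rule GA.hati_phi[OF LB_univ LB_scal_def[symmetric] LB_gen_hpart g])
 qed
qed

text \<open>The spanning condition is the uniqueness of the extended action: by
  \<open>Act_completion_graded\<close>, every universal coefficient over the completion lies in the
  span of products of elements coming from \<open>L_ring A\<close> with scalars.\<close>

lemma LS: "adic_span A (L_ring A) prL I (L_scal A) (L_ring Ac) alp0 (L_scal Ac) gam0"
proof (intro adic_span.intro adic_span_axioms.intro LA.adic_algebra_axioms Ab.L_gfam Ab.L_span alp0(1) Ab.L_scal_hom alp_scal(1) gam0(1) gam_alp(1))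
 note N = LA.span_gfam[OF Ab.L_cring alp0(1) Ab.L_scal_hom]
 let ?N = "%n. aspan (L_ring Ac) {alp0 r *[L_ring Ac] L_scal Ac b | r b. r : hpart (L_ring A) n & b : car Ac}"
 have F: "L_gen Ac (FCoeff i j) : ?N (2 * (i + j - 1))" for i j
  using N(2)[OF L_gen_hpart[of "FCoeff i j"]] alp0(2)[of "FCoeff i j"] by simp
 have S: "L_gen Ac (Scal b) : ?N 0" if "b : car Ac" for b using N(3)[OF that] by(simp add: L_scal_def)
 have P: "L_gen Ac (Act (ph a) i) : ?N (2 * (i - 1))" if "a : car A" for a i
  using N(2)[OF L_gen_hpart[of "Act a i"]] alp0(2)[of "Act a i"] that by simp
 fix n
 show "hpart (L_ring Ac) n \<subseteq> ?N n"
 proof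
  fix x assume x: "x : hpart (L_ring Ac) n"
  show "x : ?N n"
  proof (rule Ab.L_graded_hom[OF N(1) id_hom _ x])
   fix g assume "g : mod_gens Ac"
   thus "L_gen Ac g : ?N (mod_weight g)"
   proof (cases rule: mod_gens_cases)
    case (3 b i)
    show ?thesis unfolding 3(1) mod_weight.simps by(rule LA.Act_completion_graded[OF N(1) Ab.L_univ S F P 3(2)])
   qed (use F S in simp_all)
  qed
 qed
 show "alp0 r *[L_ring Ac] L_scal Ac b : hpart (L_ring Ac) n" if "r : hpart (L_ring A) n" "b : car Ac" for r b
  using gfam.H_mult[OF Ab.L_gfam alp0_graded[OF that(1)] Ab.L_scal_hpart[OF that(2)]] by simp
 show "gam0 (L_scal Ac b) = m0 b" if "b : car Ac" for b using gam0(2)[of "Scal b"] that by(simp add: L_scal_def LA.hatm_def)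
qed

text \<open>Uniqueness is applied to the source and to the target module; the coefficients of the
  isomorphism itself already come from \<open>A\<close>.\<close>

lemma GS: "adic_span A G prG I (LB_scal A) (LB_ring Ac) alp1 (LB_scal Ac) gam1"
proof (intro adic_span.intro adic_span_axioms.intro GA.adic_algebra_axioms Ab.LB_gfam Ab.G_span alp1(1) Ab.LB_scal_hom alp_scal(2) gam1(1) gam_alp(2))
 note N = GA.span_gfam[OF Ab.LB_cring alp1(1) Ab.LB_scal_hom]
 let ?N = "%n. aspan (LB_ring Ac) {alp1 r *[LB_ring Ac] LB_scal Ac b | r b. r : hpart G n & b : car Ac}"
 have g: "LB_gen Ac (map_iso_gen ph h) : ?N (iso_weight h)" if "h : iso_gens A" for h
  using N(2)[OF LB_gen_hpart[OF that]] alp1(2)[OF that] by simp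
 note U = Ab.LBR.strict_isoD(1,2)[OF Ab.LB_univ]
 have F: "LB_gen Ac (Src (FCoeff i j)) : ?N (2 * (i + j - 1))" "LB_gen Ac (Tgt (FCoeff i j)) : ?N (2 * (i + j - 1))" for i j
  using g[of "Src (FCoeff i j)"] g[of "Tgt (FCoeff i j)"] by simp_all
 have S: "LB_gen Ac (Src (Scal b)) : ?N 0" "LB_gen Ac (Tgt (Scal b)) : ?N 0" if "b : car Ac" for b
  using N(3)[OF that] Ab.LB_scal_Tgt[OF that] by(simp_all add: LB_scal_def)
 have P: "LB_gen Ac (Src (Act (ph a) i)) : ?N (2 * (i - 1))" "LB_gen Ac (Tgt (Act (ph a) i)) : ?N (2 * (i - 1))" if "a : car A" for a i
  using g[of "Src (Act a i)"] g[of "Tgt (Act a i)"] that by simp_all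
 have Sr: "LB_gen Ac (Src h) : ?N (mod_weight h)" if "h : mod_gens Ac" for h
  using that
 proof (cases rule: mod_gens_cases)
  case (3 b i)
  show ?thesis unfolding 3(1) mod_weight.simps by(rule GA.Act_completion_graded[OF N(1) U(1) S(1) F(1) P(1) 3(2)])
 qed (use F S in simp_all)
 have Tg: "LB_gen Ac (Tgt h) : ?N (mod_weight h)" if "h : mod_gens Ac" for h
  using that
 proof (cases rule: mod_gens_cases)
  case (3 b i)
  show ?thesis unfolding 3(1) mod_weight.simps by(rule GA.Act_completion_graded[OF N(1) U(2) S(2) F(2) P(2) 3(2)])
 qed (use F S in simp_all)
 fix n
 show "hpart (LB_ring Ac) n \<subseteq> ?N n"
 proof
  fix x assume x: "x : hpart (LB_ring Ac) n"
  show "x : ?N n"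
  proof (rule Ab.LB_graded_hom[OF N(1) id_hom _ x])
   fix h assume "h : iso_gens Ac"
   thus "LB_gen Ac h : ?N (iso_weight h)"
    by(cases rule: iso_gens_cases) (use Sr Tg g[of "IsoCoeff i" for i] in simp_all)
  qed
 qed
 show "alp1 r *[LB_ring Ac] LB_scal Ac b : hpart (LB_ring Ac) n" if "r : hpart G n" "b : car Ac" for r b
  using gfam.H_mult[OF Ab.LB_gfam alp1_graded[OF that(1)] Ab.LB_scal_hpart[OF that(2)]] by simp
 show "gam1 (LB_scal Ac b) = m1 b" if "b : car Ac" for b
  using gam1(2)[of "Src (Scal b)"] that by(simp add: LB_scal_def GA.hati_def GA.hatm_def)
qed

lemma L_complete: "graded_complete (L_ring Ac) (L_completion_adic A I)"
 and L_inv: "x : car (L_ring Ac) ==> L_completion_map A I (gam0 x) = x"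
proof -
 have e: "L_completion_adic A I = adic A I (L_ring Ac) (%a. alp0 (L_scal A a))" by(rule adic_cong[OF A_cring I]) (rule alp_scal(1)[symmetric])
 show "graded_complete (L_ring Ac) (L_completion_adic A I)" unfolding e by(rule adic_span.C_complete[OF LS])
 show "x : car (L_ring Ac) ==> L_completion_map A I (gam0 x) = x"
  unfolding L_completion_map_def e by(rule adic_span.extend_limit_ga[OF LS])
qed

lemma LB_complete: "graded_complete (LB_ring Ac) (LB_completion_adic A I)"
 and LB_inv: "x : car (LB_ring Ac) ==> LB_completion_map A I (gam1 x) = x"
proof -
 have e: "LB_completion_adic A I = adic A I (LB_ring Ac) (%a. alp1 (LB_scal A a))" by(rule adic_cong[OF A_cring I]) (rule alp_scal(2)[symmetric])
 show "graded_complete (LB_ring Ac) (LB_completion_adic A I)" unfolding e by(rule adic_span.C_complete[OF GS])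
 show "x : car (LB_ring Ac) ==> LB_completion_map A I (gam1 x) = x"
  unfolding LB_completion_map_def e by(rule adic_span.extend_limit_ga[OF GS])
qed

section \<open>The completed Hopf algebroid\<close>

abbreviation "lK == lmap G GA.J (L_lunit A)"
abbreviation "rK == lmap G GA.J (L_runit A)"
abbreviation "coK == lmap (L_ring A) LA.J (L_counit A)"
abbreviation "cjK == lmap G GA.J (L_conjugation A)"
abbreviation "cmK == lmap TL.TT TA.J (L_comult A)"
abbreviation "i1K == lmap TL.TT TA.J (%u. in1 u)"
abbreviation "i2K == lmap TL.TT TA.J (%u. in2 u)"

lemma lu: "adic_hom A (L_ring A) prL I (L_scal A) G prG (LB_scal A) (L_lunit A)"
 and ru: "adic_hom A (L_ring A) prL I (L_scal A) G prG (LB_scal A) (L_runit A)"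
 and co: "adic_hom A G prG I (LB_scal A) (L_ring A) prL (L_scal A) (L_counit A)"
 and cj: "adic_hom A G prG I (LB_scal A) G prG (LB_scal A) (L_conjugation A)"
 and cm: "adic_hom A G prG I (LB_scal A) TL.TT prT (%a. in1 (LB_scal A a)) (L_comult A)"
 and i1: "adic_hom A G prG I (LB_scal A) TL.TT prT (%a. in1 (LB_scal A a)) (%u. in1 u)"
 and i2: "adic_hom A G prG I (LB_scal A) TL.TT prT (%a. in1 (LB_scal A a)) (%u. in2 u)"
 by(intro adic_hom.intro adic_hom_axioms.intro LA.adic_algebra_axioms GA.adic_algebra_axioms TA.adic_algebra_axioms
   lunit(1) runit(1) counit(1) conj(1) comult(1) TL.in1_hom TL.in2_hom scal_maps refl
   lunit_graded runit_graded counit_graded conj_graded comult_graded in_hpart; assumption)+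

lemmas K_hom = lu[THEN adic_hom.lh_GL] ru[THEN adic_hom.lh_GL] co[THEN adic_hom.lh_GL] cj[THEN adic_hom.lh_GL]
 cm[THEN adic_hom.lh_GL] i1[THEN adic_hom.lh_GL] i2[THEN adic_hom.lh_GL]
lemmas K_c = lu[THEN adic_hom.lh_to_limit] ru[THEN adic_hom.lh_to_limit] co[THEN adic_hom.lh_to_limit] cj[THEN adic_hom.lh_to_limit]
 cm[THEN adic_hom.lh_to_limit] i1[THEN adic_hom.lh_to_limit] i2[THEN adic_hom.lh_to_limit]
lemmas K_m = lu[THEN adic_hom.lh_scal] ru[THEN adic_hom.lh_scal] co[THEN adic_hom.lh_scal] cj[THEN adic_hom.lh_scal]
 cm[THEN adic_hom.lh_scal] i1[THEN adic_hom.lh_scal] i2[THEN adic_hom.lh_scal]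

sublocale TK: graded_tensor GH GH LH rK lK
proof (intro graded_tensor.intro graded_tensor_axioms.intro tensor_algebra.intro tensor_algebra_axioms.intro GA.GL_cring
  rh_cl[OF K_hom(1)] rh_cl[OF K_hom(2)])
 show "gfam GH (hpart GH)" using GA.GL_gfam by(simp only: GA.GL_simps)
 thus "gfam GH (hpart GH)" .
 show "x : aspan GH (\<Union>n. hpart GH n)" if "x : car GH" for x using GA.GL_aspan[OF that] by(simp only: GA.GL_simps)
 thus "y : aspan GH (\<Union>n. hpart GH n)" if "y : car GH" for y using that .
qed

abbreviation "in1K u == TK.tt u 1[GH]"
abbreviation "in2K v == TK.tt 1[GH] v"
abbreviation "K == hopf_completion A I (L_scal A) (LB_scal A) (L_hopf A)"

lemma inK_m: "b : car Ac ==> in2K (m1 b) = in1K (m1 b)"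
 using TK.in1_in2[OF rh_cl[OF LA.limit_map_s_GL]] K_m(1,2) by simp

lemma inK_rl: assumes k: "k : car (L_ring A)" shows "in1K (c1 (L_runit A k)) = in2K (c1 (L_lunit A k))"
 using TK.in1_in2[OF rh_cl[OF LA.to_limit_GL k]] unfolding K_c(1)[OF k] K_c(2)[OF k] .

text \<open>\<open>alpT\<close> goes from the tensor square to the tensor square of the completions,
  \<open>gamT\<close> from there to the completion of the tensor square; the composite is the
  canonical map to the completion.\<close>

definition "alpT = pres_map TK.TT (%(u, v). TK.tt (c1 u) (c1 v))"
definition "gamT = pres_map TH (%(u, v). i1K u *[TH] i2K v)"

lemma alpT: "alpT : ring_hom TL.TT TK.TT" "u : car G ==> alpT (in1 u) = in1K (c1 u)" "u : car G ==> alpT (in2 u) = in2K (c1 u)"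
proof -
 have \<phi>: "(case (u, v) of (u, v) => TK.tt (c1 u) (c1 v)) = in1K (c1 u) *[TK.TT] in2K (c1 v)" if "u : car G" "v : car G" for u v
  unfolding prod.case by(rule TK.tt_split[OF rh_cl[OF GA.to_limit_GL that(1)] rh_cl[OF GA.to_limit_GL that(2)]])
 note l = TL.tensor_lift[where \<phi> = "%(u, v). TK.tt (c1 u) (c1 v)", OF TK.T_cring rh_comp[OF GA.to_limit_GL TK.in1_hom] rh_comp[OF GA.to_limit_GL TK.in2_hom] inK_rl \<phi>]
 show "alpT : ring_hom TL.TT TK.TT" unfolding alpT_def by(rule l(1))
 show "alpT (in1 u) = in1K (c1 u)" if "u : car G" unfolding alpT_def by(rule l(3)) (use that in simp_all)
 show "alpT (in2 u) = in2K (c1 u)" if "u : car G" unfolding alpT_def by(rule l(4)) (use that in simp_all)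
qed

lemma i12K: assumes z: "z : car LH" shows "i1K (rK z) = i2K (lK z)"
proof (rule LA.GL_hom_ext[OF TA.GL_cring rh_comp[OF K_hom(2) K_hom(6)] rh_comp[OF K_hom(1) K_hom(7)] _ _ z])
 show "i1K (rK (c0 r)) = i2K (lK (c0 r))" if r: "r : car (L_ring A)" for r
  unfolding K_c(1)[OF r] K_c(2)[OF r] K_c(6)[OF rh_cl[OF runit(1) r]] K_c(7)[OF rh_cl[OF lunit(1) r]] TL.in1_in2[OF r] ..
 show "i1K (rK (m0 b)) = i2K (lK (m0 b))" if b: "b : car Ac" for b
  unfolding K_m(1)[OF b] K_m(2)[OF b] K_m(6)[OF b] K_m(7)[OF b] ..
qed

lemma gamT: "gamT : ring_hom TK.TT TH" "u : car GH ==> gamT (in1K u) = i1K u" "u : car GH ==> gamT (in2K u) = i2K u"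
proof -
 note l = TK.tensor_lift[where \<phi> = "%(u, v). i1K u *[TH] i2K v", OF TA.GL_cring K_hom(6) K_hom(7) i12K prod.case]
 show "gamT : ring_hom TK.TT TH" unfolding gamT_def by(rule l(1))
 show "gamT (in1K u) = i1K u" if "u : car GH" unfolding gamT_def by(rule l(3)) (use that in simp_all)
 show "gamT (in2K u) = i2K u" if "u : car GH" unfolding gamT_def by(rule l(4)) (use that in simp_all)
qed

text \<open>Each completed factor is spanned by uncompleted elements and scalars, and scalars pass
  across the tensor sign. So the ordinary tensor square of the completions is already complete in
  each degree.\<close>

lemma TKS: "adic_span A TL.TT prT I (%a. in1 (LB_scal A a)) TK.TT alpT (%b. in1K (m1 b)) gamT"
proof (intro adic_span.intro adic_span_axioms.intro TA.adic_algebra_axioms TK.T_gfam TK.T_span alpT(1) gamT(1))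
 show bh: "(%b. in1K (m1 b)) : ring_hom Ac TK.TT" by(rule rh_comp[OF GA.limit_map_s_GL TK.in1_hom])
 show "alpT (in1 (LB_scal A a)) = in1K (m1 (ph a))" if a: "a : car A" for a
  unfolding alpT(2)[OF rh_cl[OF LB_scal_hom a]] GA.limit_map_s_phi[OF a] ..
 note N = TA.span_gfam[OF TK.T_cring alpT(1) bh]
 let ?N = "%n. aspan TK.TT {alpT r *[TK.TT] in1K (m1 b) | r b. r : hpart TL.TT n & b : car Ac}"
 interpret N: gfam TK.TT ?N by(rule N(1))
 have hG: "hpart GH i = lpart G GA.J i" for i by simp
 have n1: "in1K u : ?N i" if u: "u : hpart GH i" for u i
 proof (rule GA.GL_graded_hom[OF N(1) TK.in1_hom N(3) _ u[unfolded hG]])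
  show "in1K (c1 r) : ?N n" if r: "r : hpart G n" for r n
   using N(2)[OF in_hpart(1)[OF r]] unfolding alpT(2)[OF gfam.H_carr[OF LB_gfam r]] .
 qed
 have n2: "in2K u : ?N i" if u: "u : hpart GH i" for u i
 proof (rule GA.GL_graded_hom[OF N(1) TK.in2_hom _ _ u[unfolded hG]])
  show "in2K (m1 b) : ?N 0" if "b : car Ac" for b unfolding inK_m[OF that] by(rule N(3)[OF that])
  show "in2K (c1 r) : ?N n" if r: "r : hpart G n" for r n
   using N(2)[OF in_hpart(2)[OF r]] unfolding alpT(3)[OF gfam.H_carr[OF LB_gfam r]] .
 qed
 show "hpart TK.TT n \<subseteq> ?N n" for n
  unfolding TK.T_hpart
 proof (rule TK.T.aspan_min[OF N.H_sub], rule subsetI)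
  fix x assume "x : {TK.tt b c | b c i j. i + j = n & b : hpart GH i & c : hpart GH j}"
  then obtain b c i j where x: "x = TK.tt b c" "i + j = n" "b : hpart GH i" "c : hpart GH j" by blast
  show "x : ?N n" unfolding x(1) TK.tt_split[OF TK.GB.H_carr[OF x(3)] TK.GB.H_carr[OF x(4)]]
   using N.H_mult[OF n1[OF x(3)] n2[OF x(4)]] unfolding x(2) .
 qed
 have aT: "alpT r : hpart TK.TT n" if r: "r : hpart TL.TT n" for r n
 proof (rule TL.tensor_graded_hom[OF TK.T_gfam alpT(1) _ _ r])
  fix b i assume b: "b : hpart G i"
  have cb: "c1 b : hpart GH i" using GA.to_limit_part[OF b] by simp
  show "alpT (in1 b) : hpart TK.TT i" "alpT (in2 b) : hpart TK.TT i"
   unfolding alpT(2)[OF gfam.H_carr[OF LB_gfam b]] alpT(3)[OF gfam.H_carr[OF LB_gfam b]]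
   using TK.tt_hpart[OF cb TK.GB.H_one, of i] TK.tt_hpart[OF TK.GB.H_one cb, of i] by simp_all
 qed
 show "alpT r *[TK.TT] in1K (m1 b) : hpart TK.TT n" if "r : hpart TL.TT n" "b : car Ac" for r b n
 proof -
  have mb: "m1 b : hpart GH 0" using GA.limit_map_s_part[OF that(2)] by simp
  have "in1K (m1 b) : hpart TK.TT 0" by(rule TK.tt_hpart[OF mb TK.GB.H_one]) simp
  from TK.GT.H_mult[OF aT[OF that(1)] this] show ?thesis by simp
 qed
 show "gamT (alpT r) = to_limit TL.TT TA.J r" if r: "r : car TL.TT" for r
 proof (rule TL.tensor_hom_ext[OF TA.GL_cring rh_comp[OF alpT(1) gamT(1)] TA.to_limit_GL _ _ r])
  fix b assume b: "b : car G"
  note cb = rh_cl[OF GA.to_limit_GL b]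
  show "gamT (alpT (in1 b)) = to_limit TL.TT TA.J (in1 b)" "gamT (alpT (in2 b)) = to_limit TL.TT TA.J (in2 b)"
   unfolding alpT(2)[OF b] alpT(3)[OF b] gamT(2)[OF cb] gamT(3)[OF cb] K_c(6)[OF b] K_c(7)[OF b] by(rule refl)+
 qed
 show "gamT (in1K (m1 b)) = lmap TL.TT TA.J (%a. in1 (LB_scal A a)) b" if b: "b : car Ac" for b
  unfolding gamT(2)[OF rh_cl[OF GA.limit_map_s_GL b]] by(rule K_m(6)[OF b])
qed

lemma K_simps: "obj_ring K = LH" "mor_ring K = GH" "hopf_algebroid.lunit K = lK" "hopf_algebroid.runit K = rK" "hopf_algebroid.counit K = coK"
  "conjugation K = cjK" "comp_ring K = TK.TT" "comp_elem K = TK.tt"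
 by(simp_all add: hopf_completion_def Let_def L_hopf_def comp_ring_def comp_elem_def del: GA.GL_simps LA.GL_simps)

abbreviation "JT == adic A I TK.TT (%a. alpT (in1 (LB_scal A a)))"

lemma JT_eq: "adic A I TK.TT (%a. in1K (c1 (LB_scal A a))) = JT"
 by(rule adic_cong[OF A_cring I]) (rule alpT(2)[OF rh_cl[OF LB_scal_hom], symmetric])

lemma K_comult_eq: "hcomult K = extend_limit TK.TT JT (%y. alpT (L_comult A y))"
proof -
 have "hcomult K = extend_limit TK.TT (adic A I TK.TT (%a. in1K (c1 (LB_scal A a))))
   (%y. pres_map TK.TT (%(u, v). TK.tt (c1 u) (c1 v)) (L_comult A y))"
  by(simp add: hopf_completion_def Let_def L_hopf_def del: GA.GL_simps LA.GL_simps)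
 thus ?thesis unfolding JT_eq alpT_def[symmetric] .
qed

lemma K_ok: "hopf_completion_ok A I (L_scal A) (LB_scal A) (L_hopf A)"
proof -
 have m: "mor_ring (L_hopf A) = G" by(simp add: L_hopf_def)
 show ?thesis
  unfolding hopf_completion_ok_def Let_def K_simps m JT_eq by(rule adic_span.C_complete[OF TKS])
qed

text \<open>The extended comultiplication equals the completed map followed by the inverse of
  \<open>gamT\<close>; in this form it is visibly a homomorphism and can be evaluated.\<close>

lemma K_comult: "hcomult K : ring_hom GH TK.TT"
  "y : car G ==> hcomult K (c1 y) = alpT (L_comult A y)"
  "b : car Ac ==> hcomult K (m1 b) = in1K (m1 b)"
proof -
 interpret cm: adic_hom A G prG I "LB_scal A" TL.TT prT "%a. in1 (LB_scal A a)" "L_comult A" by(rule cm)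
 let ?g = "extend_limit TK.TT JT alpT"
 have g: "?g (gamT x) = x" if "x : car TK.TT" for x by(rule adic_span.extend_limit_ga[OF TKS that])
 have gh: "?g : ring_hom TH TK.TT" by(rule ring_hom_inverse(1)[OF TK.T_cring gamT(1) adic_span.ga_bij[OF TKS]]) (rule g)
 have JTf: "filtered TK.TT JT" by(rule adic_span.JC_filtered[OF TKS])
 have aJ: "alpT ` TA.J k \<subseteq> JT k" for k by(rule adic_span.al_J[OF TKS])
 have e: "hcomult K y = ?g (cmK y)" if y: "y : car GH" for y
 proof -
  obtain rh where r: "GA.coh rh" "y = GA.mk rh" by(rule GA.limE[OF GA.GL_sub[OF y]])
  note rc = GA.coh_carr[OF r(1)]
  have dc: "L_comult A (rh k) : car TL.TT" for k using rh_cl[OF comult(1) rc] .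
  have aJ': "(%y. alpT (L_comult A y)) ` GA.J k \<subseteq> JT k" for k using aJ[of k] cm.h_J[of k] by blast
  have "lmap TK.TT JT (%y. alpT (L_comult A y)) y = filtered.mk TK.TT JT (%k. alpT (L_comult A (rh k)))"
   unfolding r(2) by(rule limit_map_mk(1)[OF GA.filtered_axioms JTf rh_comp[OF comult(1) alpT(1)] aJ' rc])
  also have "... = lmap TK.TT JT alpT (TA.mk (%k. L_comult A (rh k)))"
   by(rule limit_map_mk(1)[OF TA.filtered_axioms JTf alpT(1) aJ dc, symmetric])
  also have "TA.mk (%k. L_comult A (rh k)) = cmK y" unfolding r(2) by(rule cm.lh_mk(1)[OF rc, symmetric])
  finally show ?thesis unfolding K_comult_eq extend_limit_def by simp
 qed
 show "hcomult K : ring_hom GH TK.TT" by(rule ring_hom_eq_on[OF GA.GL_cring rh_comp[OF K_hom(5) gh] e])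
 show "hcomult K (c1 y) = alpT (L_comult A y)" if y: "y : car G"
 proof -
  note d = rh_cl[OF comult(1) y]
  have "gamT (alpT (L_comult A y)) = to_limit TL.TT TA.J (L_comult A y)" using TKS d by(simp add: adic_span_def adic_span_axioms_def)
  hence "?g (cmK (c1 y)) = alpT (L_comult A y)" unfolding K_c(5)[OF y] using g[OF rh_cl[OF alpT(1) d]] by simp
  thus ?thesis using e[OF rh_cl[OF GA.to_limit_GL y]] by simp
 qed
 show "hcomult K (m1 b) = in1K (m1 b)" if b: "b : car Ac"
 proof -
  note mc = rh_cl[OF GA.limit_map_s_GL b]
  have "gamT (in1K (m1 b)) = cmK (m1 b)" unfolding K_m(5)[OF b] gamT(2)[OF mc] by(rule K_m(6)[OF b])
  thus ?thesis using e[OF mc] g[OF TK.in1.hom_closed[OF mc]] by simp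
 qed
qed

end

context completed_base
begin

section \<open>Comparison of the base change with the completion\<close>

abbreviation "f0 == bc_to_compl A I (L_ring A) (L_scal A)"
abbreviation "f1 == bc_to_compl A I G (LB_scal A)"
abbreviation "BCH == base_change A (L_scal A) (LB_scal A) (L_hopf A) Ac ph"
abbreviation "lB == pres_map GA.BC (%(x, b). GA.bc (L_lunit A x) b)"
abbreviation "rB == pres_map GA.BC (%(x, b). GA.bc (L_runit A x) b)"
abbreviation "E1 u == GA.bc u 1[Ac]"
abbreviation "E2 b == GA.bc 1[G] b"

lemma lB: "lB : ring_hom LA.BC GA.BC" "r : car (L_ring A) ==> lB (LA.bc r 1[Ac]) = E1 (L_lunit A r)"
  "x : car LA.BC ==> f1 (lB x) = lK (f0 x)"
 using adic_hom.bm(1,2)[OF lu] adic_hom.bm_completion[OF lu] unfolding adic_hom.bm_def[OF lu] by blast+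

lemma rB: "rB : ring_hom LA.BC GA.BC" "r : car (L_ring A) ==> rB (LA.bc r 1[Ac]) = E1 (L_runit A r)"
  "x : car LA.BC ==> f1 (rB x) = rK (f0 x)"
 using adic_hom.bm(1,2)[OF ru] adic_hom.bm_completion[OF ru] unfolding adic_hom.bm_def[OF ru] by blast+

lemma E_hom: "(%u. E1 u) : ring_hom G GA.BC" "(%b. E2 b) : ring_hom Ac GA.BC" "E2 1[Ac] = 1[GA.BC]"
 using GA.BCT.in1_hom GA.BCT.in2_hom GA.BCT.tt_one unfolding degree_zero_hom by simp_all

lemma f_gens: "r : car G ==> f1 (E1 r) = c1 r" "b : car Ac ==> f1 (E2 b) = m1 b"
 by(rule GA.base_change_map(2), assumption, rule GA.base_change_map(3), assumption)

abbreviation "TB == tensor GA.BC GA.BC LA.BC rB lB"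
abbreviation "tB == tensor_elem GA.BC GA.BC LA.BC rB lB"
abbreviation "WB == pres_map TB (%(u, v). tB (E1 u) (E1 v))"
abbreviation "DB == pres_map TB (%(y, b). WB (L_comult A y) *[TB] tB (E2 b) (E2 1[Ac]))"

lemma BCH_simps: "obj_ring BCH = LA.BC" "mor_ring BCH = GA.BC" "hopf_algebroid.lunit BCH = lB" "hopf_algebroid.runit BCH = rB"
  "hopf_algebroid.counit BCH = pres_map LA.BC (%(y, b). LA.bc (L_counit A y) b)"
  "conjugation BCH = pres_map GA.BC (%(y, b). GA.bc (L_conjugation A y) b)" "hcomult BCH = DB"
 by(simp_all add: base_change_def Let_def L_hopf_def)

text \<open>Both sides are homomorphisms on a tensor product and are compared on its two factors: on
  the first they agree through \<open>alpT\<close>, and on the second both send \<open>b\<close> to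
  the scalar on the left.\<close>

lemma base_change_comult: assumes y: "y : car GA.BC" shows "comp_map K f1 (DB y) = hcomult K (f1 y)"
proof -
 interpret B: tensor_algebra GA.BC GA.BC LA.BC rB lB
  by(intro tensor_algebra.intro tensor_algebra_axioms.intro GA.BCT.T_cring rh_cl[OF lB(1)] rh_cl[OF rB(1)])
 note f1h = GA.base_change_map(1) and f0h = LA.base_change_map(1)
 have Lc: "LA.bc k 1[Ac] : car LA.BC" if "k : car (L_ring A)" for k
  using LA.BCT.in1.hom_closed[OF that] by simp
 note Ec = rh_cl[OF E_hom(1)] rh_cl[OF E_hom(2)]
 have Wbal: "tB (E1 (L_runit A k)) 1[GA.BC] = tB 1[GA.BC] (E1 (L_lunit A k))" if k: "k : car (L_ring A)" for k
  using B.in1_in2[OF Lc[OF k]] unfolding lB(2)[OF k] rB(2)[OF k] .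
 have W\<phi>: "(case (u, v) of (u, v) => tB (E1 u) (E1 v)) = tB (E1 u) 1[GA.BC] *[TB] tB 1[GA.BC] (E1 v)" if "u : car G" "v : car G" for u v
  unfolding prod.case by(rule B.tt_split[OF Ec(1)[OF that(1)] Ec(1)[OF that(2)]])
 note Wl = TL.tensor_lift[where \<phi> = "%(u, v). tB (E1 u) (E1 v)", OF B.T_cring rh_comp[OF E_hom(1) B.in1_hom] rh_comp[OF E_hom(1) B.in2_hom] Wbal W\<phi>]
 have W: "WB : ring_hom TL.TT TB" by(rule Wl(1))
 have W1: "WB (in1 u) = tB (E1 u) 1[GA.BC]" if "u : car G" for u by(rule Wl(3)) (use that in simp_all)
 have W2: "WB (in2 u) = tB 1[GA.BC] (E1 u)" if "u : car G" for u by(rule Wl(4)) (use that in simp_all)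
 have q: "(%b. tB (E2 b) 1[GA.BC]) : ring_hom (deg0 Ac) TB"
  unfolding degree_zero_hom by(rule rh_comp[OF E_hom(2) B.in1_hom])
 have Dbal: "WB (L_comult A (LB_scal A a)) = tB (E2 (ph a)) 1[GA.BC]" if a: "a : car A" for a
 proof -
  have "E1 (LB_scal A a) = E2 (ph a)" using GA.BCT.in1_in2[OF a] by simp
  thus ?thesis unfolding scal_maps(5)[OF a] W1[OF rh_cl[OF LB_scal_hom a]] by simp
 qed
 note Dl = GA.BCT.tensor_lift[where \<phi> = "%(y, b). WB (L_comult A y) *[TB] tB (E2 b) (E2 1[Ac])",
   OF B.T_cring rh_comp[OF comult(1) W] q Dbal, unfolded E_hom(3), OF _ prod.case]
 have D: "DB : ring_hom GA.BC TB" unfolding E_hom(3) by(rule Dl(1))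
 have D1: "DB (E1 u) = WB (L_comult A u)" if "u : car G" for u
  unfolding E_hom(3) using Dl(3)[of u] that by simp
 have D2: "DB (E2 b) = tB (E2 b) 1[GA.BC]" if "b : car Ac" for b
  unfolding E_hom(3) using Dl(4)[of b] that by simp
 have CM: "comp_map K f1 = pres_map TK.TT (%(x, y). TK.tt (f1 x) (f1 y))" unfolding comp_map_def K_simps ..
 have Cbal: "in1K (f1 (rB k)) = in2K (f1 (lB k))" if k: "k : car LA.BC" for k
  unfolding lB(3)[OF k] rB(3)[OF k] by(rule TK.in1_in2[OF rh_cl[OF f0h k]])
 have C\<phi>: "(case (x, y) of (x, y) => TK.tt (f1 x) (f1 y)) = in1K (f1 x) *[TK.TT] in2K (f1 y)" if "x : car GA.BC" "y : car GA.BC" for x y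
  unfolding prod.case by(rule TK.tt_split[OF rh_cl[OF f1h that(1)] rh_cl[OF f1h that(2)]])
 note Cl = B.tensor_lift[where \<phi> = "%(x, y). TK.tt (f1 x) (f1 y)", OF TK.T_cring rh_comp[OF f1h TK.in1_hom] rh_comp[OF f1h TK.in2_hom] Cbal C\<phi>]
 have C: "comp_map K f1 : ring_hom TB TK.TT" unfolding CM by(rule Cl(1))
 have C1: "comp_map K f1 (tB x 1[GA.BC]) = in1K (f1 x)" if "x : car GA.BC" for x unfolding CM by(rule Cl(3)) (use that in simp_all)
 have C2: "comp_map K f1 (tB 1[GA.BC] x) = in2K (f1 x)" if "x : car GA.BC" for x unfolding CM by(rule Cl(4)) (use that in simp_all)
 have CW: "comp_map K f1 (WB z) = alpT z" if z: "z : car TL.TT" for z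
 proof (rule TL.tensor_hom_ext[OF TK.T_cring rh_comp[OF W C] alpT(1) _ _ z])
  fix b assume b: "b : car G"
  show "comp_map K f1 (WB (in1 b)) = alpT (in1 b)" unfolding W1[OF b] C1[OF Ec(1)[OF b]] f_gens(1)[OF b] alpT(2)[OF b] ..
  show "comp_map K f1 (WB (in2 b)) = alpT (in2 b)" unfolding W2[OF b] C2[OF Ec(1)[OF b]] f_gens(1)[OF b] alpT(3)[OF b] ..
 qed
 show ?thesis
 proof (rule GA.BCT.tensor_hom_ext[OF TK.T_cring rh_comp[OF D C] rh_comp[OF f1h K_comult(1)] _ _ y])
  fix b assume b: "b : car G"
  have "comp_map K f1 (DB (E1 b)) = hcomult K (f1 (E1 b))"
   unfolding D1[OF b] CW[OF rh_cl[OF comult(1) b]] f_gens(1)[OF b] K_comult(2)[OF b] ..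
  thus "comp_map K f1 (DB (GA.bc b 1[deg0 Ac])) = hcomult K (f1 (GA.bc b 1[deg0 Ac]))" by simp
 next
  fix b assume "b : car (deg0 Ac)"
  hence b: "b : car Ac" by simp
  show "comp_map K f1 (DB (E2 b)) = hcomult K (f1 (E2 b))"
   unfolding D2[OF b] C1[OF Ec(2)[OF b]] f_gens(2)[OF b] K_comult(3)[OF b] ..
 qed
qed

lemma base_change_iso: "hopf_iso BCH K f0 f1"
proof -
 have hp: "hpart LH n = lpart (L_ring A) LA.J n" "hpart GH n = lpart G GA.J n" for n by simp_all
 note b0 = adic_span.ga_bij[OF LA.base_change_span] adic_span.ga_bij_hpart[OF LA.base_change_span]
 note b1 = adic_span.ga_bij[OF GA.base_change_span] adic_span.ga_bij_hpart[OF GA.base_change_span]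
 have g0: "f0 : graded_ring_hom LA.BC LH" and g1: "f1 : graded_ring_hom GA.BC GH"
  using LA.base_change_map(1) GA.base_change_map(1) b0(2) b1(2) unfolding graded_ring_hom_def hp bij_betw_def by blast+
 show ?thesis
  unfolding hopf_iso_def hopf_hom_def BCH_simps K_simps hp
  using g0 g1 b0 b1 lB(3) rB(3) adic_hom.bm_completion[OF co, unfolded adic_hom.bm_def[OF co]]
   adic_hom.bm_completion[OF cj, unfolded adic_hom.bm_def[OF cj]] base_change_comult
  by(intro conjI ballI allI) (simp_all only: )
qed

section \<open>Comparison of the completion with the Hopf algebroid of the completion\<close>

abbreviation "F0 == L_completion_map A I"
abbreviation "F1 == LB_completion_map A I"

text \<open>The map inverts \<open>gam0\<close>, from which the homomorphism property, bijectivity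
  and compatibility with degrees are inherited.\<close>

lemma F0: "F0 : ring_hom LH (L_ring Ac)" "bij_betw F0 (car LH) (car (L_ring Ac))" "bij_betw F0 (lpart (L_ring A) LA.J n) (hpart (L_ring Ac) n)"
  "r : car (L_ring A) ==> F0 (c0 r) = alp0 r" "b : car Ac ==> F0 (m0 b) = L_scal Ac b"
proof -
 note inv = ring_hom_inverse[OF Ab.L_cring gam0(1) adic_span.ga_bij[OF LS]]
 show "F0 : ring_hom LH (L_ring Ac)" by(rule inv(1)) (rule L_inv)
 show "bij_betw F0 (car LH) (car (L_ring Ac))" by(rule inv(2)) (rule L_inv)
 show "bij_betw F0 (lpart (L_ring A) LA.J n) (hpart (L_ring Ac) n)"
  by(rule inv(3)[OF _ _ adic_span.ga_bij_hpart[OF LS]]) (rule L_inv, assumption, use gfam.H_carr[OF Ab.L_gfam] in blast)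
 show "F0 (c0 r) = alp0 r" if "r : car (L_ring A)" using L_inv[OF rh_cl[OF alp0(1) that]] unfolding gam_alp(1)[OF that] .
 show "F0 (m0 b) = L_scal Ac b" if "b : car Ac"
  using L_inv[OF rh_cl[OF Ab.L_scal_hom that]] unfolding adic_span.gabt[OF LS that] .
qed

lemma F1: "F1 : ring_hom GH (LB_ring Ac)" "bij_betw F1 (car GH) (car (LB_ring Ac))" "bij_betw F1 (lpart G GA.J n) (hpart (LB_ring Ac) n)"
  "u : car G ==> F1 (c1 u) = alp1 u" "b : car Ac ==> F1 (m1 b) = LB_scal Ac b"
proof -
 note inv = ring_hom_inverse[OF Ab.LB_cring gam1(1) adic_span.ga_bij[OF GS]]
 show "F1 : ring_hom GH (LB_ring Ac)" by(rule inv(1)) (rule LB_inv)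
 show "bij_betw F1 (car GH) (car (LB_ring Ac))" by(rule inv(2)) (rule LB_inv)
 show "bij_betw F1 (lpart G GA.J n) (hpart (LB_ring Ac) n)"
  by(rule inv(3)[OF _ _ adic_span.ga_bij_hpart[OF GS]]) (rule LB_inv, assumption, use gfam.H_carr[OF Ab.LB_gfam] in blast)
 show "F1 (c1 u) = alp1 u" if "u : car G" using LB_inv[OF rh_cl[OF alp1(1) that]] unfolding gam_alp(2)[OF that] .
 show "F1 (m1 b) = LB_scal Ac b" if "b : car Ac"
  using LB_inv[OF rh_cl[OF Ab.LB_scal_hom that]] unfolding adic_span.gabt[OF GS that] .
qed

lemma alp_gen: "h : mod_gens A ==> alp1 (LB_gen A (Src h)) = LB_gen Ac (Src (map_mod_gen ph h))"
  "h : mod_gens A ==> alp1 (LB_gen A (Tgt h)) = LB_gen Ac (Tgt (map_mod_gen ph h))" "alp1 (LB_gen A (IsoCoeff i)) = LB_gen Ac (IsoCoeff i)"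
 using alp1(2)[of "Src h"] alp1(2)[of "Tgt h"] alp1(2)[of "IsoCoeff i"] by simp_all

lemma alp_lunit: "r : car (L_ring A) ==> alp1 (L_lunit A r) = L_lunit Ac (alp0 r)"
 by(rule L_hom_ext[OF Ab.LB_cring rh_comp[OF lunit(1) alp1(1)] rh_comp[OF alp0(1) Ab.lunit(1)]])
  (simp_all add: lunit(2) Ab.lunit(2) alp_gen alp0(2) gens_map)

lemma alp_runit: "r : car (L_ring A) ==> alp1 (L_runit A r) = L_runit Ac (alp0 r)"
 by(rule L_hom_ext[OF Ab.LB_cring rh_comp[OF runit(1) alp1(1)] rh_comp[OF alp0(1) Ab.runit(1)]])
  (simp_all add: runit(2) Ab.runit(2) alp_gen alp0(2) gens_map)

lemma alp_counit: assumes y: "y : car G" shows "alp0 (L_counit A y) = L_counit Ac (alp1 y)"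
proof (rule LB_hom_ext[OF Ab.L_cring rh_comp[OF counit(1) alp0(1)] rh_comp[OF alp1(1) Ab.counit(1)] _ y])
 fix g assume "g : iso_gens A"
 thus "alp0 (L_counit A (LB_gen A g)) = L_counit Ac (alp1 (LB_gen A g))"
 proof (cases rule: iso_gens_cases)
  case (3 i)
  have "alp0 1[L_ring A] = 1[L_ring Ac]" "alp0 0[L_ring A] = 0[L_ring Ac]"
   using ring_hom_one[OF alp0(1)] ring_hom_zero[OF alp0(1) cring.axioms(1)[OF L_cring] cring.axioms(1)[OF Ab.L_cring]] .
  thus ?thesis by(simp add: 3 counit(4) Ab.counit(4) alp_gen)
 qed (simp_all add: counit Ab.counit alp_gen alp0(2) gens_map)
qed

lemma alp_conj: assumes y: "y : car G" shows "alp1 (L_conjugation A y) = L_conjugation Ac (alp1 y)"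
proof (rule LB_hom_ext[OF Ab.LB_cring rh_comp[OF conj(1) alp1(1)] rh_comp[OF alp1(1) Ab.conj(1)] _ y])
 fix g assume "g : iso_gens A"
 thus "alp1 (L_conjugation A (LB_gen A g)) = L_conjugation Ac (alp1 (LB_gen A g))"
 proof (cases rule: iso_gens_cases)
  case (3 i)
  note h = rh_cringI[OF LB_cring Ab.LB_cring alp1(1)]
  show ?thesis unfolding 3 conj(4) alp_gen(3) Ab.conj(4)
   using ring_hom_cring.hom_series_inverse[OF h, of "%j. LB_gen A (IsoCoeff j)" i] LBR.strict_isoD(3,4,5)[OF LB_univ] by(simp add: alp_gen(3))
 qed (simp_all add: conj Ab.conj alp_gen gens_map)
qed

text \<open>On images of \<open>L_ring A\<close> this is naturality in the base ring; on the
  completion of \<open>A\<close> it holds because the units fix scalars.\<close>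

lemma F_units: assumes x: "x : car LH" shows "F1 (lK x) = L_lunit Ac (F0 x)" "F1 (rK x) = L_runit Ac (F0 x)"
proof -
 show "F1 (lK x) = L_lunit Ac (F0 x)"
 proof (rule LA.GL_hom_ext[OF Ab.LB_cring rh_comp[OF K_hom(1) F1(1)] rh_comp[OF F0(1) Ab.lunit(1)] _ _ x])
  show "F1 (lK (c0 r)) = L_lunit Ac (F0 (c0 r))" if r: "r : car (L_ring A)" for r
   unfolding K_c(1)[OF r] F1(4)[OF rh_cl[OF lunit(1) r]] F0(4)[OF r] by(rule alp_lunit[OF r])
  show "F1 (lK (m0 b)) = L_lunit Ac (F0 (m0 b))" if b: "b : car Ac" for b
   unfolding K_m(1)[OF b] F1(5)[OF b] F0(5)[OF b] Ab.scal_maps(1)[OF b] ..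
 qed
 show "F1 (rK x) = L_runit Ac (F0 x)"
 proof (rule LA.GL_hom_ext[OF Ab.LB_cring rh_comp[OF K_hom(2) F1(1)] rh_comp[OF F0(1) Ab.runit(1)] _ _ x])
  show "F1 (rK (c0 r)) = L_runit Ac (F0 (c0 r))" if r: "r : car (L_ring A)" for r
   unfolding K_c(2)[OF r] F1(4)[OF rh_cl[OF runit(1) r]] F0(4)[OF r] by(rule alp_runit[OF r])
  show "F1 (rK (m0 b)) = L_runit Ac (F0 (m0 b))" if b: "b : car Ac" for b
   unfolding K_m(2)[OF b] F1(5)[OF b] F0(5)[OF b] Ab.scal_maps(2)[OF b] ..
 qed
qed

lemma F_counit: assumes y: "y : car GH" shows "F0 (coK y) = L_counit Ac (F1 y)"
proof (rule GA.GL_hom_ext[OF Ab.L_cring rh_comp[OF K_hom(3) F0(1)] rh_comp[OF F1(1) Ab.counit(1)] _ _ y])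
 show "F0 (coK (c1 r)) = L_counit Ac (F1 (c1 r))" if r: "r : car G" for r
  unfolding K_c(3)[OF r] F0(4)[OF rh_cl[OF counit(1) r]] F1(4)[OF r] by(rule alp_counit[OF r])
 show "F0 (coK (m1 b)) = L_counit Ac (F1 (m1 b))" if b: "b : car Ac" for b
  unfolding K_m(3)[OF b] F1(5)[OF b] F0(5)[OF b] Ab.scal_maps(3)[OF b] ..
qed

lemma F_conj: assumes y: "y : car GH" shows "F1 (cjK y) = L_conjugation Ac (F1 y)"
proof (rule GA.GL_hom_ext[OF Ab.LB_cring rh_comp[OF K_hom(4) F1(1)] rh_comp[OF F1(1) Ab.conj(1)] _ _ y])
 show "F1 (cjK (c1 r)) = L_conjugation Ac (F1 (c1 r))" if r: "r : car G" for r
  unfolding K_c(4)[OF r] F1(4)[OF rh_cl[OF conj(1) r]] F1(4)[OF r] by(rule alp_conj[OF r])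
 show "F1 (cjK (m1 b)) = L_conjugation Ac (F1 (m1 b))" if b: "b : car Ac" for b
  unfolding K_m(4)[OF b] F1(5)[OF b] Ab.scal_maps(4)[OF b] ..
qed

text \<open>On uncompleted elements this is naturality of composition: homomorphisms preserve the
  coefficients of composite series by \<open>hom_series_comp\<close>. On scalars both sides land in
  the left factor.\<close>

lemma F_comult: assumes y: "y : car GH" shows "comp_map (L_hopf Ac) F1 (hcomult K y) = L_comult Ac (F1 y)"
proof -
 have CM: "comp_map (L_hopf Ac) F1 = pres_map Ab.TL.TT (%(x, y). Ab.TL.tt (F1 x) (F1 y))" unfolding comp_map_def Ab.comp_ring_L ..
 have bal: "Ab.in1 (F1 (rK k)) = Ab.in2 (F1 (lK k))" if k: "k : car LH" for k
  unfolding F_units[OF k] by(rule Ab.TL.in1_in2[OF rh_cl[OF F0(1) k]])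
 have \<phi>: "(case (x, y) of (x, y) => Ab.TL.tt (F1 x) (F1 y)) = Ab.in1 (F1 x) *[Ab.TL.TT] Ab.in2 (F1 y)" if "x : car GH" "y : car GH" for x y
  unfolding prod.case by(rule Ab.TL.tt_split[OF rh_cl[OF F1(1) that(1)] rh_cl[OF F1(1) that(2)]])
 note Cl = TK.tensor_lift[where \<phi> = "%(x, y). Ab.TL.tt (F1 x) (F1 y)", OF Ab.TL.T_cring rh_comp[OF F1(1) Ab.TL.in1_hom] rh_comp[OF F1(1) Ab.TL.in2_hom] bal \<phi>]
 let ?C = "comp_map (L_hopf Ac) F1"
 have C: "?C : ring_hom TK.TT Ab.TL.TT" unfolding CM by(rule Cl(1))
 have C1: "?C (in1K x) = Ab.in1 (F1 x)" if "x : car GH" for x unfolding CM by(rule Cl(3)) (use that in simp_all)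
 have C2: "?C (in2K x) = Ab.in2 (F1 x)" if "x : car GH" for x unfolding CM by(rule Cl(4)) (use that in simp_all)
 have a1: "?C (alpT (in1 u)) = Ab.in1 (alp1 u)" if u: "u : car G" for u
  unfolding alpT(2)[OF u] C1[OF rh_cl[OF GA.to_limit_GL u]] F1(4)[OF u] ..
 have a2: "?C (alpT (in2 u)) = Ab.in2 (alp1 u)" if u: "u : car G" for u
  unfolding alpT(3)[OF u] C2[OF rh_cl[OF GA.to_limit_GL u]] F1(4)[OF u] ..
 have n: "?C (alpT (L_comult A u)) = L_comult Ac (alp1 u)" if u: "u : car G" for u
 proof (rule LB_hom_ext[OF Ab.TL.T_cring rh_comp[OF rh_comp[OF comult(1) alpT(1)] C] rh_comp[OF alp1(1) Ab.comult(1)] _ u])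
  fix g assume "g : iso_gens A"
  thus "?C (alpT (L_comult A (LB_gen A g))) = L_comult Ac (alp1 (LB_gen A g))"
  proof (cases rule: iso_gens_cases)
   case (1 h)
   thus ?thesis using a1[OF LB_gen_closed[of "Src h"]] by(simp add: comult(2) Ab.comult(2) alp_gen gens_map)
  next
   case (2 h)
   thus ?thesis using a2[OF LB_gen_closed[of "Tgt h"]] by(simp add: comult(3) Ab.comult(3) alp_gen gens_map)
  next
   case (3 i)
   note h = rh_cringI[OF TL.T_cring Ab.TL.T_cring rh_comp[OF alpT(1) C]]
   have ic: "LB_gen A (IsoCoeff j) : car G" for j using LB_gen_closed[of "IsoCoeff j"] by simp
   have "?C (alpT (series_comp TL.TT (%j. in2 (LB_gen A (IsoCoeff j))) (%j. in1 (LB_gen A (IsoCoeff j))) i)) =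
    series_comp Ab.TL.TT (%j. ?C (alpT (in2 (LB_gen A (IsoCoeff j))))) (%j. ?C (alpT (in1 (LB_gen A (IsoCoeff j))))) i"
    by(rule ring_hom_cring.hom_series_comp[OF h]) (rule TL.in2.hom_closed[OF ic] TL.in1.hom_closed[OF ic])+
   thus ?thesis unfolding 3 comult(4) alp_gen(3) Ab.comult(4) a1[OF ic] a2[OF ic] .
  qed
 qed
 show ?thesis
 proof (rule GA.GL_hom_ext[OF Ab.TL.T_cring rh_comp[OF K_comult(1) C] rh_comp[OF F1(1) Ab.comult(1)] _ _ y])
  show "?C (hcomult K (c1 r)) = L_comult Ac (F1 (c1 r))" if r: "r : car G" for r
   unfolding K_comult(2)[OF r] F1(4)[OF r] by(rule n[OF r])
  show "?C (hcomult K (m1 b)) = L_comult Ac (F1 (m1 b))" if b: "b : car Ac" for b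
   unfolding K_comult(3)[OF b] F1(5)[OF b] C1[OF rh_cl[OF GA.limit_map_s_GL b]] Ab.scal_maps(5)[OF b] ..
 qed
qed

lemma completion_iso: "hopf_iso K (L_hopf Ac) F0 F1"
proof -
 have hp: "hpart LH n = lpart (L_ring A) LA.J n" "hpart GH n = lpart G GA.J n" for n by simp_all
 have g0: "F0 : graded_ring_hom LH (L_ring Ac)" and g1: "F1 : graded_ring_hom GH (LB_ring Ac)"
  using F0(1,3) F1(1,3) unfolding graded_ring_hom_def hp bij_betw_def by blast+
 have HA: "obj_ring (L_hopf Ac) = L_ring Ac" "mor_ring (L_hopf Ac) = LB_ring Ac" "hopf_algebroid.lunit (L_hopf Ac) = L_lunit Ac"
  "hopf_algebroid.runit (L_hopf Ac) = L_runit Ac" "hopf_algebroid.counit (L_hopf Ac) = L_counit Ac"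
  "conjugation (L_hopf Ac) = L_conjugation Ac" "hcomult (L_hopf Ac) = L_comult Ac"
  by(simp_all add: L_hopf_def)
 show ?thesis
  unfolding hopf_iso_def hopf_hom_def HA K_simps hp
  by(intro conjI ballI allI g0 g1 F_units F_counit F_conj F_comult F0(2,3) F1(2,3))
qed

end

theorem theorem2p16:
  fixes A :: "('a, 'm) ring_scheme" and I :: "'a set"
  assumes "cring A"
    and torsion_free: "\<And>(n::nat) a. \<lbrakk>n > 0; a \<in> carrier A; add_pow A n a = \<zero>\<^bsub>A\<^esub>\<rbrakk> \<Longrightarrow> a = \<zero>\<^bsub>A\<^esub>"
    and fin_gen: "\<exists>S. finite S \<and> S \<subseteq> carrier A \<and> generate_ring A S = carrier A"
    and "maximalideal I A"
    and separated: "(\<Inter>k::nat. I [^]\<^bsub>ideals_set A\<^esub> k) = {\<zero>\<^bsub>A\<^esub>}"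
  shows
    "hopf_completion_ok A I (L_scal A) (LB_scal A) (L_hopf A) \<and>
     hopf_iso
       (base_change A (L_scal A) (LB_scal A) (L_hopf A) (completion A I) (to_completion A I))
       (hopf_completion A I (L_scal A) (LB_scal A) (L_hopf A))
       (base_change_to_completion A I (L_ring A) (L_scal A))
       (base_change_to_completion A I (LB_ring A) (LB_scal A)) \<and>
     graded_complete (L_ring (completion A I)) (L_completion_adic A I) \<and>
     graded_complete (LB_ring (completion A I)) (LB_completion_adic A I) \<and>
     hopf_iso
       (hopf_completion A I (L_scal A) (LB_scal A) (L_hopf A))
       (L_hopf (completion A I))
       (L_completion_map A I)
       (LB_completion_map A I)"
proof -
  interpret completed_base A I
    by (intro completed_base.intro completed_base_axioms.intro fg_base_ring.intro fg_base_ring_axioms.intro base_ring.intro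
        assms(1) fin_gen maximalideal.axioms(1)[OF assms(4)])
  show ?thesis
    by (intro conjI K_ok base_change_iso L_complete LB_complete completion_iso)
qed

end
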